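(* Let $(M,L,\psi)$ be a weighted Finsler spacetime of dimension $n+1\ge3$. Given $N\in(-\infty,1]\cup[n,+\infty]$, take $\epsilon\in\mathbb{R}$ such that $\epsilon=0$ if $N=1$, and $|\epsilon|<\sqrt{\frac{N-1}{N-n}}$ if $N\ne1$ (the bound is read as $1$ for $N=+\infty$, and as no restriction for $N=n$). Let $c=c(N,\epsilon)=\frac1{n-1}\big(1-\epsilon^2\frac{N-n}{N-1}\big)>0$, with $c(1,0)=\frac1{n-1}$ and $c(+\infty,\epsilon)=\frac{1-\epsilon^2}{n-1}$. Let $\eta:(a,b)\to M$ be a lightlike geodesic such that $\mathrm{Ric}_N(\eta^* )\ge0$ on $(a,b)$, let $\mathsf{J}$ be a Lagrange tensor field along $\eta$, and let $t_0\in(a,b)$. Set $$s_0:=\tau_\epsilon^{-1}\Big(\tau_\epsilon(t_0)-\frac{1}{c\,\theta_\epsilon(t_0)}\Big)-t_0.$$ If $\theta_\epsilon(t_0)<0$, then $\det\mathsf{J}(t)=0$ for some $t\in[t_0,t_0+s_0]$, provided that $t_0+s_0<b$ (i.e. provided that $\tau_\epsilon(t_0)-\frac{1}{c\theta_\epsilon(t_0)}$ is attained by $\tau_\epsilon$ on $(a,b)$). Similarly, if $\theta_\epsilon(t_0)>0$, then $\det\mathsf{J}(t)=0$ for some $t\in[t_0+s_0,t_0]$, provided that $t_0+s_0>a$ (in the same sense).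
   Context: **Lorentz–Finsler setting.** $M$ is a connected $C^\infty$-manifold without boundary of dimension $n+1$. A Lorentz–Finsler structure is a function $L:TM\to\mathbb{R}$ such that $L\in C^\infty(TM\setminus\{0\})$; $L(cv)=c^2L(v)$ for all $v\in TM$, $c>0$; and for every $v\in TM\setminus\{0\}$ the matrix $g_{\alpha\beta}(v)=\frac{\partial^2 L}{\partial v^\alpha\partial v^\beta}(v)$, $\alpha,\beta=0,\dots,n$, is non-degenerate of signature $(-,+,\dots,+)$. It defines a Lorentzian inner product $g_v$ on $T_xM$ (for $v\in T_xM\setminus\{0\}$), with $g_v(v,v)=2L(v)$. A vector $v$ is timelike if $L(v)<0$, lightlike if $L(v)=0$ and $v\ne 0$, causal if timelike or lightlike. A Finsler spacetime is such an $(M,L)$ time-oriented by a smooth vector field $X$ with $L(X(x))<0$ for all $x$. A causal $v\in T_xM$ is future-directed if it lies in the same connected component of $\overline{\Omega'_x}\setminus\{0\}$ as $X(x)$, where $\Omega'_x=\{v\in T_xM: L(v)<0\}$. $\Omega_x$ is the set of future-directed timelike vectors, $\overline\Omega=\bigcup_x\overline\Omega_x$. All causal curves and geodesics are future-directed. **Connection and curvature.** With $(g^{\alpha\beta}(v))$ the inverse matrix, set $\widetilde\Gamma^\alpha_{\beta\gamma}(v)=\frac12\sum_\delta g^{\alpha\delta}(v)\big(\frac{\partial g_{\delta\gamma}}{\partial x^\beta}+\frac{\partial g_{\beta\delta}}{\partial x^\gamma}-\frac{\partial g_{\beta\gamma}}{\partial x^\delta}\big)(v)$, $G^\alpha(v)=\frac12\sum_{\beta,\gamma}\widetilde\Gamma^\alpha_{\beta\gamma}(v)v^\beta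 v^\gamma$, $N^\alpha_\beta(v)=\frac{\partial G^\alpha}{\partial v^\beta}(v)$, and $\Gamma^\alpha_{\beta\gamma}(v)=\widetilde\Gamma^\alpha_{\beta\gamma}(v)-\frac12\sum_{\delta,\mu}g^{\alpha\delta}(v)\big(\frac{\partial g_{\delta\gamma}}{\partial v^\mu}N^\mu_\beta+\frac{\partial g_{\beta\delta}}{\partial v^\mu}N^\mu_\gamma-\frac{\partial g_{\beta\gamma}}{\partial v^\mu}N^\mu_\delta\big)(v)$. Along a curve $\eta$, the covariant derivative $Y'=D^{\dot\eta}_{\dot\eta}Y$ has components $\dot Y^\alpha+\sum\Gamma^\alpha_{\beta\gamma}(\dot\eta)\dot\eta^\beta Y^\gamma$; for endomorphism fields $E$, $E'(P)=E(P)'-E(P')$. A causal geodesic is a smooth causal curve with $\ddot\eta^\alpha+2G^\alpha(\dot\eta)=0$. Put $R^\alpha_\beta(v)=2\frac{\partial G^\alpha}{\partial x^\beta}-\sum_\gamma\big(\frac{\partial N^\alpha_\beta}{\partial x^\gamma}v^\gamma-2\frac{\partial N^\alpha_\beta}{\partial v^\gamma}G^\gamma\big)-\sum_\gamma N^\alpha_\gamma N^\gamma_\beta$ (all at $v$), $R_v(w)=\sum R^\alpha_\beta(v)w^\beta\frac{\partial}{\partial x^\alpha}$ and $\mathrm{Ric}(v)=\mathrm{trace}(R_v)$. **Weight.** $\psi:\overline\Omega\setminus\{0\}\to\mathbb{R}$ is $C^\infty$ with $\psi(cv)=\psi(v)$ for $c>0$. For a causal geodesic $\eta$, $\psi_\eta(t)=\psi(\dot\eta(t))$.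 For $v\in\overline\Omega\setminus\{0\}$ and the geodesic $\eta$ with $\dot\eta(0)=v$: $\mathrm{Ric}_N(v)=\mathrm{Ric}(v)+\psi_\eta''(0)-\frac{\psi_\eta'(0)^2}{N-n}$ for $N\in\mathbb{R}\setminus\{n\}$; $\mathrm{Ric}_\infty(v)=\mathrm{Ric}(v)+\psi_\eta''(0)$; $\mathrm{Ric}_n(v)=\mathrm{Ric}(v)+\psi_\eta''(0)$ if $\psi_\eta'(0)=0$ and $-\infty$ otherwise. **Null Lagrange tensors, $\epsilon$-quantities.** For a lightlike geodesic $\eta$, $N_\eta(t)=\{w\in T_{\eta(t)}M: g_{\dot\eta(t)}(\dot\eta(t),w)=0\}\ni\dot\eta(t)$ and $Q_\eta(t)=N_\eta(t)/\mathbb{R}\dot\eta(t)$, of dimension $n-1$; $g_{\dot\eta}$ induces a positive-definite metric $h$ on $Q_\eta$, the covariant derivative $'$ along $\eta$ descends to $Q_\eta$ and its endomorphisms, and $R_{\dot\eta(t)}$ induces the $h$-symmetric endomorphism $\mathsf{R}(t)$ of $Q_\eta(t)$. A Jacobi tensor field is a smooth field of endomorphisms $\mathsf{J}(t)$ of $Q_\eta(t)$ with $\mathsf{J}''+\mathsf{R}\mathsf{J}=0$ and $\ker\mathsf{J}(t)\cap\ker\mathsf{J}'(t)=\{0\}$; it is Lagrange if moreover $(\mathsf{J}')^{\mathsf{T}}\mathsf{J}-\mathsf{J}^{\mathsf{T}}\mathsf{J}'=0$ ($\mathsf{T}$ = $h$-transpose). $\tau_\epsilon$ is a fixed primitive $\int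 e^{\frac{2(\epsilon-1)}{n-1}\psi_\eta(t)}dt$ (strictly increasing on $(a,b)$), and $\eta^*=e^{\frac{2(1-\epsilon)}{n-1}\psi_\eta}\dot\eta$. Where $\mathsf{J}(t)$ is invertible (in particular this is understood at $t_0$), $\theta(t)=\mathrm{trace}(\mathsf{J}'\mathsf{J}^{-1})(t)$ and $\theta_\epsilon(t)=e^{\frac{2(1-\epsilon)}{n-1}\psi_\eta(t)}(\theta(t)-\psi'_\eta(t))$. *)

theory Defs
  imports
    "Jordan_Normal_Form.Determinant"
    "HOL-Library.Set_Algebras"
    "HOL-Analysis.Analysis"
begin

no_notation vec_index (infixl "$" 100)

section \<open>Smooth maps\<close>

primrec Ck_on ::
  "nat \<Rightarrow> 'a::real_normed_vector set \<Rightarrow> ('a \<Rightarrow> 'b::real_normed_vector) \<Rightarrow> bool" where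
  "Ck_on 0 S f \<longleftrightarrow> continuous_on S f"
| "Ck_on (Suc k) S f \<longleftrightarrow> (\<forall>x\<in>S. f differentiable (at x)) \<and>
     (\<forall>v. Ck_on k S (\<lambda>x. frechet_derivative f (at x) v))"

text \<open>Only meaningful for open \<open>S\<close>.\<close>

definition smooth_on ::
  "'a::real_normed_vector set \<Rightarrow> ('a \<Rightarrow> 'b::real_normed_vector) \<Rightarrow> bool" where
  "smooth_on S f \<longleftrightarrow> (\<forall>k. Ck_on k S f)"

text \<open>Smoothness on an arbitrary set: local existence of smooth extensions to open sets.\<close>

definition smooth_ext_on ::
  "'a::real_normed_vector set \<Rightarrow> ('a \<Rightarrow> 'b::real_normed_vector) \<Rightarrow> bool" where
  "smooth_ext_on S f \<longleftrightarrow>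
     (\<forall>x\<in>S. \<exists>U g. open U \<and> x \<in> U \<and> smooth_on U g \<and> (\<forall>y\<in>S \<inter> U. g y = f y))"

section \<open>Manifolds and tangent vectors\<close>

text \<open>
  The manifold is the whole type \<open>'a\<close>, equipped with a smooth atlas \<open>A\<close>; a chart is a pair of its
  domain and its coordinate map. The dimension is \<open>CARD('m)\<close>, which is \<open>n + 1\<close> below.\<close>

type_synonym ('a, 'm) chart = "'a set \<times> ('a \<Rightarrow> real^'m)"

definition chart_inv :: "('a, 'm) chart \<Rightarrow> real^'m \<Rightarrow> 'a" where
  "chart_inv c = inv_into (fst c) (snd c)"

definition smooth_atlas :: "('a::topological_space, 'm::finite) chart set \<Rightarrow> bool" where
  "smooth_atlas A \<longleftrightarrow>
     (\<forall>c\<in>A. open (fst c) \<and> open (snd c ` fst c) \<and>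
        homeomorphism (fst c) (snd c ` fst c) (snd c) (chart_inv c)) \<and>
     (\<Union>c\<in>A. fst c) = UNIV \<and>
     (\<forall>c\<in>A. \<forall>d\<in>A. smooth_on (snd c ` (fst c \<inter> fst d)) (snd d \<circ> chart_inv c))"

text \<open>
  Tangent spaces: at each point \<open>p\<close> one chart \<open>pref_chart A p\<close> around \<open>p\<close> is selected, and the tangent
  space at \<open>p\<close> is identified with \<open>real^'m\<close> through the components in that chart. A tangent vector at
  \<open>p\<close> is thus an element of \<open>real^'m\<close>; its components in any other chart \<open>c\<close> around \<open>p\<close> are given by
  \<open>to_chart A c p\<close>, and \<open>of_chart A c x\<close> is the inverse isomorphism for \<open>p = chart_inv c x\<close>. A function
  on the tangent bundle is a function \<open>f p v\<close> of a point and a tangent vector at that point, and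
  \<open>local_expr A c f\<close> is its expression in the coordinates \<open>(x, v)\<close> of \<open>c\<close>.\<close>

definition pref_chart :: "('a, 'm) chart set \<Rightarrow> 'a \<Rightarrow> ('a, 'm) chart" where
  "pref_chart A p = (SOME c. c \<in> A \<and> p \<in> fst c)"

definition to_chart ::
  "('a, 'm::finite) chart set \<Rightarrow> ('a, 'm) chart \<Rightarrow> 'a \<Rightarrow> real^'m \<Rightarrow> real^'m" where
  "to_chart A c p v =
     frechet_derivative (snd c \<circ> chart_inv (pref_chart A p)) (at (snd (pref_chart A p) p)) v"

definition of_chart ::
  "('a, 'm::finite) chart set \<Rightarrow> ('a, 'm) chart \<Rightarrow> real^'m \<Rightarrow> real^'m \<Rightarrow> real^'m" where
  "of_chart A c x u =
     frechet_derivative (snd (pref_chart A (chart_inv c x)) \<circ> chart_inv c) (at x) u"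

definition local_expr ::
  "('a, 'm::finite) chart set \<Rightarrow> ('a, 'm) chart \<Rightarrow> ('a \<Rightarrow> real^'m \<Rightarrow> real) \<Rightarrow>
   (real^'m) \<times> (real^'m) \<Rightarrow> real" where
  "local_expr A c f z = f (chart_inv c (fst z)) (of_chart A c (fst z) (snd z))"

definition smooth_vector_field ::
  "('a, 'm::finite) chart set \<Rightarrow> ('a \<Rightarrow> real^'m) \<Rightarrow> bool" where
  "smooth_vector_field A X \<longleftrightarrow>
     (\<forall>c\<in>A. smooth_on (snd c ` fst c)
        (\<lambda>x. to_chart A c (chart_inv c x) (X (chart_inv c x))))"

definition smooth_curve ::
  "('a::topological_space, 'm::finite) chart set \<Rightarrow> real set \<Rightarrow> (real \<Rightarrow> 'a) \<Rightarrow> bool" where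
  "smooth_curve A I \<eta> \<longleftrightarrow>
     continuous_on I \<eta> \<and> (\<forall>c\<in>A. smooth_on {t\<in>I. \<eta> t \<in> fst c} (snd c \<circ> \<eta>))"

definition velocity :: "('a, 'm::finite) chart set \<Rightarrow> (real \<Rightarrow> 'a) \<Rightarrow> real \<Rightarrow> real^'m" where
  "velocity A \<eta> t = vector_derivative (snd (pref_chart A (\<eta> t)) \<circ> \<eta>) (at t)"

text \<open>The coordinates \<open>(x, v)\<close> of the velocity vector in the chart \<open>c\<close>.\<close>

definition velocity_coords ::
  "('a, 'm::finite) chart \<Rightarrow> (real \<Rightarrow> 'a) \<Rightarrow> real \<Rightarrow> (real^'m) \<times> (real^'m)" where
  "velocity_coords c \<eta> t = (snd c (\<eta> t), vector_derivative (snd c \<circ> \<eta>) (at t))"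

section \<open>The local formulas of Lorentz--Finsler geometry\<close>

text \<open>
  Here \<open>F\<close> is the expression of \<open>L\<close> in a chart, and \<open>z = (x, v)\<close>.
  \<open>dx\<close> and \<open>dv\<close> are the partial derivatives in the position and in the vector components.\<close>

definition dx :: "'m::finite \<Rightarrow> ((real^'m) \<times> (real^'m) \<Rightarrow> real) \<Rightarrow> (real^'m) \<times> (real^'m) \<Rightarrow> real" where
  "dx \<alpha> f z = deriv (\<lambda>s. f (fst z + s *\<^sub>R axis \<alpha> 1, snd z)) 0"

definition dv :: "'m::finite \<Rightarrow> ((real^'m) \<times> (real^'m) \<Rightarrow> real) \<Rightarrow> (real^'m) \<times> (real^'m) \<Rightarrow> real" where
  "dv \<alpha> f z = deriv (\<lambda>s. f (fst z, snd z + s *\<^sub>R axis \<alpha> 1)) 0"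

context
  fixes F :: "(real^'m::finite) \<times> (real^'m) \<Rightarrow> real"
begin

definition gmat :: "(real^'m) \<times> (real^'m) \<Rightarrow> real^'m^'m" where
  "gmat z = (\<chi> \<alpha> \<beta>. dv \<alpha> (dv \<beta> F) z)"

definition Gamma_tilde :: "'m \<Rightarrow> 'm \<Rightarrow> 'm \<Rightarrow> (real^'m) \<times> (real^'m) \<Rightarrow> real" where
  "Gamma_tilde \<alpha> \<beta> \<gamma> z = 1 / 2 * (\<Sum>\<delta>\<in>UNIV. matrix_inv (gmat z) $ \<alpha> $ \<delta> *
     (dx \<beta> (\<lambda>y. gmat y $ \<delta> $ \<gamma>) z + dx \<gamma> (\<lambda>y. gmat y $ \<beta> $ \<delta>) z - dx \<delta> (\<lambda>y. gmat y $ \<beta> $ \<gamma>) z))"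

definition spray :: "'m \<Rightarrow> (real^'m) \<times> (real^'m) \<Rightarrow> real" where
  "spray \<alpha> z = 1 / 2 * (\<Sum>\<beta>\<in>UNIV. \<Sum>\<gamma>\<in>UNIV. Gamma_tilde \<alpha> \<beta> \<gamma> z * snd z $ \<beta> * snd z $ \<gamma>)"

definition nonlin_conn :: "'m \<Rightarrow> 'm \<Rightarrow> (real^'m) \<times> (real^'m) \<Rightarrow> real" where
  "nonlin_conn \<alpha> \<beta> z = dv \<beta> (spray \<alpha>) z"

definition Gamma :: "'m \<Rightarrow> 'm \<Rightarrow> 'm \<Rightarrow> (real^'m) \<times> (real^'m) \<Rightarrow> real" where
  "Gamma \<alpha> \<beta> \<gamma> z = Gamma_tilde \<alpha> \<beta> \<gamma> z -
     1 / 2 * (\<Sum>\<delta>\<in>UNIV. \<Sum>\<mu>\<in>UNIV. matrix_inv (gmat z) $ \<alpha> $ \<delta> *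
       (dv \<mu> (\<lambda>y. gmat y $ \<delta> $ \<gamma>) z * nonlin_conn \<mu> \<beta> z
        + dv \<mu> (\<lambda>y. gmat y $ \<beta> $ \<delta>) z * nonlin_conn \<mu> \<gamma> z
        - dv \<mu> (\<lambda>y. gmat y $ \<beta> $ \<gamma>) z * nonlin_conn \<mu> \<delta> z))"

definition curv :: "'m \<Rightarrow> 'm \<Rightarrow> (real^'m) \<times> (real^'m) \<Rightarrow> real" where
  "curv \<alpha> \<beta> z = 2 * dx \<beta> (spray \<alpha>) z
     - (\<Sum>\<gamma>\<in>UNIV. dx \<gamma> (nonlin_conn \<alpha> \<beta>) z * snd z $ \<gamma> - 2 * dv \<gamma> (nonlin_conn \<alpha> \<beta>) z * spray \<gamma> z)
     - (\<Sum>\<gamma>\<in>UNIV. nonlin_conn \<alpha> \<gamma> z * nonlin_conn \<gamma> \<beta> z)"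

end

section \<open>Finsler spacetimes\<close>

text \<open>A symmetric matrix congruent to \<open>diag (-1, 1, \<dots>, 1)\<close>.\<close>

definition lorentz_signature :: "real^'m::finite^'m \<Rightarrow> bool" where
  "lorentz_signature B \<longleftrightarrow> (\<exists>(P :: real^'m^'m) i0. invertible P \<and>
     Finite_Cartesian_Product.transpose P ** B ** P =
       (\<chi> i j. if i = j then (if i = i0 then -1 else 1) else 0))"

definition lorentz_finsler :: "('a, 'm::finite) chart set \<Rightarrow> ('a \<Rightarrow> real^'m \<Rightarrow> real) \<Rightarrow> bool" where
  "lorentz_finsler A L \<longleftrightarrow>
     (\<forall>c\<in>A. smooth_on {(x, u). x \<in> snd c ` fst c \<and> u \<noteq> 0} (local_expr A c L)) \<and>
     (\<forall>p v k. k > 0 \<longrightarrow> L p (k *\<^sub>R v) = k\<^sup>2 * L p v) \<and>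
     (\<forall>c\<in>A. \<forall>x\<in>snd c ` fst c. \<forall>u. u \<noteq> 0 \<longrightarrow> lorentz_signature (gmat (local_expr A c L) (x, u)))"

definition timelike :: "('a \<Rightarrow> real^'m \<Rightarrow> real) \<Rightarrow> 'a \<Rightarrow> real^'m \<Rightarrow> bool" where
  "timelike L p v \<longleftrightarrow> L p v < 0"

definition lightlike :: "('a \<Rightarrow> real^'m \<Rightarrow> real) \<Rightarrow> 'a \<Rightarrow> real^'m \<Rightarrow> bool" where
  "lightlike L p v \<longleftrightarrow> L p v = 0 \<and> v \<noteq> 0"

definition causal :: "('a \<Rightarrow> real^'m \<Rightarrow> real) \<Rightarrow> 'a \<Rightarrow> real^'m \<Rightarrow> bool" where
  "causal L p v \<longleftrightarrow> timelike L p v \<or> lightlike L p v"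

definition future_causal ::
  "('a \<Rightarrow> real^'m::finite \<Rightarrow> real) \<Rightarrow> ('a \<Rightarrow> real^'m) \<Rightarrow> 'a \<Rightarrow> real^'m \<Rightarrow> bool" where
  "future_causal L X p v \<longleftrightarrow> causal L p v \<and>
     connected_component (closure {w. timelike L p w} - {0}) (X p) v"

definition Omega ::
  "('a \<Rightarrow> real^'m::finite \<Rightarrow> real) \<Rightarrow> ('a \<Rightarrow> real^'m) \<Rightarrow> 'a \<Rightarrow> (real^'m) set" where
  "Omega L X p = {v. timelike L p v \<and> future_causal L X p v}"

definition finsler_spacetime ::
  "('a::{t2_space, second_countable_topology}, 'm::finite) chart set \<Rightarrow>
   ('a \<Rightarrow> real^'m \<Rightarrow> real) \<Rightarrow> ('a \<Rightarrow> real^'m) \<Rightarrow> bool" where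
  "finsler_spacetime A L X \<longleftrightarrow>
     connected (UNIV :: 'a set) \<and> smooth_atlas A \<and> lorentz_finsler A L \<and>
     smooth_vector_field A X \<and> (\<forall>p. timelike L p (X p))"

text \<open>The weight \<open>\<psi>\<close> is only relevant on nonzero vectors of the closed cones.\<close>

definition weight ::
  "('a, 'm::finite) chart set \<Rightarrow> ('a \<Rightarrow> real^'m \<Rightarrow> real) \<Rightarrow> ('a \<Rightarrow> real^'m) \<Rightarrow>
   ('a \<Rightarrow> real^'m \<Rightarrow> real) \<Rightarrow> bool" where
  "weight A L X \<psi> \<longleftrightarrow>
     (\<forall>c\<in>A. smooth_ext_on
        {(x, u). x \<in> snd c ` fst c \<and> u \<noteq> 0 \<and>
           of_chart A c x u \<in> closure (Omega L X (chart_inv c x))}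
        (local_expr A c \<psi>)) \<and>
     (\<forall>p. \<forall>v\<in>closure (Omega L X p) - {0}. \<forall>k>0. \<psi> p (k *\<^sub>R v) = \<psi> p v)"

definition causal_geodesic ::
  "('a::topological_space, 'm::finite) chart set \<Rightarrow> ('a \<Rightarrow> real^'m \<Rightarrow> real) \<Rightarrow> ('a \<Rightarrow> real^'m) \<Rightarrow>
   real set \<Rightarrow> (real \<Rightarrow> 'a) \<Rightarrow> bool" where
  "causal_geodesic A L X I \<eta> \<longleftrightarrow>
     smooth_curve A I \<eta> \<and> (\<forall>t\<in>I. future_causal L X (\<eta> t) (velocity A \<eta> t)) \<and>
     (\<forall>c\<in>A. \<forall>t\<in>I. \<eta> t \<in> fst c \<longrightarrow>
        (\<forall>\<alpha>. vector_derivative (\<lambda>s. vector_derivative (snd c \<circ> \<eta>) (at s)) (at t) $ \<alpha>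
             + 2 * spray (local_expr A c L) \<alpha> (velocity_coords c \<eta> t) = 0))"

definition lightlike_geodesic ::
  "('a::topological_space, 'm::finite) chart set \<Rightarrow> ('a \<Rightarrow> real^'m \<Rightarrow> real) \<Rightarrow> ('a \<Rightarrow> real^'m) \<Rightarrow>
   real set \<Rightarrow> (real \<Rightarrow> 'a) \<Rightarrow> bool" where
  "lightlike_geodesic A L X I \<eta> \<longleftrightarrow>
     causal_geodesic A L X I \<eta> \<and> (\<forall>t\<in>I. lightlike L (\<eta> t) (velocity A \<eta> t))"

section \<open>Metric and curvature on the tangent spaces\<close>

text \<open>
  These tensors at \<open>p\<close> are evaluated in \<open>pref_chart A p\<close>, in which the components of a tangent vector
  at \<open>p\<close> are the vector itself.\<close>

definition gmetric ::
  "('a, 'm::finite) chart set \<Rightarrow> ('a \<Rightarrow> real^'m \<Rightarrow> real) \<Rightarrow> 'a \<Rightarrow> real^'m \<Rightarrow> real^'m \<Rightarrow> real^'m \<Rightarrow> real" where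
  "gmetric A L p v u w = (\<Sum>\<alpha>\<in>UNIV. \<Sum>\<beta>\<in>UNIV.
     gmat (local_expr A (pref_chart A p) L) (snd (pref_chart A p) p, v) $ \<alpha> $ \<beta> * u $ \<alpha> * w $ \<beta>)"

definition Rmat ::
  "('a, 'm::finite) chart set \<Rightarrow> ('a \<Rightarrow> real^'m \<Rightarrow> real) \<Rightarrow> 'a \<Rightarrow> real^'m \<Rightarrow> real^'m^'m" where
  "Rmat A L p v =
     (\<chi> \<alpha> \<beta>. curv (local_expr A (pref_chart A p) L) \<alpha> \<beta> (snd (pref_chart A p) p, v))"

definition Ric ::
  "('a, 'm::finite) chart set \<Rightarrow> ('a \<Rightarrow> real^'m \<Rightarrow> real) \<Rightarrow> 'a \<Rightarrow> real^'m \<Rightarrow> real" where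
  "Ric A L p v = trace (Rmat A L p v)"

definition weight_along ::
  "('a, 'm::finite) chart set \<Rightarrow> ('a \<Rightarrow> real^'m \<Rightarrow> real) \<Rightarrow> (real \<Rightarrow> 'a) \<Rightarrow> real \<Rightarrow> real" where
  "weight_along A \<psi> \<eta> t = \<psi> (\<eta> t) (velocity A \<eta> t)"

definition geodesic_from ::
  "('a::topological_space, 'm::finite) chart set \<Rightarrow> ('a \<Rightarrow> real^'m \<Rightarrow> real) \<Rightarrow> ('a \<Rightarrow> real^'m) \<Rightarrow>
   'a \<Rightarrow> real^'m \<Rightarrow> real \<Rightarrow> 'a" where
  "geodesic_from A L X p v = (SOME \<sigma>.
     (\<exists>\<delta>>0. causal_geodesic A L X {-\<delta><..<\<delta>} \<sigma>) \<and> \<sigma> 0 = p \<and> velocity A \<sigma> 0 = v)"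

text \<open>Weighted Ricci curvature for \<open>N \<in> (-\<infinity>, \<infinity>]\<close>; \<open>CARD('m) - 1\<close> is \<open>n\<close>.\<close>

definition Ric_N ::
  "('a::topological_space, 'm::finite) chart set \<Rightarrow> ('a \<Rightarrow> real^'m \<Rightarrow> real) \<Rightarrow> ('a \<Rightarrow> real^'m) \<Rightarrow>
   ('a \<Rightarrow> real^'m \<Rightarrow> real) \<Rightarrow> ereal \<Rightarrow> 'a \<Rightarrow> real^'m \<Rightarrow> ereal" where
  "Ric_N A L X \<psi> N p v =
     (let n = real CARD('m) - 1;
          f = weight_along A \<psi> (geodesic_from A L X p v);
          d1 = deriv f 0;
          d2 = deriv (deriv f) 0
      in if N = \<infinity> then ereal (Ric A L p v + d2)
         else if N = ereal n then (if d1 = 0 then ereal (Ric A L p v + d2) else -\<infinity>)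
         else ereal (Ric A L p v + d2 - d1\<^sup>2 / (real_of_ereal N - n)))"

section \<open>The quotient of the null hyperplane\<close>

text \<open>\<open>quot_class v w\<close> is the class of \<open>w\<close> modulo the line spanned by \<open>v\<close>.\<close>

definition quot_class :: "real^'m \<Rightarrow> real^'m \<Rightarrow> (real^'m) set" where
  "quot_class v w = {w + s *\<^sub>R v | s. True}"

definition null_perp ::
  "('a, 'm::finite) chart set \<Rightarrow> ('a \<Rightarrow> real^'m \<Rightarrow> real) \<Rightarrow> 'a \<Rightarrow> real^'m \<Rightarrow> (real^'m) set" where
  "null_perp A L p v = {w. gmetric A L p v v w = 0}"

definition quot_space ::
  "('a, 'm::finite) chart set \<Rightarrow> ('a \<Rightarrow> real^'m \<Rightarrow> real) \<Rightarrow> 'a \<Rightarrow> real^'m \<Rightarrow> (real^'m) set set" where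
  "quot_space A L p v = quot_class v ` null_perp A L p v"

text \<open>
  The induced bilinear form and the induced curvature endomorphism; neither depends on the
  representatives, since \<open>v\<close> is lightlike and \<open>R\<^sub>v v = 0\<close>.\<close>

definition quot_metric ::
  "('a, 'm::finite) chart set \<Rightarrow> ('a \<Rightarrow> real^'m \<Rightarrow> real) \<Rightarrow> 'a \<Rightarrow> real^'m \<Rightarrow>
   (real^'m) set \<Rightarrow> (real^'m) set \<Rightarrow> real" where
  "quot_metric A L p v q r = gmetric A L p v (SOME u. u \<in> q) (SOME w. w \<in> r)"

definition quot_curv ::
  "('a, 'm::finite) chart set \<Rightarrow> ('a \<Rightarrow> real^'m \<Rightarrow> real) \<Rightarrow> 'a \<Rightarrow> real^'m \<Rightarrow>
   (real^'m) set \<Rightarrow> (real^'m) set" where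
  "quot_curv A L p v q = (\<Union>w\<in>q. quot_class v (Rmat A L p v *v w))"

definition quot_endo ::
  "('a, 'm::finite) chart set \<Rightarrow> ('a \<Rightarrow> real^'m \<Rightarrow> real) \<Rightarrow> 'a \<Rightarrow> real^'m \<Rightarrow>
   ((real^'m) set \<Rightarrow> (real^'m) set) \<Rightarrow> bool" where
  "quot_endo A L p v E \<longleftrightarrow>
     (\<forall>q\<in>quot_space A L p v. E q \<in> quot_space A L p v) \<and>
     (\<forall>w1\<in>null_perp A L p v. \<forall>w2\<in>null_perp A L p v. \<forall>u1\<in>null_perp A L p v. \<forall>u2\<in>null_perp A L p v. \<forall>k.
        E (quot_class v w1) = quot_class v u1 \<and> E (quot_class v w2) = quot_class v u2 \<longrightarrow>
        E (quot_class v (k *\<^sub>R w1 + w2)) = quot_class v (k *\<^sub>R u1 + u2))"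

text \<open>\<open>F\<close> is the transpose of \<open>E\<close> with respect to \<open>quot_metric\<close>.\<close>

definition is_quot_transpose ::
  "('a, 'm::finite) chart set \<Rightarrow> ('a \<Rightarrow> real^'m \<Rightarrow> real) \<Rightarrow> 'a \<Rightarrow> real^'m \<Rightarrow>
   ((real^'m) set \<Rightarrow> (real^'m) set) \<Rightarrow> ((real^'m) set \<Rightarrow> (real^'m) set) \<Rightarrow> bool" where
  "is_quot_transpose A L p v E F \<longleftrightarrow> quot_endo A L p v F \<and>
     (\<forall>q\<in>quot_space A L p v. \<forall>r\<in>quot_space A L p v.
        quot_metric A L p v (F q) r = quot_metric A L p v q (E r))"

text \<open>
  \<open>quot_basis A L p v b\<close>: the classes of \<open>b 0, \<dots>, b (CARD('m) - 3)\<close> form a basis of the quotient,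
  which has dimension \<open>CARD('m) - 2 = n - 1\<close>. Trace and determinant of an endomorphism are those
  of its matrix in such a basis.\<close>

definition quot_basis ::
  "('a, 'm::finite) chart set \<Rightarrow> ('a \<Rightarrow> real^'m \<Rightarrow> real) \<Rightarrow> 'a \<Rightarrow> real^'m \<Rightarrow> (nat \<Rightarrow> real^'m) \<Rightarrow> bool" where
  "quot_basis A L p v b \<longleftrightarrow>
     (\<forall>i<CARD('m) - 2. b i \<in> null_perp A L p v) \<and>
     (\<forall>q\<in>quot_space A L p v. \<exists>!a. a \<in> extensional {..<CARD('m) - 2} \<and>
        q = quot_class v (\<Sum>i<CARD('m) - 2. a i *\<^sub>R b i))"

definition is_quot_matrix ::
  "('a, 'm::finite) chart set \<Rightarrow> ('a \<Rightarrow> real^'m \<Rightarrow> real) \<Rightarrow> 'a \<Rightarrow> real^'m \<Rightarrow>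
   ((real^'m) set \<Rightarrow> (real^'m) set) \<Rightarrow> real mat \<Rightarrow> bool" where
  "is_quot_matrix A L p v E B \<longleftrightarrow>
     B \<in> carrier_mat (CARD('m) - 2) (CARD('m) - 2) \<and>
     (\<exists>b. quot_basis A L p v b \<and>
        (\<forall>j<CARD('m) - 2. E (quot_class v (b j)) =
           quot_class v (\<Sum>i<CARD('m) - 2. B $$ (i, j) *\<^sub>R b i)))"

definition quot_trace ::
  "('a, 'm::finite) chart set \<Rightarrow> ('a \<Rightarrow> real^'m \<Rightarrow> real) \<Rightarrow> 'a \<Rightarrow> real^'m \<Rightarrow>
   ((real^'m) set \<Rightarrow> (real^'m) set) \<Rightarrow> real" where
  "quot_trace A L p v E =
     (let B = (SOME B. is_quot_matrix A L p v E B) in \<Sum>i<CARD('m) - 2. B $$ (i, i))"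

definition quot_det ::
  "('a, 'm::finite) chart set \<Rightarrow> ('a \<Rightarrow> real^'m \<Rightarrow> real) \<Rightarrow> 'a \<Rightarrow> real^'m \<Rightarrow>
   ((real^'m) set \<Rightarrow> (real^'m) set) \<Rightarrow> real" where
  "quot_det A L p v E = Determinant.det (SOME B. is_quot_matrix A L p v E B)"

section \<open>Lagrange tensor fields along a lightlike geodesic\<close>

text \<open>
  \<open>cov_deriv A L c \<eta> Y t\<close> is the tangent vector at \<open>\<eta> t\<close> whose components in the chart \<open>c\<close> are those
  of the covariant derivative of \<open>Y\<close> along \<open>\<eta>\<close>, with reference vector the velocity of \<open>\<eta>\<close>.\<close>

definition cov_deriv ::
  "('a, 'm::finite) chart set \<Rightarrow> ('a \<Rightarrow> real^'m \<Rightarrow> real) \<Rightarrow> ('a, 'm) chart \<Rightarrow> (real \<Rightarrow> 'a) \<Rightarrow>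
   (real \<Rightarrow> real^'m) \<Rightarrow> real \<Rightarrow> real^'m" where
  "cov_deriv A L c \<eta> Y t =
     (let Yc = (\<lambda>s. to_chart A c (\<eta> s) (Y s)); z = velocity_coords c \<eta> t
      in of_chart A c (fst z)
           (vector_derivative Yc (at t) +
            (\<chi> \<alpha>. \<Sum>\<beta>\<in>UNIV. \<Sum>\<gamma>\<in>UNIV. Gamma (local_expr A c L) \<alpha> \<beta> \<gamma> z * snd z $ \<beta> * Yc t $ \<gamma>)))"

text \<open>
  Sections \<open>q\<close> of the quotient bundle over an open interval \<open>K\<close> that \<open>\<eta>\<close> maps into the domain of the
  chart \<open>c\<close>, represented by smooth vector fields \<open>w\<close> in the null hyperplanes.\<close>

definition quot_section_lift ::
  "('a, 'm::finite) chart set \<Rightarrow> ('a \<Rightarrow> real^'m \<Rightarrow> real) \<Rightarrow> ('a, 'm) chart \<Rightarrow> (real \<Rightarrow> 'a) \<Rightarrow>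
   real set \<Rightarrow> (real \<Rightarrow> (real^'m) set) \<Rightarrow> (real \<Rightarrow> real^'m) \<Rightarrow> bool" where
  "quot_section_lift A L c \<eta> K q w \<longleftrightarrow>
     smooth_on K (\<lambda>t. to_chart A c (\<eta> t) (w t)) \<and>
     (\<forall>t\<in>K. w t \<in> null_perp A L (\<eta> t) (velocity A \<eta> t) \<and>
        q t = quot_class (velocity A \<eta> t) (w t))"

definition smooth_quot_section ::
  "('a, 'm::finite) chart set \<Rightarrow> ('a \<Rightarrow> real^'m \<Rightarrow> real) \<Rightarrow> ('a, 'm) chart \<Rightarrow> (real \<Rightarrow> 'a) \<Rightarrow>
   real set \<Rightarrow> (real \<Rightarrow> (real^'m) set) \<Rightarrow> bool" where
  "smooth_quot_section A L c \<eta> K q \<longleftrightarrow> (\<exists>w. quot_section_lift A L c \<eta> K q w)"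

definition has_quot_deriv ::
  "('a, 'm::finite) chart set \<Rightarrow> ('a \<Rightarrow> real^'m \<Rightarrow> real) \<Rightarrow> ('a, 'm) chart \<Rightarrow> (real \<Rightarrow> 'a) \<Rightarrow>
   real set \<Rightarrow> (real \<Rightarrow> (real^'m) set) \<Rightarrow> (real \<Rightarrow> (real^'m) set) \<Rightarrow> bool" where
  "has_quot_deriv A L c \<eta> K q q' \<longleftrightarrow>
     (\<exists>w. quot_section_lift A L c \<eta> K q w \<and>
        (\<forall>t\<in>K. q' t = quot_class (velocity A \<eta> t) (cov_deriv A L c \<eta> w t)))"

text \<open>
  Fields \<open>E\<close> of endomorphisms of the quotient spaces. Smoothness and the covariant derivative are
  local, so they are tested on all sections over intervals contained in a chart; the derivative
  \<open>E'\<close> is characterized by \<open>(E q)' = E' q + E q'\<close>, where \<open>+\<close> is the sum of cosets.\<close>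

definition smooth_quot_endo_field ::
  "('a, 'm::finite) chart set \<Rightarrow> ('a \<Rightarrow> real^'m \<Rightarrow> real) \<Rightarrow> real set \<Rightarrow> (real \<Rightarrow> 'a) \<Rightarrow>
   (real \<Rightarrow> (real^'m) set \<Rightarrow> (real^'m) set) \<Rightarrow> bool" where
  "smooth_quot_endo_field A L I \<eta> E \<longleftrightarrow>
     (\<forall>t\<in>I. quot_endo A L (\<eta> t) (velocity A \<eta> t) (E t)) \<and>
     (\<forall>c\<in>A. \<forall>r s q. {r<..<s} \<subseteq> I \<and> \<eta> ` {r<..<s} \<subseteq> fst c \<and>
        smooth_quot_section A L c \<eta> {r<..<s} q \<longrightarrow>
        smooth_quot_section A L c \<eta> {r<..<s} (\<lambda>t. E t (q t)))"

definition has_quot_endo_deriv ::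
  "('a, 'm::finite) chart set \<Rightarrow> ('a \<Rightarrow> real^'m \<Rightarrow> real) \<Rightarrow> real set \<Rightarrow> (real \<Rightarrow> 'a) \<Rightarrow>
   (real \<Rightarrow> (real^'m) set \<Rightarrow> (real^'m) set) \<Rightarrow> (real \<Rightarrow> (real^'m) set \<Rightarrow> (real^'m) set) \<Rightarrow> bool" where
  "has_quot_endo_deriv A L I \<eta> E E' \<longleftrightarrow>
     (\<forall>t\<in>I. quot_endo A L (\<eta> t) (velocity A \<eta> t) (E' t)) \<and>
     (\<forall>c\<in>A. \<forall>r s q q'. {r<..<s} \<subseteq> I \<and> \<eta> ` {r<..<s} \<subseteq> fst c \<and>
        has_quot_deriv A L c \<eta> {r<..<s} q q' \<longrightarrow>
        has_quot_deriv A L c \<eta> {r<..<s} (\<lambda>t. E t (q t)) (\<lambda>t. E' t (q t) + E t (q' t)))"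

text \<open>\<open>J\<close> is a Jacobi, respectively Lagrange, tensor field along \<open>\<eta>\<close> with covariant derivative \<open>J'\<close>.\<close>

definition jacobi_tensor_field ::
  "('a, 'm::finite) chart set \<Rightarrow> ('a \<Rightarrow> real^'m \<Rightarrow> real) \<Rightarrow> real set \<Rightarrow> (real \<Rightarrow> 'a) \<Rightarrow>
   (real \<Rightarrow> (real^'m) set \<Rightarrow> (real^'m) set) \<Rightarrow> (real \<Rightarrow> (real^'m) set \<Rightarrow> (real^'m) set) \<Rightarrow> bool" where
  "jacobi_tensor_field A L I \<eta> J J' \<longleftrightarrow>
     smooth_quot_endo_field A L I \<eta> J \<and> has_quot_endo_deriv A L I \<eta> J J' \<and>
     (\<exists>J''. has_quot_endo_deriv A L I \<eta> J' J'' \<and>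
        (\<forall>t\<in>I. \<forall>q\<in>quot_space A L (\<eta> t) (velocity A \<eta> t).
           J'' t q + quot_curv A L (\<eta> t) (velocity A \<eta> t) (J t q) = quot_class (velocity A \<eta> t) 0)) \<and>
     (\<forall>t\<in>I. {q \<in> quot_space A L (\<eta> t) (velocity A \<eta> t).
                J t q = quot_class (velocity A \<eta> t) 0 \<and> J' t q = quot_class (velocity A \<eta> t) 0}
            = {quot_class (velocity A \<eta> t) 0})"

definition lagrange_tensor_field ::
  "('a, 'm::finite) chart set \<Rightarrow> ('a \<Rightarrow> real^'m \<Rightarrow> real) \<Rightarrow> real set \<Rightarrow> (real \<Rightarrow> 'a) \<Rightarrow>
   (real \<Rightarrow> (real^'m) set \<Rightarrow> (real^'m) set) \<Rightarrow> (real \<Rightarrow> (real^'m) set \<Rightarrow> (real^'m) set) \<Rightarrow> bool" where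
  "lagrange_tensor_field A L I \<eta> J J' \<longleftrightarrow>
     jacobi_tensor_field A L I \<eta> J J' \<and>
     (\<forall>t\<in>I. \<exists>JT JT'.
        is_quot_transpose A L (\<eta> t) (velocity A \<eta> t) (J t) JT \<and>
        is_quot_transpose A L (\<eta> t) (velocity A \<eta> t) (J' t) JT' \<and>
        (\<forall>q\<in>quot_space A L (\<eta> t) (velocity A \<eta> t). JT' (J t q) = JT (J' t q)))"

text \<open>Only meaningful where \<open>J t\<close> is bijective on the quotient space.\<close>

definition expansion ::
  "('a, 'm::finite) chart set \<Rightarrow> ('a \<Rightarrow> real^'m \<Rightarrow> real) \<Rightarrow> (real \<Rightarrow> 'a) \<Rightarrow>
   (real \<Rightarrow> (real^'m) set \<Rightarrow> (real^'m) set) \<Rightarrow> (real \<Rightarrow> (real^'m) set \<Rightarrow> (real^'m) set) \<Rightarrow> real \<Rightarrow> real" where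
  "expansion A L \<eta> J J' t =
     quot_trace A L (\<eta> t) (velocity A \<eta> t)
       (J' t \<circ> inv_into (quot_space A L (\<eta> t) (velocity A \<eta> t)) (J t))"

definition eps_expansion ::
  "('a, 'm::finite) chart set \<Rightarrow> ('a \<Rightarrow> real^'m \<Rightarrow> real) \<Rightarrow> ('a \<Rightarrow> real^'m \<Rightarrow> real) \<Rightarrow> real \<Rightarrow> (real \<Rightarrow> 'a) \<Rightarrow>
   (real \<Rightarrow> (real^'m) set \<Rightarrow> (real^'m) set) \<Rightarrow> (real \<Rightarrow> (real^'m) set \<Rightarrow> (real^'m) set) \<Rightarrow> real \<Rightarrow> real" where
  "eps_expansion A L \<psi> \<epsilon> \<eta> J J' t =
     exp (2 * (1 - \<epsilon>) / (real CARD('m) - 2) * weight_along A \<psi> \<eta> t) *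
       (expansion A L \<eta> J J' t - deriv (weight_along A \<psi> \<eta>) t)"

section \<open>The range of \<open>\<epsilon>\<close> and the constant \<open>c\<close>\<close>

definition eps_admissible :: "nat \<Rightarrow> ereal \<Rightarrow> real \<Rightarrow> bool" where
  "eps_admissible n N \<epsilon> \<longleftrightarrow>
     (if N = 1 then \<epsilon> = 0
      else if N = ereal (real n) then True
      else if N = \<infinity> then \<bar>\<epsilon>\<bar> < 1
      else \<bar>\<epsilon>\<bar> < sqrt ((real_of_ereal N - 1) / (real_of_ereal N - real n)))"

definition c_const :: "nat \<Rightarrow> ereal \<Rightarrow> real \<Rightarrow> real" where
  "c_const n N \<epsilon> =
     (if N = 1 then 1 / (real n - 1)
      else if N = \<infinity> then (1 - \<epsilon>\<^sup>2) / (real n - 1)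
      else 1 / (real n - 1) *
        (1 - \<epsilon>\<^sup>2 * ((real_of_ereal N - real n) / (real_of_ereal N - 1))))"

end

theory Submission
  imports Defs
begin

text \<open>
  Along \<open>\<eta>\<close> put \<open>U = J' J\<^sup>-\<^sup>1\<close> on the quotient bundle. The Lagrange condition makes \<open>U\<close> symmetric, the
  Jacobi equation gives the Riccati equation \<open>U' = - R - U\<^sup>2\<close>, and the trace of \<open>R\<close> on the quotient equals
  \<open>Ric\<close>, because \<open>R\<^sub>v v = 0\<close> and \<open>R\<^sub>v\<close> takes values in the null hyperplane of \<open>v\<close>. Cauchy--Schwarz then yields
  \<open>\<theta>' \<le> - \<theta>\<^sup>2 / (n - 1) - Ric\<close>. Inserting the lower bound on \<open>Ric\<^sub>N\<close> and completing a square, one finds that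
  \<open>x = \<theta>\<^sub>\<epsilon>\<close> satisfies \<open>x' \<le> - c \<tau>\<^sub>\<epsilon>' x\<^sup>2\<close>. Hence \<open>1 / x - c \<tau>\<^sub>\<epsilon>\<close> is nondecreasing, which is impossible up to the
  time where \<open>\<tau>\<^sub>\<epsilon>\<close> takes the value \<open>\<tau>\<^sub>\<epsilon>(t\<^sub>0) - 1 / (c x(t\<^sub>0))\<close>.

  The Riccati equation is derived at one instant \<open>t\<close> at a time, in the chart \<open>pref_chart A (\<eta> t)\<close>, where the
  identification of the tangent space with \<open>real^'m\<close> is the identity; this way no transformation law of the
  connection or of the curvature under a change of charts is needed.\<close>

section \<open>Calculus of smooth maps\<close>

text \<open>The two facts on \<open>R_v\<close> have different sources. \<open>R_v v = 0\<close> is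
  Euler's identity applied to the spray and its fibre derivatives. That \<open>R_v\<close> maps into
  the null hyperplane of \<open>v\<close> reflects that \<open>L\<close> is constant in horizontal
  directions. In a null frame they delete the two diagonal entries which the quotient does not see.
  Endomorphisms of the quotient are maps on cosets, and their traces and determinants refer to
  matrices picked by choice. Differentiation is therefore done on matrices in a frame that follows
  the null hyperplanes; its connection matrix enters as a commutator and leaves the trace.
  \<open>Ric_N\<close> reads the weight along a geodesic picked by choice, starting with the
  rescaled velocity. Local uniqueness identifies it with an affine reparametrization of
  \<open>\<eta>\<close>. All terms have degree 2, so the scale factor does not affect the sign. The
  square absorbs the mixed term in \<open>\<epsilon>\<close> and the derivative of the weight;
  \<open>c\<close> is what it leaves of the coefficient of the squared expansion, and the bound on
  \<open>\<epsilon>\<close> makes it positive.\<close>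

lemma Ck_on_subset: "Ck_on k S f \<Longrightarrow> T \<subseteq> S \<Longrightarrow> Ck_on k T f"
  by (induction k arbitrary: f) (auto intro: continuous_on_subset)

lemma Ck_on_Suc_imp: "Ck_on (Suc k) S f \<Longrightarrow> Ck_on k S f"
proof (induction k arbitrary: f)
  case 0
  then show ?case
    by (metis Ck_on.simps differentiable_at_withinI differentiable_imp_continuous_on differentiable_on_def)
next
  case (Suc k)
  then show ?case by (metis Ck_on.simps(2))
qed

text \<open>Since \<open>S\<close> is open, agreement on \<open>S\<close> is agreement near each of
  its points, so the derivatives agree on \<open>S\<close> too and the induction can pass to
  them.\<close>

lemma Ck_on_cong:
  assumes "open S" "\<And>x. x \<in> S \<Longrightarrow> f x = g x" "Ck_on k S f"
  shows "Ck_on k S g"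
  using assms(2,3)
proof (induction k arbitrary: f g)
  case 0
  then show ?case using continuous_on_cong by fastforce
next
  case (Suc k)
  have df: "(f has_derivative frechet_derivative f (at x)) (at x)" if "x \<in> S" for x
    using Suc.prems that frechet_derivative_works by auto
  have dg: "(g has_derivative frechet_derivative f (at x)) (at x)" if "x \<in> S" for x
    using has_derivative_transform_within_open[OF df[OF that] \<open>open S\<close> that] Suc.prems(1) by auto
  have eq: "frechet_derivative f (at x) v = frechet_derivative g (at x) v" if "x \<in> S" for x v
    using frechet_derivative_at[OF dg[OF that]] by simp
  show ?case
    unfolding Ck_on.simps
  proof (intro conjI ballI allI)
    show "g differentiable at x" if "x \<in> S" for x
      using dg[OF that] by (auto simp: differentiable_def)
    show "Ck_on k S (\<lambda>x. frechet_derivative g (at x) v)" for v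
      by (rule Suc.IH[of "\<lambda>x. frechet_derivative f (at x) v"]) (use Suc.prems eq in auto)
  qed
qed

text \<open>Replaces the choice-based \<open>frechet_derivative\<close> of the definition by any
  explicit family of derivatives, so that the rules below can compute with formulas.\<close>

lemma Ck_on_SucI:
  assumes "open S" "\<And>x. x \<in> S \<Longrightarrow> (f has_derivative f' x) (at x)"
    and "\<And>v. Ck_on k S (\<lambda>x. f' x v)"
  shows "Ck_on (Suc k) S f"
  unfolding Ck_on.simps
proof (intro conjI ballI allI)
  show "f differentiable at x" if "x \<in> S" for x
    using assms(2)[OF that] by (auto simp: differentiable_def)
  show "Ck_on k S (\<lambda>x. frechet_derivative f (at x) v)" for v
    by (rule Ck_on_cong[OF assms(1) _ assms(3)[of v]]) (use frechet_derivative_at[OF assms(2)] in metis)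
qed

lemma Ck_on_has_derivative:
  "Ck_on (Suc k) S f \<Longrightarrow> x \<in> S \<Longrightarrow> (f has_derivative frechet_derivative f (at x)) (at x)"
  using frechet_derivative_works by auto

lemma Ck_on_const: "Ck_on k S (\<lambda>x. c)"
proof (induction k arbitrary: c)
  case (Suc k)
  show ?case by (simp add: Suc)
qed simp

lemma Ck_on_bounded_linear:
  assumes "bounded_linear h" shows "Ck_on k S h"
proof (cases k)
  case 0
  then show ?thesis using linear_continuous_on[OF assms] by simp
next
  case (Suc l)
  have "(h has_derivative h) (at x)" for x
    using assms by (rule bounded_linear_imp_has_derivative)
  then show ?thesis
    unfolding Suc using frechet_derivative_at[of h h]
    by (auto simp: differentiable_def Ck_on_const)
qed

lemma Ck_on_add:
  assumes "open S" "Ck_on k S f" "Ck_on k S g"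
  shows "Ck_on k S (\<lambda>x. f x + g x)"
  using assms(2,3)
proof (induction k arbitrary: f g)
  case 0
  then show ?case by (auto intro: continuous_on_add)
next
  case (Suc k)
  show ?case
    by (rule Ck_on_SucI[OF \<open>open S\<close> has_derivative_add[OF Ck_on_has_derivative[OF Suc.prems(1)]
            Ck_on_has_derivative[OF Suc.prems(2)]]])
      (use Suc in auto)
qed

lemma (in bounded_bilinear) Ck_on:
  assumes "open S" "Ck_on k S f" "Ck_on k S g"
  shows "Ck_on k S (\<lambda>x. prod (f x) (g x))"
  using assms(2,3)
proof (induction k arbitrary: f g)
  case 0
  then show ?case by (auto intro: continuous_on)
next
  case (Suc k)
  show ?case
  proof (rule Ck_on_SucI[OF \<open>open S\<close> FDERIV[OF Ck_on_has_derivative[OF Suc.prems(1)]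
          Ck_on_has_derivative[OF Suc.prems(2)]]])
    fix v
    have "Ck_on k S (\<lambda>x. prod (f x) (frechet_derivative g (at x) v))"
      "Ck_on k S (\<lambda>x. prod (frechet_derivative f (at x) v) (g x))"
      using Suc.prems Ck_on_Suc_imp[OF Suc.prems(1)] Ck_on_Suc_imp[OF Suc.prems(2)]
      by (auto intro!: Suc.IH)
    then show "Ck_on k S (\<lambda>x. prod (f x) (frechet_derivative g (at x) v) +
        prod (frechet_derivative f (at x) v) (g x))"
      by (rule Ck_on_add[OF \<open>open S\<close>])
  qed auto
qed

lemma Ck_on_sum:
  assumes "open S" "\<And>i. i \<in> I \<Longrightarrow> Ck_on k S (f i)"
  shows "Ck_on k S (\<lambda>x. \<Sum>i\<in>I. f i x)"
  using assms(2)
  by (induction I rule: infinite_finite_induct) (auto intro: Ck_on_const Ck_on_add[OF \<open>open S\<close>])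

lemma Ck_on_compose:
  fixes f :: "'a::real_normed_vector \<Rightarrow> 'b::euclidean_space"
  assumes "open S" "open T" "f ` S \<subseteq> T" "Ck_on k S f" "Ck_on k T g"
  shows "Ck_on k S (\<lambda>x. g (f x))"
  using assms(4,5)
proof (induction k arbitrary: g)
  case 0
  then show ?case
    using \<open>f ` S \<subseteq> T\<close> continuous_on_compose2[of T g S f] by simp
next
  case (Suc k)
  let ?D = "\<lambda>f x. frechet_derivative f (at x)"
  have df: "(f has_derivative ?D f x) (at x)" if "x \<in> S" for x
    using Ck_on_has_derivative[OF Suc.prems(1) that] .
  have dg: "(g has_derivative ?D g (f x)) (at (f x))" if "x \<in> S" for x
    using Ck_on_has_derivative[OF Suc.prems(2)] that assms(3) by blast
  show ?case
  proof (rule Ck_on_SucI[OF \<open>open S\<close>])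
    show "((\<lambda>x. g (f x)) has_derivative (\<lambda>v. ?D g (f x) (?D f x v))) (at x)" if "x \<in> S" for x
      using has_derivative_compose[OF df[OF that] dg[OF that]] .
    fix v
    \<comment> \<open>In \<open>?D g (f x) (?D f x v)\<close> the direction varies with
      \<open>x\<close>, while \<open>Ck_on\<close> controls fixed directions only. Expanding the
      direction in the basis of the middle space leaves fixed directions \<open>b\<close> with
      scalar coefficients.\<close>
    have "Ck_on k S (\<lambda>x. \<Sum>b\<in>Basis. (?D f x v \<bullet> b) *\<^sub>R ?D g (f x) b)"
    proof (rule Ck_on_sum[OF \<open>open S\<close>])
      fix b :: 'b assume "b \<in> Basis"
      have "Ck_on k S (\<lambda>x. ?D f x v \<bullet> b)"
        using Suc.prems
        by (auto intro!: bounded_bilinear.Ck_on[OF bounded_bilinear_inner \<open>open S\<close> _ Ck_on_const])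
      moreover have "Ck_on k S (\<lambda>x. ?D g (f x) b)"
        using Suc.prems Ck_on_Suc_imp[OF Suc.prems(1)] by (intro Suc.IH) auto
      ultimately show "Ck_on k S (\<lambda>x. (?D f x v \<bullet> b) *\<^sub>R ?D g (f x) b)"
        by (rule bounded_bilinear.Ck_on[OF bounded_bilinear_scaleR \<open>open S\<close>])
    qed
    moreover have "?D g (f x) (?D f x v) = (\<Sum>b\<in>Basis. (?D f x v \<bullet> b) *\<^sub>R ?D g (f x) b)"
      if "x \<in> S" for x
    proof -
      have "linear (?D g (f x))" using dg[OF that] has_derivative_linear by blast
      then have "?D g (f x) (\<Sum>b\<in>Basis. (?D f x v \<bullet> b) *\<^sub>R b) = (\<Sum>b\<in>Basis. (?D f x v \<bullet> b) *\<^sub>R ?D g (f x) b)"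
        by (simp add: linear_sum linear_cmul)
      then show ?thesis by (simp add: euclidean_representation)
    qed
    ultimately show "Ck_on k S (\<lambda>x. ?D g (f x) (?D f x v))"
      by (auto intro: Ck_on_cong[OF \<open>open S\<close>])
  qed
qed

text \<open>The derivative is a product of copies of \<open>inverse\<close> with a constant, so the
  induction closes by the product rule.\<close>

lemma Ck_on_inverse_real: "Ck_on k (- {0}) (inverse :: real \<Rightarrow> real)"
proof (induction k)
  case 0
  then show ?case by (auto intro!: continuous_intros)
next
  case (Suc k)
  have op: "open (- {0::real})" by auto
  show ?case
  proof (rule Ck_on_SucI[OF op])
    show "(inverse has_derivative (\<lambda>h. - (inverse x * h * inverse x))) (at x)"
      if "x \<in> - {0}" for x :: real
      using that by (auto intro: has_derivative_inverse')
    fix v :: real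
    have "Ck_on k (- {0}) (\<lambda>x::real. (inverse x * inverse x) * (- v))"
      by (intro bounded_bilinear.Ck_on[OF bounded_bilinear_mult op] Suc Ck_on_const)
    then show "Ck_on k (- {0}) (\<lambda>x::real. - (inverse x * v * inverse x))"
      by (rule Ck_on_cong[OF op, rotated]) auto
  qed
qed

section \<open>Closure properties of infinitely differentiable maps, order by order\<close>

lemma smooth_on_subset: "smooth_on S f \<Longrightarrow> T \<subseteq> S \<Longrightarrow> smooth_on T f"
  unfolding smooth_on_def using Ck_on_subset by blast

lemma smooth_on_cong: "open S \<Longrightarrow> (\<And>x. x \<in> S \<Longrightarrow> f x = g x) \<Longrightarrow> smooth_on S f \<Longrightarrow> smooth_on S g"
  unfolding smooth_on_def using Ck_on_cong by metis

lemma smooth_on_const: "smooth_on S (\<lambda>x. c)"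
  unfolding smooth_on_def using Ck_on_const by blast

lemma smooth_on_bounded_linear: "bounded_linear h \<Longrightarrow> smooth_on S h"
  unfolding smooth_on_def using Ck_on_bounded_linear by blast

lemma smooth_on_id: "smooth_on S (\<lambda>x. x)"
  by (rule smooth_on_bounded_linear[OF bounded_linear_ident])

lemma smooth_on_add:
  "open S \<Longrightarrow> smooth_on S f \<Longrightarrow> smooth_on S g \<Longrightarrow> smooth_on S (\<lambda>x. f x + g x)"
  unfolding smooth_on_def using Ck_on_add by blast

lemma (in bounded_bilinear) smooth_on:
  "open S \<Longrightarrow> smooth_on S f \<Longrightarrow> smooth_on S g \<Longrightarrow> smooth_on S (\<lambda>x. prod (f x) (g x))"
  unfolding smooth_on_def using Ck_on by blast

lemmas smooth_on_scaleR = bounded_bilinear.smooth_on[OF bounded_bilinear_scaleR]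
lemmas smooth_on_mult = bounded_bilinear.smooth_on[OF bounded_bilinear_mult]
lemmas smooth_on_inner = bounded_bilinear.smooth_on[OF bounded_bilinear_inner]

lemma smooth_on_sum:
  "open S \<Longrightarrow> (\<And>i. i \<in> I \<Longrightarrow> smooth_on S (f i)) \<Longrightarrow> smooth_on S (\<lambda>x. \<Sum>i\<in>I. f i x)"
  unfolding smooth_on_def by (auto intro: Ck_on_sum)

lemma smooth_on_prod:
  fixes f :: "'i \<Rightarrow> 'a::real_normed_vector \<Rightarrow> real"
  assumes "open S" "\<And>i. i \<in> I \<Longrightarrow> smooth_on S (f i)"
  shows "smooth_on S (\<lambda>x. \<Prod>i\<in>I. f i x)"
  using assms(2)
  by (induction I rule: infinite_finite_induct) (auto intro: smooth_on_const smooth_on_mult[OF \<open>open S\<close>])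

lemma smooth_on_compose:
  fixes f :: "'a::real_normed_vector \<Rightarrow> 'b::euclidean_space"
  shows "open S \<Longrightarrow> open T \<Longrightarrow> f ` S \<subseteq> T \<Longrightarrow> smooth_on S f \<Longrightarrow> smooth_on T g \<Longrightarrow> smooth_on S (\<lambda>x. g (f x))"
  unfolding smooth_on_def using Ck_on_compose by blast

lemma smooth_on_linear_compose:
  fixes f :: "'a::real_normed_vector \<Rightarrow> 'b::euclidean_space"
  assumes "open S" "smooth_on S f" "bounded_linear h"
  shows "smooth_on S (\<lambda>x. h (f x))"
  by (rule smooth_on_compose[OF assms(1) open_UNIV _ assms(2) smooth_on_bounded_linear[OF assms(3)]]) auto

lemma smooth_on_minus:
  fixes f :: "'a::real_normed_vector \<Rightarrow> 'b::euclidean_space"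
  shows "open S \<Longrightarrow> smooth_on S f \<Longrightarrow> smooth_on S (\<lambda>x. - f x)"
  by (rule smooth_on_linear_compose) (auto intro: bounded_linear_minus bounded_linear_ident)

lemma smooth_on_diff:
  fixes f :: "'a::real_normed_vector \<Rightarrow> 'b::euclidean_space"
  assumes "open S" "smooth_on S f" "smooth_on S g"
  shows "smooth_on S (\<lambda>x. f x - g x)"
  using smooth_on_add[OF assms(1,2) smooth_on_minus[OF assms(1,3)]] by simp

lemma smooth_on_divide:
  fixes f g :: "'a::real_normed_vector \<Rightarrow> real"
  assumes "open S" "smooth_on S f" "smooth_on S g" "\<And>x. x \<in> S \<Longrightarrow> g x \<noteq> 0"
  shows "smooth_on S (\<lambda>x. f x / g x)"
proof -
  have "smooth_on S (\<lambda>x. inverse (g x))"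
    by (rule smooth_on_compose[OF assms(1) _ _ assms(3), of "- {0}"])
      (use assms(4) Ck_on_inverse_real in \<open>auto simp: smooth_on_def\<close>)
  then show ?thesis
    unfolding divide_inverse by (rule smooth_on_mult[OF assms(1,2)])
qed

lemma smooth_on_vec_nth:
  fixes f :: "'a::real_normed_vector \<Rightarrow> real^'m::finite"
  assumes "open S" "smooth_on S f" shows "smooth_on S (\<lambda>x. f x $ i)"
  by (rule smooth_on_linear_compose[OF assms bounded_linear_vec_nth])

lemma smooth_on_vec_lambda:
  fixes f :: "'a::real_normed_vector \<Rightarrow> real^'m::finite"
  assumes "open S" "\<And>i. smooth_on S (\<lambda>x. f x $ i)"
  shows "smooth_on S f"
proof -
  have "smooth_on S (\<lambda>x. \<Sum>i\<in>UNIV. f x $ i *\<^sub>R axis i 1)"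
    by (intro smooth_on_sum smooth_on_scaleR smooth_on_const assms)
  then show ?thesis
    by (rule smooth_on_cong[OF assms(1), rotated])
      (simp add: basis_expansion scalar_mult_eq_scaleR[symmetric])
qed

lemma smooth_on_Pair:
  fixes f :: "'a::real_normed_vector \<Rightarrow> 'b::euclidean_space" and g :: "'a \<Rightarrow> 'c::euclidean_space"
  assumes "open S" "smooth_on S f" "smooth_on S g"
  shows "smooth_on S (\<lambda>x. (f x, g x))"
proof -
  have "smooth_on S (\<lambda>x. (f x, 0) + (0, g x))"
    by (intro smooth_on_add smooth_on_linear_compose[OF assms(1,2)] smooth_on_linear_compose[OF assms(1,3)] assms(1)
        bounded_linear_Pair bounded_linear_ident bounded_linear_zero)
  then show ?thesis by simp
qed

lemma smooth_on_snd:
  fixes f :: "'a::real_normed_vector \<Rightarrow> 'b::euclidean_space \<times> 'c::euclidean_space"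
  shows "open S \<Longrightarrow> smooth_on S f \<Longrightarrow> smooth_on S (\<lambda>x. snd (f x))"
  by (rule smooth_on_linear_compose) (auto intro: bounded_linear_snd)

lemma smooth_on_differentiable: "smooth_on S f \<Longrightarrow> x \<in> S \<Longrightarrow> f differentiable (at x)"
  unfolding smooth_on_def by (metis Ck_on.simps(2))

lemma smooth_on_has_derivative:
  "smooth_on S f \<Longrightarrow> x \<in> S \<Longrightarrow> (f has_derivative frechet_derivative f (at x)) (at x)"
  using smooth_on_differentiable frechet_derivative_works by blast

lemma smooth_on_frechet: "smooth_on S f \<Longrightarrow> smooth_on S (\<lambda>x. frechet_derivative f (at x) v)"
  unfolding smooth_on_def by (metis Ck_on.simps(2))

lemma smooth_on_continuous: "smooth_on S f \<Longrightarrow> continuous_on S f"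
  unfolding smooth_on_def by (metis Ck_on.simps(1))

lemma smooth_on_vector_derivative:
  fixes f :: "real \<Rightarrow> 'b::real_normed_vector"
  assumes "open S" "smooth_on S f"
  shows "smooth_on S (\<lambda>t. vector_derivative f (at t))"
proof (rule smooth_on_cong[OF assms(1) _ smooth_on_frechet[OF assms(2)]])
  show "frechet_derivative f (at t) 1 = vector_derivative f (at t)" if "t \<in> S" for t
    using frechet_derivative_eq_vector_derivative[OF smooth_on_differentiable[OF assms(2) that]] by simp
qed

lemma smooth_on_has_vector_derivative:
  fixes f :: "real \<Rightarrow> 'b::real_normed_vector"
  assumes "smooth_on S f" "t \<in> S"
  shows "(f has_vector_derivative vector_derivative f (at t)) (at t)"
  using smooth_on_differentiable[OF assms] vector_derivative_works by blast

section \<open>Mixed partial derivatives\<close>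

lemma DERIV_along:
  fixes f :: "'a::real_normed_vector \<Rightarrow> real"
  assumes "(f has_derivative D) (at (p t))" "(p has_derivative (\<lambda>s. s *\<^sub>R w)) (at t)"
  shows "DERIV (\<lambda>t. f (p t)) t :> D w"
proof (rule has_derivative_imp_has_field_derivative[OF has_derivative_compose[OF assms(2,1)]])
  show "s * D w = D (s *\<^sub>R w)" for s
    using has_derivative_linear[OF assms(1)] by (simp add: linear_cmul)
qed

text \<open>The second difference is an increment of increments: the mean value theorem in the
  direction \<open>v\<close> is applied to the difference in the direction \<open>w\<close>, and
  then once more in the direction \<open>w\<close>. The intermediate point stays inside the
  parallelogram.\<close>

lemma second_difference_mean_value:
  fixes f :: "'a::real_normed_vector \<Rightarrow> real"
  assumes S: "open S" "Ck_on 2 S f" and h: "h > 0"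
    and in_S: "\<And>s t. 0 \<le> s \<Longrightarrow> s \<le> h \<Longrightarrow> 0 \<le> t \<Longrightarrow> t \<le> h \<Longrightarrow> x + s *\<^sub>R v + t *\<^sub>R w \<in> S"
  obtains s t where "0 < s" "s < h" "0 < t" "t < h"
    "f (x + h *\<^sub>R v + h *\<^sub>R w) - f (x + h *\<^sub>R v) - f (x + h *\<^sub>R w) + f x =
      h\<^sup>2 * frechet_derivative (\<lambda>y. frechet_derivative f (at y) v) (at (x + s *\<^sub>R v + t *\<^sub>R w)) w"
proof -
  have C2: "Ck_on (Suc (Suc 0)) S f" using S(2) by (simp add: numeral_2_eq_2)
  have df: "(f has_derivative frechet_derivative f (at y)) (at y)" if "y \<in> S" for y
    using Ck_on_has_derivative[OF C2 that] .
  define D where "D y = frechet_derivative f (at y) v" for y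
  have dD: "(D has_derivative frechet_derivative D (at y)) (at y)" if "y \<in> S" for y
    using Ck_on_has_derivative[of 0 S D y] C2 that unfolding D_def by auto
  define \<phi> where "\<phi> t = f (x + t *\<^sub>R v + h *\<^sub>R w) - f (x + t *\<^sub>R v)" for t
  have d\<phi>: "DERIV \<phi> t :> D (x + t *\<^sub>R v + h *\<^sub>R w) - D (x + t *\<^sub>R v)" if "0 \<le> t" "t \<le> h" for t
  proof -
    have "((\<lambda>t. f (x + t *\<^sub>R v + c *\<^sub>R w)) has_derivative (\<lambda>s. s * D (x + t *\<^sub>R v + c *\<^sub>R w))) (at t)"
      if c: "0 \<le> c" "c \<le> h" for c
    proof -
      have y: "x + t *\<^sub>R v + c *\<^sub>R w \<in> S" using in_S \<open>0 \<le> t\<close> \<open>t \<le> h\<close> c by blast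
      have "((\<lambda>t. x + t *\<^sub>R v + c *\<^sub>R w) has_derivative (\<lambda>s. s *\<^sub>R v)) (at t)"
        by (auto intro!: derivative_eq_intros)
      from has_derivative_compose[OF this df[OF y]] show ?thesis
        using has_derivative_linear[OF df[OF y]] by (simp add: linear_cmul D_def)
    qed
    from this[of h] this[of 0] h
    have "(\<phi> has_derivative (\<lambda>s. s * D (x + t *\<^sub>R v + h *\<^sub>R w) - s * D (x + t *\<^sub>R v))) (at t)"
      unfolding \<phi>_def by (auto intro!: has_derivative_diff)
    then show ?thesis
      unfolding has_field_derivative_def by (rule has_derivative_eq_rhs) (auto simp: algebra_simps)
  qed
  obtain s where s: "0 < s" "s < h"
    "\<phi> h - \<phi> 0 = h * (D (x + s *\<^sub>R v + h *\<^sub>R w) - D (x + s *\<^sub>R v))"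
    using MVT2[OF h, of \<phi> "\<lambda>t. D (x + t *\<^sub>R v + h *\<^sub>R w) - D (x + t *\<^sub>R v)"] d\<phi> by auto
  define \<xi> where "\<xi> t = D (x + s *\<^sub>R v + t *\<^sub>R w)" for t
  have d\<xi>: "DERIV \<xi> t :> frechet_derivative D (at (x + s *\<^sub>R v + t *\<^sub>R w)) w"
    if "0 \<le> t" "t \<le> h" for t
  proof -
    have y: "x + s *\<^sub>R v + t *\<^sub>R w \<in> S" using in_S s that by simp
    have "((\<lambda>t. x + s *\<^sub>R v + t *\<^sub>R w) has_derivative (\<lambda>r. r *\<^sub>R w)) (at t)"
      by (auto intro!: derivative_eq_intros)
    from DERIV_along[OF dD[OF y] this] show ?thesis unfolding \<xi>_def .
  qed
  obtain t where t: "0 < t" "t < h"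
    "\<xi> h - \<xi> 0 = h * frechet_derivative D (at (x + s *\<^sub>R v + t *\<^sub>R w)) w"
    using MVT2[OF h, of \<xi> "\<lambda>t. frechet_derivative D (at (x + s *\<^sub>R v + t *\<^sub>R w)) w"] d\<xi> by auto
  have "\<phi> h - \<phi> 0 = h * (\<xi> h - \<xi> 0)" using s(3) by (simp add: \<xi>_def)
  then have "\<phi> h - \<phi> 0 = h\<^sup>2 * frechet_derivative D (at (x + s *\<^sub>R v + t *\<^sub>R w)) w"
    unfolding t(3) by (simp add: power2_eq_square)
  then show ?thesis
    using that[OF s(1,2) t(1,2)] by (simp add: \<phi>_def D_def[abs_def] algebra_simps)
qed

text \<open>Schwarz's theorem. The second difference over a parallelogram does not depend on the
  order of its sides, so the two mixed derivatives agree at points arbitrarily close to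
  \<open>x\<close>; continuity does the rest.\<close>

lemma mixed_derivatives_commute:
  fixes f :: "'a::real_normed_vector \<Rightarrow> real"
  assumes S: "open S" "Ck_on 2 S f" "x \<in> S"
  shows "frechet_derivative (\<lambda>y. frechet_derivative f (at y) v) (at x) w =
         frechet_derivative (\<lambda>y. frechet_derivative f (at y) w) (at x) v"
proof -
  define P where "P v w y = frechet_derivative (\<lambda>y. frechet_derivative f (at y) v) (at y) w" for v w y
  have C2: "Ck_on (Suc (Suc 0)) S f" using S(2) by (simp add: numeral_2_eq_2)
  then have "continuous_on S (P v w)" for v w unfolding P_def by auto
  then have cont: "\<exists>d>0. \<forall>y\<in>S. dist y x < d \<longrightarrow> dist (P v w y) (P v w x) < e" if "e > 0" for e v w
    using that S(3) unfolding continuous_on_iff by blast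
  have "\<bar>P v w x - P w v x\<bar> < e" if e: "e > 0" for e
  proof -
    obtain d1 where d1: "d1 > 0" "\<And>y. y \<in> S \<Longrightarrow> dist y x < d1 \<Longrightarrow> dist (P v w y) (P v w x) < e / 2"
      using cont[of "e / 2" v w] e by auto
    obtain d2 where d2: "d2 > 0" "\<And>y. y \<in> S \<Longrightarrow> dist y x < d2 \<Longrightarrow> dist (P w v y) (P w v x) < e / 2"
      using cont[of "e / 2" w v] e by auto
    obtain d3 where d3: "d3 > 0" "\<And>y. dist y x < d3 \<Longrightarrow> y \<in> S"
      using S(1,3) unfolding open_dist by blast
    define d where "d = min d1 (min d2 d3)"
    have d: "d > 0" "d \<le> d1" "d \<le> d2" "d \<le> d3" using d1 d2 d3 by (auto simp: d_def)
    \<comment> \<open>Small enough for the parallelogram with sides \<open>h v\<close> and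
      \<open>h w\<close> to stay within distance \<open>d\<close>; the summand 1 keeps the
      denominator positive and the bound strict.\<close>
    define h where "h = d / (norm v + norm w + 1)"
    have pos: "norm v + norm w + 1 > 0" using norm_ge_zero[of v] norm_ge_zero[of w] by linarith
    have h: "h > 0" using d pos by (simp add: h_def)
    have near: "dist (x + s *\<^sub>R v + t *\<^sub>R w) x < d" "dist (x + s *\<^sub>R w + t *\<^sub>R v) x < d"
      if "0 \<le> s" "s \<le> h" "0 \<le> t" "t \<le> h" for s t
    proof -
      have "norm (s *\<^sub>R a + t *\<^sub>R b) \<le> h * norm a + h * norm b" for a b :: 'a
        using that norm_triangle_ineq[of "s *\<^sub>R a" "t *\<^sub>R b"]
        by (smt (verit) mult_right_mono norm_ge_zero norm_scaleR)
      moreover have "h * norm v + h * norm w < d"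
      proof -
        have "h * (norm v + norm w + 1) = d" using pos by (simp add: h_def)
        then show ?thesis using h by (simp add: algebra_simps)
      qed
      ultimately have "norm (s *\<^sub>R v + t *\<^sub>R w) < d" "norm (s *\<^sub>R w + t *\<^sub>R v) < d"
        by (smt (verit))+
      then show "dist (x + s *\<^sub>R v + t *\<^sub>R w) x < d" "dist (x + s *\<^sub>R w + t *\<^sub>R v) x < d"
        by (simp_all add: dist_norm add.assoc)
    qed
    then have in_S: "x + s *\<^sub>R v + t *\<^sub>R w \<in> S" "x + s *\<^sub>R w + t *\<^sub>R v \<in> S"
      if "0 \<le> s" "s \<le> h" "0 \<le> t" "t \<le> h" for s t
      using that d d3(2) by (meson order_less_le_trans)+
    obtain s t where st: "0 < s" "s < h" "0 < t" "t < h"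
      "f (x + h *\<^sub>R v + h *\<^sub>R w) - f (x + h *\<^sub>R v) - f (x + h *\<^sub>R w) + f x =
        h\<^sup>2 * P v w (x + s *\<^sub>R v + t *\<^sub>R w)"
      by (rule second_difference_mean_value[OF S(1,2) h in_S(1), folded P_def])
    obtain s' t' where st': "0 < s'" "s' < h" "0 < t'" "t' < h"
      "f (x + h *\<^sub>R w + h *\<^sub>R v) - f (x + h *\<^sub>R w) - f (x + h *\<^sub>R v) + f x =
        h\<^sup>2 * P w v (x + s' *\<^sub>R w + t' *\<^sub>R v)"
      by (rule second_difference_mean_value[OF S(1,2) h in_S(2), folded P_def])
    have swap: "x + h *\<^sub>R w + h *\<^sub>R v = x + h *\<^sub>R v + h *\<^sub>R w" by simp
    have "h\<^sup>2 * P v w (x + s *\<^sub>R v + t *\<^sub>R w) = h\<^sup>2 * P w v (x + s' *\<^sub>R w + t' *\<^sub>R v)"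
      using st(5) st'(5)[unfolded swap] by linarith
    then have eq: "P v w (x + s *\<^sub>R v + t *\<^sub>R w) = P w v (x + s' *\<^sub>R w + t' *\<^sub>R v)" using h by simp
    have "dist (P v w (x + s *\<^sub>R v + t *\<^sub>R w)) (P v w x) < e / 2"
      using d1(2)[OF in_S(1)[of s t]] near(1)[of s t] st d by auto
    moreover have "dist (P w v (x + s' *\<^sub>R w + t' *\<^sub>R v)) (P w v x) < e / 2"
      using d2(2)[OF in_S(2)[of s' t']] near(2)[of s' t'] st' d by auto
    ultimately show ?thesis unfolding eq dist_real_def by linarith
  qed
  \<comment> \<open>If the two values differed, the absolute value of the difference could be taken
    for \<open>e\<close>, giving \<open>e < e\<close>.\<close>
  from this[of "\<bar>P v w x - P w v x\<bar>"] have "P v w x = P w v x" by (cases "P v w x = P w v x") auto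
  then show ?thesis by (simp add: P_def)
qed

lemma smooth_on_frechet_commute:
  fixes f :: "'a::real_normed_vector \<Rightarrow> real"
  assumes "open S" "smooth_on S f" "x \<in> S"
  shows "frechet_derivative (\<lambda>y. frechet_derivative f (at y) v) (at x) w =
         frechet_derivative (\<lambda>y. frechet_derivative f (at y) w) (at x) v"
  using mixed_derivatives_commute[OF assms(1) _ assms(3)] assms(2) smooth_on_def by blast

section \<open>Position and fibre derivatives\<close>

type_synonym 'm tangent = "(real^'m) \<times> (real^'m)"

text \<open>\<open>dx\<close> and \<open>dv\<close> are \<open>deriv\<close> of functions of one
  real variable. Differentiability makes them components of a single linear map, to which the chain
  rule and Schwarz's theorem apply.\<close>

lemma dx_eq:
  fixes f :: "'m::finite tangent \<Rightarrow> real"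
  assumes "f differentiable (at z)"
  shows "dx \<alpha> f z = frechet_derivative f (at z) (axis \<alpha> 1, 0)"
proof -
  let ?D = "frechet_derivative f (at z)"
  have D: "(f has_derivative ?D) (at (fst z + 0 *\<^sub>R axis \<alpha> 1, snd z))"
    using assms frechet_derivative_works by auto
  have "((\<lambda>s. (fst z + s *\<^sub>R axis \<alpha> 1, snd z)) has_derivative (\<lambda>s. s *\<^sub>R (axis \<alpha> 1, 0))) (at 0)"
    by (auto intro!: derivative_eq_intros)
  from DERIV_along[OF D this] show ?thesis unfolding dx_def by (rule DERIV_imp_deriv)
qed

lemma dv_eq:
  fixes f :: "'m::finite tangent \<Rightarrow> real"
  assumes "f differentiable (at z)"
  shows "dv \<alpha> f z = frechet_derivative f (at z) (0, axis \<alpha> 1)"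
proof -
  let ?D = "frechet_derivative f (at z)"
  have D: "(f has_derivative ?D) (at (fst z, snd z + 0 *\<^sub>R axis \<alpha> 1))"
    using assms frechet_derivative_works by auto
  have "((\<lambda>s. (fst z, snd z + s *\<^sub>R axis \<alpha> 1)) has_derivative (\<lambda>s. s *\<^sub>R (0, axis \<alpha> 1))) (at 0)"
    by (auto intro!: derivative_eq_intros)
  from DERIV_along[OF D this] show ?thesis unfolding dv_def by (rule DERIV_imp_deriv)
qed

lemma frechet_derivative_expand:
  fixes f :: "'m::finite tangent \<Rightarrow> real"
  assumes "f differentiable (at z)"
  shows "frechet_derivative f (at z) w =
    (\<Sum>\<alpha>\<in>UNIV. fst w $ \<alpha> * dx \<alpha> f z) + (\<Sum>\<alpha>\<in>UNIV. snd w $ \<alpha> * dv \<alpha> f z)"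
proof -
  let ?D = "frechet_derivative f (at z)"
  have lin: "linear ?D" using assms frechet_derivative_works has_derivative_linear by blast
  have "w = (\<Sum>\<alpha>\<in>UNIV. fst w $ \<alpha> *\<^sub>R axis \<alpha> 1, \<Sum>\<alpha>\<in>UNIV. snd w $ \<alpha> *\<^sub>R axis \<alpha> 1)"
    by (simp add: basis_expansion scalar_mult_eq_scaleR[symmetric])
  also have "\<dots> = (\<Sum>\<alpha>\<in>UNIV. fst w $ \<alpha> *\<^sub>R (axis \<alpha> 1, 0)) + (\<Sum>\<alpha>\<in>UNIV. snd w $ \<alpha> *\<^sub>R (0, axis \<alpha> 1))"
    by (simp add: prod_eq_iff fst_sum snd_sum)
  finally have "?D w = ?D ((\<Sum>\<alpha>\<in>UNIV. fst w $ \<alpha> *\<^sub>R (axis \<alpha> 1, 0)) + (\<Sum>\<alpha>\<in>UNIV. snd w $ \<alpha> *\<^sub>R (0, axis \<alpha> 1)))"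
    by simp
  also have "\<dots> = (\<Sum>\<alpha>\<in>UNIV. fst w $ \<alpha> * dx \<alpha> f z) + (\<Sum>\<alpha>\<in>UNIV. snd w $ \<alpha> * dv \<alpha> f z)"
    by (simp add: linear_add[OF lin] linear_sum[OF lin] linear_cmul[OF lin] dx_eq[OF assms] dv_eq[OF assms]
        del: scaleR_Pair)
  finally show ?thesis .
qed

text \<open>\<open>dx\<close> and \<open>dv\<close> see a function only near the point, so an
  identity valid on an open set may be differentiated. Many of the identities below arise in this
  way.\<close>

lemma
  fixes f g :: "'m::finite tangent \<Rightarrow> real"
  assumes "open S" "z \<in> S" "\<And>y. y \<in> S \<Longrightarrow> f y = g y"
  shows dx_cong_open: "dx \<alpha> f z = dx \<alpha> g z" and dv_cong_open: "dv \<alpha> f z = dv \<alpha> g z"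
proof -
  have ev: "eventually (\<lambda>s. p s \<in> S) (nhds (0::real))" if "isCont p 0" "p 0 = z" for p :: "real \<Rightarrow> 'm tangent"
    using topological_tendstoD[of p "p 0" "nhds 0" S] that assms(1,2)
    by (metis isCont_def tendsto_at_iff_tendsto_nhds)
  have "eventually (\<lambda>s. (fst z + s *\<^sub>R axis \<alpha> 1, snd z) \<in> S) (nhds (0::real))"
    "eventually (\<lambda>s. (fst z, snd z + s *\<^sub>R axis \<alpha> 1) \<in> S) (nhds (0::real))"
    by (rule ev; auto intro!: continuous_intros)+
  then show "dx \<alpha> f z = dx \<alpha> g z" "dv \<alpha> f z = dv \<alpha> g z"
    unfolding dx_def dv_def using assms(3) by (auto intro!: deriv_cong_ev elim: eventually_mono)
qed

lemma
  fixes f :: "'m::finite tangent \<Rightarrow> real"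
  assumes "open S" "smooth_on S f"
  shows smooth_on_dx: "smooth_on S (dx \<alpha> f)" and smooth_on_dv: "smooth_on S (dv \<alpha> f)"
  by (rule smooth_on_cong[OF assms(1) _ smooth_on_frechet[OF assms(2)]],
      simp add: dx_eq dv_eq smooth_on_differentiable[OF assms(2)])+

lemma
  fixes f :: "'m::finite tangent \<Rightarrow> real"
  assumes "open S" "smooth_on S f" "z \<in> S"
  shows dx_dx_commute: "dx \<alpha> (dx \<beta> f) z = dx \<beta> (dx \<alpha> f) z"
    and dx_dv_commute: "dx \<alpha> (dv \<beta> f) z = dv \<beta> (dx \<alpha> f) z"
    and dv_dv_commute: "dv \<alpha> (dv \<beta> f) z = dv \<beta> (dv \<alpha> f) z"
proof -
  let ?D = "\<lambda>w z. frechet_derivative f (at z) w"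
  have eq: "dx \<alpha> f y = ?D (axis \<alpha> 1, 0) y" "dv \<alpha> f y = ?D (0, axis \<alpha> 1) y" if "y \<in> S" for y \<alpha>
    using dx_eq dv_eq smooth_on_differentiable[OF assms(2) that] by blast+
  have dd: "?D w differentiable (at z)" for w
    using smooth_on_differentiable[OF smooth_on_frechet[OF assms(2)] assms(3)] .
  have "dx \<alpha> (dx \<beta> f) z = frechet_derivative (?D (axis \<beta> 1, 0)) (at z) (axis \<alpha> 1, 0)"
    "dv \<alpha> (dx \<beta> f) z = frechet_derivative (?D (axis \<beta> 1, 0)) (at z) (0, axis \<alpha> 1)"
    "dx \<alpha> (dv \<beta> f) z = frechet_derivative (?D (0, axis \<beta> 1)) (at z) (axis \<alpha> 1, 0)"
    "dv \<alpha> (dv \<beta> f) z = frechet_derivative (?D (0, axis \<beta> 1)) (at z) (0, axis \<alpha> 1)" for \<alpha> \<beta>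
    unfolding dx_eq[OF dd, symmetric] dv_eq[OF dd, symmetric]
    by (rule dx_cong_open[OF assms(1,3)] dv_cong_open[OF assms(1,3)], erule eq)+
  then show "dx \<alpha> (dx \<beta> f) z = dx \<beta> (dx \<alpha> f) z" "dx \<alpha> (dv \<beta> f) z = dv \<beta> (dx \<alpha> f) z"
    "dv \<alpha> (dv \<beta> f) z = dv \<beta> (dv \<alpha> f) z"
    by (simp_all only: smooth_on_frechet_commute[OF assms])
qed

lemma
  fixes f g :: "'m::finite tangent \<Rightarrow> real"
  assumes "f differentiable (at z)" "g differentiable (at z)"
  shows dx_mult: "dx \<alpha> (\<lambda>z. f z * g z) z = dx \<alpha> f z * g z + f z * dx \<alpha> g z"
    and dv_mult: "dv \<alpha> (\<lambda>z. f z * g z) z = dv \<alpha> f z * g z + f z * dv \<alpha> g z"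
    and dx_diff: "dx \<alpha> (\<lambda>z. f z - g z) z = dx \<alpha> f z - dx \<alpha> g z"
    and dv_diff: "dv \<alpha> (\<lambda>z. f z - g z) z = dv \<alpha> f z - dv \<alpha> g z"
proof -
  let ?f = "frechet_derivative f (at z)" and ?g = "frechet_derivative g (at z)"
  have D: "(f has_derivative ?f) (at z)" "(g has_derivative ?g) (at z)"
    using assms frechet_derivative_works by auto
  have m: "((\<lambda>z. f z * g z) has_derivative (\<lambda>w. f z * ?g w + ?f w * g z)) (at z)"
    by (rule has_derivative_mult[OF D])
  have d: "((\<lambda>z. f z - g z) has_derivative (\<lambda>w. ?f w - ?g w)) (at z)"
    by (rule has_derivative_diff[OF D])
  have md: "(\<lambda>z. f z * g z) differentiable (at z)" "(\<lambda>z. f z - g z) differentiable (at z)"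
    using m d by (auto simp: differentiable_def)
  show "dx \<alpha> (\<lambda>z. f z * g z) z = dx \<alpha> f z * g z + f z * dx \<alpha> g z"
    "dv \<alpha> (\<lambda>z. f z * g z) z = dv \<alpha> f z * g z + f z * dv \<alpha> g z"
    "dx \<alpha> (\<lambda>z. f z - g z) z = dx \<alpha> f z - dx \<alpha> g z"
    "dv \<alpha> (\<lambda>z. f z - g z) z = dv \<alpha> f z - dv \<alpha> g z"
    by (simp_all add: dx_eq[OF md(1)] dv_eq[OF md(1)] dx_eq[OF md(2)] dv_eq[OF md(2)]
        frechet_derivative_at[OF m, symmetric] frechet_derivative_at[OF d, symmetric]
        dx_eq[OF assms(1)] dv_eq[OF assms(1)] dx_eq[OF assms(2)] dv_eq[OF assms(2)])
qed

lemma
  fixes f :: "'i \<Rightarrow> 'm::finite tangent \<Rightarrow> real"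
  assumes "\<And>i. i \<in> I \<Longrightarrow> f i differentiable (at z)"
  shows dx_sum: "dx \<alpha> (\<lambda>z. \<Sum>i\<in>I. f i z) z = (\<Sum>i\<in>I. dx \<alpha> (f i) z)"
    and dv_sum: "dv \<alpha> (\<lambda>z. \<Sum>i\<in>I. f i z) z = (\<Sum>i\<in>I. dv \<alpha> (f i) z)"
proof -
  have m: "((\<lambda>z. \<Sum>i\<in>I. f i z) has_derivative (\<lambda>w. \<Sum>i\<in>I. frechet_derivative (f i) (at z) w)) (at z)"
    by (rule has_derivative_sum) (use assms frechet_derivative_works in auto)
  then have md: "(\<lambda>z. \<Sum>i\<in>I. f i z) differentiable (at z)" by (auto simp: differentiable_def)
  show "dx \<alpha> (\<lambda>z. \<Sum>i\<in>I. f i z) z = (\<Sum>i\<in>I. dx \<alpha> (f i) z)"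
    "dv \<alpha> (\<lambda>z. \<Sum>i\<in>I. f i z) z = (\<Sum>i\<in>I. dv \<alpha> (f i) z)"
    by (simp_all add: dx_eq[OF md] dv_eq[OF md] frechet_derivative_at[OF m, symmetric] dx_eq[OF assms] dv_eq[OF assms])
qed

lemma differentiable_snd_nth: "(\<lambda>z::'m::finite tangent. snd z $ \<beta>) differentiable (at z)"
  by (intro bounded_linear_imp_differentiable bounded_linear_compose[OF bounded_linear_vec_nth] bounded_linear_snd)

lemma dv_snd_nth: "dv \<alpha> (\<lambda>z::'m::finite tangent. snd z $ \<beta>) z = (if \<alpha> = \<beta> then 1 else 0)"
proof -
  have "((\<lambda>z::'m tangent. snd z $ \<beta>) has_derivative (\<lambda>w. snd w $ \<beta>)) (at z)"
    by (intro bounded_linear_imp_has_derivative bounded_linear_compose[OF bounded_linear_vec_nth] bounded_linear_snd)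
  from frechet_derivative_at[OF this] show ?thesis
    by (simp add: dv_eq[OF differentiable_snd_nth] axis_def fun_eq_iff)
qed

lemma dx_snd_nth: "dx \<alpha> (\<lambda>z::'m::finite tangent. snd z $ \<beta>) z = 0"
  unfolding dx_def by simp

subsection \<open>Homogeneous functions\<close>

text \<open>Positive factors only, since \<open>L\<close> need not take equal values at
  \<open>v\<close> and \<open>-v\<close>.\<close>

definition conic :: "'m::finite tangent set \<Rightarrow> bool" where
  "conic S \<longleftrightarrow> (\<forall>x u k. (x, u) \<in> S \<and> k > 0 \<longrightarrow> (x, k *\<^sub>R u) \<in> S)"

definition homogeneous :: "'m::finite tangent set \<Rightarrow> nat \<Rightarrow> ('m tangent \<Rightarrow> real) \<Rightarrow> bool" where
  "homogeneous S r f \<longleftrightarrow> (\<forall>x u k. (x, u) \<in> S \<and> k > 0 \<longrightarrow> f (x, k *\<^sub>R u) = k ^ r * f (x, u))"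

text \<open>Both sides of the homogeneity relation are differentiated in the factor \<open>k\<close>
  at 1.\<close>

lemma euler_identity:
  assumes "homogeneous S r f" "z \<in> S" "f differentiable (at z)"
  shows "(\<Sum>\<alpha>\<in>UNIV. snd z $ \<alpha> * dv \<alpha> f z) = real r * f z"
proof -
  let ?D = "frechet_derivative f (at z)"
  have D: "(f has_derivative ?D) (at (fst z, 1 *\<^sub>R snd z))"
    using assms(3) frechet_derivative_works by auto
  have "((\<lambda>k. (fst z, k *\<^sub>R snd z)) has_derivative (\<lambda>s. s *\<^sub>R (0, snd z))) (at (1::real))"
    by (auto intro!: derivative_eq_intros)
  from DERIV_along[OF D this]
  have 1: "DERIV (\<lambda>k. f (fst z, k *\<^sub>R snd z)) 1 :> ?D (0, snd z)" .
  have "DERIV (\<lambda>k. k ^ r * f z) 1 :> real r * f z"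
    by (auto intro!: derivative_eq_intros)
  moreover have "eventually (\<lambda>k. k > 0) (nhds (1::real))"
    using eventually_nhds_in_open[of "{0<..}" "1::real"] by simp
  then have "eventually (\<lambda>k. k ^ r * f z = f (fst z, k *\<^sub>R snd z)) (nhds (1::real))"
  proof (rule eventually_mono)
    show "k ^ r * f z = f (fst z, k *\<^sub>R snd z)" if "k > 0" for k
      using assms(1,2) that unfolding homogeneous_def by (cases z) auto
  qed
  ultimately have "DERIV (\<lambda>k. f (fst z, k *\<^sub>R snd z)) 1 :> real r * f z"
    by (simp only: DERIV_cong_ev[OF refl _ refl])
  with 1 have "?D (0, snd z) = real r * f z" by (rule DERIV_unique)
  then show ?thesis by (simp add: frechet_derivative_expand[OF assms(3)])
qed

text \<open>Both sides of the homogeneity relation are differentiated at \<open>(x, u)\<close>. The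
  inner map multiplies fibre directions by \<open>k\<close>, so one power of \<open>k\<close>
  cancels.\<close>

lemma homogeneous_dv:
  assumes "open S" "conic S" "smooth_on S f" "homogeneous S (Suc r) f"
  shows "homogeneous S r (dv \<alpha> f)"
  unfolding homogeneous_def
proof (intro allI impI)
  fix x u and k :: real assume A: "(x, u) \<in> S \<and> k > 0"
  then have z: "(x, k *\<^sub>R u) \<in> S" using assms(2) by (auto simp: conic_def)
  define D where "D = frechet_derivative f (at (x, u))"
  define D' where "D' = frechet_derivative f (at (x, k *\<^sub>R u))"
  have D: "(f has_derivative D) (at (x, u))" and D': "(f has_derivative D') (at (x, k *\<^sub>R u))"
    using A z smooth_on_has_derivative[OF assms(3)] by (auto simp: D_def D'_def)
  have "((\<lambda>y. (fst y, k *\<^sub>R snd y)) has_derivative (\<lambda>w. (fst w, k *\<^sub>R snd w))) (at (x, u))"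
    by (auto intro!: derivative_eq_intros)
  from has_derivative_compose[OF this, of f D'] D'
  have 1: "((\<lambda>y. f (fst y, k *\<^sub>R snd y)) has_derivative (\<lambda>w. D' (fst w, k *\<^sub>R snd w))) (at (x, u))"
    by simp
  have "((\<lambda>y. k ^ Suc r * f y) has_derivative (\<lambda>w. k ^ Suc r * D w)) (at (x, u))"
    by (rule has_derivative_mult_right[OF D])
  then have "((\<lambda>y. f (fst y, k *\<^sub>R snd y)) has_derivative (\<lambda>w. k ^ Suc r * D w)) (at (x, u))"
    by (rule has_derivative_transform_within_open[OF _ assms(1)])
      (use A assms(4) in \<open>auto simp: homogeneous_def\<close>)
  from fun_cong[OF has_derivative_unique[OF 1 this]]
  have "D' (fst w, k *\<^sub>R snd w) = k ^ Suc r * D w" for w .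
  from this[of "(0, axis \<alpha> 1)"] have "D' (k *\<^sub>R (0, axis \<alpha> 1)) = k ^ Suc r * D (0, axis \<alpha> 1)" by simp
  then have "D' (0, axis \<alpha> 1) = k ^ r * D (0, axis \<alpha> 1)"
    using A has_derivative_linear[OF D'] by (simp add: linear_cmul del: scaleR_Pair)
  then show "dv \<alpha> f (x, k *\<^sub>R u) = k ^ r * dv \<alpha> f (x, u)"
    using A z smooth_on_differentiable[OF assms(3)] by (simp add: dv_eq D_def D'_def)
qed

text \<open>The same comparison as for \<open>dv\<close>, but the inner map fixes position
  directions, so the degree is kept.\<close>

lemma homogeneous_dx:
  assumes "open S" "conic S" "smooth_on S f" "homogeneous S r f"
  shows "homogeneous S r (dx \<alpha> f)"
  unfolding homogeneous_def
proof (intro allI impI)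
  fix x u and k :: real assume A: "(x, u) \<in> S \<and> k > 0"
  then have z: "(x, k *\<^sub>R u) \<in> S" using assms(2) by (auto simp: conic_def)
  define D where "D = frechet_derivative f (at (x, u))"
  define D' where "D' = frechet_derivative f (at (x, k *\<^sub>R u))"
  have D: "(f has_derivative D) (at (x, u))" and D': "(f has_derivative D') (at (x, k *\<^sub>R u))"
    using A z smooth_on_has_derivative[OF assms(3)] by (auto simp: D_def D'_def)
  have "((\<lambda>y. (fst y, k *\<^sub>R snd y)) has_derivative (\<lambda>w. (fst w, k *\<^sub>R snd w))) (at (x, u))"
    by (auto intro!: derivative_eq_intros)
  from has_derivative_compose[OF this, of f D'] D'
  have 1: "((\<lambda>y. f (fst y, k *\<^sub>R snd y)) has_derivative (\<lambda>w. D' (fst w, k *\<^sub>R snd w))) (at (x, u))"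
    by simp
  have "((\<lambda>y. k ^ r * f y) has_derivative (\<lambda>w. k ^ r * D w)) (at (x, u))"
    by (rule has_derivative_mult_right[OF D])
  then have "((\<lambda>y. f (fst y, k *\<^sub>R snd y)) has_derivative (\<lambda>w. k ^ r * D w)) (at (x, u))"
    by (rule has_derivative_transform_within_open[OF _ assms(1)])
      (use A assms(4) in \<open>auto simp: homogeneous_def\<close>)
  from fun_cong[OF has_derivative_unique[OF 1 this]]
  have "D' (fst w, k *\<^sub>R snd w) = k ^ r * D w" for w .
  from this[of "(axis \<alpha> 1, 0)"] show "dx \<alpha> f (x, k *\<^sub>R u) = k ^ r * dx \<alpha> f (x, u)"
    using A z smooth_on_differentiable[OF assms(3)] by (simp add: dx_eq D_def D'_def)
qed

section \<open>Local Lorentz--Finsler geometry\<close>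

lemma dx_const [simp]: "dx \<alpha> (\<lambda>z. c) z = 0" and dv_const [simp]: "dv \<alpha> (\<lambda>z. c) z = 0"
  by (simp_all add: dx_def dv_def)

lemma smooth_on_det:
  fixes M :: "'a::real_normed_vector \<Rightarrow> real^'m::finite^'m"
  assumes "open S" "\<And>i j. smooth_on S (\<lambda>z. M z $ i $ j)"
  shows "smooth_on S (\<lambda>z. det (M z))"
  unfolding det_def
  by (intro smooth_on_sum smooth_on_mult smooth_on_const smooth_on_prod assms)

lemma matrix_inv_mult:
  fixes A :: "real^'m::finite^'m"
  assumes "invertible A"
  shows "A ** matrix_inv A = mat 1" "matrix_inv A ** A = mat 1"
  using assms unfolding invertible_def matrix_inv_def by (metis (mono_tags, lifting) someI_ex)+

text \<open>Cramer's rule with right-hand side \<open>axis l 1\<close> yields one column of the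
  inverse. Quotients of determinants make the inverse metric visibly smooth.\<close>

lemma matrix_inv_cramer:
  fixes A :: "real^'m::finite^'m"
  assumes "invertible A"
  shows "matrix_inv A $ k $ l = det (\<chi> i j. if j = k then axis l 1 $ i else A $ i $ j) / det A"
proof -
  have d: "det A \<noteq> 0" using assms invertible_det_nz by blast
  have "A *v (matrix_inv A *v axis l 1) = axis l 1"
    using matrix_inv_mult(1)[OF assms] by (simp add: matrix_vector_mul_assoc)
  then have "matrix_inv A *v axis l 1 =
      (\<chi> k. det (\<chi> i j. if j = k then axis l 1 $ i else A $ i $ j) / det A)"
    using cramer[OF d] by blast
  then show ?thesis
    by (simp add: matrix_vector_mult_basis column_def vec_eq_iff)
qed

lemma smooth_on_matrix_inv:
  fixes M :: "'a::real_normed_vector \<Rightarrow> real^'m::finite^'m"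
  assumes "open S" "\<And>i j. smooth_on S (\<lambda>z. M z $ i $ j)" "\<And>z. z \<in> S \<Longrightarrow> invertible (M z)"
  shows "smooth_on S (\<lambda>z. matrix_inv (M z) $ k $ l)"
proof (rule smooth_on_cong[OF assms(1)])
  show "det (\<chi> i j. if j = k then axis l 1 $ i else M z $ i $ j) / det (M z) = matrix_inv (M z) $ k $ l"
    if "z \<in> S" for z
    using matrix_inv_cramer[OF assms(3)[OF that]] by simp
  have "smooth_on S (\<lambda>z. det (\<chi> i j. if j = k then axis l 1 $ i else M z $ i $ j))"
  proof (rule smooth_on_det[OF assms(1)])
    show "smooth_on S (\<lambda>z. (\<chi> i j. if j = k then axis l 1 $ i else M z $ i $ j) $ i $ j)" for i j
      by (cases "j = k") (simp_all add: smooth_on_const assms(2))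
  qed
  then show "smooth_on S (\<lambda>z. det (\<chi> i j. if j = k then axis l 1 $ i else M z $ i $ j) / det (M z))"
    by (rule smooth_on_divide[OF assms(1) _ smooth_on_det[OF assms(1,2)]])
      (use assms(3) invertible_det_nz in blast)
qed

text \<open>The model of a single chart: \<open>F\<close> is the expression of \<open>L\<close>, and
  \<open>S\<close> is the tangent bundle without the zero section, off which \<open>L\<close> is
  smooth.\<close>

locale finsler_chart =
  fixes F :: "'m::finite tangent \<Rightarrow> real" and S :: "'m tangent set"
  assumes open_S: "open S" and conic_S: "conic S"
    and smooth_F: "smooth_on S F" and hom_F: "homogeneous S 2 F"
    and inv_g: "z \<in> S \<Longrightarrow> invertible (gmat F z)"
begin

abbreviation "g \<equiv> gmat F"

abbreviation "G \<equiv> spray F"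

abbreviation "NC \<equiv> nonlin_conn F"

lemma g_eq: "g z $ \<alpha> $ \<beta> = dv \<alpha> (dv \<beta> F) z"
  by (simp add: gmat_def)

lemma g_fun_eq: "(\<lambda>z. g z $ \<alpha> $ \<beta>) = dv \<alpha> (dv \<beta> F)"
  by (simp add: fun_eq_iff g_eq)

lemmas smooth_dx = smooth_on_dx[OF open_S]
lemmas smooth_dv = smooth_on_dv[OF open_S]

lemma smooth_snd_nth: "smooth_on S (\<lambda>z. snd z $ \<beta>)"
  by (intro smooth_on_vec_nth smooth_on_snd smooth_on_id open_S)

lemma smooth_g: "smooth_on S (\<lambda>z. g z $ \<alpha> $ \<beta>)"
  unfolding g_fun_eq by (intro smooth_dv smooth_F)

lemma diff_F: "z \<in> S \<Longrightarrow> F differentiable (at z)"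
  and diff_dv_F: "z \<in> S \<Longrightarrow> dv \<alpha> F differentiable (at z)"
  and diff_dx_F: "z \<in> S \<Longrightarrow> dx \<alpha> F differentiable (at z)"
  and diff_g: "z \<in> S \<Longrightarrow> dv \<alpha> (dv \<beta> F) differentiable (at z)"
  by (blast intro: smooth_on_differentiable smooth_F smooth_dv smooth_dx)+

lemma hom_dv_F: "homogeneous S 1 (dv \<alpha> F)"
  using homogeneous_dv[OF open_S conic_S smooth_F, of 1] hom_F by (simp add: numeral_2_eq_2)

lemma hom_g: "homogeneous S 0 (dv \<alpha> (dv \<beta> F))"
  using homogeneous_dv[OF open_S conic_S smooth_dv[OF smooth_F], of 0] hom_dv_F by simp

lemma g_sym: "z \<in> S \<Longrightarrow> g z $ \<alpha> $ \<beta> = g z $ \<beta> $ \<alpha>"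
  unfolding g_eq by (rule dv_dv_commute[OF open_S smooth_F])

lemma euler_F: "z \<in> S \<Longrightarrow> (\<Sum>\<alpha>\<in>UNIV. snd z $ \<alpha> * dv \<alpha> F z) = 2 * F z"
  using euler_identity[OF hom_F _ diff_F] by simp

text \<open>Euler's identity for \<open>dv F\<close>, of degree 1. So \<open>dv F\<close> is the
  momentum (Legendre transform) of the vector, and its kernel is the hyperplane orthogonal to the
  vector.\<close>

lemma g_snd:
  assumes "z \<in> S" shows "(\<Sum>\<beta>\<in>UNIV. g z $ \<alpha> $ \<beta> * snd z $ \<beta>) = dv \<alpha> F z"
  using euler_identity[OF hom_dv_F assms diff_dv_F[OF assms]] g_sym[OF assms, of \<alpha>]
  by (simp add: g_eq[of _ _ \<alpha>] mult.commute)

text \<open>Up to a factor this is the Cartan tensor; as a third fibre derivative of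
  \<open>F\<close> it is symmetric in all indices.\<close>

lemma dv_g_sym:
  assumes "z \<in> S"
  shows "dv \<gamma> (\<lambda>z. g z $ \<alpha> $ \<beta>) z = dv \<alpha> (\<lambda>z. g z $ \<gamma> $ \<beta>) z"
    "dv \<gamma> (\<lambda>z. g z $ \<alpha> $ \<beta>) z = dv \<beta> (\<lambda>z. g z $ \<alpha> $ \<gamma>) z"
proof -
  show 1: "dv \<gamma> (\<lambda>z. g z $ \<alpha> $ \<beta>) z = dv \<alpha> (\<lambda>z. g z $ \<gamma> $ \<beta>) z" for \<alpha> \<beta> \<gamma>
    unfolding g_fun_eq by (rule dv_dv_commute[OF open_S smooth_dv[OF smooth_F] assms])
  have sym: "dv \<gamma> (\<lambda>z. g z $ \<alpha> $ \<beta>) z = dv \<gamma> (\<lambda>z. g z $ \<beta> $ \<alpha>) z" for \<alpha> \<beta> \<gamma>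
    by (rule dv_cong_open[OF open_S assms g_sym])
  show "dv \<gamma> (\<lambda>z. g z $ \<alpha> $ \<beta>) z = dv \<beta> (\<lambda>z. g z $ \<alpha> $ \<gamma>) z"
    using 1 sym by metis
qed

text \<open>The metric has degree 0 in the fibre, so Euler's identity kills the contraction of its
  fibre derivative with the vector; by total symmetry the contracted slot is arbitrary.\<close>

lemma dv_g_snd:
  assumes "z \<in> S"
  shows "(\<Sum>\<beta>\<in>UNIV. snd z $ \<beta> * dv \<gamma> (\<lambda>z. g z $ \<alpha> $ \<beta>) z) = 0"
    "(\<Sum>\<alpha>\<in>UNIV. snd z $ \<alpha> * dv \<gamma> (\<lambda>z. g z $ \<alpha> $ \<beta>) z) = 0"
  using euler_identity[OF hom_g assms diff_g[OF assms], of \<alpha> \<gamma>]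
    euler_identity[OF hom_g assms diff_g[OF assms], of \<gamma> \<beta>]
  unfolding dv_g_sym(2)[OF assms, of \<gamma> \<alpha>] dv_g_sym(1)[OF assms, of \<gamma> _ \<beta>]
  unfolding g_fun_eq by simp_all

lemma dx_g_snd:
  assumes "z \<in> S"
  shows "(\<Sum>\<beta>\<in>UNIV. snd z $ \<beta> * dx \<gamma> (\<lambda>z. g z $ \<alpha> $ \<beta>) z) = dx \<gamma> (dv \<alpha> F) z"
proof -
  have "dx \<gamma> (dv \<alpha> F) z = dx \<gamma> (\<lambda>z. \<Sum>\<beta>\<in>UNIV. g z $ \<alpha> $ \<beta> * snd z $ \<beta>) z"
    by (rule dx_cong_open[OF open_S assms]) (simp add: g_snd)
  also have "\<dots> = (\<Sum>\<beta>\<in>UNIV. snd z $ \<beta> * dx \<gamma> (\<lambda>z. g z $ \<alpha> $ \<beta>) z)"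
    using assms by (simp add: dx_sum dx_mult dx_snd_nth differentiable_snd_nth diff_g g_eq
        differentiable_mult mult.commute)
  finally show ?thesis by simp
qed

lemma dx_euler_F:
  assumes "z \<in> S"
  shows "(\<Sum>\<alpha>\<in>UNIV. snd z $ \<alpha> * dx \<gamma> (dv \<alpha> F) z) = 2 * dx \<gamma> F z"
proof -
  \<comment> \<open>The right side is written as \<open>F z + F z\<close> so that it can be
    differentiated as a sum over the two-element type \<open>bool\<close>.\<close>
  have "dx \<gamma> (\<lambda>z. \<Sum>\<alpha>\<in>UNIV. snd z $ \<alpha> * dv \<alpha> F z) z = dx \<gamma> (\<lambda>z. F z + F z) z"
    by (rule dx_cong_open[OF open_S assms]) (simp add: euler_F)
  moreover have "dx \<gamma> (\<lambda>z. F z + F z) z = 2 * dx \<gamma> F z"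
    using dx_sum[of "UNIV :: bool set" "\<lambda>_. F" z \<gamma>] diff_F[OF assms] by (simp add: UNIV_bool)
  ultimately show ?thesis
    using assms by (simp add: dx_sum dx_mult dx_snd_nth differentiable_snd_nth diff_dv_F differentiable_mult)
qed

text \<open>Twice the Christoffel symbols of the first kind of \<open>g\<close> in the position
  variables, with \<open>\<delta>\<close> the lowered index.\<close>

definition chris :: "'m \<Rightarrow> 'm \<Rightarrow> 'm \<Rightarrow> 'm tangent \<Rightarrow> real" where
  "chris \<delta> \<beta> \<gamma> z = dx \<beta> (\<lambda>y. g y $ \<delta> $ \<gamma>) z + dx \<gamma> (\<lambda>y. g y $ \<beta> $ \<delta>) z - dx \<delta> (\<lambda>y. g y $ \<beta> $ \<gamma>) z"

lemma Gamma_tilde_eq: "Gamma_tilde F \<alpha> \<beta> \<gamma> z = 1 / 2 * (\<Sum>\<delta>\<in>UNIV. matrix_inv (g z) $ \<alpha> $ \<delta> * chris \<delta> \<beta> \<gamma> z)"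
  by (simp add: Gamma_tilde_def chris_def)

lemma dx_g_sym: "z \<in> S \<Longrightarrow> dx \<gamma> (\<lambda>z. g z $ \<alpha> $ \<beta>) z = dx \<gamma> (\<lambda>z. g z $ \<beta> $ \<alpha>) z"
  by (rule dx_cong_open[OF open_S _ g_sym])

lemma chris_snd_snd:
  assumes "z \<in> S"
  shows "(\<Sum>\<beta>\<in>UNIV. \<Sum>\<gamma>\<in>UNIV. chris \<delta> \<beta> \<gamma> z * snd z $ \<beta> * snd z $ \<gamma>) =
    2 * (\<Sum>\<beta>\<in>UNIV. snd z $ \<beta> * dx \<beta> (dv \<delta> F) z) - 2 * dx \<delta> F z" (is "?L = _")
proof -
  let ?u = "snd z"
  have "?L = (\<Sum>\<beta>\<in>UNIV. ?u $ \<beta> * (\<Sum>\<gamma>\<in>UNIV. ?u $ \<gamma> * dx \<beta> (\<lambda>y. g y $ \<delta> $ \<gamma>) z))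
      + (\<Sum>\<beta>\<in>UNIV. \<Sum>\<gamma>\<in>UNIV. ?u $ \<gamma> * (?u $ \<beta> * dx \<gamma> (\<lambda>y. g y $ \<delta> $ \<beta>) z))
      - (\<Sum>\<beta>\<in>UNIV. ?u $ \<beta> * (\<Sum>\<gamma>\<in>UNIV. ?u $ \<gamma> * dx \<delta> (\<lambda>y. g y $ \<beta> $ \<gamma>) z))"
    unfolding chris_def dx_g_sym[OF assms, of _ _ \<delta>]
    by (simp add: sum_distrib_left sum.distrib[symmetric] sum_subtractf[symmetric] algebra_simps)
  also have "(\<Sum>\<beta>\<in>UNIV. \<Sum>\<gamma>\<in>UNIV. ?u $ \<gamma> * (?u $ \<beta> * dx \<gamma> (\<lambda>y. g y $ \<delta> $ \<beta>) z))
      = (\<Sum>\<gamma>\<in>UNIV. ?u $ \<gamma> * (\<Sum>\<beta>\<in>UNIV. ?u $ \<beta> * dx \<gamma> (\<lambda>y. g y $ \<delta> $ \<beta>) z))"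
    by (subst sum.swap) (simp add: sum_distrib_left)
  finally show ?thesis
    by (simp add: dx_g_snd[OF assms] dx_euler_F[OF assms])
qed

text \<open>Lowering the index of the spray produces the Euler--Lagrange expression of
  \<open>F\<close>: contracted twice with the vector, the Christoffel symbols collapse by Euler's
  identities to first derivatives of \<open>F\<close> and \<open>dv F\<close>. From here on the
  spray is handled through \<open>F\<close>.\<close>

lemma g_spray:
  assumes "z \<in> S"
  shows "(\<Sum>\<alpha>\<in>UNIV. g z $ \<delta> $ \<alpha> * (2 * G \<alpha> z)) =
    (\<Sum>\<beta>\<in>UNIV. snd z $ \<beta> * dx \<beta> (dv \<delta> F) z) - dx \<delta> F z"
proof -
  let ?u = "snd z"
  define W where "W = (\<chi> \<delta>. \<Sum>\<beta>\<in>UNIV. \<Sum>\<gamma>\<in>UNIV. chris \<delta> \<beta> \<gamma> z * ?u $ \<beta> * ?u $ \<gamma>)"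
  have "2 * G \<alpha> z = ((1 / 2) *\<^sub>R (matrix_inv (g z) *v W)) $ \<alpha>" for \<alpha>
  proof -
    have "(\<Sum>\<delta>\<in>UNIV. matrix_inv (g z) $ \<alpha> $ \<delta> * (\<Sum>\<beta>\<in>UNIV. \<Sum>\<gamma>\<in>UNIV. chris \<delta> \<beta> \<gamma> z * ?u $ \<beta> * ?u $ \<gamma>))
      = (\<Sum>\<beta>\<in>UNIV. \<Sum>\<delta>\<in>UNIV. \<Sum>\<gamma>\<in>UNIV. matrix_inv (g z) $ \<alpha> $ \<delta> * chris \<delta> \<beta> \<gamma> z * ?u $ \<beta> * ?u $ \<gamma>)"
      by (subst sum.swap) (simp add: sum_distrib_left mult.assoc)
    also have "\<dots> = (\<Sum>\<beta>\<in>UNIV. \<Sum>\<gamma>\<in>UNIV. \<Sum>\<delta>\<in>UNIV. matrix_inv (g z) $ \<alpha> $ \<delta> * chris \<delta> \<beta> \<gamma> z * ?u $ \<beta> * ?u $ \<gamma>)"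
      by (rule sum.cong[OF refl], rule sum.swap)
    finally show ?thesis
      by (simp add: spray_def Gamma_tilde_eq W_def matrix_vector_mult_def sum_distrib_left sum_distrib_right
        mult_ac)
  qed
  then have "(\<Sum>\<alpha>\<in>UNIV. g z $ \<delta> $ \<alpha> * (2 * G \<alpha> z)) = (g z *v ((1 / 2) *\<^sub>R (matrix_inv (g z) *v W))) $ \<delta>"
    by (simp only: matrix_vector_mult_def[of "g z"] vec_lambda_beta)
  also have "\<dots> = W $ \<delta> / 2"
    using matrix_inv_mult(1)[OF inv_g[OF assms]] by (simp add: matrix_vector_mult_scaleR matrix_vector_mul_assoc)
  finally show ?thesis
    by (simp add: W_def chris_snd_snd[OF assms])
qed

text \<open>The left side is the derivative of the momentum component \<open>dv \<gamma> F\<close>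
  along the spray, the vector field with position part \<open>snd z\<close> and fibre part
  \<open>-2 G\<close>.\<close>

lemma euler_lagrange:
  assumes "z \<in> S"
  shows "(\<Sum>\<beta>\<in>UNIV. snd z $ \<beta> * dx \<beta> (dv \<gamma> F) z) - 2 * (\<Sum>\<alpha>\<in>UNIV. G \<alpha> z * dv \<alpha> (dv \<gamma> F) z) = dx \<gamma> F z"
  using g_spray[OF assms, of \<gamma>] g_sym[OF assms, of \<gamma>]
  by (simp add: g_eq[of _ _ \<gamma>] sum_distrib_left algebra_simps)

lemma smooth_Gamma_tilde: "smooth_on S (Gamma_tilde F \<alpha> \<beta> \<gamma>)"
proof -
  have "smooth_on S (\<lambda>z. 1 / 2 * (\<Sum>\<delta>\<in>UNIV. matrix_inv (g z) $ \<alpha> $ \<delta> * chris \<delta> \<beta> \<gamma> z))"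
    unfolding chris_def
    by (intro smooth_on_mult smooth_on_sum smooth_on_const smooth_on_matrix_inv smooth_on_diff
        smooth_on_add smooth_dx smooth_g inv_g open_S)
  then show ?thesis by (simp add: Gamma_tilde_eq[abs_def])
qed

lemma smooth_spray: "smooth_on S (G \<alpha>)"
  unfolding spray_def[abs_def]
  by (intro smooth_on_mult smooth_on_sum smooth_on_const smooth_Gamma_tilde smooth_snd_nth open_S)

lemma smooth_NC: "smooth_on S (NC \<alpha> \<beta>)"
  unfolding nonlin_conn_def[abs_def] by (intro smooth_dv smooth_spray)

lemma diff_spray: "z \<in> S \<Longrightarrow> G \<alpha> differentiable (at z)"
  and diff_NC: "z \<in> S \<Longrightarrow> NC \<alpha> \<beta> differentiable (at z)"
  by (blast intro: smooth_on_differentiable smooth_spray smooth_NC)+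

text \<open>Conservation of energy along geodesics. Contracting \<open>g_spray\<close> with the
  vector turns the metric into the momentum on the left, and the right side collapses by
  \<open>dx_euler_F\<close>.\<close>

lemma spray_F:
  assumes "z \<in> S"
  shows "(\<Sum>\<gamma>\<in>UNIV. snd z $ \<gamma> * dx \<gamma> F z) - 2 * (\<Sum>\<alpha>\<in>UNIV. G \<alpha> z * dv \<alpha> F z) = 0"
proof -
  let ?u = "snd z"
  have "2 * (\<Sum>\<alpha>\<in>UNIV. G \<alpha> z * dv \<alpha> F z) = (\<Sum>\<alpha>\<in>UNIV. \<Sum>\<delta>\<in>UNIV. ?u $ \<delta> * (g z $ \<delta> $ \<alpha> * (2 * G \<alpha> z)))"
    unfolding g_snd[OF assms, symmetric] by (simp add: sum_distrib_left g_sym[OF assms] mult_ac)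
  also have "\<dots> = (\<Sum>\<delta>\<in>UNIV. ?u $ \<delta> * (\<Sum>\<alpha>\<in>UNIV. g z $ \<delta> $ \<alpha> * (2 * G \<alpha> z)))"
    by (subst sum.swap) (simp add: sum_distrib_left)
  also have "\<dots> = (\<Sum>\<delta>\<in>UNIV. \<Sum>\<beta>\<in>UNIV. ?u $ \<delta> * (?u $ \<beta> * dx \<beta> (dv \<delta> F) z)) - (\<Sum>\<delta>\<in>UNIV. ?u $ \<delta> * dx \<delta> F z)"
    unfolding g_spray[OF assms] by (simp add: right_diff_distrib sum_subtractf sum_distrib_left)
  also have "(\<Sum>\<delta>\<in>UNIV. \<Sum>\<beta>\<in>UNIV. ?u $ \<delta> * (?u $ \<beta> * dx \<beta> (dv \<delta> F) z)) =
      (\<Sum>\<beta>\<in>UNIV. ?u $ \<beta> * (\<Sum>\<delta>\<in>UNIV. ?u $ \<delta> * dx \<beta> (dv \<delta> F) z))"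
    by (subst sum.swap) (simp add: sum_distrib_left mult_ac)
  also have "\<dots> = 2 * (\<Sum>\<beta>\<in>UNIV. ?u $ \<beta> * dx \<beta> F z)"
    by (simp add: dx_euler_F[OF assms] sum_distrib_left mult_ac)
  finally show ?thesis by simp
qed

text \<open>The horizontal derivatives of \<open>F\<close> vanish. Applying
  \<open>dv \<beta>\<close> to \<open>spray_F\<close> produces \<open>NC\<close> from
  \<open>G\<close>; after \<open>euler_lagrange\<close> replaces the second derivatives by
  \<open>dx \<beta> F\<close>, what remains is twice the claim.\<close>

lemma horizontal_F:
  assumes "z \<in> S"
  shows "dx \<beta> F z = (\<Sum>\<alpha>\<in>UNIV. NC \<alpha> \<beta> z * dv \<alpha> F z)"
proof -
  let ?u = "snd z"
  have "dv \<beta> (\<lambda>z. (\<Sum>\<gamma>\<in>UNIV. snd z $ \<gamma> * dx \<gamma> F z) - (\<Sum>\<alpha>\<in>UNIV. (G \<alpha> z * dv \<alpha> F z + G \<alpha> z * dv \<alpha> F z))) z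
      = dv \<beta> (\<lambda>z. 0) z"
    by (rule dv_cong_open[OF open_S assms]) (use spray_F in \<open>simp add: sum_distrib_left mult_ac\<close>)
  also have "\<dots> = 0" by (simp add: dv_def)
  finally have "dv \<beta> (\<lambda>z. (\<Sum>\<gamma>\<in>UNIV. snd z $ \<gamma> * dx \<gamma> F z) - (\<Sum>\<alpha>\<in>UNIV. (2 * G \<alpha> z) * dv \<alpha> F z)) z = 0"
    by (simp add: algebra_simps)
  moreover have d2: "(\<lambda>z. 2 * G \<alpha> z) differentiable (at z)" for \<alpha>
    using diff_spray[OF assms] by (intro differentiable_mult) auto
  moreover have "dv \<beta> (\<lambda>z. 2 * G \<alpha> z) z = 2 * NC \<alpha> \<beta> z" for \<alpha>
    using dv_mult[OF differentiable_const diff_spray[OF assms], of \<beta> 2 \<alpha>] by (simp add: nonlin_conn_def)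
  ultimately have "(\<Sum>\<gamma>\<in>UNIV. (if \<beta> = \<gamma> then 1 else 0) * dx \<gamma> F z + ?u $ \<gamma> * dv \<beta> (dx \<gamma> F) z)
      - (\<Sum>\<alpha>\<in>UNIV. 2 * NC \<alpha> \<beta> z * dv \<alpha> F z + 2 * G \<alpha> z * dv \<beta> (dv \<alpha> F) z) = 0"
    using assms by (simp add: dv_diff dv_sum dv_mult dv_snd_nth differentiable_snd_nth diff_dv_F diff_dx_F
        differentiable_mult differentiable_sum)
  then have "dx \<beta> F z + (\<Sum>\<gamma>\<in>UNIV. ?u $ \<gamma> * dx \<gamma> (dv \<beta> F) z) - 2 * (\<Sum>\<alpha>\<in>UNIV. NC \<alpha> \<beta> z * dv \<alpha> F z)
      - 2 * (\<Sum>\<alpha>\<in>UNIV. G \<alpha> z * dv \<alpha> (dv \<beta> F) z) = 0"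
    by (simp add: sum.distrib dx_dv_commute[OF open_S smooth_F assms] dv_dv_commute[OF open_S smooth_F assms, of \<beta>]
        if_distrib[where f="\<lambda>x. x * _"] sum_distrib_left mult.assoc cong: if_cong)
  then show ?thesis using euler_lagrange[OF assms, of \<beta>] by simp
qed

text \<open>Compares the spray derivative of the horizontal derivatives of \<open>F\<close> with the position derivatives
  of the spray derivative of \<open>F\<close>, both of which vanish.\<close>

lemma dv_F_curv:
  assumes "z \<in> S"
  shows "(\<Sum>\<alpha>\<in>UNIV. curv F \<alpha> \<beta> z * dv \<alpha> F z) = 0"
proof -
  let ?u = "snd z"
  let ?A = "(\<Sum>\<gamma>\<in>UNIV. ?u $ \<gamma> * dx \<gamma> (dx \<beta> F) z) - 2 * (\<Sum>\<gamma>\<in>UNIV. G \<gamma> z * dv \<gamma> (dx \<beta> F) z)"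
  define SN where "SN \<alpha> = (\<Sum>\<gamma>\<in>UNIV. dx \<gamma> (NC \<alpha> \<beta>) z * ?u $ \<gamma> - 2 * dv \<gamma> (NC \<alpha> \<beta>) z * G \<gamma> z)" for \<alpha>
  have x: "dx \<gamma> (dx \<beta> F) z = (\<Sum>\<alpha>\<in>UNIV. dx \<gamma> (NC \<alpha> \<beta>) z * dv \<alpha> F z + NC \<alpha> \<beta> z * dx \<gamma> (dv \<alpha> F) z)" for \<gamma>
  proof -
    have "dx \<gamma> (dx \<beta> F) z = dx \<gamma> (\<lambda>z. \<Sum>\<alpha>\<in>UNIV. NC \<alpha> \<beta> z * dv \<alpha> F z) z"
      by (rule dx_cong_open[OF open_S assms]) (rule horizontal_F)
    then show ?thesis
      using assms by (simp add: dx_sum dx_mult diff_NC diff_dv_F differentiable_mult)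
  qed
  have v: "dv \<gamma> (dx \<beta> F) z = (\<Sum>\<alpha>\<in>UNIV. dv \<gamma> (NC \<alpha> \<beta>) z * dv \<alpha> F z + NC \<alpha> \<beta> z * dv \<gamma> (dv \<alpha> F) z)" for \<gamma>
  proof -
    have "dv \<gamma> (dx \<beta> F) z = dv \<gamma> (\<lambda>z. \<Sum>\<alpha>\<in>UNIV. NC \<alpha> \<beta> z * dv \<alpha> F z) z"
      by (rule dv_cong_open[OF open_S assms]) (rule horizontal_F)
    then show ?thesis
      using assms by (simp add: dv_sum dv_mult diff_NC diff_dv_F differentiable_mult)
  qed
  have "?A = (\<Sum>\<gamma>\<in>UNIV. \<Sum>\<alpha>\<in>UNIV. (dx \<gamma> (NC \<alpha> \<beta>) z * ?u $ \<gamma> - 2 * dv \<gamma> (NC \<alpha> \<beta>) z * G \<gamma> z) * dv \<alpha> F z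
      + NC \<alpha> \<beta> z * (?u $ \<gamma> * dx \<gamma> (dv \<alpha> F) z - 2 * (G \<gamma> z * dv \<gamma> (dv \<alpha> F) z)))"
    unfolding x v by (simp add: sum_distrib_left sum_subtractf[symmetric] algebra_simps)
  also have "\<dots> = (\<Sum>\<alpha>\<in>UNIV. SN \<alpha> * dv \<alpha> F z + NC \<alpha> \<beta> z * ((\<Sum>\<gamma>\<in>UNIV. ?u $ \<gamma> * dx \<gamma> (dv \<alpha> F) z)
      - 2 * (\<Sum>\<gamma>\<in>UNIV. G \<gamma> z * dv \<gamma> (dv \<alpha> F) z)))"
    by (subst sum.swap) (simp add: SN_def sum.distrib sum_distrib_left sum_distrib_right sum_subtractf[symmetric])
  also have "\<dots> = (\<Sum>\<alpha>\<in>UNIV. SN \<alpha> * dv \<alpha> F z + NC \<alpha> \<beta> z * dx \<alpha> F z)"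
    by (simp only: euler_lagrange[OF assms])
  also have "\<dots> = (\<Sum>\<alpha>\<in>UNIV. SN \<alpha> * dv \<alpha> F z) + (\<Sum>\<mu>\<in>UNIV. \<Sum>\<alpha>\<in>UNIV. NC \<alpha> \<mu> z * NC \<mu> \<beta> z * dv \<alpha> F z)"
    unfolding horizontal_F[OF assms] by (simp add: sum.distrib sum_distrib_left mult_ac)
  also have "(\<Sum>\<mu>\<in>UNIV. \<Sum>\<alpha>\<in>UNIV. NC \<alpha> \<mu> z * NC \<mu> \<beta> z * dv \<alpha> F z)
     = (\<Sum>\<alpha>\<in>UNIV. (\<Sum>\<mu>\<in>UNIV. NC \<alpha> \<mu> z * NC \<mu> \<beta> z) * dv \<alpha> F z)"
    by (subst sum.swap) (simp add: sum_distrib_right)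
  finally have A1: "?A = (\<Sum>\<alpha>\<in>UNIV. SN \<alpha> * dv \<alpha> F z) + (\<Sum>\<alpha>\<in>UNIV. (\<Sum>\<mu>\<in>UNIV. NC \<alpha> \<mu> z * NC \<mu> \<beta> z) * dv \<alpha> F z)" .
  have "dx \<beta> (\<lambda>z. (\<Sum>\<gamma>\<in>UNIV. snd z $ \<gamma> * dx \<gamma> F z) - (\<Sum>\<alpha>\<in>UNIV. (2 * G \<alpha> z) * dv \<alpha> F z)) z = dx \<beta> (\<lambda>z. 0) z"
    by (rule dx_cong_open[OF open_S assms]) (use spray_F in \<open>simp add: sum_distrib_left mult.assoc\<close>)
  also have "\<dots> = 0" by (simp add: dx_def)
  finally have "dx \<beta> (\<lambda>z. (\<Sum>\<gamma>\<in>UNIV. snd z $ \<gamma> * dx \<gamma> F z) - (\<Sum>\<alpha>\<in>UNIV. (2 * G \<alpha> z) * dv \<alpha> F z)) z = 0" .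
  moreover have d2: "(\<lambda>z. 2 * G \<alpha> z) differentiable (at z)" for \<alpha>
    using diff_spray[OF assms] by (intro differentiable_mult) auto
  moreover have "dx \<beta> (\<lambda>z. 2 * G \<alpha> z) z = 2 * dx \<beta> (G \<alpha>) z" for \<alpha>
    using dx_mult[OF differentiable_const diff_spray[OF assms], of \<beta> 2 \<alpha>] by simp
  ultimately have "(\<Sum>\<gamma>\<in>UNIV. ?u $ \<gamma> * dx \<beta> (dx \<gamma> F) z)
      - (\<Sum>\<alpha>\<in>UNIV. 2 * dx \<beta> (G \<alpha>) z * dv \<alpha> F z + 2 * G \<alpha> z * dx \<beta> (dv \<alpha> F) z) = 0"
    using assms by (simp add: dx_diff dx_sum dx_mult dx_snd_nth differentiable_snd_nth diff_dv_F diff_dx_F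
        differentiable_mult differentiable_sum)
  then have A2: "?A = (\<Sum>\<alpha>\<in>UNIV. 2 * dx \<beta> (G \<alpha>) z * dv \<alpha> F z)"
    by (simp add: sum.distrib dx_dv_commute[OF open_S smooth_F assms, symmetric] dx_dx_commute[OF open_S smooth_F assms, of \<beta>]
        sum_distrib_left mult.assoc)
  \<comment> \<open>Subtracting the two values \<open>A1\<close> and \<open>A2\<close> of
    \<open>?A\<close> reproduces the three terms of \<open>curv\<close> paired with
    \<open>dv F\<close>.\<close>
  show ?thesis
    using A1 A2 unfolding curv_def SN_def[symmetric]
    by (simp add: left_diff_distrib sum_subtractf)
qed

end

section \<open>Degrees of the connection and the curvature, and their contractions with the
  vector\<close>

lemma homogeneous_mult: "homogeneous S r f \<Longrightarrow> homogeneous S s h \<Longrightarrow> homogeneous S (r + s) (\<lambda>z. f z * h z)"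
  unfolding homogeneous_def by (simp add: power_add)

lemma homogeneous_sum: "(\<And>i. i \<in> I \<Longrightarrow> homogeneous S r (f i)) \<Longrightarrow> homogeneous S r (\<lambda>z. \<Sum>i\<in>I. f i z)"
  unfolding homogeneous_def by (simp add: sum_distrib_left)

lemma homogeneous_add: "homogeneous S r f \<Longrightarrow> homogeneous S r h \<Longrightarrow> homogeneous S r (\<lambda>z. f z + h z)"
  unfolding homogeneous_def by (simp add: algebra_simps)

lemma homogeneous_diff: "homogeneous S r f \<Longrightarrow> homogeneous S r h \<Longrightarrow> homogeneous S r (\<lambda>z. f z - h z)"
  unfolding homogeneous_def by (simp add: algebra_simps)

lemma homogeneous_cmult: "homogeneous S r f \<Longrightarrow> homogeneous S r (\<lambda>z. c * f z)"
  unfolding homogeneous_def by simp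

lemma homogeneous_snd_nth: "homogeneous S 1 (\<lambda>z. snd z $ \<beta>)"
  unfolding homogeneous_def by simp

context finsler_chart
begin

lemma hom_Gamma_tilde: "homogeneous S 0 (Gamma_tilde F \<alpha> \<beta> \<gamma>)"
proof -
  have "homogeneous S 0 (\<lambda>z. matrix_inv (g z) $ \<alpha> $ \<delta>)" for \<delta>
  proof -
    have "g (x, k *\<^sub>R u) = g (x, u)" if "(x, u) \<in> S" "k > 0" for x u k
      using hom_g that by (simp add: homogeneous_def vec_eq_iff g_eq)
    then show ?thesis by (simp add: homogeneous_def)
  qed
  moreover have "homogeneous S 0 (chris \<delta> \<beta> \<gamma>)" for \<delta>
    unfolding chris_def[abs_def] g_fun_eq
    by (intro homogeneous_diff homogeneous_add homogeneous_dx open_S conic_S smooth_dv smooth_F hom_g)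
  ultimately have "homogeneous S (0 + 0) (\<lambda>z. matrix_inv (g z) $ \<alpha> $ \<delta> * chris \<delta> \<beta> \<gamma> z)" for \<delta>
    by (rule homogeneous_mult)
  then show ?thesis
    unfolding Gamma_tilde_eq[abs_def] by (intro homogeneous_cmult homogeneous_sum) simp
qed

lemma hom_spray: "homogeneous S 2 (G \<alpha>)"
proof -
  have "homogeneous S (0 + 1 + 1) (\<lambda>z. Gamma_tilde F \<alpha> \<beta> \<gamma> z * snd z $ \<beta> * snd z $ \<gamma>)" for \<beta> \<gamma>
    by (intro homogeneous_mult hom_Gamma_tilde homogeneous_snd_nth)
  then show ?thesis
    unfolding spray_def[abs_def]
    by (intro homogeneous_cmult homogeneous_sum) (simp add: numeral_2_eq_2)
qed

lemma hom_NC: "homogeneous S 1 (NC \<alpha> \<beta>)"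
  unfolding nonlin_conn_def[abs_def]
  by (rule homogeneous_dv[OF open_S conic_S smooth_spray]) (use hom_spray in \<open>simp add: numeral_2_eq_2\<close>)

lemma hom_curv: "homogeneous S 2 (curv F \<alpha> \<beta>)"
proof -
  have "homogeneous S (1 + 1) (\<lambda>z. dx \<gamma> (NC \<alpha> \<beta>) z * snd z $ \<gamma>)" for \<gamma>
    by (intro homogeneous_mult homogeneous_dx open_S conic_S smooth_NC hom_NC homogeneous_snd_nth)
  moreover have "homogeneous S (0 + 2) (\<lambda>z. 2 * dv \<gamma> (NC \<alpha> \<beta>) z * G \<gamma> z)" for \<gamma>
    by (intro homogeneous_mult homogeneous_cmult homogeneous_dv open_S conic_S smooth_NC hom_spray)
      (use hom_NC in simp)
  moreover have "homogeneous S (1 + 1) (\<lambda>z. NC \<alpha> \<gamma> z * NC \<gamma> \<beta> z)" for \<gamma>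
    by (intro homogeneous_mult hom_NC)
  ultimately show ?thesis
    unfolding curv_def[abs_def]
    by (intro homogeneous_diff homogeneous_sum homogeneous_cmult homogeneous_dx open_S conic_S smooth_spray hom_spray)
      (simp_all only: add_0 one_add_one)
qed

lemma NC_snd:
  assumes "z \<in> S" shows "(\<Sum>\<beta>\<in>UNIV. snd z $ \<beta> * NC \<alpha> \<beta> z) = 2 * G \<alpha> z"
  using euler_identity[OF hom_spray assms diff_spray[OF assms]] by (simp add: nonlin_conn_def)

text \<open>Euler's identity is applied to each term of \<open>curv\<close>: the derivatives
  \<open>dx G\<close> from the first two terms cancel, and so do the products \<open>2 G NC\<close>
  from the last two.\<close>

lemma curv_snd:
  assumes "z \<in> S" shows "(\<Sum>\<beta>\<in>UNIV. curv F \<alpha> \<beta> z * snd z $ \<beta>) = 0"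
proof -
  let ?u = "snd z"
  have x: "(\<Sum>\<beta>\<in>UNIV. ?u $ \<beta> * dx \<gamma> (NC \<alpha> \<beta>) z) = 2 * dx \<gamma> (G \<alpha>) z" for \<gamma>
  proof -
    have "dx \<gamma> (\<lambda>z. \<Sum>\<beta>\<in>UNIV. snd z $ \<beta> * NC \<alpha> \<beta> z) z = dx \<gamma> (\<lambda>z. 2 * G \<alpha> z) z"
      by (rule dx_cong_open[OF open_S assms]) (rule NC_snd)
    moreover have "dx \<gamma> (\<lambda>z. 2 * G \<alpha> z) z = 2 * dx \<gamma> (G \<alpha>) z"
      using dx_mult[OF differentiable_const diff_spray[OF assms], of \<gamma> 2 \<alpha>] by simp
    ultimately show ?thesis
      using assms by (simp add: dx_sum dx_mult dx_snd_nth differentiable_snd_nth diff_NC differentiable_mult)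
  qed
  \<comment> \<open>As a second fibre derivative of \<open>G\<close>,
    \<open>dv \<gamma> (NC \<alpha> \<beta>)\<close> is symmetric in \<open>\<beta>\<close> and
    \<open>\<gamma>\<close>; so this is Euler's identity for \<open>NC\<close>, of degree 1.\<close>
  have v: "(\<Sum>\<beta>\<in>UNIV. ?u $ \<beta> * dv \<gamma> (NC \<alpha> \<beta>) z) = NC \<alpha> \<gamma> z" for \<gamma>
  proof -
    have "dv \<gamma> (NC \<alpha> \<beta>) z = dv \<beta> (NC \<alpha> \<gamma>) z" for \<beta>
      unfolding nonlin_conn_def[abs_def] by (rule dv_dv_commute[OF open_S smooth_spray assms])
    then show ?thesis
      using euler_identity[OF hom_NC assms diff_NC[OF assms]] by simp
  qed
  have "(\<Sum>\<beta>\<in>UNIV. \<Sum>\<gamma>\<in>UNIV. (dx \<gamma> (NC \<alpha> \<beta>) z * ?u $ \<gamma> - 2 * dv \<gamma> (NC \<alpha> \<beta>) z * G \<gamma> z) * ?u $ \<beta>)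
     = (\<Sum>\<gamma>\<in>UNIV. ?u $ \<gamma> * (\<Sum>\<beta>\<in>UNIV. ?u $ \<beta> * dx \<gamma> (NC \<alpha> \<beta>) z)
          - 2 * G \<gamma> z * (\<Sum>\<beta>\<in>UNIV. ?u $ \<beta> * dv \<gamma> (NC \<alpha> \<beta>) z))"
    by (subst sum.swap) (simp add: sum_distrib_left sum_subtractf[symmetric] algebra_simps)
  also have "\<dots> = (\<Sum>\<gamma>\<in>UNIV. ?u $ \<gamma> * (2 * dx \<gamma> (G \<alpha>) z)) - (\<Sum>\<gamma>\<in>UNIV. 2 * G \<gamma> z * NC \<alpha> \<gamma> z)"
    unfolding x v by (simp add: sum_subtractf)
  finally have 1: "(\<Sum>\<beta>\<in>UNIV. \<Sum>\<gamma>\<in>UNIV. (dx \<gamma> (NC \<alpha> \<beta>) z * ?u $ \<gamma> - 2 * dv \<gamma> (NC \<alpha> \<beta>) z * G \<gamma> z) * ?u $ \<beta>)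
     = (\<Sum>\<gamma>\<in>UNIV. ?u $ \<gamma> * (2 * dx \<gamma> (G \<alpha>) z)) - (\<Sum>\<gamma>\<in>UNIV. 2 * G \<gamma> z * NC \<alpha> \<gamma> z)" .
  have "(\<Sum>\<beta>\<in>UNIV. \<Sum>\<gamma>\<in>UNIV. NC \<alpha> \<gamma> z * NC \<gamma> \<beta> z * ?u $ \<beta>) = (\<Sum>\<gamma>\<in>UNIV. NC \<alpha> \<gamma> z * (\<Sum>\<beta>\<in>UNIV. ?u $ \<beta> * NC \<gamma> \<beta> z))"
    by (subst sum.swap) (simp add: sum_distrib_left mult_ac)
  also have "\<dots> = (\<Sum>\<gamma>\<in>UNIV. 2 * G \<gamma> z * NC \<alpha> \<gamma> z)" unfolding NC_snd[OF assms] by (simp add: mult_ac)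
  finally have 2: "(\<Sum>\<beta>\<in>UNIV. \<Sum>\<gamma>\<in>UNIV. NC \<alpha> \<gamma> z * NC \<gamma> \<beta> z * ?u $ \<beta>) = (\<Sum>\<gamma>\<in>UNIV. 2 * G \<gamma> z * NC \<alpha> \<gamma> z)" .
  show ?thesis
    unfolding curv_def left_diff_distrib sum_subtractf sum_distrib_right
    using 1[unfolded left_diff_distrib sum_subtractf] 2
    by (simp add: mult_ac)
qed

lemma dv_F_ginv:
  assumes "z \<in> S"
  shows "(\<Sum>\<alpha>\<in>UNIV. dv \<alpha> F z * matrix_inv (g z) $ \<alpha> $ \<delta>) = snd z $ \<delta>"
proof -
  have "(\<Sum>\<alpha>\<in>UNIV. dv \<alpha> F z * matrix_inv (g z) $ \<alpha> $ \<delta>) =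
      (\<Sum>\<alpha>\<in>UNIV. \<Sum>\<beta>\<in>UNIV. snd z $ \<beta> * (g z $ \<beta> $ \<alpha> * matrix_inv (g z) $ \<alpha> $ \<delta>))"
    unfolding g_snd[OF assms, symmetric] sum_distrib_right
    by (intro sum.cong refl) (simp add: g_sym[OF assms] mult_ac)
  also have "\<dots> = (\<Sum>\<beta>\<in>UNIV. snd z $ \<beta> * ((g z ** matrix_inv (g z)) $ \<beta> $ \<delta>))"
    by (subst sum.swap) (simp add: sum_distrib_left matrix_matrix_mult_def)
  also have "\<dots> = snd z $ \<delta>"
    using matrix_inv_mult(1)[OF inv_g[OF assms]] by (simp add: mat_def if_distrib cong: if_cong)
  finally show ?thesis .
qed

text \<open>The part of \<open>Gamma\<close> that involves the nonlinear connection. In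
  \<open>chris - cartan\<close> every position derivative \<open>dx \<beta>\<close> of
  \<open>g\<close> is corrected to the horizontal derivative
  \<open>dx \<beta> - NC \<mu> \<beta> dv \<mu>\<close>, summed over \<open>\<mu>\<close>: this is
  the Chern connection.\<close>

definition cartan :: "'m \<Rightarrow> 'm \<Rightarrow> 'm \<Rightarrow> 'm tangent \<Rightarrow> real" where
  "cartan \<delta> \<beta> \<gamma> z = (\<Sum>\<mu>\<in>UNIV. dv \<mu> (\<lambda>y. g y $ \<delta> $ \<gamma>) z * NC \<mu> \<beta> z
        + dv \<mu> (\<lambda>y. g y $ \<beta> $ \<delta>) z * NC \<mu> \<gamma> z - dv \<mu> (\<lambda>y. g y $ \<beta> $ \<gamma>) z * NC \<mu> \<delta> z)"

lemma Gamma_eq: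
  "Gamma F \<alpha> \<beta> \<gamma> z = 1 / 2 * (\<Sum>\<delta>\<in>UNIV. matrix_inv (g z) $ \<alpha> $ \<delta> * (chris \<delta> \<beta> \<gamma> z - cartan \<delta> \<beta> \<gamma> z))"
  unfolding Gamma_def Gamma_tilde_eq cartan_def
  by (simp add: sum_distrib_left right_diff_distrib sum_subtractf)

text \<open>In every summand at least one of the two contracted indices sits on the Cartan tensor,
  which the vector annihilates.\<close>

lemma cartan_snd_snd:
  assumes "z \<in> S"
  shows "(\<Sum>\<beta>\<in>UNIV. \<Sum>\<gamma>\<in>UNIV. cartan \<delta> \<beta> \<gamma> z * snd z $ \<beta> * snd z $ \<gamma>) = 0"
    "(\<Sum>\<beta>\<in>UNIV. \<Sum>\<delta>\<in>UNIV. cartan \<delta> \<beta> \<gamma> z * snd z $ \<beta> * snd z $ \<delta>) = 0"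
proof -
  let ?u = "snd z"
  define C where "C \<mu> \<alpha> \<beta> = dv \<mu> (\<lambda>y. g y $ \<alpha> $ \<beta>) z" for \<mu> \<alpha> \<beta>
  have C: "(\<Sum>\<beta>\<in>UNIV. ?u $ \<beta> * C \<mu> \<alpha> \<beta>) = 0" "(\<Sum>\<beta>\<in>UNIV. ?u $ \<beta> * C \<mu> \<beta> \<alpha>) = 0" for \<mu> \<alpha>
    using dv_g_snd[OF assms] by (simp_all add: C_def)
  \<comment> \<open>Covers the summands whose inner summation index sits on the Cartan tensor;
    \<open>four\<close> covers the outer index.\<close>
  have three: "(\<Sum>\<beta>\<in>UNIV. \<Sum>\<gamma>\<in>UNIV. (\<Sum>\<mu>\<in>UNIV. f \<beta> \<mu> \<gamma> * h \<beta> \<mu>) * ?u $ \<beta> * ?u $ \<gamma>) = 0"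
    if "\<And>\<beta> \<mu>. (\<Sum>\<gamma>\<in>UNIV. ?u $ \<gamma> * f \<beta> \<mu> \<gamma>) = 0" for f :: "'m \<Rightarrow> 'm \<Rightarrow> 'm \<Rightarrow> real" and h
  proof -
    have "(\<Sum>\<gamma>\<in>UNIV. (\<Sum>\<mu>\<in>UNIV. f \<beta> \<mu> \<gamma> * h \<beta> \<mu>) * ?u $ \<beta> * ?u $ \<gamma>) =
        (\<Sum>\<mu>\<in>UNIV. ?u $ \<beta> * h \<beta> \<mu> * (\<Sum>\<gamma>\<in>UNIV. ?u $ \<gamma> * f \<beta> \<mu> \<gamma>))" for \<beta>
      unfolding sum_distrib_right sum_distrib_left by (subst sum.swap) (simp add: mult_ac)
    then show ?thesis using that by simp
  qed
  have four: "(\<Sum>\<beta>\<in>UNIV. \<Sum>\<gamma>\<in>UNIV. (\<Sum>\<mu>\<in>UNIV. f \<gamma> \<mu> \<beta> * h \<gamma> \<mu>) * ?u $ \<beta> * ?u $ \<gamma>) = 0"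
    if "\<And>\<beta> \<mu>. (\<Sum>\<gamma>\<in>UNIV. ?u $ \<gamma> * f \<beta> \<mu> \<gamma>) = 0" for f :: "'m \<Rightarrow> 'm \<Rightarrow> 'm \<Rightarrow> real" and h
    using three[of f h, OF that] by (subst sum.swap) (simp add: mult_ac)
  have split: "cartan \<delta> \<beta> \<gamma> z * a * b = (\<Sum>\<mu>\<in>UNIV. C \<mu> \<delta> \<gamma> * NC \<mu> \<beta> z) * a * b
     + (\<Sum>\<mu>\<in>UNIV. C \<mu> \<beta> \<delta> * NC \<mu> \<gamma> z) * a * b - (\<Sum>\<mu>\<in>UNIV. C \<mu> \<beta> \<gamma> * NC \<mu> \<delta> z) * a * b" for \<beta> \<gamma> \<delta> a b
    unfolding cartan_def C_def by (simp add: sum.distrib sum_subtractf algebra_simps)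
  show "(\<Sum>\<beta>\<in>UNIV. \<Sum>\<gamma>\<in>UNIV. cartan \<delta> \<beta> \<gamma> z * ?u $ \<beta> * ?u $ \<gamma>) = 0"
    unfolding split sum.distrib sum_subtractf
    using three[of "\<lambda>\<beta> \<mu> \<gamma>. C \<mu> \<delta> \<gamma>" "\<lambda>\<beta> \<mu>. NC \<mu> \<beta> z"] four[of "\<lambda>\<gamma> \<mu> \<beta>. C \<mu> \<beta> \<delta>" "\<lambda>\<beta> \<mu>. NC \<mu> \<beta> z"]
      three[of "\<lambda>\<beta> \<mu> \<gamma>. C \<mu> \<beta> \<gamma>" "\<lambda>\<beta> \<mu>. NC \<mu> \<delta> z"] C
    by simp
  show "(\<Sum>\<beta>\<in>UNIV. \<Sum>\<delta>\<in>UNIV. cartan \<delta> \<beta> \<gamma> z * ?u $ \<beta> * ?u $ \<delta>) = 0"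
    unfolding split sum.distrib sum_subtractf
    using three[of "\<lambda>\<beta> \<mu> \<delta>. C \<mu> \<delta> \<gamma>" "\<lambda>\<beta> \<mu>. NC \<mu> \<beta> z"] four[of "\<lambda>\<delta> \<mu> \<beta>. C \<mu> \<beta> \<gamma>" "\<lambda>\<beta> \<mu>. NC \<mu> \<beta> z"]
      three[of "\<lambda>\<beta> \<mu> \<delta>. C \<mu> \<beta> \<delta>" "\<lambda>\<beta> \<mu>. NC \<mu> \<gamma> z"] C
    by simp
qed

text \<open>The Cartan part is annihilated, so \<open>Gamma\<close> and \<open>Gamma_tilde\<close>
  have the same spray. Hence the velocity of a geodesic is parallel for the covariant derivative
  built from \<open>Gamma\<close>.\<close>

lemma Gamma_snd_snd:
  assumes "z \<in> S"
  shows "(\<Sum>\<beta>\<in>UNIV. \<Sum>\<gamma>\<in>UNIV. Gamma F \<alpha> \<beta> \<gamma> z * snd z $ \<beta> * snd z $ \<gamma>) = 2 * G \<alpha> z"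
proof -
  let ?u = "snd z"
  let ?i = "\<lambda>\<delta>. matrix_inv (g z) $ \<alpha> $ \<delta>"
  have "(\<Sum>\<beta>\<in>UNIV. \<Sum>\<gamma>\<in>UNIV. (\<Sum>\<delta>\<in>UNIV. ?i \<delta> * cartan \<delta> \<beta> \<gamma> z) * ?u $ \<beta> * ?u $ \<gamma>)
      = (\<Sum>\<beta>\<in>UNIV. \<Sum>\<delta>\<in>UNIV. \<Sum>\<gamma>\<in>UNIV. ?i \<delta> * (cartan \<delta> \<beta> \<gamma> z * ?u $ \<beta> * ?u $ \<gamma>))"
    unfolding sum_distrib_right by (rule sum.cong[OF refl], subst sum.swap) (simp add: mult.assoc)
  also have "\<dots> = (\<Sum>\<delta>\<in>UNIV. ?i \<delta> * (\<Sum>\<beta>\<in>UNIV. \<Sum>\<gamma>\<in>UNIV. cartan \<delta> \<beta> \<gamma> z * ?u $ \<beta> * ?u $ \<gamma>))"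
    by (subst sum.swap) (simp add: sum_distrib_left)
  finally have 0: "(\<Sum>\<beta>\<in>UNIV. \<Sum>\<gamma>\<in>UNIV. (\<Sum>\<delta>\<in>UNIV. ?i \<delta> * cartan \<delta> \<beta> \<gamma> z) * ?u $ \<beta> * ?u $ \<gamma>) = 0"
    by (simp add: cartan_snd_snd[OF assms])
  define K where "K \<beta> \<gamma> = (\<Sum>\<delta>\<in>UNIV. ?i \<delta> * cartan \<delta> \<beta> \<gamma> z)" for \<beta> \<gamma>
  have "Gamma F \<alpha> \<beta> \<gamma> z = Gamma_tilde F \<alpha> \<beta> \<gamma> z - 1 / 2 * K \<beta> \<gamma>" for \<beta> \<gamma>
    unfolding Gamma_eq Gamma_tilde_eq K_def by (simp add: right_diff_distrib sum_subtractf)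
  then have "(\<Sum>\<beta>\<in>UNIV. \<Sum>\<gamma>\<in>UNIV. Gamma F \<alpha> \<beta> \<gamma> z * ?u $ \<beta> * ?u $ \<gamma>) = 2 * G \<alpha> z
     - 1 / 2 * (\<Sum>\<beta>\<in>UNIV. \<Sum>\<gamma>\<in>UNIV. K \<beta> \<gamma> * ?u $ \<beta> * ?u $ \<gamma>)"
    unfolding spray_def by (simp add: left_diff_distrib sum_subtractf sum_distrib_left mult.assoc)
  then show ?thesis using 0 unfolding K_def by simp
qed

text \<open>With the lowered index contracted as well, the first and the last term of
  \<open>chris\<close> differ only by a swap of the summation indices and cancel.\<close>

lemma chris_snd_first:
  assumes "z \<in> S"
  shows "(\<Sum>\<beta>\<in>UNIV. \<Sum>\<delta>\<in>UNIV. chris \<delta> \<beta> \<gamma> z * snd z $ \<beta> * snd z $ \<delta>) = 2 * dx \<gamma> F z"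
proof -
  let ?u = "snd z"
  have "(\<Sum>\<beta>\<in>UNIV. \<Sum>\<delta>\<in>UNIV. chris \<delta> \<beta> \<gamma> z * ?u $ \<beta> * ?u $ \<delta>) =
      (\<Sum>\<beta>\<in>UNIV. \<Sum>\<delta>\<in>UNIV. dx \<beta> (\<lambda>y. g y $ \<delta> $ \<gamma>) z * ?u $ \<beta> * ?u $ \<delta>)
      + (\<Sum>\<beta>\<in>UNIV. ?u $ \<beta> * (\<Sum>\<delta>\<in>UNIV. ?u $ \<delta> * dx \<gamma> (\<lambda>y. g y $ \<beta> $ \<delta>) z))
      - (\<Sum>\<beta>\<in>UNIV. \<Sum>\<delta>\<in>UNIV. dx \<delta> (\<lambda>y. g y $ \<beta> $ \<gamma>) z * ?u $ \<beta> * ?u $ \<delta>)"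
    unfolding chris_def
    by (simp add: sum_distrib_left sum.distrib[symmetric] sum_subtractf[symmetric] algebra_simps)
  also have "(\<Sum>\<beta>\<in>UNIV. \<Sum>\<delta>\<in>UNIV. dx \<delta> (\<lambda>y. g y $ \<beta> $ \<gamma>) z * ?u $ \<beta> * ?u $ \<delta>)
      = (\<Sum>\<beta>\<in>UNIV. \<Sum>\<delta>\<in>UNIV. dx \<beta> (\<lambda>y. g y $ \<delta> $ \<gamma>) z * ?u $ \<beta> * ?u $ \<delta>)"
    by (subst sum.swap) (simp add: mult_ac)
  finally show ?thesis by (simp add: dx_g_snd[OF assms] dx_euler_F[OF assms])
qed

text \<open>Pairing with the momentum replaces the raised index by the vector itself
  (\<open>dv_F_ginv\<close>), so the claim becomes \<open>chris_snd_first\<close> with the Cartan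
  part removed. It will show that the momentum of a geodesic is parallel.\<close>

lemma dv_F_Gamma_snd:
  assumes "z \<in> S"
  shows "(\<Sum>\<alpha>\<in>UNIV. dv \<alpha> F z * (\<Sum>\<beta>\<in>UNIV. Gamma F \<alpha> \<beta> \<gamma> z * snd z $ \<beta>)) = dx \<gamma> F z"
proof -
  let ?u = "snd z"
  let ?i = "\<lambda>\<alpha> \<delta>. matrix_inv (g z) $ \<alpha> $ \<delta>"
  define K where "K \<delta> = (\<Sum>\<beta>\<in>UNIV. (chris \<delta> \<beta> \<gamma> z - cartan \<delta> \<beta> \<gamma> z) * ?u $ \<beta>)" for \<delta>
  have "(\<Sum>\<beta>\<in>UNIV. Gamma F \<alpha> \<beta> \<gamma> z * ?u $ \<beta>) = 1 / 2 * (\<Sum>\<delta>\<in>UNIV. ?i \<alpha> \<delta> * K \<delta>)" for \<alpha>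
    unfolding Gamma_eq K_def sum_distrib_left sum_distrib_right
    by (subst sum.swap) (simp add: mult_ac)
  then have "(\<Sum>\<alpha>\<in>UNIV. dv \<alpha> F z * (\<Sum>\<beta>\<in>UNIV. Gamma F \<alpha> \<beta> \<gamma> z * ?u $ \<beta>))
     = 1 / 2 * (\<Sum>\<alpha>\<in>UNIV. \<Sum>\<delta>\<in>UNIV. dv \<alpha> F z * ?i \<alpha> \<delta> * K \<delta>)"
    by (simp add: sum_distrib_left mult_ac)
  also have "\<dots> = 1 / 2 * (\<Sum>\<delta>\<in>UNIV. (\<Sum>\<alpha>\<in>UNIV. dv \<alpha> F z * ?i \<alpha> \<delta>) * K \<delta>)"
    by (subst sum.swap) (simp add: sum_distrib_right)
  also have "\<dots> = 1 / 2 * (\<Sum>\<delta>\<in>UNIV. \<Sum>\<beta>\<in>UNIV. (chris \<delta> \<beta> \<gamma> z - cartan \<delta> \<beta> \<gamma> z) * ?u $ \<beta> * ?u $ \<delta>)"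
    unfolding dv_F_ginv[OF assms] K_def by (simp add: sum_distrib_left mult_ac)
  also have "\<dots> = 1 / 2 * (\<Sum>\<beta>\<in>UNIV. \<Sum>\<delta>\<in>UNIV. chris \<delta> \<beta> \<gamma> z * ?u $ \<beta> * ?u $ \<delta>)
      - 1 / 2 * (\<Sum>\<beta>\<in>UNIV. \<Sum>\<delta>\<in>UNIV. cartan \<delta> \<beta> \<gamma> z * ?u $ \<beta> * ?u $ \<delta>)"
    by (subst sum.swap) (simp add: left_diff_distrib sum_subtractf)
  finally show ?thesis by (simp add: chris_snd_first[OF assms] cartan_snd_snd[OF assms])
qed

end

section \<open>Charts\<close>

definition transition :: "('a, 'm::finite) chart \<Rightarrow> ('a, 'm) chart \<Rightarrow> 'a \<Rightarrow> real^'m \<Rightarrow> real^'m" where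
  "transition c d p = frechet_derivative (snd d \<circ> chart_inv c) (at (snd c p))"

definition chart_slit :: "('a, 'm::finite) chart \<Rightarrow> 'm tangent set" where
  "chart_slit c = {(x, u). x \<in> snd c ` fst c \<and> u \<noteq> 0}"

context
  fixes A :: "('a::topological_space, 'm::finite) chart set"
  assumes atlas: "smooth_atlas A"
begin

lemma pref_chart: "pref_chart A p \<in> A" "p \<in> fst (pref_chart A p)"
proof -
  have "\<exists>c. c \<in> A \<and> p \<in> fst c" using atlas unfolding smooth_atlas_def by blast
  from someI_ex[OF this] show "pref_chart A p \<in> A" "p \<in> fst (pref_chart A p)"
    unfolding pref_chart_def by auto
qed

context
  fixes c assumes c: "c \<in> A"
begin

lemma chart_homeo: "homeomorphism (fst c) (snd c ` fst c) (snd c) (chart_inv c)"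
  and chart_dom_open: "open (fst c)" and chart_image_open: "open (snd c ` fst c)"
  using atlas c unfolding smooth_atlas_def by blast+

lemma chart_inv_left: "p \<in> fst c \<Longrightarrow> chart_inv c (snd c p) = p"
  using homeomorphism_apply1[OF chart_homeo] .

lemma chart_inv_right:
  "x \<in> snd c ` fst c \<Longrightarrow> snd c (chart_inv c x) = x"
  "x \<in> snd c ` fst c \<Longrightarrow> chart_inv c x \<in> fst c"
  using chart_inv_left by auto

lemma open_chart_image:
  assumes "open U" shows "open (snd c ` (fst c \<inter> U))"
proof -
  have "open (snd c ` fst c \<inter> chart_inv c -` (fst c \<inter> U))"
    using continuous_on_open_vimage[OF chart_image_open, of "chart_inv c"]
      homeomorphism_cont2[OF chart_homeo] open_Int[OF chart_dom_open assms] by (metis inf_commute)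
  moreover have "snd c ` fst c \<inter> chart_inv c -` (fst c \<inter> U) = snd c ` (fst c \<inter> U)"
    using chart_inv_left by auto
  ultimately show ?thesis by simp
qed

lemma transition_smooth:
  "d \<in> A \<Longrightarrow> smooth_on (snd c ` (fst c \<inter> fst d)) (snd d \<circ> chart_inv c)"
  using atlas c unfolding smooth_atlas_def by blast

end

lemma transition_has_derivative:
  assumes "c \<in> A" "d \<in> A" "p \<in> fst c" "p \<in> fst d"
  shows "((snd d \<circ> chart_inv c) has_derivative transition c d p) (at (snd c p))"
  unfolding transition_def
  by (rule smooth_on_has_derivative[OF transition_smooth[OF assms(1,2)]]) (use assms in auto)

lemma transition_id:
  assumes "c \<in> A" "p \<in> fst c" shows "transition c c p = id"
proof -
  have "((\<lambda>x. x) has_derivative (\<lambda>x. x)) (at (snd c p))" by (rule has_derivative_ident)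
  then have "((snd c \<circ> chart_inv c) has_derivative (\<lambda>x. x)) (at (snd c p))"
    by (rule has_derivative_transform_within_open[OF _ chart_image_open[OF assms(1)]])
      (use assms chart_inv_right in auto)
  from has_derivative_unique[OF this transition_has_derivative[OF assms(1,1,2,2)]]
  show ?thesis by (auto simp: fun_eq_iff)
qed

lemma transition_comp:
  assumes "c \<in> A" "d \<in> A" "e \<in> A" "p \<in> fst c" "p \<in> fst d" "p \<in> fst e"
  shows "transition d e p (transition c d p v) = transition c e p v"
proof -
  have "((snd e \<circ> chart_inv d) has_derivative transition d e p) (at ((snd d \<circ> chart_inv c) (snd c p)))"
    using transition_has_derivative[OF assms(2,3,5,6)] chart_inv_left[OF assms(1,4)] by simp
  from has_derivative_compose[OF transition_has_derivative[OF assms(1,2,4,5)] this]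
  have 1: "((\<lambda>x. (snd e \<circ> chart_inv d) ((snd d \<circ> chart_inv c) x)) has_derivative
      (\<lambda>v. transition d e p (transition c d p v))) (at (snd c p))" .
  have "((snd e \<circ> chart_inv c) has_derivative (\<lambda>v. transition d e p (transition c d p v))) (at (snd c p))"
    by (rule has_derivative_transform_within_open[OF 1 open_chart_image[OF assms(1) chart_dom_open[OF assms(2)]]])
      (use assms(4,5) in \<open>auto simp: chart_inv_left[OF assms(1)] chart_inv_left[OF assms(2)]\<close>)
  from has_derivative_unique[OF this transition_has_derivative[OF assms(1,3,4,6)]]
  show ?thesis by metis
qed

lemma to_chart_eq: "to_chart A c p = transition (pref_chart A p) c p"
  by (simp add: to_chart_def[abs_def] transition_def)

context
  fixes c p assumes c: "c \<in> A" and p: "p \<in> fst c"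
begin

lemma of_chart_eq: "of_chart A c (snd c p) = transition c (pref_chart A p) p"
  by (simp add: of_chart_def[abs_def] transition_def chart_inv_left[OF c p])

lemma to_of_chart [simp]: "to_chart A c p (of_chart A c (snd c p) u) = u"
  unfolding to_chart_eq of_chart_eq
  by (simp add: transition_comp[OF c pref_chart(1) c p pref_chart(2) p] transition_id[OF c p])

lemma of_to_chart [simp]: "of_chart A c (snd c p) (to_chart A c p v) = v"
  unfolding to_chart_eq of_chart_eq
  by (simp add: transition_comp[OF pref_chart(1) c pref_chart(1) pref_chart(2) p pref_chart(2)]
      transition_id[OF pref_chart])

lemma linear_of_chart: "linear (of_chart A c (snd c p))"
  unfolding of_chart_eq
  by (rule has_derivative_linear[OF transition_has_derivative[OF c pref_chart(1) p pref_chart(2)]])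

lemma linear_to_chart: "linear (to_chart A c p)"
  unfolding to_chart_eq
  by (rule has_derivative_linear[OF transition_has_derivative[OF pref_chart(1) c pref_chart(2) p]])

lemma of_chart_eq_0_iff: "of_chart A c (snd c p) u = 0 \<longleftrightarrow> u = 0"
  by (metis linear_0 linear_of_chart to_of_chart linear_to_chart)

end

text \<open>Holds at the point \<open>p\<close> itself. At neighbouring points another preferred
  chart may be selected, which is why \<open>of_chart\<close> and \<open>to_chart\<close> persist
  along curves.\<close>

lemma to_chart_pref: "to_chart A (pref_chart A p) p v = v"
  unfolding to_chart_eq by (simp add: transition_id[OF pref_chart])

lemma of_chart_pref: "of_chart A (pref_chart A p) (snd (pref_chart A p) p) v = v"
  using of_to_chart[OF pref_chart, of p v] by (simp add: to_chart_pref)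

lemma curve_change_chart:
  assumes "c \<in> A" "d \<in> A" "\<eta> t \<in> fst c" "\<eta> t \<in> fst d" "isCont \<eta> t"
    and "((snd c \<circ> \<eta>) has_vector_derivative u) (at t)"
  shows "((snd d \<circ> \<eta>) has_vector_derivative transition c d (\<eta> t) u) (at t)"
proof -
  have "((snd c \<circ> \<eta>) has_derivative (\<lambda>s. s *\<^sub>R u)) (at t)"
    using assms(6) by (simp add: has_vector_derivative_def)
  from has_derivative_compose[OF this, of "snd d \<circ> chart_inv c"] transition_has_derivative[OF assms(1-4)]
  have 1: "((\<lambda>s. (snd d \<circ> chart_inv c) ((snd c \<circ> \<eta>) s)) has_derivative (\<lambda>s. transition c d (\<eta> t) (s *\<^sub>R u))) (at t)"
    by simp
  have "eventually (\<lambda>s. \<eta> s \<in> fst c) (at t)"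
    using assms(3,5) chart_dom_open[OF assms(1)] by (metis isCont_def topological_tendstoD)
  then have "eventually (\<lambda>s. (snd d \<circ> chart_inv c) ((snd c \<circ> \<eta>) s) = (snd d \<circ> \<eta>) s) (at t)"
    by (rule eventually_mono) (simp add: chart_inv_left[OF assms(1)])
  from has_derivative_transform_eventually[OF 1 this]
  have "((snd d \<circ> \<eta>) has_derivative (\<lambda>s. transition c d (\<eta> t) (s *\<^sub>R u))) (at t)"
    by (simp add: chart_inv_left[OF assms(1,3)] o_def)
  then show ?thesis
    using has_derivative_linear[OF transition_has_derivative[OF assms(1-4)]]
    by (simp add: has_vector_derivative_def linear_cmul)
qed

lemma velocity_chart:
  assumes "c \<in> A" "\<eta> t \<in> fst c" "isCont \<eta> t" "(snd c \<circ> \<eta>) differentiable (at t)"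
  shows "velocity A \<eta> t = of_chart A c (snd c (\<eta> t)) (vector_derivative (snd c \<circ> \<eta>) (at t))"
    "to_chart A c (\<eta> t) (velocity A \<eta> t) = vector_derivative (snd c \<circ> \<eta>) (at t)"
proof -
  show 1: "velocity A \<eta> t = of_chart A c (snd c (\<eta> t)) (vector_derivative (snd c \<circ> \<eta>) (at t))"
    unfolding velocity_def of_chart_eq[OF assms(1,2)]
    by (intro vector_derivative_at curve_change_chart assms pref_chart)
      (use assms(4) vector_derivative_works in blast)
  show "to_chart A c (\<eta> t) (velocity A \<eta> t) = vector_derivative (snd c \<circ> \<eta>) (at t)"
    unfolding 1 by (rule to_of_chart[OF assms(1,2)])
qed

subsection \<open>Lorentz--Finsler structures in charts\<close>

lemma chart_slit_open: "c \<in> A \<Longrightarrow> open (chart_slit c)"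
proof -
  assume c: "c \<in> A"
  have "chart_slit c = (snd c ` fst c) \<times> (- {0})" by (auto simp: chart_slit_def)
  then show ?thesis using open_Times[OF chart_image_open[OF c], of "- {0}"] open_delete[OF open_UNIV, of 0] by (simp add: Compl_eq_Diff_UNIV)
qed

lemma lorentz_signature_invertible:
  fixes B :: "real^'m^'m"
  assumes "lorentz_signature B" shows "invertible B"
proof -
  obtain P :: "real^'m^'m" and i0 where P: "invertible P"
    "Finite_Cartesian_Product.transpose P ** B ** P = (\<chi> i j. if i = j then (if i = i0 then -1 else 1) else 0)"
    using assms unfolding lorentz_signature_def by blast
  let ?D = "(\<chi> i j. if i = j then (if i = i0 then -1 else 1) else 0) :: real^'m^'m"
  have "?D ** ?D = mat 1"
    by (simp add: matrix_matrix_mult_def vec_eq_iff mat_def if_distrib[where f="\<lambda>x. x * _"] cong: if_cong)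
  then have "invertible ?D" unfolding invertible_def by blast
  then have "Determinants.det ?D \<noteq> 0" by (simp add: invertible_det_nz)
  then have "Determinants.det B \<noteq> 0" unfolding P(2)[symmetric] by (auto simp: det_mul)
  then show ?thesis by (simp add: invertible_det_nz)
qed

end

lemma finsler_chart_local:
  fixes A :: "('a::topological_space, 'm::finite) chart set"
  assumes atlas: "smooth_atlas A" and L: "lorentz_finsler A L" and c: "c \<in> A"
  shows "finsler_chart (local_expr A c L) (chart_slit c)"
proof
  show "open (chart_slit c)" using chart_slit_open[OF atlas c] .
  show "conic (chart_slit c)" by (auto simp: conic_def chart_slit_def)
  show "smooth_on (chart_slit c) (local_expr A c L)"
    using L c by (simp add: lorentz_finsler_def chart_slit_def)
  show "homogeneous (chart_slit c) 2 (local_expr A c L)"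
    unfolding homogeneous_def
  proof (intro allI impI)
    fix x u and k :: real assume z: "(x, u) \<in> chart_slit c \<and> k > 0"
    then obtain p where p: "p \<in> fst c" "x = snd c p" by (auto simp: chart_slit_def)
    have "of_chart A c x (k *\<^sub>R u) = k *\<^sub>R of_chart A c x u"
      unfolding p(2) using linear_of_chart[OF atlas c p(1)] by (rule linear_cmul)
    then show "local_expr A c L (x, k *\<^sub>R u) = k\<^sup>2 * local_expr A c L (x, u)"
      using L z by (simp add: local_expr_def lorentz_finsler_def)
  qed
  show "invertible (gmat (local_expr A c L) z)" if "z \<in> chart_slit c" for z
    using that L c lorentz_signature_invertible[OF atlas] unfolding lorentz_finsler_def chart_slit_def by blast
qed

lemma local_expr_snd:
  assumes "smooth_atlas A" "c \<in> A" "p \<in> fst c"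
  shows "local_expr A c f (snd c p, u) = f p (of_chart A c (snd c p) u)"
  by (simp add: local_expr_def chart_inv_left[OF assms])

lemma (in finsler_chart) g_snd_inner:
  assumes "z \<in> S"
  shows "(\<Sum>\<alpha>\<in>UNIV. \<Sum>\<beta>\<in>UNIV. g z $ \<alpha> $ \<beta> * snd z $ \<alpha> * w $ \<beta>) = (\<Sum>\<beta>\<in>UNIV. dv \<beta> F z * w $ \<beta>)"
proof -
  have "(\<Sum>\<alpha>\<in>UNIV. \<Sum>\<beta>\<in>UNIV. g z $ \<alpha> $ \<beta> * snd z $ \<alpha> * w $ \<beta>) =
      (\<Sum>\<beta>\<in>UNIV. (\<Sum>\<alpha>\<in>UNIV. g z $ \<beta> $ \<alpha> * snd z $ \<alpha>) * w $ \<beta>)"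
    by (subst sum.swap) (simp add: sum_distrib_right g_sym[OF assms])
  then show ?thesis by (simp add: g_snd[OF assms])
qed

lemma (in finsler_chart) fibre_derivative:
  assumes "z \<in> S"
  shows "DERIV (\<lambda>s. F (fst z, snd z + s *\<^sub>R w)) 0 :> (\<Sum>\<alpha>\<in>UNIV. dv \<alpha> F z * w $ \<alpha>)"
proof -
  have D: "(F has_derivative frechet_derivative F (at z)) (at (fst z, snd z + 0 *\<^sub>R w))"
    using diff_F[OF assms] frechet_derivative_works by auto
  have "((\<lambda>s. (fst z, snd z + s *\<^sub>R w)) has_derivative (\<lambda>s. s *\<^sub>R (0, w))) (at 0)"
    by (auto intro!: derivative_eq_intros)
  from DERIV_along[OF D this] show ?thesis
    by (simp add: frechet_derivative_expand[OF diff_F[OF assms]] mult.commute)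
qed

text \<open>The pairing of \<open>v\<close> with \<open>w\<close> under the metric at
  \<open>v\<close> is the derivative of \<open>L\<close> along the line \<open>v + s w\<close> at
  \<open>s = 0\<close>. That function of \<open>s\<close> is the same in all charts, so the
  hyperplane can be read off in any of them.\<close>

lemma null_perp_chart:
  fixes A :: "('a::topological_space, 'm::finite) chart set"
  assumes atlas: "smooth_atlas A" and L: "lorentz_finsler A L" and c: "c \<in> A" and p: "p \<in> fst c"
    and u: "u \<noteq> 0"
  shows "of_chart A c (snd c p) w \<in> null_perp A L p (of_chart A c (snd c p) u) \<longleftrightarrow>
    (\<Sum>\<alpha>\<in>UNIV. dv \<alpha> (local_expr A c L) (snd c p, u) * w $ \<alpha>) = 0"
proof -
  let ?P = "pref_chart A p" and ?O = "of_chart A c (snd c p)"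
  note P = pref_chart[OF atlas, of p]
  interpret C: finsler_chart "local_expr A c L" "chart_slit c" by (rule finsler_chart_local[OF atlas L c])
  interpret P: finsler_chart "local_expr A ?P L" "chart_slit ?P" by (rule finsler_chart_local[OF atlas L P(1)])
  have lin: "linear ?O" by (rule linear_of_chart[OF atlas c p])
  have z: "(snd c p, u) \<in> chart_slit c" "(snd ?P p, ?O u) \<in> chart_slit ?P"
    using u p P by (auto simp: chart_slit_def of_chart_eq_0_iff[OF atlas c p])
  have "local_expr A c L (snd c p, u + s *\<^sub>R w) = local_expr A ?P L (snd ?P p, ?O u + s *\<^sub>R ?O w)" for s
    unfolding local_expr_snd[OF atlas c p] local_expr_snd[OF atlas P] of_chart_pref[OF atlas]
    by (simp add: linear_add[OF lin] linear_cmul[OF lin])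
  then have "(\<Sum>\<alpha>\<in>UNIV. dv \<alpha> (local_expr A c L) (snd c p, u) * w $ \<alpha>) =
      (\<Sum>\<alpha>\<in>UNIV. dv \<alpha> (local_expr A ?P L) (snd ?P p, ?O u) * ?O w $ \<alpha>)"
    using C.fibre_derivative[OF z(1), of w] P.fibre_derivative[OF z(2), of "?O w"]
    by (simp add: DERIV_unique)
  also have "\<dots> = gmetric A L p (?O u) (?O u) (?O w)"
    using P.g_snd_inner[OF z(2), of "?O w"] by (simp add: gmetric_def)
  finally show ?thesis by (simp add: null_perp_def)
qed

section \<open>Adapted frames of Lorentzian inner products\<close>

lemma orthonormal_expansion:
  fixes x :: "'a::euclidean_space"
  assumes "finite B" "pairwise orthogonal B" "\<And>b. b \<in> B \<Longrightarrow> norm b = 1" "x \<in> span B"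
  shows "(\<Sum>b\<in>B. (b \<bullet> x) *\<^sub>R b) = x"
proof -
  let ?r = "x - (\<Sum>b\<in>B. (b \<bullet> x) *\<^sub>R b)"
  have "orthogonal ?r c" if c: "c \<in> B" for c
  proof -
    have "(\<Sum>b\<in>B. (b \<bullet> x) *\<^sub>R b) \<bullet> c = (\<Sum>b\<in>B. if b = c then b \<bullet> x else 0)"
      unfolding inner_sum_left
    proof (rule sum.cong[OF refl])
      fix b assume "b \<in> B"
      then show "((b \<bullet> x) *\<^sub>R b) \<bullet> c = (if b = c then b \<bullet> x else 0)"
        using assms(2,3) c by (auto simp: pairwise_def orthogonal_def norm_eq_1)
    qed
    then show ?thesis using c assms(1) by (simp add: orthogonal_def inner_diff_left inner_commute[of x c])
  qed
  then have "orthogonal ?r y" if "y \<in> span B" for y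
    using orthogonal_to_span[OF that] by blast
  moreover have "?r \<in> span B"
    by (intro span_diff assms(4) span_sum span_scale span_base)
  ultimately have "orthogonal ?r ?r" by blast
  then show ?thesis by (simp add: orthogonal_self)
qed

text \<open>\<open>f\<close>, \<open>fv\<close>, \<open>fz\<close> form the dual basis, as covectors
  represented through the Euclidean inner product. In the uses below \<open>v\<close> is null, the
  \<open>e i\<close> lie in its null hyperplane and \<open>z\<close> is transversal to it.\<close>

definition null_frame ::
  "real^'m::finite \<Rightarrow> (nat \<Rightarrow> real^'m) \<Rightarrow> real^'m \<Rightarrow> (nat \<Rightarrow> real^'m) \<Rightarrow> real^'m \<Rightarrow> real^'m \<Rightarrow> bool" where
  "null_frame v e z f fv fz \<longleftrightarrow>
     (\<forall>w. w = (\<Sum>i<CARD('m) - 2. (f i \<bullet> w) *\<^sub>R e i) + (fv \<bullet> w) *\<^sub>R v + (fz \<bullet> w) *\<^sub>R z) \<and>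
     (\<forall>i<CARD('m) - 2. \<forall>j<CARD('m) - 2. f i \<bullet> e j = (if i = j then 1 else 0)) \<and>
     (\<forall>i<CARD('m) - 2. f i \<bullet> v = 0 \<and> f i \<bullet> z = 0 \<and> fv \<bullet> e i = 0 \<and> fz \<bullet> e i = 0) \<and>
     fv \<bullet> v = 1 \<and> fv \<bullet> z = 0 \<and> fz \<bullet> v = 0 \<and> fz \<bullet> z = 1"

text \<open>In the coordinates given by \<open>P\<close> the form is the Euclidean product minus
  twice the product of the \<open>a\<close>-components. The frame is made of an orthonormal basis of
  the Euclidean complement of the time axis \<open>a\<close> and of the null vector
  \<open>y\<close>, together with \<open>v\<close> and the timelike vector
  \<open>P *v a\<close>.\<close>

lemma lorentz_null_frame:
  fixes B :: "real^'m::finite^'m"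
  assumes B: "lorentz_signature B" and v: "v \<noteq> 0" "v \<bullet> (B *v v) = 0"
  obtains e z f fv fz where "null_frame v e z f fv fz"
    "\<And>i j. i < CARD('m) - 2 \<Longrightarrow> j < CARD('m) - 2 \<Longrightarrow> e i \<bullet> (B *v e j) = (if i = j then 1 else 0)"
    "\<And>i. i < CARD('m) - 2 \<Longrightarrow> v \<bullet> (B *v e i) = 0"
    "v \<bullet> (B *v z) \<noteq> 0"
proof -
  obtain P :: "real^'m^'m" and i0 where P: "invertible P"
    "Finite_Cartesian_Product.transpose P ** B ** P = (\<chi> i j. if i = j then (if i = i0 then -1 else 1) else 0)"
    using B unfolding lorentz_signature_def by blast
  define Q where "Q = matrix_inv P"
  have PQ: "P *v (Q *v x) = x" "Q *v (P *v x) = x" for x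
    unfolding Q_def using matrix_inv_mult[OF P(1)] by (simp_all add: matrix_vector_mul_assoc)
  define a :: "real^'m" where "a = axis i0 1"
  have aa: "a \<bullet> a = 1" by (simp add: a_def inner_axis_axis)
  have ax: "a \<bullet> x = x $ i0" and ai: "a $ i = (if i = i0 then 1 else 0)" for x i
    by (simp_all add: a_def inner_axis') (simp add: axis_def)
  have form: "(P *v x) \<bullet> (B *v (P *v x')) = x \<bullet> x' - 2 * (a \<bullet> x) * (a \<bullet> x')" for x x'
  proof -
    have "(P *v x) \<bullet> (B *v (P *v x')) = x \<bullet> (Finite_Cartesian_Product.transpose P *v (B *v (P *v x')))"
      by (metis dot_lmul_matrix inner_commute transpose_matrix_vector)
    also have "\<dots> = x \<bullet> ((\<chi> i j. if i = j then (if i = i0 then -1 else 1) else 0) *v x')"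
      by (simp add: matrix_vector_mul_assoc P(2)[symmetric] matrix_mul_assoc)
    also have "(\<chi> i j. if i = j then (if i = i0 then -1 else 1) else 0) *v x' = x' - (2 * (a \<bullet> x')) *\<^sub>R a"
      by (simp add: vec_eq_iff matrix_vector_mult_def ax ai
          if_distrib[where f="\<lambda>c. c * _"] cong: if_cong)
    finally show ?thesis by (simp add: inner_diff_right inner_commute[of x a])
  qed
  define y where "y = Q *v v"
  define y0 where "y0 = a \<bullet> y"
  have Py: "P *v y = v" by (simp add: y_def PQ)
  have yy: "y \<bullet> y = 2 * y0\<^sup>2"
    using form[of y y] v(2) by (simp add: Py y0_def power2_eq_square)
  have "y \<noteq> 0" using v(1) Py by auto
  then have y0: "y0 \<noteq> 0" using yy by auto
  \<comment> \<open>The spatial part of \<open>y\<close>. It is orthogonal to \<open>a\<close> and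
    pairs with \<open>y\<close> to \<open>y0^2\<close>, so it reads off the coefficient of
    \<open>y\<close> in the expansion \<open>rep\<close>.\<close>
  define y' where "y' = y - y0 *\<^sub>R a"
  have y'a: "y' \<bullet> a = 0" unfolding inner_commute[of y' a]
    by (simp add: y'_def inner_diff_right aa y0_def)
  have y'y: "y' \<bullet> y = y0\<^sup>2"
    by (simp add: y'_def inner_diff_left yy y0_def[symmetric] power2_eq_square)
  \<comment> \<open>Where the \<open>a\<close>-component is zero, the second summand of
    \<open>form\<close> vanishes. So the form is Euclidean on \<open>W\<close>, and \<open>W\<close>
    is orthogonal to \<open>y\<close> for both products.\<close>
  define W where "W = {x. \<forall>s\<in>span {a, y}. orthogonal s x}"
  have W: "x \<in> W \<longleftrightarrow> a \<bullet> x = 0 \<and> y \<bullet> x = 0" for x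
  proof
    show "x \<in> W \<Longrightarrow> a \<bullet> x = 0 \<and> y \<bullet> x = 0"
      by (auto simp: W_def orthogonal_def span_base)
    assume "a \<bullet> x = 0 \<and> y \<bullet> x = 0"
    then have "orthogonal x s" if "s \<in> span {a, y}" for s
      using that by (intro orthogonal_to_span[OF that]) (auto simp: orthogonal_def inner_commute)
    then show "x \<in> W" by (simp add: W_def orthogonal_commute)
  qed
  have sub: "subspace W"
    unfolding subspace_def by (simp add: W inner_add_right)
  have "independent {a, y}"
  proof -
    have "y \<noteq> k *\<^sub>R a" for k
    proof
      assume k: "y = k *\<^sub>R a"
      then have "y0 = k" by (simp add: y0_def aa)
      with k yy have "k\<^sup>2 = 2 * k\<^sup>2" by (simp add: aa power2_eq_square)
      with y0 \<open>y0 = k\<close> show False by simp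
    qed
    then have "y \<notin> span {a}" by (auto simp: span_singleton)
    moreover have "independent {a}" using aa by (auto simp: independent_insert)
    ultimately show ?thesis by (simp add: insert_commute[of a] independent_insert)
  qed
  moreover have "a \<noteq> y" using y'y y'a y0 by auto
  ultimately have "dim (span {a, y}) = 2" by (simp add: dim_eq_card_independent)
  then have dimW: "dim W = CARD('m) - 2"
    using dim_subspace_orthogonal_to_vectors[of "span {a, y}" UNIV] unfolding W_def by (simp add: subspace_span)
  obtain C where C: "C \<subseteq> W" "pairwise orthogonal C" "\<And>x. x \<in> C \<Longrightarrow> norm x = 1"
    "independent C" "card C = dim W" "span C = W"
    using orthonormal_basis_subspace[OF sub] by metis
  have fin: "finite C" using C(4) independent_imp_finite by blast
  obtain x where x: "bij_betw x {..<CARD('m) - 2} C"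
    using ex_bij_betw_nat_finite[OF fin] C(5) dimW by (auto simp: atLeast0LessThan)
  have xC: "x i \<in> C" if "i < CARD('m) - 2" for i using x that by (auto simp: bij_betw_def)
  have xx: "x i \<bullet> x j = (if i = j then 1 else 0)" if "i < CARD('m) - 2" "j < CARD('m) - 2" for i j
  proof (cases "i = j")
    case True then show ?thesis using C(3)[OF xC[OF that(1)]] by (simp add: norm_eq_1)
  next
    case False
    then have "x i \<noteq> x j" using x that by (auto simp: bij_betw_def inj_on_def)
    then show ?thesis using C(2) xC that False by (auto simp: pairwise_def orthogonal_def)
  qed
  have xay: "a \<bullet> x i = 0" "y \<bullet> x i = 0" "y' \<bullet> x i = 0" if "i < CARD('m) - 2" for i
    using xC[OF that] C(1) W by (auto simp: y'_def inner_diff_left)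
  have xay': "x i \<bullet> a = 0" "x i \<bullet> y = 0" if "i < CARD('m) - 2" for i
    using xay[OF that] by (simp_all add: inner_commute)
  have rep: "w = (\<Sum>i<CARD('m) - 2. (x i \<bullet> w) *\<^sub>R x i) + ((y' \<bullet> w) / y0\<^sup>2) *\<^sub>R y + (a \<bullet> w - (y' \<bullet> w) / y0) *\<^sub>R a" for w
  proof -
    define r where "r = w - ((y' \<bullet> w) / y0\<^sup>2) *\<^sub>R y - (a \<bullet> w - (y' \<bullet> w) / y0) *\<^sub>R a"
    have ar: "a \<bullet> r = 0"
      using y0 by (simp add: r_def inner_diff_right aa y0_def[symmetric] power2_eq_square)
    have "y' \<bullet> r = 0"
      using y0 by (simp add: r_def inner_diff_right y'a y'y)
    then have "y \<bullet> r = 0" using ar by (simp add: y'_def inner_diff_left)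
    then have "r \<in> span C" using ar W C(6) by simp
    then have "(\<Sum>b\<in>C. (b \<bullet> r) *\<^sub>R b) = r" using orthonormal_expansion[OF fin C(2,3)] by blast
    then have "(\<Sum>i<CARD('m) - 2. (x i \<bullet> r) *\<^sub>R x i) = r"
      using sum.reindex_bij_betw[OF x, of "\<lambda>b. (b \<bullet> r) *\<^sub>R b"] by simp
    moreover have "x i \<bullet> r = x i \<bullet> w" if "i < CARD('m) - 2" for i
      using xay'[OF that] by (simp add: r_def inner_diff_right)
    ultimately have "(\<Sum>i<CARD('m) - 2. (x i \<bullet> w) *\<^sub>R x i) = r" by simp
    then show ?thesis by (simp add: r_def)
  qed
  \<comment> \<open>Pulls covectors back along \<open>Q\<close>, so that the dual basis found in the
    coordinates of \<open>P\<close> becomes one in the original coordinates.\<close>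
  define pb where "pb u = u v* Q" for u
  have pb: "pb u \<bullet> w = u \<bullet> (Q *v w)" for u w by (simp add: pb_def dot_lmul_matrix)
  let ?e = "\<lambda>i. P *v x i" and ?z = "P *v a" and ?f = "\<lambda>i. pb (x i)" and ?fv = "pb ((1 / y0\<^sup>2) *\<^sub>R y')"
    and ?fz = "pb (a - (1 / y0) *\<^sub>R y')"
  have "null_frame v ?e ?z ?f ?fv ?fz"
    unfolding null_frame_def
  proof (intro conjI allI impI)
    fix w
    have "P *v (Q *v w) = P *v ((\<Sum>i<CARD('m) - 2. (x i \<bullet> (Q *v w)) *\<^sub>R x i) + ((y' \<bullet> (Q *v w)) / y0\<^sup>2) *\<^sub>R y
      + (a \<bullet> (Q *v w) - (y' \<bullet> (Q *v w)) / y0) *\<^sub>R a)"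
      using rep[of "Q *v w"] by simp
    also have "\<dots> = (\<Sum>i<CARD('m) - 2. (x i \<bullet> (Q *v w)) *\<^sub>R (P *v x i)) + ((y' \<bullet> (Q *v w)) / y0\<^sup>2) *\<^sub>R (P *v y)
      + (a \<bullet> (Q *v w) - (y' \<bullet> (Q *v w)) / y0) *\<^sub>R (P *v a)"
      by (simp add: linear_sum[OF matrix_vector_mul_linear[of P]] matrix_vector_right_distrib matrix_vector_mult_scaleR)
    finally show "w = (\<Sum>i<CARD('m) - 2. (?f i \<bullet> w) *\<^sub>R ?e i) + (?fv \<bullet> w) *\<^sub>R v + (?fz \<bullet> w) *\<^sub>R ?z"
      by (simp add: PQ pb Py inner_diff_left)
  qed (use y0 in \<open>simp_all add: pb PQ xx xay xay' inner_diff_left aa y'a y'y y_def[symmetric] y0_def[symmetric]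
      power2_eq_square\<close>)
  moreover have "v \<bullet> (B *v ?z) \<noteq> 0"
    unfolding Py[symmetric] form using y0 by (simp add: aa y0_def inner_commute)
  ultimately show ?thesis
    using that[of ?e ?z ?f ?fv ?fz] unfolding Py[symmetric] form by (auto simp: xx xay)
qed

lemma trace_null_frame:
  fixes R :: "real^'m::finite^'m"
  assumes "null_frame v e z f fv fz"
  shows "trace R = (\<Sum>i<CARD('m) - 2. f i \<bullet> (R *v e i)) + fv \<bullet> (R *v v) + fz \<bullet> (R *v z)"
proof -
  have *: "(\<Sum>\<alpha>\<in>UNIV. \<phi> $ \<alpha> * (R *v w) $ \<alpha>) = \<phi> \<bullet> (R *v w)" for \<phi> w :: "real^'m"
    by (simp add: inner_vec_def)
  have "R $ \<alpha> $ \<alpha> = (\<Sum>i<CARD('m) - 2. f i $ \<alpha> * (R *v e i) $ \<alpha>) + fv $ \<alpha> * (R *v v) $ \<alpha> + fz $ \<alpha> * (R *v z) $ \<alpha>" for \<alpha>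
  proof -
    have "axis \<alpha> 1 = (\<Sum>i<CARD('m) - 2. (f i \<bullet> axis \<alpha> 1) *\<^sub>R e i) + (fv \<bullet> axis \<alpha> 1) *\<^sub>R v + (fz \<bullet> axis \<alpha> 1) *\<^sub>R z"
      using assms unfolding null_frame_def by blast
    then have "R *v axis \<alpha> 1 = R *v ((\<Sum>i<CARD('m) - 2. (f i $ \<alpha>) *\<^sub>R e i) + (fv $ \<alpha>) *\<^sub>R v + (fz $ \<alpha>) *\<^sub>R z)"
      by (simp add: inner_axis)
    also have "\<dots> = (\<Sum>i<CARD('m) - 2. (f i $ \<alpha>) *\<^sub>R (R *v e i)) + (fv $ \<alpha>) *\<^sub>R (R *v v) + (fz $ \<alpha>) *\<^sub>R (R *v z)"
      by (simp add: linear_sum[OF matrix_vector_mul_linear[of R]] matrix_vector_right_distrib matrix_vector_mult_scaleR)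
    finally have "(R *v axis \<alpha> 1) $ \<alpha> = \<dots> $ \<alpha>" by simp
    moreover have "(R *v axis \<alpha> 1) $ \<alpha> = R $ \<alpha> $ \<alpha>"
      by (simp add: matrix_vector_mult_basis column_def)
    ultimately show ?thesis by simp
  qed
  then have "trace R = (\<Sum>\<alpha>\<in>UNIV. (\<Sum>i<CARD('m) - 2. f i $ \<alpha> * (R *v e i) $ \<alpha>)) + fv \<bullet> (R *v v) + fz \<bullet> (R *v z)"
    by (simp add: trace_def sum.distrib *)
  also have "(\<Sum>\<alpha>\<in>UNIV. (\<Sum>i<CARD('m) - 2. f i $ \<alpha> * (R *v e i) $ \<alpha>)) = (\<Sum>i<CARD('m) - 2. f i \<bullet> (R *v e i))"
    by (subst sum.swap) (simp add: *)
  finally show ?thesis .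
qed

section \<open>Matrix functions\<close>

definition mtrace :: "real mat \<Rightarrow> real" where
  "mtrace M = (\<Sum>i<dim_row M. M $$ (i, i))"

lemma mtrace_mult:
  assumes "M \<in> carrier_mat d d" "K \<in> carrier_mat d d"
  shows "mtrace (M * K) = (\<Sum>i<d. \<Sum>j<d. M $$ (i, j) * K $$ (j, i))"
  using assms by (simp add: mtrace_def scalar_prod_def atLeast0LessThan)

lemma mtrace_comm:
  assumes "M \<in> carrier_mat d d" "K \<in> carrier_mat d d"
  shows "mtrace (M * K) = mtrace (K * M)"
  unfolding mtrace_mult[OF assms] mtrace_mult[OF assms(2,1)]
  by (subst sum.swap) (simp add: mult.commute)

lemma mtrace_add: "M \<in> carrier_mat d d \<Longrightarrow> K \<in> carrier_mat d d \<Longrightarrow> mtrace (M + K) = mtrace M + mtrace K"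
  and mtrace_minus: "M \<in> carrier_mat d d \<Longrightarrow> K \<in> carrier_mat d d \<Longrightarrow> mtrace (M - K) = mtrace M - mtrace K"
  by (auto simp: mtrace_def sum.distrib sum_subtractf)

lemma mtrace_similar:
  assumes "M \<in> carrier_mat d d" "M' \<in> carrier_mat d d" "T \<in> carrier_mat d d" "U \<in> carrier_mat d d"
    and "T * M = M' * T" "U * T = 1\<^sub>m d" "T * U = 1\<^sub>m d"
  shows "mtrace M = mtrace M'"
proof -
  have "M = U * (M' * T)"
    unfolding assms(5)[symmetric] using assms(1,6) assoc_mult_mat[OF assms(4,3,1)] by simp
  then have "mtrace M = mtrace ((M' * T) * U)"
    using mtrace_comm[of U d "M' * T"] assms by simp
  also have "(M' * T) * U = M'"
    using assms by (simp add: assoc_mult_mat[of M' d d T d U d])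
  finally show ?thesis .
qed

text \<open>Cauchy--Schwarz compares the diagonal with the constant vector 1; symmetry makes
  \<open>mtrace (C * C)\<close> the sum of all squared entries, which dominates the diagonal
  ones.\<close>

lemma mtrace_square_symmetric:
  assumes "C \<in> carrier_mat d d" "d > 0" "\<And>i j. i < d \<Longrightarrow> j < d \<Longrightarrow> C $$ (i, j) = C $$ (j, i)"
  shows "(mtrace C)\<^sup>2 / real d \<le> mtrace (C * C)"
proof -
  have "(mtrace C)\<^sup>2 \<le> (\<Sum>i<d. (C $$ (i, i))\<^sup>2) * (\<Sum>i<d. 1\<^sup>2)"
    using Cauchy_Schwarz_ineq_sum[of "\<lambda>i. C $$ (i, i)" "\<lambda>_. 1" "{..<d}"] assms(1) by (simp add: mtrace_def)
  then have "(mtrace C)\<^sup>2 / real d \<le> (\<Sum>i<d. (C $$ (i, i))\<^sup>2)"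
    using assms(2) by (simp add: field_simps)
  also have "\<dots> \<le> (\<Sum>i<d. \<Sum>j<d. (C $$ (i, j))\<^sup>2)"
    by (intro sum_mono member_le_sum) auto
  also have "\<dots> = mtrace (C * C)"
    unfolding mtrace_mult[OF assms(1,1)] power2_eq_square
    by (intro sum.cong refl arg_cong2[where f="(*)"]) (use assms(3) in auto)
  finally show ?thesis .
qed

lemma differentiable_prod_real:
  fixes f :: "'i \<Rightarrow> real \<Rightarrow> real"
  assumes "\<And>i. i \<in> I \<Longrightarrow> f i differentiable (at t)"
  shows "(\<lambda>s. \<Prod>i\<in>I. f i s) differentiable (at t)"
  using assms by (induction I rule: infinite_finite_induct) auto

lemma differentiable_det:
  fixes B :: "real \<Rightarrow> real mat"
  assumes "\<And>s. B s \<in> carrier_mat d d"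
    and "\<And>i j. i < d \<Longrightarrow> j < d \<Longrightarrow> (\<lambda>s. B s $$ (i, j)) differentiable (at t)"
  shows "(\<lambda>s. Determinant.det (B s)) differentiable (at t)"
proof -
  have "(\<lambda>s. \<Sum>p | p permutes {0..<d}. signof p * (\<Prod>i = 0..<d. B s $$ (i, p i))) differentiable (at t)"
  proof (intro differentiable_sum ballI differentiable_mult differentiable_const differentiable_prod_real)
    show "finite {p. p permutes {0..<d}}" by (simp add: finite_permutations)
    fix p i assume "p \<in> {p. p permutes {0..<d}}" "i \<in> {0..<d}"
    then show "(\<lambda>s. B s $$ (i, p i)) differentiable (at t)"
      using assms(2)[of i "p i"] permutes_in_image[of p "{0..<d}" i] by simp
  qed
  then show ?thesis by (simp add: det_def'[OF assms(1)])
qed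

text \<open>The adjugate formula: entries are explicit rational functions of the entries of
  \<open>M\<close>, which gives differentiability wherever the determinant is nonzero.\<close>

definition minv :: "real mat \<Rightarrow> real mat" where
  "minv M = (1 / Determinant.det M) \<cdot>\<^sub>m adj_mat M"

lemma minv:
  assumes "M \<in> carrier_mat d d" "Determinant.det M \<noteq> 0"
  shows "minv M \<in> carrier_mat d d" "M * minv M = 1\<^sub>m d" "minv M * M = 1\<^sub>m d"
proof -
  note adj = adj_mat[OF assms(1)]
  show "minv M \<in> carrier_mat d d" using adj(1) by (simp add: minv_def)
  show "M * minv M = 1\<^sub>m d" "minv M * M = 1\<^sub>m d"
    unfolding minv_def
    using assms adj by (simp_all add: mult_smult_distrib[OF assms(1) adj(1)] mult_smult_assoc_mat[OF adj(1) assms(1)])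
      (auto intro!: eq_matI)
qed

lemma differentiable_minv:
  fixes B :: "real \<Rightarrow> real mat"
  assumes B: "\<And>s. B s \<in> carrier_mat d d"
    and diff: "\<And>i j. i < d \<Longrightarrow> j < d \<Longrightarrow> (\<lambda>s. B s $$ (i, j)) differentiable (at t)"
    and det: "Determinant.det (B t) \<noteq> 0" and ij: "i < d" "j < d"
  shows "(\<lambda>s. minv (B s) $$ (i, j)) differentiable (at t)"
proof -
  have "(\<lambda>s. Determinant.det (mat_delete (B s) j i)) differentiable (at t)"
  proof (rule differentiable_det[where d="d - 1"])
    show "mat_delete (B s) j i \<in> carrier_mat (d - 1) (d - 1)" for s
      by (rule mat_delete_carrier[OF B])
    fix k l assume kl: "k < d - 1" "l < d - 1"
    have "mat_delete (B s) j i $$ (k, l) = B s $$ (if k < j then k else Suc k, if l < i then l else Suc l)" for s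
      using kl B[of s] by (simp add: mat_delete_def)
    moreover have "(\<lambda>s. B s $$ (if k < j then k else Suc k, if l < i then l else Suc l)) differentiable (at t)"
      using kl by (intro diff) auto
    ultimately show "(\<lambda>s. mat_delete (B s) j i $$ (k, l)) differentiable (at t)" by simp
  qed
  then have "(\<lambda>s. (1 / Determinant.det (B s)) * ((-1) ^ (j + i) * Determinant.det (mat_delete (B s) j i))) differentiable (at t)"
    by (intro differentiable_mult differentiable_divide differentiable_const differentiable_det[OF B diff] det)
  moreover have "minv (B s) $$ (i, j) =
      (1 / Determinant.det (B s)) * ((-1) ^ (j + i) * Determinant.det (mat_delete (B s) j i))" for s
    using B[of s] ij by (simp add: minv_def adj_mat_def Determinant.cofactor_def)
  ultimately show ?thesis by simp
qed

text \<open>The matrix form of \<open>\<theta>' = trace (J'' J\<^sup>-\<^sup>1) - trace ((J' J\<^sup>-\<^sup>1)\<^sup>2)\<close> in a frame with connection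
  matrix \<open>\<Gamma>\<close>: the commutator terms do not contribute to the trace.\<close>

lemma trace_log_derivative:
  fixes B B1 :: "real \<Rightarrow> real mat"
  assumes B: "\<And>s. B s \<in> carrier_mat d d" "\<And>s. B1 s \<in> carrier_mat d d"
    and C: "B2 \<in> carrier_mat d d" "\<Gamma> \<in> carrier_mat d d"
    and det: "Determinant.det (B t) \<noteq> 0"
    and dB: "\<And>i j. i < d \<Longrightarrow> j < d \<Longrightarrow>
       ((\<lambda>s. B s $$ (i, j)) has_real_derivative (B1 t + (B t * \<Gamma> - \<Gamma> * B t)) $$ (i, j)) (at t)"
    and dB1: "\<And>i j. i < d \<Longrightarrow> j < d \<Longrightarrow>
       ((\<lambda>s. B1 s $$ (i, j)) has_real_derivative (B2 + (B1 t * \<Gamma> - \<Gamma> * B1 t)) $$ (i, j)) (at t)"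
  shows "((\<lambda>s. mtrace (B1 s * minv (B s))) has_real_derivative
     mtrace (B2 * minv (B t)) - mtrace ((B1 t * minv (B t)) * (B1 t * minv (B t)))) (at t)"
    "eventually (\<lambda>s. Determinant.det (B s) \<noteq> 0) (nhds t)"
proof -
  have diff: "(\<lambda>s. B s $$ (i, j)) differentiable (at t)" if "i < d" "j < d" for i j
    using dB[OF that] by (auto simp: differentiable_def has_field_derivative_def)
  have "isCont (\<lambda>s. Determinant.det (B s)) t"
    by (rule differentiable_imp_continuous_within[OF differentiable_det[OF B(1) diff]])
  then have "((\<lambda>s. Determinant.det (B s)) \<longlongrightarrow> Determinant.det (B t)) (nhds t)"
    by (metis isCont_def tendsto_at_iff_tendsto_nhds)
  then show ev: "eventually (\<lambda>s. Determinant.det (B s) \<noteq> 0) (nhds t)"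
    using det by (rule tendsto_imp_eventually_ne)
  define D where "D = minv (B t)"
  note D = minv[OF B(1) det, folded D_def]
  have "\<exists>E. ((\<lambda>s. minv (B s) $$ (i, j)) has_real_derivative E) (at t)" if "i < d" "j < d" for i j
    using differentiable_minv[OF B(1) diff det that] real_differentiable_def by blast
  then obtain E where E: "\<And>i j. i < d \<Longrightarrow> j < d \<Longrightarrow> ((\<lambda>s. minv (B s) $$ (i, j)) has_real_derivative E i j) (at t)"
    by metis
  define D' where "D' = Matrix.mat d d (\<lambda>(i, j). E i j)"
  define B' where "B' = B1 t + (B t * \<Gamma> - \<Gamma> * B t)"
  define B1' where "B1' = B2 + (B1 t * \<Gamma> - \<Gamma> * B1 t)"
  have car: "D' \<in> carrier_mat d d" "B' \<in> carrier_mat d d" "B1' \<in> carrier_mat d d"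
    "B t \<in> carrier_mat d d" "B1 t \<in> carrier_mat d d"
    unfolding B'_def B1'_def D'_def
    by ((rule add_carrier_mat minus_carrier_mat mult_carrier_mat[where ?n=d] B C)+ | simp)+
  have dD: "((\<lambda>s. minv (B s) $$ (i, j)) has_real_derivative D' $$ (i, j)) (at t)" if "i < d" "j < d" for i j
    using E[OF that] that by (simp add: D'_def)
  \<comment> \<open>The derivative of \<open>minv (B s) * B s = 1\<close>, an identity available
    only near \<open>t\<close>, where the determinant does not vanish.\<close>
  have prod0: "D' * B t + D * B' = 0\<^sub>m d d"
  proof (rule eq_matI)
    fix i j assume "i < dim_row (0\<^sub>m d d :: real mat)" "j < dim_col (0\<^sub>m d d :: real mat)"
    then have ij: "i < d" "j < d" by auto
    have "((\<lambda>s. \<Sum>k<d. minv (B s) $$ (i, k) * B s $$ (k, j)) has_real_derivative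
        (\<Sum>k<d. D' $$ (i, k) * B t $$ (k, j) + D $$ (i, k) * B' $$ (k, j))) (at t)"
      unfolding D_def B'_def
      by (intro DERIV_sum) (use dD dB ij in \<open>auto intro!: derivative_eq_intros\<close>)
    moreover have "eventually (\<lambda>s. (\<Sum>k<d. minv (B s) $$ (i, k) * B s $$ (k, j)) = (1\<^sub>m d :: real mat) $$ (i, j)) (nhds t)"
      using ev
    proof (rule eventually_mono)
      fix s assume "Determinant.det (B s) \<noteq> 0"
      note m = minv[OF B(1) this]
      have "(minv (B s) * B s) $$ (i, j) = (\<Sum>k<d. minv (B s) $$ (i, k) * B s $$ (k, j))"
        using m(1) B(1)[of s] ij by (simp add: scalar_prod_def atLeast0LessThan)
      then show "(\<Sum>k<d. minv (B s) $$ (i, k) * B s $$ (k, j)) = (1\<^sub>m d :: real mat) $$ (i, j)" using m(3) by simp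
    qed
    ultimately have "((\<lambda>s. (1\<^sub>m d :: real mat) $$ (i, j)) has_real_derivative
        (\<Sum>k<d. D' $$ (i, k) * B t $$ (k, j) + D $$ (i, k) * B' $$ (k, j))) (at t)"
      by (subst (asm) DERIV_cong_ev[OF refl _ refl])
    then have "(\<Sum>k<d. D' $$ (i, k) * B t $$ (k, j) + D $$ (i, k) * B' $$ (k, j)) = 0"
      using DERIV_const DERIV_unique by blast
    then show "(D' * B t + D * B') $$ (i, j) = 0\<^sub>m d d $$ (i, j)"
      using car D(1) ij by (simp add: scalar_prod_def atLeast0LessThan sum.distrib)
  qed (use car D in auto)
  have "D' * B t = - (D * B')"
    using prod0 car D(1) by (intro eq_matI) (auto simp: mat_eq_iff eq_neg_iff_add_eq_0)
  then have "(D' * B t) * D = (- (D * B')) * D" by simp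
  then have D'_eq: "D' = - (D * B' * D)"
    using car(1,2) D(1,2) assoc_mult_mat[OF car(1,4) D(1)] by (simp add: uminus_mult_left_mat)
  have "((\<lambda>s. \<Sum>i<d. \<Sum>j<d. B1 s $$ (i, j) * minv (B s) $$ (j, i)) has_real_derivative
     (\<Sum>i<d. \<Sum>j<d. B1' $$ (i, j) * D $$ (j, i) + B1 t $$ (i, j) * D' $$ (j, i))) (at t)"
    unfolding D_def B1'_def
    by (intro DERIV_sum) (use dD dB1 in \<open>auto intro!: derivative_eq_intros\<close>)
  moreover have "eventually (\<lambda>s. (\<Sum>i<d. \<Sum>j<d. B1 s $$ (i, j) * minv (B s) $$ (j, i)) = mtrace (B1 s * minv (B s))) (nhds t)"
    using ev
  proof (rule eventually_mono)
    fix s assume "Determinant.det (B s) \<noteq> 0"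
    from minv[OF B(1) this] show "(\<Sum>i<d. \<Sum>j<d. B1 s $$ (i, j) * minv (B s) $$ (j, i)) = mtrace (B1 s * minv (B s))"
      by (simp add: mtrace_mult[OF B(2)])
  qed
  ultimately have "((\<lambda>s. mtrace (B1 s * minv (B s))) has_real_derivative
     (\<Sum>i<d. \<Sum>j<d. B1' $$ (i, j) * D $$ (j, i) + B1 t $$ (i, j) * D' $$ (j, i))) (at t)"
    by (subst (asm) DERIV_cong_ev[OF refl _ refl])
  moreover have "(\<Sum>i<d. \<Sum>j<d. B1' $$ (i, j) * D $$ (j, i) + B1 t $$ (i, j) * D' $$ (j, i))
     = mtrace (B1' * D) + mtrace (B1 t * D')"
    by (simp add: mtrace_mult[OF car(3) D(1)] mtrace_mult[OF B(2) car(1)] sum.distrib)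
  moreover have "mtrace (B1' * D) + mtrace (B1 t * D') = mtrace (B2 * D) - mtrace ((B1 t * D) * (B1 t * D))"
  proof -
    let ?M = "B1 t"
    have c2: "?M * \<Gamma> \<in> carrier_mat d d" "\<Gamma> * ?M \<in> carrier_mat d d" "B t * \<Gamma> \<in> carrier_mat d d"
      "\<Gamma> * B t \<in> carrier_mat d d" "?M * D \<in> carrier_mat d d"  "D * \<Gamma> \<in> carrier_mat d d"
      using car C D by auto
    have c3: "B2 * D \<in> carrier_mat d d" "?M * \<Gamma> * D \<in> carrier_mat d d" "\<Gamma> * ?M * D \<in> carrier_mat d d"
      "?M * D * \<Gamma> \<in> carrier_mat d d" "?M * D * ?M * D \<in> carrier_mat d d"
      using car C D c2 by (auto intro!: mult_carrier_mat)
    have "B1' * D = B2 * D + (?M * \<Gamma> * D - \<Gamma> * ?M * D)"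
      unfolding B1'_def minus_mult_distrib_mat[OF c2(1,2) D(1), symmetric]
      by (rule add_mult_distrib_mat[OF C(1) minus_carrier_mat[OF c2(2)] D(1)])
    then have 1: "mtrace (B1' * D) = mtrace (B2 * D) + (mtrace (?M * \<Gamma> * D) - mtrace (\<Gamma> * ?M * D))"
      using mtrace_add[OF c3(1) minus_carrier_mat[OF c3(3)]] mtrace_minus[OF c3(2,3)] by simp
    have "?M * D * B' = ?M * D * ?M + (?M * D * (B t * \<Gamma>) - ?M * D * (\<Gamma> * B t))"
      unfolding B'_def mult_minus_distrib_mat[OF c2(5) c2(3,4), symmetric]
      by (rule mult_add_distrib_mat[OF c2(5) car(5) minus_carrier_mat[OF c2(4)]])
    then have "?M * D * B' * D = ?M * D * ?M * D + (?M * D * (B t * \<Gamma>) * D - ?M * D * (\<Gamma> * B t) * D)"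
      using add_mult_distrib_mat[OF mult_carrier_mat[OF c2(5) car(5)] minus_carrier_mat[OF mult_carrier_mat[OF c2(5) c2(4)]] D(1)]
        minus_mult_distrib_mat[OF mult_carrier_mat[OF c2(5) c2(3)] mult_carrier_mat[OF c2(5) c2(4)] D(1)] by simp
    moreover have "?M * D * (B t * \<Gamma>) * D = ?M * \<Gamma> * D"
      using C(2) D(3) assoc_mult_mat[OF car(5) D(1) c2(3)] assoc_mult_mat[OF D(1) car(4) C(2)] by simp
    moreover have "?M * D * (\<Gamma> * B t) * D = ?M * D * \<Gamma>"
      using c2(5) D(2) assoc_mult_mat[OF c2(5) C(2) car(4)]
        assoc_mult_mat[OF mult_carrier_mat[OF c2(5) C(2)] car(4) D(1)] right_mult_one_mat[OF c3(4)] by simp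
    ultimately have eq: "?M * D * B' * D = ?M * D * ?M * D + (?M * \<Gamma> * D - ?M * D * \<Gamma>)" by simp
    have "?M * D' = - (?M * D * B' * D)"
      unfolding D'_eq using car D by (simp add: assoc_mult_mat[of _ d d _ d _ d])
    moreover have "mtrace (- K) = - mtrace K" if "K \<in> carrier_mat d d" for K
      using that by (simp add: mtrace_def sum_negf)
    ultimately have 2: "mtrace (?M * D') = - (mtrace (?M * D * ?M * D) + (mtrace (?M * \<Gamma> * D) - mtrace (?M * D * \<Gamma>)))"
      using mtrace_add[OF c3(5) minus_carrier_mat[OF c3(4)]] mtrace_minus[OF c3(2,4)]
        add_carrier_mat[OF minus_carrier_mat[OF c3(4)], of "?M * D * ?M * D" "?M * \<Gamma> * D"] unfolding eq by simp
    \<comment> \<open>The two copies of \<open>?M * \<Gamma> * D\<close> cancel outright; this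
      cyclic permutation removes the remaining pair of connection terms.\<close>
    have "mtrace (\<Gamma> * ?M * D) = mtrace (?M * D * \<Gamma>)"
      using mtrace_comm[of \<Gamma> d "?M * D"] car C D by (simp add: assoc_mult_mat[of _ d d _ d _ d])
    then show ?thesis using 1 2 car D by (simp add: assoc_mult_mat[of _ d d _ d _ d])
  qed
  ultimately show "((\<lambda>s. mtrace (B1 s * minv (B s))) has_real_derivative
     mtrace (B2 * minv (B t)) - mtrace ((B1 t * minv (B t)) * (B1 t * minv (B t)))) (at t)"
    by (simp add: D_def)
qed

section \<open>Quotients of null hyperplanes\<close>

lemma mem_quot_class: "x \<in> quot_class v w \<longleftrightarrow> (\<exists>s. x = w + s *\<^sub>R v)"
  by (auto simp: quot_class_def)

lemma quot_class_eqI: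
  fixes w w' :: "real^'m"
  assumes "w = w' + s *\<^sub>R v" shows "quot_class v w = quot_class v w'"
proof (rule Set.set_eqI)
  fix x
  have "x = w + r *\<^sub>R v \<longleftrightarrow> x = w' + (s + r) *\<^sub>R v" for r
    unfolding assms by (simp add: scaleR_add_left add.assoc)
  then have "(\<exists>r. x = w + r *\<^sub>R v) \<longleftrightarrow> (\<exists>r. x = w' + (s + r) *\<^sub>R v)" by simp
  also have "\<dots> \<longleftrightarrow> (\<exists>r. x = w' + r *\<^sub>R v)"
  proof
    assume "\<exists>r. x = w' + r *\<^sub>R v"
    then obtain r where "x = w' + r *\<^sub>R v" ..
    then have "x = w' + (s + (r - s)) *\<^sub>R v" by simp
    then show "\<exists>r. x = w' + (s + r) *\<^sub>R v" ..
  qed blast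
  finally show "x \<in> quot_class v w \<longleftrightarrow> x \<in> quot_class v w'" by (simp add: mem_quot_class)
qed

lemma quot_class_self: "w \<in> quot_class v w"
  unfolding mem_quot_class by (rule exI[of _ 0]) simp

lemma quot_class_eq_iff: "quot_class v w = quot_class v w' \<longleftrightarrow> (\<exists>s. w = w' + s *\<^sub>R v)"
proof
  assume "quot_class v w = quot_class v w'"
  with quot_class_self[of w v] have "w \<in> quot_class v w'" by simp
  then show "\<exists>s. w = w' + s *\<^sub>R v" by (simp add: mem_quot_class)
next
  assume "\<exists>s. w = w' + s *\<^sub>R v"
  then obtain s where "w = w' + s *\<^sub>R v" ..
  then show "quot_class v w = quot_class v w'" by (rule quot_class_eqI)
qed

lemma quot_class_add: "quot_class v w + quot_class v w' = quot_class v (w + w')"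
proof (rule Set.set_eqI)
  fix x
  show "x \<in> quot_class v w + quot_class v w' \<longleftrightarrow> x \<in> quot_class v (w + w')"
  proof
    assume "x \<in> quot_class v w + quot_class v w'"
    then obtain s r where "x = (w + s *\<^sub>R v) + (w' + r *\<^sub>R v)"
      by (auto elim!: set_plus_elim simp: mem_quot_class)
    then have "x = w + w' + (s + r) *\<^sub>R v" by (simp add: scaleR_add_left)
    then show "x \<in> quot_class v (w + w')" unfolding mem_quot_class ..
  next
    assume "x \<in> quot_class v (w + w')"
    then obtain s where "x = w + w' + s *\<^sub>R v" unfolding mem_quot_class ..
    then have "x = (w + s *\<^sub>R v) + w'" by simp
    moreover have "w + s *\<^sub>R v \<in> quot_class v w" unfolding mem_quot_class by blast
    ultimately show "x \<in> quot_class v w + quot_class v w'"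
      using quot_class_self[of w' v] by (auto intro: set_plus_intro)
  qed
qed

lemma quot_class_sum_cong:
  assumes "\<And>j. j \<in> I \<Longrightarrow> quot_class v (x j) = quot_class v (y j)"
  shows "quot_class v (\<Sum>j\<in>I. a j *\<^sub>R x j) = quot_class v (\<Sum>j\<in>I. a j *\<^sub>R y j)"
proof -
  obtain s where s: "\<And>j. j \<in> I \<Longrightarrow> x j = y j + s j *\<^sub>R v"
    using assms unfolding quot_class_eq_iff by metis
  then have "(\<Sum>j\<in>I. a j *\<^sub>R x j) = (\<Sum>j\<in>I. a j *\<^sub>R y j + (a j * s j) *\<^sub>R v)"
    by (intro sum.cong refl) (simp add: scaleR_add_right)
  then show ?thesis
    unfolding quot_class_eq_iff by (auto simp: sum.distrib scaleR_sum_left[symmetric])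
qed

text \<open>Acts on coefficient functions on \<open>nat\<close>, the form in which
  \<open>quot_basis\<close> states its expansions.\<close>

definition mat_apply :: "nat \<Rightarrow> real mat \<Rightarrow> (nat \<Rightarrow> real) \<Rightarrow> nat \<Rightarrow> real" where
  "mat_apply d M a i = (\<Sum>j<d. M $$ (i, j) * a j)"

lemma mat_apply_mult:
  assumes "M \<in> carrier_mat d d" "K \<in> carrier_mat d d" "i < d"
  shows "mat_apply d (M * K) a i = mat_apply d M (mat_apply d K a) i"
proof -
  have "mat_apply d (M * K) a i = (\<Sum>j<d. \<Sum>k<d. M $$ (i, k) * K $$ (k, j) * a j)"
    using assms by (simp add: mat_apply_def scalar_prod_def atLeast0LessThan sum_distrib_right)
  also have "\<dots> = (\<Sum>k<d. \<Sum>j<d. M $$ (i, k) * (K $$ (k, j) * a j))"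
    by (subst sum.swap) (simp add: mult.assoc)
  finally show ?thesis by (simp add: mat_apply_def sum_distrib_left)
qed

lemma mat_apply_one: "i < d \<Longrightarrow> mat_apply d (1\<^sub>m d) a i = a i"
  by (simp add: mat_apply_def if_distrib[where f="\<lambda>c. c * _"] cong: if_cong)

lemma mat_apply_cong: "(\<And>j. j < d \<Longrightarrow> a j = a' j) \<Longrightarrow> mat_apply d M a = mat_apply d M a'"
  by (simp add: mat_apply_def fun_eq_iff)

lemma mat_apply_linear:
  "mat_apply d M (\<lambda>i. k * a i + a' i) = (\<lambda>i. k * mat_apply d M a i + mat_apply d M a' i)"
  by (simp add: mat_apply_def fun_eq_iff sum.distrib sum_distrib_left algebra_simps)

lemma null_perp_subspace: "subspace (null_perp A L p v)"
proof -
  have "gmetric A L p v v (x + y) = gmetric A L p v v x + gmetric A L p v v y"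
    "gmetric A L p v v (c *\<^sub>R x) = c * gmetric A L p v v x" for x y c
    unfolding gmetric_def by (simp_all add: sum.distrib sum_distrib_left algebra_simps)
  moreover have "gmetric A L p v v 0 = 0" by (simp add: gmetric_def)
  ultimately show ?thesis unfolding subspace_def null_perp_def by auto
qed

context
  fixes A :: "('a, 'm::finite) chart set" and L :: "'a \<Rightarrow> real^'m \<Rightarrow> real" and p :: 'a and v :: "real^'m"
begin

abbreviation (input) "NP \<equiv> null_perp A L p v"

abbreviation (input) "QS \<equiv> quot_space A L p v"

abbreviation (input) "cl \<equiv> quot_class v"

definition quot_comb :: "(nat \<Rightarrow> real^'m) \<Rightarrow> (nat \<Rightarrow> real) \<Rightarrow> (real^'m) set" where
  "quot_comb b a = cl (\<Sum>i<CARD('m) - 2. a i *\<^sub>R b i)"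

lemma quot_comb_cong: "(\<And>i. i < CARD('m) - 2 \<Longrightarrow> a i = a' i) \<Longrightarrow> quot_comb b a = quot_comb b a'"
  by (simp add: quot_comb_def)

lemma quot_basis_comb:
  assumes "quot_basis A L p v b"
  shows "quot_comb b a \<in> QS"
    and "q \<in> QS \<Longrightarrow> \<exists>a. q = quot_comb b a"
    and "quot_comb b a = quot_comb b a' \<Longrightarrow> i < CARD('m) - 2 \<Longrightarrow> a i = a' i"
proof -
  have "(\<Sum>i<CARD('m) - 2. a i *\<^sub>R b i) \<in> NP" for a
    using assms null_perp_subspace unfolding quot_basis_def by (intro subspace_sum subspace_scale) auto
  then show Q: "quot_comb b a \<in> QS" for a by (auto simp: quot_space_def quot_comb_def)
  show "q \<in> QS \<Longrightarrow> \<exists>a. q = quot_comb b a"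
    using assms unfolding quot_basis_def quot_comb_def by blast
  assume eq: "quot_comb b a = quot_comb b a'" and i: "i < CARD('m) - 2"
  \<comment> \<open>Uniqueness in \<open>quot_basis\<close> holds among extensional functions, so
    coefficients are first cut off outside the index range.\<close>
  let ?r = "\<lambda>a. restrict a {..<CARD('m) - 2}"
  have "quot_comb b (?r a) = quot_comb b a" "quot_comb b (?r a') = quot_comb b a'"
    by (auto intro!: quot_comb_cong)
  then have "?r a = ?r a'"
  proof -
    have "\<exists>!x. x \<in> extensional {..<CARD('m) - 2} \<and> quot_comb b a = quot_comb b x"
      using assms Q[of a] unfolding quot_basis_def quot_comb_def by blast
    moreover have "?r a \<in> extensional {..<CARD('m) - 2}" "?r a' \<in> extensional {..<CARD('m) - 2}" by auto
    moreover have "quot_comb b a = quot_comb b (?r a)" "quot_comb b a = quot_comb b (?r a')"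
      using eq \<open>quot_comb b (?r a) = _\<close> \<open>quot_comb b (?r a') = _\<close> by simp_all
    ultimately show ?thesis by blast
  qed
  then have "?r a i = ?r a' i" by simp
  then show "a i = a' i" using i by simp
qed

lemma quot_endo_comb:
  assumes E: "quot_endo A L p v E" and b: "\<And>i. i < CARD('m) - 2 \<Longrightarrow> b i \<in> NP"
    and M: "\<And>j. j < CARD('m) - 2 \<Longrightarrow> E (cl (b j)) = cl (\<Sum>i<CARD('m) - 2. M $$ (i, j) *\<^sub>R b i)"
  shows "E (quot_comb b a) = quot_comb b (mat_apply (CARD('m) - 2) M a)"
proof -
  define u where "u j = (\<Sum>i<CARD('m) - 2. M $$ (i, j) *\<^sub>R b i)" for j
  have u: "u j \<in> NP" for j
    unfolding u_def using b by (intro subspace_sum[OF null_perp_subspace] subspace_scale[OF null_perp_subspace]) auto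
  have lin: "E (cl (k *\<^sub>R w1 + w2)) = cl (k *\<^sub>R u1 + u2)"
    if "w1 \<in> NP" "w2 \<in> NP" "u1 \<in> NP" "u2 \<in> NP" "E (cl w1) = cl u1" "E (cl w2) = cl u2" for w1 w2 u1 u2 k
    using E that unfolding quot_endo_def by blast
  have 0: "0 \<in> NP" by (rule subspace_0[OF null_perp_subspace])
  then have "E (cl 0) \<in> QS" using E by (auto simp: quot_endo_def quot_space_def)
  then obtain u0 where "u0 \<in> NP" "E (cl 0) = cl u0" by (auto simp: quot_space_def)
  \<comment> \<open>\<open>quot_endo\<close> has no separate clause for zero; its linearity clause
    with factor -1 gives \<open>- u0 + u0\<close>.\<close>
  from lin[OF 0 0 this(1,1,2,2), of "-1"] have E0: "E (cl 0) = cl 0" by simp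
  have "E (cl (\<Sum>j<n. a j *\<^sub>R b j)) = cl (\<Sum>j<n. a j *\<^sub>R u j) \<and> (\<Sum>j<n. a j *\<^sub>R b j) \<in> NP \<and> (\<Sum>j<n. a j *\<^sub>R u j) \<in> NP"
    if "n \<le> (CARD('m) - 2)" for n
    using that
  proof (induction n)
    case 0
    then show ?case using E0 subspace_0[OF null_perp_subspace] by simp
  next
    case (Suc n)
    then have IH: "E (cl (\<Sum>j<n. a j *\<^sub>R b j)) = cl (\<Sum>j<n. a j *\<^sub>R u j)" "(\<Sum>j<n. a j *\<^sub>R b j) \<in> NP" "(\<Sum>j<n. a j *\<^sub>R u j) \<in> NP"
      and n: "n < CARD('m) - 2" by auto
    from lin[OF b[OF n] IH(2) u IH(3) _ IH(1), of n "a n"] M[OF n]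
    have "E (cl (a n *\<^sub>R b n + (\<Sum>j<n. a j *\<^sub>R b j))) = cl (a n *\<^sub>R u n + (\<Sum>j<n. a j *\<^sub>R u j))"
      by (simp add: u_def)
    then show ?case
      using IH(2,3) b[OF n] u subspace_add[OF null_perp_subspace[of A L p v]] subspace_scale[OF null_perp_subspace[of A L p v]]
      by (simp add: add.commute[of "sum _ _"])
  qed
  from this[of "CARD('m) - 2"] have "E (quot_comb b a) = cl (\<Sum>j<CARD('m) - 2. a j *\<^sub>R u j)" by (simp add: quot_comb_def)
  also have "(\<Sum>j<CARD('m) - 2. a j *\<^sub>R u j) = (\<Sum>i<CARD('m) - 2. mat_apply (CARD('m) - 2) M a i *\<^sub>R b i)"
    unfolding u_def mat_apply_def scaleR_sum_right scaleR_sum_left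
    by (subst sum.swap) (simp add: mult.commute)
  finally show ?thesis by (simp add: quot_comb_def)
qed

lemma quot_comb_basis_vector: "j < CARD('m) - 2 \<Longrightarrow> quot_comb b (\<lambda>i. if i = j then 1 else 0) = cl (b j)"
  by (simp add: quot_comb_def if_distrib[where f="\<lambda>c. c *\<^sub>R _"] cong: if_cong)

lemma mat_apply_basis_vector: "j < d \<Longrightarrow> mat_apply d M (\<lambda>i. if i = j then 1 else 0) i = M $$ (i, j)"
  by (simp add: mat_apply_def if_distrib[where f="\<lambda>c. _ * c"] cong: if_cong)

section \<open>Independence of trace and determinant from the chosen basis\<close>

lemma quot_basis_transition:
  assumes b: "quot_basis A L p v b" and b': "quot_basis A L p v b'"
  obtains T where "T \<in> carrier_mat (CARD('m) - 2) (CARD('m) - 2)" "\<And>a. quot_comb b a = quot_comb b' (mat_apply (CARD('m) - 2) T a)"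
proof -
  have "\<exists>t. cl (b j) = quot_comb b' t" if "j < CARD('m) - 2" for j
    using quot_basis_comb(2)[OF b', of "cl (b j)"] b that by (auto simp: quot_space_def quot_basis_def)
  then obtain t where t: "\<And>j. j < CARD('m) - 2 \<Longrightarrow> cl (b j) = quot_comb b' (t j)" by metis
  define T where "T = Matrix.mat (CARD('m) - 2) (CARD('m) - 2) (\<lambda>(i, j). t j i)"
  have T: "cl (b j) = cl (\<Sum>i<CARD('m) - 2. T $$ (i, j) *\<^sub>R b' i)" if "j < CARD('m) - 2" for j
    using t[OF that] that by (simp add: quot_comb_def T_def)
  have "quot_comb b a = quot_comb b' (mat_apply (CARD('m) - 2) T a)" for a
  proof -
    have "quot_comb b a = cl (\<Sum>j<CARD('m) - 2. a j *\<^sub>R (\<Sum>i<CARD('m) - 2. T $$ (i, j) *\<^sub>R b' i))"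
      unfolding quot_comb_def by (rule quot_class_sum_cong) (use T in auto)
    also have "(\<Sum>j<CARD('m) - 2. a j *\<^sub>R (\<Sum>i<CARD('m) - 2. T $$ (i, j) *\<^sub>R b' i)) = (\<Sum>i<CARD('m) - 2. mat_apply (CARD('m) - 2) T a i *\<^sub>R b' i)"
      unfolding mat_apply_def scaleR_sum_right scaleR_sum_left
      by (subst sum.swap) (simp add: mult.commute)
    finally show ?thesis by (simp add: quot_comb_def)
  qed
  then show ?thesis using that[of T] by (simp add: T_def)
qed

lemma quot_comb_endo_eq:
  assumes "quot_basis A L p v b" and "M \<in> carrier_mat (CARD('m) - 2) (CARD('m) - 2)" "K \<in> carrier_mat (CARD('m) - 2) (CARD('m) - 2)"
    and "\<And>a. quot_comb b (mat_apply (CARD('m) - 2) M a) = quot_comb b (mat_apply (CARD('m) - 2) K a)"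
  shows "M = K"
proof (rule eq_matI)
  fix i j assume "i < dim_row K" "j < dim_col K"
  then have ij: "i < CARD('m) - 2" "j < CARD('m) - 2" using assms(3) by auto
  have "mat_apply (CARD('m) - 2) M (\<lambda>i. if i = j then 1 else 0) i = mat_apply (CARD('m) - 2) K (\<lambda>i. if i = j then 1 else 0) i"
    by (rule quot_basis_comb(3)[OF assms(1) assms(4) ij(1)])
  then show "M $$ (i, j) = K $$ (i, j)" using ij by (simp add: mat_apply_basis_vector)
qed (use assms in auto)

lemma quot_basis_mem: "quot_basis A L p v b \<Longrightarrow> i < CARD('m) - 2 \<Longrightarrow> b i \<in> NP"
  by (simp add: quot_basis_def)

text \<open>\<open>quot_trace\<close> takes an arbitrary matrix in an arbitrary basis. The two
  transition matrices are inverse to each other and conjugate it to \<open>M\<close>, so the choice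
  is immaterial.\<close>

lemma quot_trace_eq:
  assumes E: "quot_endo A L p v E" and b: "quot_basis A L p v b" and M: "M \<in> carrier_mat (CARD('m) - 2) (CARD('m) - 2)"
    and EM: "\<And>j. j < CARD('m) - 2 \<Longrightarrow> E (cl (b j)) = cl (\<Sum>i<CARD('m) - 2. M $$ (i, j) *\<^sub>R b i)"
  shows "quot_trace A L p v E = mtrace M"
proof -
  define M' where "M' = (SOME B. is_quot_matrix A L p v E B)"
  have "is_quot_matrix A L p v E M" unfolding is_quot_matrix_def using b M EM by blast
  then have "is_quot_matrix A L p v E M'" unfolding M'_def by (rule someI)
  then obtain b' where M': "M' \<in> carrier_mat (CARD('m) - 2) (CARD('m) - 2)" and b': "quot_basis A L p v b'"
    and EM': "\<And>j. j < CARD('m) - 2 \<Longrightarrow> E (cl (b' j)) = cl (\<Sum>i<CARD('m) - 2. M' $$ (i, j) *\<^sub>R b' i)"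
    unfolding is_quot_matrix_def by blast
  obtain T where T: "T \<in> carrier_mat (CARD('m) - 2) (CARD('m) - 2)" "\<And>a. quot_comb b a = quot_comb b' (mat_apply (CARD('m) - 2) T a)"
    using quot_basis_transition[OF b b'] by blast
  obtain U where U: "U \<in> carrier_mat (CARD('m) - 2) (CARD('m) - 2)" "\<And>a. quot_comb b' a = quot_comb b (mat_apply (CARD('m) - 2) U a)"
    using quot_basis_transition[OF b' b] by blast
  note comp = quot_comb_cong[OF mat_apply_mult]
  have one: "quot_comb b (mat_apply (CARD('m) - 2) (1\<^sub>m (CARD('m) - 2)) a) = quot_comb b a" for b a
    by (rule quot_comb_cong) (rule mat_apply_one)
  have "U * T = 1\<^sub>m (CARD('m) - 2)"
    by (rule quot_comb_endo_eq[OF b mult_carrier_mat[OF U(1) T(1)] one_carrier_mat])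
      (simp add: comp[OF U(1) T(1)] one T(2)[symmetric] U(2)[symmetric])
  moreover have "T * U = 1\<^sub>m (CARD('m) - 2)"
    by (rule quot_comb_endo_eq[OF b' mult_carrier_mat[OF T(1) U(1)] one_carrier_mat])
      (simp add: comp[OF T(1) U(1)] one T(2)[symmetric] U(2)[symmetric])
  moreover have "T * M = M' * T"
  proof (rule quot_comb_endo_eq[OF b'])
    fix a
    have "quot_comb b' (mat_apply (CARD('m) - 2) (T * M) a) = quot_comb b (mat_apply (CARD('m) - 2) M a)"
      by (simp add: comp[OF T(1) M] T(2)[symmetric])
    also have "\<dots> = E (quot_comb b a)"
      using quot_endo_comb[where b=b and M=M, OF E quot_basis_mem[OF b] EM] by simp
    also have "\<dots> = E (quot_comb b' (mat_apply (CARD('m) - 2) T a))" by (simp add: T(2))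
    also have "\<dots> = quot_comb b' (mat_apply (CARD('m) - 2) M' (mat_apply (CARD('m) - 2) T a))"
      using quot_endo_comb[where b=b' and M=M', OF E quot_basis_mem[OF b'] EM'] by simp
    also have "\<dots> = quot_comb b' (mat_apply (CARD('m) - 2) (M' * T) a)"
      by (simp add: comp[OF M' T(1)])
    finally show "quot_comb b' (mat_apply (CARD('m) - 2) (T * M) a) = quot_comb b' (mat_apply (CARD('m) - 2) (M' * T) a)" .
  qed (use T M M' in auto)
  ultimately have "mtrace M = mtrace M'" using mtrace_similar[OF M M' T(1) U(1)] by blast
  then show ?thesis
    using M' by (simp add: quot_trace_def M'_def[symmetric] mtrace_def)
qed

lemma quot_endo_bij_iff:
  assumes E: "quot_endo A L p v E" and b: "quot_basis A L p v b" and M: "M \<in> carrier_mat (CARD('m) - 2) (CARD('m) - 2)"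
    and EM: "\<And>j. j < CARD('m) - 2 \<Longrightarrow> E (cl (b j)) = cl (\<Sum>i<CARD('m) - 2. M $$ (i, j) *\<^sub>R b i)"
  shows "bij_betw E QS QS \<longleftrightarrow> Determinant.det M \<noteq> 0"
proof
  have EM': "E (quot_comb b a) = quot_comb b (mat_apply (CARD('m) - 2) M a)" for a
    by (rule quot_endo_comb[OF E _ EM]) (rule quot_basis_mem[OF b])
  assume bij: "bij_betw E QS QS"
  show "Determinant.det M \<noteq> 0"
  proof
    assume "Determinant.det M = 0"
    then obtain x where x: "x \<in> carrier_vec (CARD('m) - 2)" "x \<noteq> 0\<^sub>v (CARD('m) - 2)" "M *\<^sub>v x = 0\<^sub>v (CARD('m) - 2)"
      using det_0_iff_vec_prod_zero[OF M] by blast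
    have "mat_apply (CARD('m) - 2) M (\<lambda>j. vec_index x j) i = 0" if "i < CARD('m) - 2" for i
    proof -
      have "mat_apply (CARD('m) - 2) M (\<lambda>j. vec_index x j) i = vec_index (M *\<^sub>v x) i"
        using M x(1) that by (simp add: mat_apply_def scalar_prod_def atLeast0LessThan)
      then show ?thesis using x(3) that by simp
    qed
    then have "E (quot_comb b (\<lambda>j. vec_index x j)) = quot_comb b (\<lambda>j. 0)"
      unfolding EM' by (rule quot_comb_cong)
    also have "\<dots> = E (quot_comb b (\<lambda>j. 0))" unfolding EM' by (rule quot_comb_cong) (simp add: mat_apply_def)
    finally have "quot_comb b (\<lambda>j. vec_index x j) = quot_comb b (\<lambda>j. 0)"
      using bij quot_basis_comb(1)[OF b] unfolding bij_betw_def inj_on_def by blast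
    then have "vec_index x i = 0" if "i < CARD('m) - 2" for i using quot_basis_comb(3)[OF b _ that] by blast
    then have "x = 0\<^sub>v (CARD('m) - 2)" using x(1) by (intro eq_vecI) auto
    with x(2) show False by simp
  qed
next
  have EM': "E (quot_comb b a) = quot_comb b (mat_apply (CARD('m) - 2) M a)" for a
    by (rule quot_endo_comb[OF E _ EM]) (rule quot_basis_mem[OF b])
  assume "Determinant.det M \<noteq> 0"
  note m = minv[OF M this]
  show "bij_betw E QS QS"
    unfolding bij_betw_def
  proof
    show "inj_on E QS"
    proof (rule inj_onI)
      fix q r assume "q \<in> QS" "r \<in> QS" and eq: "E q = E r"
      then obtain a a' where a: "q = quot_comb b a" "r = quot_comb b a'"
        using quot_basis_comb(2)[OF b] by metis
      have "mat_apply (CARD('m) - 2) M a i = mat_apply (CARD('m) - 2) M a' i" if "i < CARD('m) - 2" for i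
        using quot_basis_comb(3)[OF b _ that] eq unfolding a EM' by blast
      then have eq': "mat_apply (CARD('m) - 2) (minv M) (mat_apply (CARD('m) - 2) M a) = mat_apply (CARD('m) - 2) (minv M) (mat_apply (CARD('m) - 2) M a')"
        by (rule mat_apply_cong)
      have "mat_apply (CARD('m) - 2) (minv M) (mat_apply (CARD('m) - 2) M x) i = x i" if "i < CARD('m) - 2" for i x
        using mat_apply_mult[OF m(1) M that, of x] mat_apply_one[OF that, of x] by (simp add: m(3))
      then show "q = r" unfolding a using eq' by (intro quot_comb_cong) metis
    qed
    show "E ` QS = QS"
    proof
      show "E ` QS \<subseteq> QS" using E by (auto simp: quot_endo_def)
      show "QS \<subseteq> E ` QS"
      proof
        fix q assume "q \<in> QS"
        then obtain a where a: "q = quot_comb b a" using quot_basis_comb(2)[OF b] by metis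
        have "E (quot_comb b (mat_apply (CARD('m) - 2) (minv M) a)) = q"
          unfolding EM' a
        proof (rule quot_comb_cong)
          show "mat_apply (CARD('m) - 2) M (mat_apply (CARD('m) - 2) (minv M) a) i = a i" if "i < CARD('m) - 2" for i
            using mat_apply_mult[OF M m(1) that, of a] mat_apply_one[OF that, of a] by (simp add: m(2))
        qed
        then show "q \<in> E ` QS" using quot_basis_comb(1)[OF b] by blast
      qed
    qed
  qed
qed

lemma quot_endo_matrix_exists:
  assumes E: "quot_endo A L p v E" and b: "quot_basis A L p v b"
  obtains M where "M \<in> carrier_mat (CARD('m) - 2) (CARD('m) - 2)" "\<And>j. j < CARD('m) - 2 \<Longrightarrow> E (cl (b j)) = cl (\<Sum>i<CARD('m) - 2. M $$ (i, j) *\<^sub>R b i)"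
proof -
  have "\<exists>t. E (cl (b j)) = quot_comb b t" if "j < CARD('m) - 2" for j
    using quot_basis_comb(2)[OF b, of "E (cl (b j))"] quot_basis_mem[OF b that] E
    by (auto simp: quot_endo_def quot_space_def)
  then obtain t where t: "\<And>j. j < CARD('m) - 2 \<Longrightarrow> E (cl (b j)) = quot_comb b (t j)" by metis
  show ?thesis
    by (rule that[of "Matrix.mat (CARD('m) - 2) (CARD('m) - 2) (\<lambda>(i, j). t j i)"]) (simp_all add: t quot_comb_def)
qed

text \<open>A basis guarantees that some matrix of \<open>E\<close> exists, so the one selected
  inside \<open>quot_det\<close> is a genuine matrix of \<open>E\<close>, though possibly in another
  basis; bijectivity can be tested in that basis.\<close>

lemma quot_det_nonzero_bij:
  assumes E: "quot_endo A L p v E" and b: "quot_basis A L p v b" and "quot_det A L p v E \<noteq> 0"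
  shows "bij_betw E QS QS"
proof -
  obtain M where "M \<in> carrier_mat (CARD('m) - 2) (CARD('m) - 2)" "\<And>j. j < CARD('m) - 2 \<Longrightarrow> E (cl (b j)) = cl (\<Sum>i<CARD('m) - 2. M $$ (i, j) *\<^sub>R b i)"
    using quot_endo_matrix_exists[OF E b] by blast
  then have "is_quot_matrix A L p v E M" unfolding is_quot_matrix_def using b by blast
  then have "is_quot_matrix A L p v E (SOME B. is_quot_matrix A L p v E B)" by (rule someI)
  then obtain b' where "(SOME B. is_quot_matrix A L p v E B) \<in> carrier_mat (CARD('m) - 2) (CARD('m) - 2)" "quot_basis A L p v b'"
    "\<And>j. j < CARD('m) - 2 \<Longrightarrow> E (cl (b' j)) = cl (\<Sum>i<CARD('m) - 2. (SOME B. is_quot_matrix A L p v E B) $$ (i, j) *\<^sub>R b' i)"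
    unfolding is_quot_matrix_def by blast
  from quot_endo_bij_iff[OF E this(2,1,3)] assms(3) show ?thesis by (simp add: quot_det_def)
qed

text \<open>The second and third conclusions compute \<open>E1\<close> on explicit preimages under
  \<open>E\<close>; they give the matrix of the composite here and are used again to turn the
  Lagrange condition into symmetry.\<close>

lemma quot_trace_quotient:
  assumes E: "quot_endo A L p v E" "quot_endo A L p v E1" and b: "quot_basis A L p v b"
    and M: "M \<in> carrier_mat (CARD('m) - 2) (CARD('m) - 2)" "M1 \<in> carrier_mat (CARD('m) - 2) (CARD('m) - 2)"
    and EM: "\<And>j. j < CARD('m) - 2 \<Longrightarrow> E (cl (b j)) = cl (\<Sum>i<CARD('m) - 2. M $$ (i, j) *\<^sub>R b i)"
    and EM1: "\<And>j. j < CARD('m) - 2 \<Longrightarrow> E1 (cl (b j)) = cl (\<Sum>i<CARD('m) - 2. M1 $$ (i, j) *\<^sub>R b i)"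
    and bij: "bij_betw E QS QS"
  shows "quot_trace A L p v (E1 \<circ> inv_into QS E) = mtrace (M1 * minv M)"
    "quot_comb b a = E (quot_comb b (mat_apply (CARD('m) - 2) (minv M) a))"
    "E1 (quot_comb b (mat_apply (CARD('m) - 2) (minv M) a)) = quot_comb b (mat_apply (CARD('m) - 2) (M1 * minv M) a)"
proof -
  have det: "Determinant.det M \<noteq> 0" using quot_endo_bij_iff[OF E(1) b M(1) EM] bij by blast
  note m = minv[OF M(1) det]
  have car: "M1 * minv M \<in> carrier_mat (CARD('m) - 2) (CARD('m) - 2)" using M(2) m(1) by simp
  have C: "E (quot_comb b a) = quot_comb b (mat_apply (CARD('m) - 2) M a)" for a
    by (rule quot_endo_comb[OF E(1) _ EM]) (rule quot_basis_mem[OF b])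
  have C1: "E1 (quot_comb b a) = quot_comb b (mat_apply (CARD('m) - 2) M1 a)" for a
    by (rule quot_endo_comb[OF E(2) _ EM1]) (rule quot_basis_mem[OF b])
  show surj: "quot_comb b a = E (quot_comb b (mat_apply (CARD('m) - 2) (minv M) a))" for a
    unfolding C
  proof (rule quot_comb_cong)
    show "a i = mat_apply (CARD('m) - 2) M (mat_apply (CARD('m) - 2) (minv M) a) i" if "i < CARD('m) - 2" for i
      using mat_apply_mult[OF M(1) m(1) that, of a] mat_apply_one[OF that, of a] by (simp add: m(2))
  qed
  show E1: "E1 (quot_comb b (mat_apply (CARD('m) - 2) (minv M) a)) = quot_comb b (mat_apply (CARD('m) - 2) (M1 * minv M) a)" for a
    unfolding C1 by (rule quot_comb_cong) (simp add: mat_apply_mult[OF M(2) m(1)])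
  have inv: "inv_into QS E (quot_comb b a) = quot_comb b (mat_apply (CARD('m) - 2) (minv M) a)" for a
    using bij quot_basis_comb(1)[OF b] surj[of a] by (metis bij_betw_def inv_into_f_f)
  let ?F = "E1 \<circ> inv_into QS E"
  have F: "?F (quot_comb b a) = quot_comb b (mat_apply (CARD('m) - 2) (M1 * minv M) a)" for a
    by (simp add: inv E1)
  show "quot_trace A L p v ?F = mtrace (M1 * minv M)"
  proof (rule quot_trace_eq[OF _ b car])
    show "?F (cl (b j)) = cl (\<Sum>i<CARD('m) - 2. (M1 * minv M) $$ (i, j) *\<^sub>R b i)" if "j < CARD('m) - 2" for j
      using F[of "\<lambda>i. if i = j then 1 else 0"] that
      by (simp add: quot_comb_basis_vector[OF that] mat_apply_basis_vector[OF that] quot_comb_def del: index_mult_mat o_apply)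
    show "quot_endo A L p v ?F"
      unfolding quot_endo_def
    proof (intro conjI ballI allI impI)
      fix q assume "q \<in> QS"
      then show "?F q \<in> QS" using F quot_basis_comb[OF b] by metis
    next
      fix w1 w2 u1 u2 and k :: real
      assume w: "w1 \<in> NP" "w2 \<in> NP" "u1 \<in> NP" "u2 \<in> NP"
        and eq: "?F (cl w1) = cl u1 \<and> ?F (cl w2) = cl u2"
      have "cl w1 \<in> QS" "cl w2 \<in> QS" "cl u1 \<in> QS" "cl u2 \<in> QS" using w by (auto simp: quot_space_def)
      then obtain a1 a2 where a: "cl w1 = quot_comb b a1" "cl w2 = quot_comb b a2"
        using quot_basis_comb(2)[OF b] by metis
      have lin: "cl (k *\<^sub>R x1 + x2) = quot_comb b (\<lambda>i. k * c1 i + c2 i)"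
        if x: "cl x1 = quot_comb b c1" "cl x2 = quot_comb b c2" for x1 x2 c1 c2
      proof -
        obtain s1 where "x1 = (\<Sum>i<CARD('m) - 2. c1 i *\<^sub>R b i) + s1 *\<^sub>R v"
          using x(1) unfolding quot_comb_def quot_class_eq_iff ..
        moreover obtain s2 where "x2 = (\<Sum>i<CARD('m) - 2. c2 i *\<^sub>R b i) + s2 *\<^sub>R v"
          using x(2) unfolding quot_comb_def quot_class_eq_iff ..
        ultimately have "k *\<^sub>R x1 + x2 = (\<Sum>i<CARD('m) - 2. (k * c1 i + c2 i) *\<^sub>R b i) + (k * s1 + s2) *\<^sub>R v"
          by (simp add: scaleR_add_left scaleR_add_right sum.distrib scaleR_sum_right)
        then show ?thesis unfolding quot_comb_def by (rule quot_class_eqI)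
      qed
      have "cl u1 = quot_comb b (mat_apply (CARD('m) - 2) (M1 * minv M) a1)" "cl u2 = quot_comb b (mat_apply (CARD('m) - 2) (M1 * minv M) a2)"
        using eq unfolding a F by auto
      from lin[OF this] have "cl (k *\<^sub>R u1 + u2) =
          quot_comb b (mat_apply (CARD('m) - 2) (M1 * minv M) (\<lambda>i. k * a1 i + a2 i))"
        by (simp only: mat_apply_linear)
      then show "?F (cl (k *\<^sub>R w1 + w2)) = cl (k *\<^sub>R u1 + u2)"
        unfolding lin[OF a] F by simp
    qed
  qed
qed

end

section \<open>Geodesics in charts\<close>

locale causal_geod =
  fixes A :: "('a::topological_space, 'm::finite) chart set" and L :: "'a \<Rightarrow> real^'m \<Rightarrow> real"
    and X :: "'a \<Rightarrow> real^'m" and I :: "real set" and \<eta> :: "real \<Rightarrow> 'a"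
  assumes atlas: "smooth_atlas A" and lf: "lorentz_finsler A L"
    and open_I: "open I" and geod: "causal_geodesic A L X I \<eta>"
begin

definition chart_times :: "('a, 'm) chart \<Rightarrow> real set" where
  "chart_times c = {s \<in> I. \<eta> s \<in> fst c}"

abbreviation coord_velocity :: "('a, 'm) chart \<Rightarrow> real \<Rightarrow> real^'m" where
  "coord_velocity c s \<equiv> vector_derivative (snd c \<circ> \<eta>) (at s)"

lemma cont_\<eta>: "continuous_on I \<eta>" "s \<in> I \<Longrightarrow> isCont \<eta> s"
  using geod open_I by (auto simp: causal_geodesic_def smooth_curve_def continuous_on_eq_continuous_at)

lemma causal_velocity_nonzero:
  assumes "s \<in> I" shows "velocity A \<eta> s \<noteq> 0"
proof -
  have "\<forall>p v k. 0 < k \<longrightarrow> L p (k *\<^sub>R v) = k\<^sup>2 * L p v"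
    using lf by (simp add: lorentz_finsler_def)
  \<comment> \<open>Factor 2 gives \<open>L 0 = 4 * L 0\<close>, so the zero vector is not timelike,
    and it is not lightlike by definition.\<close>
  from this[rule_format, of 2 "\<eta> s" 0] have "L (\<eta> s) 0 = 0" by simp
  moreover have "causal L (\<eta> s) (velocity A \<eta> s)"
    using geod assms by (auto simp: causal_geodesic_def future_causal_def)
  ultimately show ?thesis by (auto simp: causal_def timelike_def lightlike_def)
qed

context
  fixes c assumes c: "c \<in> A"
begin

lemma open_chart_times: "open (chart_times c)"
proof -
  have "chart_times c = I \<inter> \<eta> -` fst c" by (auto simp: chart_times_def)
  then show ?thesis
    using continuous_open_preimage[OF cont_\<eta>(1) open_I chart_dom_open[OF atlas c]] by simp
qed

lemma smooth_position: "smooth_on (chart_times c) (snd c \<circ> \<eta>)"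
  using geod c by (auto simp: causal_geodesic_def smooth_curve_def chart_times_def)

lemma smooth_coord_velocity: "smooth_on (chart_times c) (coord_velocity c)"
  by (rule smooth_on_vector_derivative[OF open_chart_times smooth_position])

lemma smooth_velocity_coords: "smooth_on (chart_times c) (velocity_coords c \<eta>)"
  using smooth_on_Pair[OF open_chart_times smooth_position smooth_coord_velocity]
  by (simp add: velocity_coords_def[abs_def] o_def)

context
  fixes s assumes s: "s \<in> chart_times c"
begin

lemma chart_times_mem: "s \<in> I" "\<eta> s \<in> fst c"
  using s by (auto simp: chart_times_def)

lemma position_derivative: "((snd c \<circ> \<eta>) has_vector_derivative coord_velocity c s) (at s)"
  by (rule smooth_on_has_vector_derivative[OF smooth_position s])

lemma velocity_eq: "velocity A \<eta> s = of_chart A c (snd c (\<eta> s)) (coord_velocity c s)"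
  and to_chart_velocity: "to_chart A c (\<eta> s) (velocity A \<eta> s) = coord_velocity c s"
  using velocity_chart[OF atlas c, of \<eta> s] chart_times_mem cont_\<eta>(2) smooth_on_differentiable[OF smooth_position s]
  by auto

lemma coord_velocity_nonzero: "coord_velocity c s \<noteq> 0"
  using causal_velocity_nonzero[OF chart_times_mem(1)] of_chart_eq_0_iff[OF atlas c chart_times_mem(2)] velocity_eq
  by metis

lemma velocity_coords_slit: "velocity_coords c \<eta> s \<in> chart_slit c"
  using coord_velocity_nonzero chart_times_mem(2) by (auto simp: chart_slit_def velocity_coords_def)

lemma acceleration:
  "(coord_velocity c has_vector_derivative (\<chi> \<alpha>. - 2 * spray (local_expr A c L) \<alpha> (velocity_coords c \<eta> s))) (at s)"
proof -
  have "vector_derivative (coord_velocity c) (at s) $ \<alpha> + 2 * spray (local_expr A c L) \<alpha> (velocity_coords c \<eta> s) = 0" for \<alpha>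
    using geod c chart_times_mem unfolding causal_geodesic_def by blast
  then have "vector_derivative (coord_velocity c) (at s) = (\<chi> \<alpha>. - 2 * spray (local_expr A c L) \<alpha> (velocity_coords c \<eta> s))"
    by (simp add: vec_eq_iff eq_neg_iff_add_eq_0)
  then show ?thesis
    using smooth_on_has_vector_derivative[OF smooth_coord_velocity s] by simp
qed

lemma velocity_coords_derivative:
  "(velocity_coords c \<eta> has_vector_derivative
     (coord_velocity c s, \<chi> \<alpha>. - 2 * spray (local_expr A c L) \<alpha> (velocity_coords c \<eta> s))) (at s)"
  using has_vector_derivative_Pair[OF position_derivative acceleration]
  by (simp add: velocity_coords_def[abs_def] o_def)

text \<open>The curve of position and velocity is an integral curve of the spray, so the chain rule
  leads to the left side of \<open>euler_lagrange\<close>.\<close>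

lemma momentum_derivative:
  "((\<lambda>s. dv \<gamma> (local_expr A c L) (velocity_coords c \<eta> s)) has_real_derivative
     dx \<gamma> (local_expr A c L) (velocity_coords c \<eta> s)) (at s)"
proof -
  interpret finsler_chart "local_expr A c L" "chart_slit c" by (rule finsler_chart_local[OF atlas lf c])
  let ?F = "local_expr A c L" and ?z = "velocity_coords c \<eta>"
  note z = velocity_coords_slit
  have "DERIV (\<lambda>s. dv \<gamma> ?F (?z s)) s :> frechet_derivative (dv \<gamma> ?F) (at (?z s))
      (coord_velocity c s, \<chi> \<alpha>. - 2 * spray ?F \<alpha> (?z s))"
    by (rule DERIV_along[where p="velocity_coords c \<eta>" and t=s, OF smooth_on_has_derivative[OF smooth_dv[OF smooth_F] z]])
      (use velocity_coords_derivative in \<open>simp add: has_vector_derivative_def\<close>)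
  also have "frechet_derivative (dv \<gamma> ?F) (at (?z s)) (coord_velocity c s, \<chi> \<alpha>. - 2 * spray ?F \<alpha> (?z s)) = dx \<gamma> ?F (?z s)"
    using euler_lagrange[OF z, of \<gamma>] unfolding frechet_derivative_expand[OF diff_dv_F[OF z]]
    by (simp add: velocity_coords_def sum_distrib_left sum_negf mult.assoc)
  finally show ?thesis .
qed

end

end

end

section \<open>Null geodesics and moving frames\<close>

locale null_geod = causal_geod A L X I \<eta>
  for A :: "('a::topological_space, 'm::finite) chart set" and L X I \<eta> +
  assumes null: "t \<in> I \<Longrightarrow> L (\<eta> t) (velocity A \<eta> t) = 0"
begin

text \<open>The covector that the metric assigns to the velocity. It turns membership in the null
  hyperplanes into vanishing of a Euclidean inner product that depends smoothly on
  \<open>s\<close>.\<close>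

definition momentum :: "('a, 'm) chart \<Rightarrow> real \<Rightarrow> real^'m" where
  "momentum c s = (\<chi> \<alpha>. dv \<alpha> (local_expr A c L) (velocity_coords c \<eta> s))"

text \<open>The zeroth order part of the covariant derivative along \<open>\<eta>\<close> in the
  chart \<open>c\<close>.\<close>

definition conn :: "('a, 'm) chart \<Rightarrow> real \<Rightarrow> real^'m \<Rightarrow> real^'m" where
  "conn c s w = (\<chi> \<alpha>. \<Sum>\<beta>\<in>UNIV. \<Sum>\<gamma>\<in>UNIV.
     Gamma (local_expr A c L) \<alpha> \<beta> \<gamma> (velocity_coords c \<eta> s) * coord_velocity c s $ \<beta> * w $ \<gamma>)"

lemma conn_linear: "linear (conn c s)"
  by (rule linearI)
    (simp_all add: conn_def vec_eq_iff sum.distrib sum_distrib_left algebra_simps)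

context
  fixes c assumes c: "c \<in> A"
begin

interpretation finsler_chart "local_expr A c L" "chart_slit c" by (rule finsler_chart_local[OF atlas lf c])

lemma momentum_smooth: "smooth_on (chart_times c) (momentum c)"
proof (rule smooth_on_vec_lambda[OF open_chart_times[OF c]])
  show "smooth_on (chart_times c) (\<lambda>s. momentum c s $ \<alpha>)" for \<alpha>
    using smooth_on_compose[OF open_chart_times[OF c] open_S _ smooth_velocity_coords[OF c] smooth_dv[OF smooth_F]]
      velocity_coords_slit[OF c] by (auto simp: momentum_def)
qed

context
  fixes s assumes s: "s \<in> chart_times c"
begin

lemma momentum_velocity: "momentum c s \<bullet> coord_velocity c s = 0"
proof -
  let ?z = "velocity_coords c \<eta> s"
  have "momentum c s \<bullet> coord_velocity c s = 2 * local_expr A c L ?z"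
    using euler_F[OF velocity_coords_slit[OF c s]]
    by (simp add: inner_vec_def momentum_def velocity_coords_def mult.commute)
  also have "local_expr A c L ?z = L (\<eta> s) (velocity A \<eta> s)"
    unfolding velocity_coords_def velocity_eq[OF c s] by (rule local_expr_snd[OF atlas c chart_times_mem(2)[OF c s]])
  finally show ?thesis using null[OF chart_times_mem(1)[OF c s]] by (simp only: mult_zero_right)
qed

lemma null_perp_momentum:
  "of_chart A c (snd c (\<eta> s)) w \<in> null_perp A L (\<eta> s) (velocity A \<eta> s) \<longleftrightarrow> momentum c s \<bullet> w = 0"
  unfolding velocity_eq[OF c s]
    null_perp_chart[OF atlas lf c chart_times_mem(2)[OF c s] coord_velocity_nonzero[OF c s]]
  by (simp add: momentum_def inner_vec_def velocity_coords_def)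

lemma momentum_conn: "momentum c s \<bullet> conn c s w = (\<Sum>\<gamma>\<in>UNIV. dx \<gamma> (local_expr A c L) (velocity_coords c \<eta> s) * w $ \<gamma>)"
proof -
  let ?z = "velocity_coords c \<eta> s"
  let ?G = "\<lambda>\<alpha> \<beta> \<gamma>. Gamma (local_expr A c L) \<alpha> \<beta> \<gamma> ?z" and ?u = "coord_velocity c s"
  have "momentum c s \<bullet> conn c s w = (\<Sum>\<alpha>\<in>UNIV. dv \<alpha> (local_expr A c L) ?z * (\<Sum>\<gamma>\<in>UNIV. (\<Sum>\<beta>\<in>UNIV. ?G \<alpha> \<beta> \<gamma> * ?u $ \<beta>) * w $ \<gamma>))"
  proof -
    have "conn c s w $ \<alpha> = (\<Sum>\<gamma>\<in>UNIV. (\<Sum>\<beta>\<in>UNIV. ?G \<alpha> \<beta> \<gamma> * ?u $ \<beta>) * w $ \<gamma>)" for \<alpha>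
      unfolding conn_def vec_lambda_beta by (subst sum.swap) (simp add: sum_distrib_right)
    then show ?thesis by (simp add: inner_vec_def momentum_def)
  qed
  also have "\<dots> = (\<Sum>\<gamma>\<in>UNIV. (\<Sum>\<alpha>\<in>UNIV. dv \<alpha> (local_expr A c L) ?z * (\<Sum>\<beta>\<in>UNIV. ?G \<alpha> \<beta> \<gamma> * ?u $ \<beta>)) * w $ \<gamma>)"
  proof -
    have "(\<Sum>\<alpha>\<in>UNIV. a \<alpha> * (\<Sum>\<gamma>\<in>UNIV. h \<alpha> \<gamma> * w $ \<gamma>)) = (\<Sum>\<gamma>\<in>UNIV. (\<Sum>\<alpha>\<in>UNIV. a \<alpha> * h \<alpha> \<gamma>) * w $ \<gamma>)"
      for a :: "'m \<Rightarrow> real" and h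
      unfolding sum_distrib_left sum_distrib_right by (subst sum.swap) (simp add: mult.assoc)
    then show ?thesis .
  qed
  also have "\<dots> = (\<Sum>\<gamma>\<in>UNIV. dx \<gamma> (local_expr A c L) ?z * w $ \<gamma>)"
    using dv_F_Gamma_snd[OF velocity_coords_slit[OF c s]] by (simp add: velocity_coords_def)
  finally show ?thesis .
qed

lemma conn_velocity: "(coord_velocity c has_vector_derivative - conn c s (coord_velocity c s)) (at s)"
proof -
  have "- conn c s (coord_velocity c s) = (\<chi> \<alpha>. - 2 * spray (local_expr A c L) \<alpha> (velocity_coords c \<eta> s))"
    using Gamma_snd_snd[OF velocity_coords_slit[OF c s]] by (simp add: vec_eq_iff conn_def velocity_coords_def)
  then show ?thesis using acceleration[OF c s] by simp
qed

text \<open>The momentum is parallel: its own derivative supplies exactly the \<open>conn\<close>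
  term. Consequently covariant differentiation preserves fields lying in the null
  hyperplanes.\<close>

lemma momentum_has_derivative:
  assumes "(w has_vector_derivative w') (at s)"
  shows "((\<lambda>s. momentum c s \<bullet> w s) has_real_derivative momentum c s \<bullet> (w' + conn c s (w s))) (at s)"
proof -
  have "((\<lambda>s. w s $ \<alpha>) has_real_derivative w' $ \<alpha>) (at s)" for \<alpha>
    using bounded_linear.has_vector_derivative[OF bounded_linear_vec_nth assms]
    by (simp add: has_real_derivative_iff_has_vector_derivative)
  then have "((\<lambda>s. \<Sum>\<alpha>\<in>UNIV. momentum c s $ \<alpha> * w s $ \<alpha>) has_real_derivative
      (\<Sum>\<alpha>\<in>UNIV. dx \<alpha> (local_expr A c L) (velocity_coords c \<eta> s) * w s $ \<alpha> + w' $ \<alpha> * momentum c s $ \<alpha>)) (at s)"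
    unfolding momentum_def vec_lambda_beta
    by (intro DERIV_sum DERIV_mult momentum_derivative[OF c s])
  moreover have "(\<Sum>\<alpha>\<in>UNIV. dx \<alpha> (local_expr A c L) (velocity_coords c \<eta> s) * w s $ \<alpha> + w' $ \<alpha> * momentum c s $ \<alpha>) =
      momentum c s \<bullet> (w' + conn c s (w s))"
    by (simp add: inner_add_right momentum_conn sum.distrib) (simp add: inner_vec_def mult.commute)
  ultimately show ?thesis by (simp add: inner_vec_def)
qed

end

end

end

lemma (in causal_geod) cov_deriv_chart:
  assumes "c \<in> A" "s \<in> chart_times c"
  shows "cov_deriv A L c \<eta> Y s = of_chart A c (snd c (\<eta> s))
    (vector_derivative (\<lambda>s. to_chart A c (\<eta> s) (Y s)) (at s) +
     (\<chi> \<alpha>. \<Sum>\<beta>\<in>UNIV. \<Sum>\<gamma>\<in>UNIV. Gamma (local_expr A c L) \<alpha> \<beta> \<gamma> (velocity_coords c \<eta> s) *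
        coord_velocity c s $ \<beta> * to_chart A c (\<eta> s) (Y s) $ \<gamma>))"
  by (simp add: cov_deriv_def Let_def velocity_coords_def)

text \<open>The frame belongs to the single instant \<open>t\<close>; its vectors are kept constant
  in the coordinates of the chart preferred at \<open>\<eta> t\<close>. The interval is taken so
  short that \<open>z0\<close> stays transversal to the null hyperplanes and \<open>fv\<close> does
  not vanish on the velocity.\<close>

locale null_geod_frame = null_geod A L X I \<eta>
  for A :: "('a::topological_space, 'm::finite) chart set" and L X I \<eta> +
  fixes t :: real and e :: "nat \<Rightarrow> real^'m" and z0 :: "real^'m" and f :: "nat \<Rightarrow> real^'m"
    and fv fz :: "real^'m" and r r' :: real
  assumes frame: "null_frame (coord_velocity (pref_chart A (\<eta> t)) t) e z0 f fv fz"
    and orth: "\<And>i. i < CARD('m) - 2 \<Longrightarrow> momentum (pref_chart A (\<eta> t)) t \<bullet> e i = 0"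
    and t_mem: "t \<in> {r<..<r'}"
    and K_sub: "{r<..<r'} \<subseteq> chart_times (pref_chart A (\<eta> t))"
    and z0_transv: "\<And>s. s \<in> {r<..<r'} \<Longrightarrow> momentum (pref_chart A (\<eta> t)) s \<bullet> z0 \<noteq> 0"
    and fv_transv: "\<And>s. s \<in> {r<..<r'} \<Longrightarrow> fv \<bullet> coord_velocity (pref_chart A (\<eta> t)) s \<noteq> 0"
begin

abbreviation "c \<equiv> pref_chart A (\<eta> t)"

abbreviation "u \<equiv> coord_velocity c"

abbreviation "lam \<equiv> momentum c"

abbreviation "K \<equiv> {r<..<r'}"

abbreviation "Oc s \<equiv> of_chart A c (snd c (\<eta> s))"

abbreviation "vel s \<equiv> velocity A \<eta> s"

lemma c_mem: "c \<in> A" "\<eta> t \<in> fst c"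
  using pref_chart[OF atlas] .

lemma K_times: "s \<in> K \<Longrightarrow> s \<in> chart_times c"
  using K_sub by blast

lemma K_fst: "s \<in> K \<Longrightarrow> s \<in> I" "s \<in> K \<Longrightarrow> \<eta> s \<in> fst c"
  using chart_times_mem[OF c_mem(1) K_times] by auto

lemma Oc_t: "Oc t w = w"
  by (rule of_chart_pref[OF atlas])

lemma vel_eq: "s \<in> K \<Longrightarrow> vel s = Oc s (u s)"
  by (rule velocity_eq[OF c_mem(1) K_times])

lemma vel_t: "vel t = u t"
  using vel_eq[OF t_mem] Oc_t by simp

lemma Oc_linear: "s \<in> K \<Longrightarrow> linear (Oc s)"
  by (rule linear_of_chart[OF atlas c_mem(1) K_fst(2)])

lemma to_chart_Oc: "s \<in> K \<Longrightarrow> to_chart A c (\<eta> s) (Oc s x) = x"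
  by (rule to_of_chart[OF atlas c_mem(1) K_fst(2)])

lemma Oc_inj:
  assumes s: "s \<in> K" and eq: "Oc s x = Oc s y" shows "x = y"
proof -
  have "to_chart A c (\<eta> s) (Oc s x) = to_chart A c (\<eta> s) (Oc s y)" by (simp only: eq)
  then show ?thesis by (simp only: to_chart_Oc[OF s])
qed

lemma class_Oc_iff:
  assumes s: "s \<in> K"
  shows "quot_class (vel s) (Oc s x) = quot_class (vel s) (Oc s y) \<longleftrightarrow> (\<exists>k. x = y + k *\<^sub>R u s)"
proof -
  have "Oc s y + k *\<^sub>R vel s = Oc s (y + k *\<^sub>R u s)" for k
    unfolding vel_eq[OF s] by (simp only: linear_add[OF Oc_linear[OF s]] linear_cmul[OF Oc_linear[OF s]])
  then show ?thesis
    unfolding quot_class_eq_iff using Oc_inj[OF s, of x] by auto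
qed

lemma frame_dual:
  "i < CARD('m) - 2 \<Longrightarrow> j < CARD('m) - 2 \<Longrightarrow> f i \<bullet> e j = (if i = j then 1 else 0)"
  "i < CARD('m) - 2 \<Longrightarrow> f i \<bullet> u t = 0" "i < CARD('m) - 2 \<Longrightarrow> f i \<bullet> z0 = 0" "i < CARD('m) - 2 \<Longrightarrow> fv \<bullet> e i = 0" "i < CARD('m) - 2 \<Longrightarrow> fz \<bullet> e i = 0"
  "fv \<bullet> u t = 1" "fv \<bullet> z0 = 0" "fz \<bullet> u t = 0" "fz \<bullet> z0 = 1"
  using frame by (auto simp: null_frame_def)

lemma frame_expansion: "w = (\<Sum>i<CARD('m) - 2. (f i \<bullet> w) *\<^sub>R e i) + (fv \<bullet> w) *\<^sub>R u t + (fz \<bullet> w) *\<^sub>R z0"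
  using frame unfolding null_frame_def by blast

text \<open>The constant vectors \<open>e i\<close> are projected along \<open>z0\<close> into the moving null hyperplanes.\<close>

definition W :: "nat \<Rightarrow> real \<Rightarrow> real^'m" where
  "W i s = e i - ((lam s \<bullet> e i) / (lam s \<bullet> z0)) *\<^sub>R z0"

text \<open>Coordinates modulo the velocity. Since \<open>fv\<close> kills every
  \<open>W i s\<close>, the quotient \<open>(fv \<bullet> w) / (fv \<bullet> u s)\<close> is the
  multiple of \<open>u s\<close> in \<open>w\<close>; it is removed before \<open>f i\<close> is
  applied.\<close>

definition coef :: "nat \<Rightarrow> real \<Rightarrow> real^'m \<Rightarrow> real" where
  "coef i s w = f i \<bullet> w - (fv \<bullet> w) / (fv \<bullet> u s) * (f i \<bullet> u s)"

lemma W_t: "i < CARD('m) - 2 \<Longrightarrow> W i t = e i"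
  by (simp add: W_def orth)

lemma lam_W: "s \<in> K \<Longrightarrow> lam s \<bullet> W i s = 0"
  using z0_transv by (simp add: W_def inner_diff_right)

lemma lam_u: "s \<in> K \<Longrightarrow> lam s \<bullet> u s = 0"
  by (rule momentum_velocity[OF c_mem(1) K_times])

lemma f_W: "i < CARD('m) - 2 \<Longrightarrow> j < CARD('m) - 2 \<Longrightarrow> f i \<bullet> W j s = (if i = j then 1 else 0)"
  and fv_W: "j < CARD('m) - 2 \<Longrightarrow> fv \<bullet> W j s = 0"
  using frame_dual by (simp_all add: W_def inner_diff_right)

lemma coef_comb:
  assumes "s \<in> K" "w = (\<Sum>j<CARD('m) - 2. a j *\<^sub>R W j s) + k *\<^sub>R u s" "i < CARD('m) - 2"
  shows "coef i s w = a i"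
proof -
  have "f i \<bullet> (\<Sum>j<CARD('m) - 2. a j *\<^sub>R W j s) = (\<Sum>j<CARD('m) - 2. if j = i then a j else 0)"
    unfolding inner_sum_right by (rule sum.cong) (use f_W assms(3) in auto)
  then have "f i \<bullet> w = a i + k * (f i \<bullet> u s)"
    using assms(3) by (simp add: assms(2) inner_add_right)
  moreover have "fv \<bullet> w = k * (fv \<bullet> u s)"
    unfolding assms(2) inner_add_right inner_sum_right by (simp add: fv_W)
  ultimately show ?thesis
    using fv_transv[OF assms(1)] by (simp add: coef_def)
qed

text \<open>The remainder is annihilated by all \<open>f i\<close> and by \<open>fv\<close>, so it
  is a multiple of \<open>z0\<close>. It is also annihilated by the momentum, which is nonzero on
  \<open>z0\<close>.\<close>

lemma moving_expansion:
  assumes s: "s \<in> K" and w: "lam s \<bullet> w = 0"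
  shows "w = (\<Sum>i<CARD('m) - 2. coef i s w *\<^sub>R W i s) + ((fv \<bullet> w) / (fv \<bullet> u s)) *\<^sub>R u s"
proof -
  define x where "x = w - (\<Sum>i<CARD('m) - 2. coef i s w *\<^sub>R W i s) - ((fv \<bullet> w) / (fv \<bullet> u s)) *\<^sub>R u s"
  have "f i \<bullet> x = 0" if "i < CARD('m) - 2" for i
  proof -
    have "f i \<bullet> (\<Sum>j<CARD('m) - 2. coef j s w *\<^sub>R W j s) = (\<Sum>j<CARD('m) - 2. if j = i then coef j s w else 0)"
      unfolding inner_sum_right by (rule sum.cong) (use f_W that in auto)
    then show ?thesis using that by (simp add: x_def inner_diff_right coef_def)
  qed
  moreover have "fv \<bullet> x = 0"
    using fv_transv[OF s] by (simp add: x_def inner_diff_right inner_sum_right fv_W)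
  ultimately have "x = (fz \<bullet> x) *\<^sub>R z0" using frame_expansion[of x] by simp
  moreover have "lam s \<bullet> x = 0"
    using w lam_W[OF s] lam_u[OF s] by (simp add: x_def inner_diff_right inner_sum_right)
  ultimately have "(fz \<bullet> x) * (lam s \<bullet> z0) = 0" using inner_scaleR_right[of "lam s" "fz \<bullet> x" z0] by simp
  then have "x = 0" using z0_transv[OF s] \<open>x = (fz \<bullet> x) *\<^sub>R z0\<close> by simp
  then show ?thesis by (simp add: x_def algebra_simps)
qed

lemma null_perp_Oc: "s \<in> K \<Longrightarrow> Oc s w \<in> null_perp A L (\<eta> s) (vel s) \<longleftrightarrow> lam s \<bullet> w = 0"
  by (rule null_perp_momentum[OF c_mem(1) K_times])

lemma null_perp_cases:
  assumes s: "s \<in> K" and x: "x \<in> null_perp A L (\<eta> s) (vel s)"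
  shows "x = Oc s (to_chart A c (\<eta> s) x)" "lam s \<bullet> to_chart A c (\<eta> s) x = 0"
proof -
  show 1: "x = Oc s (to_chart A c (\<eta> s) x)"
    using of_to_chart[OF atlas c_mem(1) K_fst(2)[OF s]] by simp
  show "lam s \<bullet> to_chart A c (\<eta> s) x = 0"
    using x null_perp_Oc[OF s, of "to_chart A c (\<eta> s) x"] 1 by simp
qed

lemma Oc_comb: "s \<in> K \<Longrightarrow> (\<Sum>i<CARD('m) - 2. a i *\<^sub>R Oc s (W i s)) = Oc s (\<Sum>i<CARD('m) - 2. a i *\<^sub>R W i s)"
  by (simp only: linear_sum[OF Oc_linear] linear_cmul[OF Oc_linear])

lemma class_moving_expansion:
  assumes s: "s \<in> K" and w: "lam s \<bullet> w = 0"
  shows "quot_class (vel s) (Oc s w) = quot_class (vel s) (\<Sum>i<CARD('m) - 2. coef i s w *\<^sub>R Oc s (W i s))"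
  unfolding Oc_comb[OF s] class_Oc_iff[OF s] using moving_expansion[OF s w] by blast

lemma moving_basis:
  assumes s: "s \<in> K"
  shows "quot_basis A L (\<eta> s) (vel s) (\<lambda>i. Oc s (W i s))"
  unfolding quot_basis_def
proof (intro conjI allI impI ballI)
  show "Oc s (W i s) \<in> null_perp A L (\<eta> s) (vel s)" for i
    using null_perp_Oc[OF s] lam_W[OF s] by simp
  fix q assume "q \<in> quot_space A L (\<eta> s) (vel s)"
  then obtain w where w: "lam s \<bullet> w = 0" "q = quot_class (vel s) (Oc s w)"
    unfolding quot_space_def using null_perp_cases[OF s] by (metis imageE)
  show "\<exists>!a. a \<in> extensional {..<CARD('m) - 2} \<and> q = quot_class (vel s) (\<Sum>i<CARD('m) - 2. a i *\<^sub>R Oc s (W i s))"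
  proof (rule ex1I)
    show "restrict (\<lambda>i. coef i s w) {..<CARD('m) - 2} \<in> extensional {..<CARD('m) - 2} \<and>
      q = quot_class (vel s) (\<Sum>i<CARD('m) - 2. restrict (\<lambda>i. coef i s w) {..<CARD('m) - 2} i *\<^sub>R Oc s (W i s))"
      using class_moving_expansion[OF s w(1)] w(2) by simp
    fix a assume a: "a \<in> extensional {..<CARD('m) - 2} \<and> q = quot_class (vel s) (\<Sum>i<CARD('m) - 2. a i *\<^sub>R Oc s (W i s))"
    then obtain k where "w = (\<Sum>i<CARD('m) - 2. a i *\<^sub>R W i s) + k *\<^sub>R u s"
      unfolding w(2) Oc_comb[OF s] class_Oc_iff[OF s] by blast
    then have "coef i s w = a i" if "i < CARD('m) - 2" for i using coef_comb[OF s _ that] by blast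
    then show "a = restrict (\<lambda>i. coef i s w) {..<CARD('m) - 2}"
      using a by (auto simp: fun_eq_iff extensional_def)
  qed
qed

lemma basis_t: "quot_basis A L (\<eta> t) (vel t) e"
proof -
  have "quot_basis A L (\<eta> t) (vel t) (\<lambda>i. W i t)" using moving_basis[OF t_mem] by (simp add: Oc_t)
  then show ?thesis by (simp add: quot_basis_def W_t)
qed

lemma W_smooth: "smooth_on K (W i)"
proof -
  have "smooth_on K lam" by (rule smooth_on_subset[OF momentum_smooth[OF c_mem(1)] K_sub])
  then have "smooth_on K (\<lambda>s. lam s \<bullet> w)" for w
    by (intro smooth_on_inner smooth_on_const) auto
  then show ?thesis
    unfolding W_def[abs_def]
    by (intro smooth_on_diff smooth_on_const smooth_on_scaleR smooth_on_divide z0_transv) auto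
qed

text \<open>Only the \<open>z0\<close>-coefficient of \<open>W i\<close> varies. As the
  \<open>f i\<close> kill \<open>z0\<close>, this derivative will not show up in the connection
  matrix.\<close>

lemma W_has_derivative: "\<exists>\<rho>. (W i has_vector_derivative \<rho> *\<^sub>R z0) (at t)"
proof -
  have "smooth_on K lam" by (rule smooth_on_subset[OF momentum_smooth[OF c_mem(1)] K_sub])
  then have "smooth_on K (\<lambda>s. (lam s \<bullet> e i) / (lam s \<bullet> z0))"
    by (intro smooth_on_divide smooth_on_inner smooth_on_const z0_transv) auto
  from smooth_on_has_vector_derivative[OF this t_mem]
  obtain \<rho> where "((\<lambda>s. (lam s \<bullet> e i) / (lam s \<bullet> z0)) has_vector_derivative \<rho>) (at t)" by blast
  then have "((\<lambda>s. e i - ((lam s \<bullet> e i) / (lam s \<bullet> z0)) *\<^sub>R z0) has_vector_derivative 0 - \<rho> *\<^sub>R z0) (at t)"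
    by (intro has_vector_derivative_diff has_vector_derivative_const
        bounded_linear.has_vector_derivative[OF bounded_linear_scaleR_left])
  then have "(W i has_vector_derivative (- \<rho>) *\<^sub>R z0) (at t)" by (simp add: W_def[abs_def])
  then show ?thesis by blast
qed

definition conn_mat :: "real mat" where
  "conn_mat = Matrix.mat (CARD('m) - 2) (CARD('m) - 2) (\<lambda>(i, j). f i \<bullet> conn c t (e j))"

lemma cov_deriv_K:
  "s \<in> K \<Longrightarrow> cov_deriv A L c \<eta> Y s =
    Oc s (vector_derivative (\<lambda>s. to_chart A c (\<eta> s) (Y s)) (at s) + conn c s (to_chart A c (\<eta> s) (Y s)))"
  unfolding conn_def by (rule cov_deriv_chart[OF c_mem(1) K_times])

text \<open>Identifies \<open>conn_mat\<close> as the connection matrix of the moving frame modulo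
  the velocity, at the instant \<open>t\<close>.\<close>

lemma cov_deriv_W:
  assumes j: "j < CARD('m) - 2"
  obtains k where "cov_deriv A L c \<eta> (\<lambda>s. Oc s (W j s)) t = (\<Sum>i<CARD('m) - 2. conn_mat $$ (i, j) *\<^sub>R e i) + k *\<^sub>R u t"
proof -
  obtain \<rho> where \<rho>: "(W j has_vector_derivative \<rho> *\<^sub>R z0) (at t)" using W_has_derivative by blast
  have "((\<lambda>s. to_chart A c (\<eta> s) (Oc s (W j s))) has_vector_derivative \<rho> *\<^sub>R z0) (at t)"
    by (rule has_vector_derivative_transform_within_open[OF \<rho> _ t_mem])
      (simp_all add: to_chart_Oc)
  from vector_derivative_at[OF this]
  have eq: "cov_deriv A L c \<eta> (\<lambda>s. Oc s (W j s)) t = \<rho> *\<^sub>R z0 + conn c t (e j)"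
    using to_chart_Oc[OF t_mem, of "e j"] unfolding cov_deriv_K[OF t_mem] Oc_t W_t[OF j] by simp
  have "((\<lambda>s. lam s \<bullet> W j s) has_real_derivative lam t \<bullet> (\<rho> *\<^sub>R z0 + conn c t (W j t))) (at t)"
    by (rule momentum_has_derivative[OF c_mem(1) K_times[OF t_mem] \<rho>])
  \<comment> \<open>The pairing of the momentum with \<open>W j\<close> vanishes identically. Its
    zero derivative places the covariant derivative in the null hyperplane, where
    \<open>moving_expansion\<close> applies.\<close>
  then have "((\<lambda>s. 0) has_real_derivative lam t \<bullet> (\<rho> *\<^sub>R z0 + conn c t (W j t))) (at t)"
    by (rule has_field_derivative_transform_within_open[OF _ _ t_mem]) (simp_all add: lam_W)
  then have "lam t \<bullet> (\<rho> *\<^sub>R z0 + conn c t (e j)) = 0"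
    using DERIV_unique[OF _ DERIV_const] W_t[OF j] by metis
  note m1 = moving_expansion[OF t_mem this]
  have m2: "(\<Sum>i<CARD('m) - 2. coef i t (\<rho> *\<^sub>R z0 + conn c t (e j)) *\<^sub>R W i t) = (\<Sum>i<CARD('m) - 2. conn_mat $$ (i, j) *\<^sub>R e i)"
    by (rule sum.cong) (use j in \<open>simp_all add: coef_def frame_dual inner_add_right conn_mat_def W_t\<close>)
  show ?thesis
    by (rule that[OF trans[OF eq trans[OF m1 arg_cong2[where f=plus, OF m2 refl]]]])
qed

text \<open>The Leibniz rule \<open>(E q)' = E' q + E q'\<close> for the classes \<open>q\<close> of
  the frame vectors, written in matrices: the connection matrix enters as a commutator. The lifts
  provided by \<open>has_quot_endo_deriv\<close> are fixed only modulo the velocity, to which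
  \<open>coef\<close> is insensitive.\<close>

lemma endo_matrix_derivative:
  assumes E': "has_quot_endo_deriv A L I \<eta> E E'"
    and E: "\<And>s. s \<in> I \<Longrightarrow> quot_endo A L (\<eta> s) (vel s) (E s)"
  obtains M where "\<And>s. M s \<in> carrier_mat (CARD('m) - 2) (CARD('m) - 2)"
    "\<And>s j. s \<in> K \<Longrightarrow> j < CARD('m) - 2 \<Longrightarrow>
       E s (quot_class (vel s) (Oc s (W j s))) = quot_class (vel s) (\<Sum>i<CARD('m) - 2. M s $$ (i, j) *\<^sub>R Oc s (W i s))"
    "\<And>M1 i j. M1 \<in> carrier_mat (CARD('m) - 2) (CARD('m) - 2) \<Longrightarrow>
       (\<And>j. j < CARD('m) - 2 \<Longrightarrow> E' t (quot_class (vel t) (e j)) = quot_class (vel t) (\<Sum>i<CARD('m) - 2. M1 $$ (i, j) *\<^sub>R e i)) \<Longrightarrow>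
       i < CARD('m) - 2 \<Longrightarrow> j < CARD('m) - 2 \<Longrightarrow>
       ((\<lambda>s. M s $$ (i, j)) has_real_derivative (M1 + (M t * conn_mat - conn_mat * M t)) $$ (i, j)) (at t)"
proof -
  let ?q = "\<lambda>j s. quot_class (vel s) (Oc s (W j s))"
  let ?q' = "\<lambda>j s. quot_class (vel s) (cov_deriv A L c \<eta> (\<lambda>s. Oc s (W j s)) s)"
  have lift: "has_quot_deriv A L c \<eta> K (?q j) (?q' j)" for j
    unfolding has_quot_deriv_def quot_section_lift_def
  proof (intro exI conjI ballI)
    show "smooth_on K (\<lambda>s. to_chart A c (\<eta> s) (Oc s (W j s)))"
      by (rule smooth_on_cong[OF _ _ W_smooth[of j]]) (simp_all add: to_chart_Oc)
    show "Oc s (W j s) \<in> null_perp A L (\<eta> s) (vel s)" if "s \<in> K" for s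
      using null_perp_Oc[OF that] lam_W[OF that] by simp
  qed simp_all
  have "{r<..<r'} \<subseteq> I \<and> \<eta> ` {r<..<r'} \<subseteq> fst c" using K_fst by blast
  then have "has_quot_deriv A L c \<eta> K (\<lambda>s. E s (?q j s)) (\<lambda>s. E' s (?q j s) + E s (?q' j s))" for j
    using E' lift[of j] c_mem(1) unfolding has_quot_endo_deriv_def by blast
  then have ex: "\<exists>Y. quot_section_lift A L c \<eta> K (\<lambda>s. E s (?q j s)) Y \<and>
        (\<forall>s\<in>K. E' s (?q j s) + E s (?q' j s) = quot_class (vel s) (cov_deriv A L c \<eta> Y s))" for j
    unfolding has_quot_deriv_def .
  from choice[OF allI[OF ex]] obtain Y where Y0: "\<forall>j. quot_section_lift A L c \<eta> K (\<lambda>s. E s (?q j s)) (Y j) \<and>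
        (\<forall>s\<in>K. E' s (?q j s) + E s (?q' j s) = quot_class (vel s) (cov_deriv A L c \<eta> (Y j) s))" ..
  then have Y: "\<And>j. quot_section_lift A L c \<eta> K (\<lambda>s. E s (?q j s)) (Y j)"
    "\<And>j s. s \<in> K \<Longrightarrow> E' s (?q j s) + E s (?q' j s) = quot_class (vel s) (cov_deriv A L c \<eta> (Y j) s)"
    by blast+
  define y where "y j s = to_chart A c (\<eta> s) (Y j s)" for j s
  have y_smooth: "smooth_on K (y j)" for j
    using Y(1)[of j] by (simp add: quot_section_lift_def y_def[abs_def])
  have Y_y: "Y j s = Oc s (y j s)" "lam s \<bullet> y j s = 0" "E s (?q j s) = quot_class (vel s) (Y j s)"
    if "s \<in> K" for s j
    using null_perp_cases[OF that, of "Y j s"] Y(1)[of j] that by (auto simp: quot_section_lift_def y_def)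
  define M where "M s = Matrix.mat (CARD('m) - 2) (CARD('m) - 2) (\<lambda>(i, j). coef i s (y j s))" for s
  have M: "M s \<in> carrier_mat (CARD('m) - 2) (CARD('m) - 2)" for s by (simp add: M_def)
  have EM: "E s (?q j s) = quot_class (vel s) (\<Sum>i<CARD('m) - 2. M s $$ (i, j) *\<^sub>R Oc s (W i s))" if "s \<in> K" "j < CARD('m) - 2" for s j
    unfolding Y_y(3)[OF that(1)] unfolding Y_y(1)[OF that(1)] class_moving_expansion[OF that(1) Y_y(2)[OF that(1)]]
    using that(2) by (simp add: M_def)
  have "((\<lambda>s. M s $$ (i, j)) has_real_derivative (M1 + (M t * conn_mat - conn_mat * M t)) $$ (i, j)) (at t)"
    if M1: "M1 \<in> carrier_mat (CARD('m) - 2) (CARD('m) - 2)"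
      "\<And>j. j < CARD('m) - 2 \<Longrightarrow> E' t (quot_class (vel t) (e j)) = quot_class (vel t) (\<Sum>i<CARD('m) - 2. M1 $$ (i, j) *\<^sub>R e i)"
      and ij: "i < CARD('m) - 2" "j < CARD('m) - 2" for M1 i j
  proof -
    define y' where "y' = vector_derivative (y j) (at t)"
    have dy: "(y j has_vector_derivative y') (at t)"
      unfolding y'_def by (rule smooth_on_has_vector_derivative[OF y_smooth t_mem])
    let ?Dy = "y' + conn c t (y j t)"
    have cov_Y: "cov_deriv A L c \<eta> (Y j) t = ?Dy"
      unfolding cov_deriv_K[OF t_mem] Oc_t y'_def by (simp add: y_def[abs_def])
    obtain k where k: "cov_deriv A L c \<eta> (\<lambda>s. Oc s (W j s)) t = (\<Sum>i<CARD('m) - 2. conn_mat $$ (i, j) *\<^sub>R e i) + k *\<^sub>R u t"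
      using cov_deriv_W[OF ij(2)] by blast
    have q't: "?q' j t = quot_comb (vel t) e (\<lambda>i. conn_mat $$ (i, j))"
      unfolding k quot_comb_def by (rule quot_class_eqI[where s=k]) (simp only: vel_t)
    have "E t (quot_comb (vel t) e (\<lambda>i. conn_mat $$ (i, j))) = quot_comb (vel t) e (mat_apply (CARD('m) - 2) (M t) (\<lambda>i. conn_mat $$ (i, j)))"
    proof (rule quot_endo_comb[OF E[OF K_fst(1)[OF t_mem]]])
      show "e i \<in> null_perp A L (\<eta> t) (vel t)" if "i < CARD('m) - 2" for i using quot_basis_mem[OF basis_t that] .
      show "E t (quot_class (vel t) (e j)) = quot_class (vel t) (\<Sum>i<CARD('m) - 2. M t $$ (i, j) *\<^sub>R e i)" if "j < CARD('m) - 2" for j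
        using EM[OF t_mem that] that by (simp add: Oc_t W_t)
    qed
    moreover have "E' t (?q j t) = quot_comb (vel t) e (\<lambda>i. M1 $$ (i, j))"
      using M1(2)[OF ij(2)] ij(2) by (simp add: Oc_t W_t quot_comb_def)
    ultimately have "quot_class (vel t) ?Dy = quot_class (vel t) ((\<Sum>i<CARD('m) - 2. M1 $$ (i, j) *\<^sub>R e i) +
        (\<Sum>i<CARD('m) - 2. mat_apply (CARD('m) - 2) (M t) (\<lambda>i. conn_mat $$ (i, j)) i *\<^sub>R e i))"
      using Y(2)[OF t_mem, of j] unfolding cov_Y q't by (simp add: quot_comb_def quot_class_add)
    then obtain k' where "?Dy = (\<Sum>l<CARD('m) - 2. (M1 $$ (l, j) + mat_apply (CARD('m) - 2) (M t) (\<lambda>i. conn_mat $$ (i, j)) l) *\<^sub>R W l t) + k' *\<^sub>R u t"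
      unfolding quot_class_eq_iff by (auto simp: vel_t W_t sum.distrib scaleR_add_left)
    from coef_comb[OF t_mem this ij(1)]
    have fDy: "f i \<bullet> ?Dy = M1 $$ (i, j) + mat_apply (CARD('m) - 2) (M t) (\<lambda>i. conn_mat $$ (i, j)) i"
      using frame_dual(2)[OF ij(1)] by (simp add: coef_def)
    \<comment> \<open>The chosen lift may have a velocity component
      \<open>fv \<bullet> y j t\<close>. It yields a term with \<open>conn c t (u t)\<close>, which
      is matched by the derivative of the velocity in \<open>coef\<close>.\<close>
    have yt: "y j t = (\<Sum>l<CARD('m) - 2. M t $$ (l, j) *\<^sub>R e l) + (fv \<bullet> y j t) *\<^sub>R u t"
      using moving_expansion[OF t_mem Y_y(2)[OF t_mem], of j] ij(2) by (simp add: M_def W_t frame_dual(6))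
    then have "conn c t (y j t) = (\<Sum>l<CARD('m) - 2. M t $$ (l, j) *\<^sub>R conn c t (e l)) + (fv \<bullet> y j t) *\<^sub>R conn c t (u t)"
    proof -
      have "conn c t ((\<Sum>l<CARD('m) - 2. M t $$ (l, j) *\<^sub>R e l) + (fv \<bullet> y j t) *\<^sub>R u t) =
        (\<Sum>l<CARD('m) - 2. M t $$ (l, j) *\<^sub>R conn c t (e l)) + (fv \<bullet> y j t) *\<^sub>R conn c t (u t)"
        by (simp only: linear_add[OF conn_linear] linear_cmul[OF conn_linear] linear_sum[OF conn_linear])
      then show ?thesis by (rule trans[OF arg_cong[where f="conn c t", OF yt]])
    qed
    then have "f i \<bullet> conn c t (y j t) = (\<Sum>l<CARD('m) - 2. M t $$ (l, j) * conn_mat $$ (i, l)) + (fv \<bullet> y j t) * (f i \<bullet> conn c t (u t))"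
      using ij(1) by (simp add: inner_add_right inner_sum_right conn_mat_def)
    then have fy': "f i \<bullet> y' + (fv \<bullet> y j t) * (f i \<bullet> conn c t (u t)) =
        M1 $$ (i, j) + mat_apply (CARD('m) - 2) (M t) (\<lambda>i. conn_mat $$ (i, j)) i - (\<Sum>l<CARD('m) - 2. M t $$ (l, j) * conn_mat $$ (i, l))"
      using fDy by (simp add: inner_add_right)
    have du: "(u has_vector_derivative - conn c t (u t)) (at t)"
      by (rule conn_velocity[OF c_mem(1) K_times[OF t_mem]])
    have inner_deriv: "((\<lambda>s. w \<bullet> h s) has_real_derivative w \<bullet> h') (at t)"
      if "(h has_vector_derivative h') (at t)" for w h' :: "real^'m" and h
      using bounded_linear.has_vector_derivative[OF bounded_linear_inner_right that]
      by (simp add: has_real_derivative_iff_has_vector_derivative)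
    \<comment> \<open>At \<open>t\<close> one has \<open>f i \<bullet> u t = 0\<close> and
      \<open>fv \<bullet> u t = 1\<close>, so of the subtracted product only the derivative of
      \<open>f i \<bullet> u s\<close> contributes, and \<open>du\<close> supplies it.\<close>
    have "((\<lambda>s. f i \<bullet> y j s - (fv \<bullet> y j s) / (fv \<bullet> u s) * (f i \<bullet> u s)) has_real_derivative
        f i \<bullet> y' + (fv \<bullet> y j t) * (f i \<bullet> conn c t (u t))) (at t)"
      using frame_dual(2)[OF ij(1)] frame_dual(6)
      by (auto intro!: derivative_eq_intros inner_deriv[OF dy] inner_deriv[OF du])
    moreover have "(M1 + (M t * conn_mat - conn_mat * M t)) $$ (i, j) =
        M1 $$ (i, j) + mat_apply (CARD('m) - 2) (M t) (\<lambda>i. conn_mat $$ (i, j)) i - (\<Sum>l<CARD('m) - 2. M t $$ (l, j) * conn_mat $$ (i, l))"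
    proof -
      have C: "conn_mat \<in> carrier_mat (CARD('m) - 2) (CARD('m) - 2)" by (simp add: conn_mat_def)
      then show ?thesis
        using M1(1) M[of t] ij by (simp add: mat_apply_def scalar_prod_def atLeast0LessThan mult.commute)
    qed
    moreover have "M s $$ (i, j) = f i \<bullet> y j s - (fv \<bullet> y j s) / (fv \<bullet> u s) * (f i \<bullet> u s)" for s
      using ij by (simp add: M_def coef_def)
    ultimately show ?thesis using fy' by simp
  qed
  then show ?thesis using that[OF M EM] by blast
qed

end

section \<open>The Raychaudhuri inequality\<close>

lemma gmetric_pref:
  "gmetric A L p v a b = a \<bullet> (gmat (local_expr A (pref_chart A p) L) (snd (pref_chart A p) p, v) *v b)"
  by (simp add: gmetric_def inner_vec_def matrix_vector_mult_def sum_distrib_left mult_ac)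

text \<open>The algebraic null frame at the instant \<open>t\<close> extends to an interval because
  both transversality conditions are open.\<close>

lemma (in null_geod) adapted_frame:
  assumes t: "t \<in> I"
  obtains e z0 f fv fz r r' where "null_geod_frame A L X I \<eta> t e z0 f fv fz r r'"
    "\<And>i j. i < CARD('m) - 2 \<Longrightarrow> j < CARD('m) - 2 \<Longrightarrow>
       gmetric A L (\<eta> t) (velocity A \<eta> t) (e i) (e j) = (if i = j then 1 else 0)"
proof -
  define c where "c = pref_chart A (\<eta> t)"
  have c: "c \<in> A" "\<eta> t \<in> fst c" using pref_chart[OF atlas] by (simp_all add: c_def)
  have tc: "t \<in> chart_times c" using c t by (simp add: chart_times_def)
  interpret C: finsler_chart "local_expr A c L" "chart_slit c" by (rule finsler_chart_local[OF atlas lf c(1)])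
  let ?z = "velocity_coords c \<eta> t" and ?u = "coord_velocity c"
  let ?B = "gmat (local_expr A c L) ?z"
  note z = velocity_coords_slit[OF c(1) tc]
  have sig: "lorentz_signature ?B"
    using lf c coord_velocity_nonzero[OF c(1) tc] unfolding lorentz_finsler_def velocity_coords_def by blast
  have uB: "?u t \<bullet> (?B *v w) = momentum c t \<bullet> w" for w
    using C.g_snd_inner[OF z, of w]
    by (simp add: inner_vec_def matrix_vector_mult_def sum_distrib_left momentum_def velocity_coords_def mult_ac)
  have null: "?u t \<bullet> (?B *v ?u t) = 0" unfolding uB by (rule momentum_velocity[OF c(1) tc])
  obtain e z0 f fv fz where fr: "null_frame (?u t) e z0 f fv fz"
    and on: "\<And>i j. i < CARD('m) - 2 \<Longrightarrow> j < CARD('m) - 2 \<Longrightarrow> e i \<bullet> (?B *v e j) = (if i = j then 1 else 0)"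
    and orth: "\<And>i. i < CARD('m) - 2 \<Longrightarrow> ?u t \<bullet> (?B *v e i) = 0"
    and z0: "?u t \<bullet> (?B *v z0) \<noteq> 0"
    using lorentz_null_frame[OF sig coord_velocity_nonzero[OF c(1) tc] null] by blast
  \<comment> \<open>Both transversality conditions are packed into one product, continuous in
    \<open>s\<close> and nonzero at \<open>t\<close>.\<close>
  have "continuous_on (chart_times c) (\<lambda>s. (momentum c s \<bullet> z0) * (fv \<bullet> ?u s))"
    by (intro continuous_intros smooth_on_continuous[OF momentum_smooth[OF c(1)]]
        smooth_on_continuous[OF smooth_coord_velocity[OF c(1)]])
  moreover have "open (- {0::real})" by (simp add: open_Compl)
  ultimately have "open (chart_times c \<inter> (\<lambda>s. (momentum c s \<bullet> z0) * (fv \<bullet> ?u s)) -` (- {0}))"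
    by (rule continuous_open_preimage[OF _ open_chart_times[OF c(1)]])
  moreover have "fv \<bullet> ?u t = 1" using fr by (simp add: null_frame_def)
  then have "t \<in> chart_times c \<inter> (\<lambda>s. (momentum c s \<bullet> z0) * (fv \<bullet> ?u s)) -` (- {0})"
    using tc z0 by (simp add: uB)
  ultimately obtain \<epsilon> where \<epsilon>: "\<epsilon> > 0"
    "ball t \<epsilon> \<subseteq> chart_times c \<inter> (\<lambda>s. (momentum c s \<bullet> z0) * (fv \<bullet> ?u s)) -` (- {0})"
    using open_contains_ball by blast
  have ball: "ball t \<epsilon> = {t - \<epsilon><..<t + \<epsilon>}" by (auto simp: dist_real_def)
  have "null_geod_frame A L X I \<eta> t e z0 f fv fz (t - \<epsilon>) (t + \<epsilon>)"
  proof (unfold_locales, unfold c_def[symmetric])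
    show "null_frame (?u t) e z0 f fv fz" by (rule fr)
    show "momentum c t \<bullet> e i = 0" if "i < CARD('m) - 2" for i using orth[OF that] by (simp add: uB)
    show "t \<in> {t - \<epsilon><..<t + \<epsilon>}" using \<epsilon>(1) by simp
    show "{t - \<epsilon><..<t + \<epsilon>} \<subseteq> chart_times c" using \<epsilon>(2) unfolding ball by blast
    show "momentum c s \<bullet> z0 \<noteq> 0" "fv \<bullet> ?u s \<noteq> 0" if "s \<in> {t - \<epsilon><..<t + \<epsilon>}" for s
      using \<epsilon>(2) that unfolding ball by auto
  qed
  moreover have "gmetric A L (\<eta> t) (velocity A \<eta> t) (e i) (e j) = (if i = j then 1 else 0)"
    if "i < CARD('m) - 2" "j < CARD('m) - 2" for i j
    using on[OF that] by (simp add: gmetric_pref c_def[symmetric] velocity_def velocity_coords_def)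
  ultimately show ?thesis by (rule that)
qed

lemma (in null_geod) quot_basis_exists: "t \<in> I \<Longrightarrow> \<exists>b. quot_basis A L (\<eta> t) (velocity A \<eta> t) b"
  using adapted_frame null_geod_frame.basis_t by metis

text \<open>Representatives may be changed freely since \<open>v\<close> is orthogonal to the null hyperplane.\<close>

lemma quot_metric_class:
  assumes sym: "\<And>a b. gmetric A L p v a b = gmetric A L p v b a"
    and v: "v \<in> null_perp A L p v" and ab: "a \<in> null_perp A L p v" "b \<in> null_perp A L p v"
  shows "quot_metric A L p v (quot_class v a) (quot_class v b) = gmetric A L p v a b"
proof -
  have "(SOME x. x \<in> quot_class v a) \<in> quot_class v a" "(SOME x. x \<in> quot_class v b) \<in> quot_class v b"
    using quot_class_self by (metis someI)+
  then obtain k l where k: "(SOME x. x \<in> quot_class v a) = a + k *\<^sub>R v" "(SOME x. x \<in> quot_class v b) = b + l *\<^sub>R v"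
    unfolding mem_quot_class by blast
  have 0: "gmetric A L p v v v = 0" "gmetric A L p v v a = 0" "gmetric A L p v v b = 0"
    using v ab by (auto simp: null_perp_def)
  then have "gmetric A L p v a v = 0" using sym by metis
  then show ?thesis
    unfolding quot_metric_def k using 0
    by (simp add: gmetric_pref matrix_vector_right_distrib matrix_vector_mult_scaleR inner_add_left inner_add_right)
qed

section \<open>Trace of the curvature and the Riccati inequality in the adapted frame\<close>

context null_geod_frame
begin

lemma curvature_velocity: "Rmat A L (\<eta> t) (vel t) *v u t = 0"
proof -
  interpret C: finsler_chart "local_expr A c L" "chart_slit c" by (rule finsler_chart_local[OF atlas lf c_mem(1)])
  have z: "(snd c (\<eta> t), u t) \<in> chart_slit c"
    using velocity_coords_slit[OF c_mem(1) K_times[OF t_mem]] by (simp add: velocity_coords_def)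
  show ?thesis
    using C.curv_snd[OF z] by (simp add: vec_eq_iff matrix_vector_mult_def Rmat_def vel_t)
qed

lemma momentum_curvature: "lam t \<bullet> (Rmat A L (\<eta> t) (vel t) *v w) = 0"
proof -
  interpret C: finsler_chart "local_expr A c L" "chart_slit c" by (rule finsler_chart_local[OF atlas lf c_mem(1)])
  let ?z = "(snd c (\<eta> t), u t)"
  have z: "?z \<in> chart_slit c"
    using velocity_coords_slit[OF c_mem(1) K_times[OF t_mem]] by (simp add: velocity_coords_def)
  have "lam t \<bullet> (Rmat A L (\<eta> t) (vel t) *v w) =
      (\<Sum>\<alpha>\<in>UNIV. \<Sum>\<beta>\<in>UNIV. curv (local_expr A c L) \<alpha> \<beta> ?z * dv \<alpha> (local_expr A c L) ?z * w $ \<beta>)"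
    by (simp add: inner_vec_def matrix_vector_mult_def Rmat_def vel_t momentum_def velocity_coords_def sum_distrib_left mult_ac)
  also have "\<dots> = (\<Sum>\<beta>\<in>UNIV. (\<Sum>\<alpha>\<in>UNIV. curv (local_expr A c L) \<alpha> \<beta> ?z * dv \<alpha> (local_expr A c L) ?z) * w $ \<beta>)"
    by (subst sum.swap) (simp add: sum_distrib_right)
  also have "\<dots> = 0" using C.dv_F_curv[OF z] by simp
  finally show ?thesis .
qed

text \<open>The momentum and \<open>fz\<close> both vanish on the \<open>e i\<close> and on the
  velocity, hence they are proportional.\<close>

lemma fz_momentum: "lam t \<bullet> w = (fz \<bullet> w) * (lam t \<bullet> z0)"
proof -
  have "lam t \<bullet> w = lam t \<bullet> ((\<Sum>i<CARD('m) - 2. (f i \<bullet> w) *\<^sub>R e i) + (fv \<bullet> w) *\<^sub>R u t + (fz \<bullet> w) *\<^sub>R z0)"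
    using frame_expansion[of w] by simp
  then show ?thesis
    using lam_u[OF t_mem] orth by (simp add: inner_add_right inner_sum_right)
qed

lemma Ric_frame: "Ric A L (\<eta> t) (vel t) = (\<Sum>i<CARD('m) - 2. f i \<bullet> (Rmat A L (\<eta> t) (vel t) *v e i))"
proof -
  have "fz \<bullet> (Rmat A L (\<eta> t) (vel t) *v z0) = 0"
    using fz_momentum[of "Rmat A L (\<eta> t) (vel t) *v z0"] momentum_curvature z0_transv[OF t_mem] by simp
  then show ?thesis
    unfolding Ric_def trace_null_frame[OF frame] curvature_velocity by simp
qed

text \<open>Orthonormality of the frame is available at \<open>t\<close>. This is enough, since it
  serves after the differentiation, to read the Lagrange condition as symmetry of the matrix of
  \<open>J' J^-1\<close> at \<open>t\<close>.\<close>

lemma frame_expansion_derivative: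
  assumes dim: "CARD('m) \<ge> 3"
    and on: "\<And>i j. i < CARD('m) - 2 \<Longrightarrow> j < CARD('m) - 2 \<Longrightarrow>
       gmetric A L (\<eta> t) (vel t) (e i) (e j) = (if i = j then 1 else 0)"
    and lag: "lagrange_tensor_field A L I \<eta> J J'"
    and bij: "bij_betw (J t) (quot_space A L (\<eta> t) (vel t)) (quot_space A L (\<eta> t) (vel t))"
  shows "\<exists>\<theta>'. (expansion A L \<eta> J J' has_real_derivative \<theta>') (at t) \<and>
    \<theta>' \<le> - (expansion A L \<eta> J J' t)\<^sup>2 / (real CARD('m) - 2) - Ric A L (\<eta> t) (vel t)"
proof -
  let ?d = "CARD('m) - 2" and ?Q = "quot_space A L (\<eta> t) (vel t)" and ?cl = "quot_class (vel t)"
    and ?R = "Rmat A L (\<eta> t) (vel t)"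
  have jac: "jacobi_tensor_field A L I \<eta> J J'" using lag by (simp add: lagrange_tensor_field_def)
  then obtain J'' where J'': "has_quot_endo_deriv A L I \<eta> J' J''"
    "\<forall>t\<in>I. \<forall>q\<in>quot_space A L (\<eta> t) (vel t). J'' t q + quot_curv A L (\<eta> t) (vel t) (J t q) = quot_class (vel t) 0"
    unfolding jacobi_tensor_field_def by blast
  have J': "has_quot_endo_deriv A L I \<eta> J J'" using jac by (simp add: jacobi_tensor_field_def)
  have endo: "quot_endo A L (\<eta> s) (vel s) (J s)" "quot_endo A L (\<eta> s) (vel s) (J' s)"
    "quot_endo A L (\<eta> s) (vel s) (J'' s)" if "s \<in> I" for s
    using jac J' J''(1) that
    by (auto simp: jacobi_tensor_field_def smooth_quot_endo_field_def has_quot_endo_deriv_def)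
  have tI: "t \<in> I" using K_fst(1)[OF t_mem] .
  obtain B where B: "\<And>s. B s \<in> carrier_mat ?d ?d"
    and JB: "\<And>s j. s \<in> K \<Longrightarrow> j < ?d \<Longrightarrow>
       J s (quot_class (vel s) (Oc s (W j s))) = quot_class (vel s) (\<Sum>i<?d. B s $$ (i, j) *\<^sub>R Oc s (W i s))"
    and dB: "\<And>M1 i j. M1 \<in> carrier_mat ?d ?d \<Longrightarrow>
       (\<And>j. j < ?d \<Longrightarrow> J' t (?cl (e j)) = ?cl (\<Sum>i<?d. M1 $$ (i, j) *\<^sub>R e i)) \<Longrightarrow> i < ?d \<Longrightarrow> j < ?d \<Longrightarrow>
       ((\<lambda>s. B s $$ (i, j)) has_real_derivative (M1 + (B t * conn_mat - conn_mat * B t)) $$ (i, j)) (at t)"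
    by (rule endo_matrix_derivative[OF J' endo(1)]) auto
  obtain B1 where B1: "\<And>s. B1 s \<in> carrier_mat ?d ?d"
    and JB1: "\<And>s j. s \<in> K \<Longrightarrow> j < ?d \<Longrightarrow>
       J' s (quot_class (vel s) (Oc s (W j s))) = quot_class (vel s) (\<Sum>i<?d. B1 s $$ (i, j) *\<^sub>R Oc s (W i s))"
    and dB1: "\<And>M1 i j. M1 \<in> carrier_mat ?d ?d \<Longrightarrow>
       (\<And>j. j < ?d \<Longrightarrow> J'' t (?cl (e j)) = ?cl (\<Sum>i<?d. M1 $$ (i, j) *\<^sub>R e i)) \<Longrightarrow> i < ?d \<Longrightarrow> j < ?d \<Longrightarrow>
       ((\<lambda>s. B1 s $$ (i, j)) has_real_derivative (M1 + (B1 t * conn_mat - conn_mat * B1 t)) $$ (i, j)) (at t)"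
    by (rule endo_matrix_derivative[OF J''(1) endo(2)]) auto
  obtain B2 where B2: "B2 \<in> carrier_mat ?d ?d"
    and JB2: "\<And>j. j < ?d \<Longrightarrow> J'' t (?cl (e j)) = ?cl (\<Sum>i<?d. B2 $$ (i, j) *\<^sub>R e i)"
    using quot_endo_matrix_exists[OF endo(3)[OF tI] basis_t] by blast
  have JBt: "J t (?cl (e j)) = ?cl (\<Sum>i<?d. B t $$ (i, j) *\<^sub>R e i)"
    and JB1t: "J' t (?cl (e j)) = ?cl (\<Sum>i<?d. B1 t $$ (i, j) *\<^sub>R e i)" if "j < ?d" for j
    using JB[OF t_mem that] JB1[OF t_mem that] that by (simp_all add: Oc_t W_t)
  have C: "conn_mat \<in> carrier_mat ?d ?d" by (simp add: conn_mat_def)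
  have det: "Determinant.det (B t) \<noteq> 0"
    using quot_endo_bij_iff[OF endo(1)[OF tI] basis_t B JBt] bij by simp
  have dB': "((\<lambda>s. B s $$ (i, j)) has_real_derivative (B1 t + (B t * conn_mat - conn_mat * B t)) $$ (i, j)) (at t)"
    and dB1': "((\<lambda>s. B1 s $$ (i, j)) has_real_derivative (B2 + (B1 t * conn_mat - conn_mat * B1 t)) $$ (i, j)) (at t)"
    if "i < ?d" "j < ?d" for i j
    by (rule dB[OF B1 _ that], rule JB1t, assumption) (rule dB1[OF B2 _ that], rule JB2, assumption)
  let ?C = "B1 t * minv (B t)"
  let ?\<theta>' = "mtrace (B2 * minv (B t)) - mtrace (?C * ?C)"
  have log: "((\<lambda>s. mtrace (B1 s * minv (B s))) has_real_derivative ?\<theta>') (at t)"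
    "eventually (\<lambda>s. Determinant.det (B s) \<noteq> 0) (nhds t)"
    using trace_log_derivative[OF B B1 B2 C det dB' dB1'] by blast+
  \<comment> \<open>The expansion at \<open>s\<close> is defined through choices in the quotient
    space at \<open>\<eta> s\<close>; near \<open>t\<close> it is matched with the differentiable
    matrix expression in the moving frame.\<close>
  have exp_eq: "mtrace (B1 s * minv (B s)) = expansion A L \<eta> J J' s"
    if s: "s \<in> K" and ds: "Determinant.det (B s) \<noteq> 0" for s
  proof -
    note E = endo(1,2)[OF K_fst(1)[OF s]]
    have "bij_betw (J s) (quot_space A L (\<eta> s) (vel s)) (quot_space A L (\<eta> s) (vel s))"
      using quot_endo_bij_iff[OF E(1) moving_basis[OF s] B JB[OF s]] ds by simp
    from quot_trace_quotient(1)[OF E moving_basis[OF s] B B1 JB[OF s] JB1[OF s] this]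
    show ?thesis by (simp add: expansion_def)
  qed
  have "eventually (\<lambda>s. s \<in> K) (nhds t)"
    using t_mem by (intro eventually_nhds_in_open) auto
  then have "eventually (\<lambda>s. mtrace (B1 s * minv (B s)) = expansion A L \<eta> J J' s) (nhds t)"
    using log(2) by eventually_elim (rule exp_eq)
  then have deriv: "(expansion A L \<eta> J J' has_real_derivative ?\<theta>') (at t)"
    using log(1) by (simp add: DERIV_cong_ev[OF refl _ refl])
  have exp_t: "expansion A L \<eta> J J' t = mtrace ?C" using exp_eq[OF t_mem det] by simp
  note inv = minv[OF B det]
  have Ccar: "?C \<in> carrier_mat ?d ?d" by (rule mult_carrier_mat[OF B1 inv(1)])
  define Rq where "Rq = Matrix.mat ?d ?d (\<lambda>(i, j). f i \<bullet> (?R *v e j))"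
  have Rq: "Rq \<in> carrier_mat ?d ?d" by (simp add: Rq_def)
  \<comment> \<open>The Jacobi equation read through the covectors \<open>f i\<close>, which kill
    the velocity and so are well defined on cosets.\<close>
  have B2_eq: "B2 = - (Rq * B t)"
  proof (rule eq_matI)
    fix i j assume "i < dim_row (- (Rq * B t))" "j < dim_col (- (Rq * B t))"
    then have ij: "i < ?d" "j < ?d" using Rq B[of t] by auto
    let ?y = "\<Sum>i<?d. B t $$ (i, j) *\<^sub>R e i" and ?b = "\<Sum>i<?d. B2 $$ (i, j) *\<^sub>R e i"
    have "?cl (e j) \<in> ?Q" using quot_basis_mem[OF basis_t ij(2)] by (auto simp: quot_space_def)
    then have "?cl ?b + quot_curv A L (\<eta> t) (vel t) (?cl ?y) = ?cl 0"
      using J''(2) tI JB2[OF ij(2)] JBt[OF ij(2)] by metis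
    \<comment> \<open>\<open>quot_curv\<close> is a union of cosets over all representatives. One of
      them is enough: the sum is the zero coset, and any of its elements is a multiple of the
      velocity.\<close>
    moreover have "?R *v ?y \<in> quot_curv A L (\<eta> t) (vel t) (?cl ?y)"
      unfolding quot_curv_def using quot_class_self by blast
    ultimately have "?b + ?R *v ?y \<in> ?cl 0"
      using quot_class_self[of ?b "vel t"] set_plus_intro by blast
    then obtain k where "?b + ?R *v ?y = k *\<^sub>R u t" by (auto simp: mem_quot_class vel_t)
    then have "f i \<bullet> ?b + f i \<bullet> (?R *v ?y) = 0"
      using frame_dual(2)[OF ij(1)] by (simp add: inner_add_right[symmetric])
    moreover have "f i \<bullet> ?b = (\<Sum>l<?d. if l = i then B2 $$ (l, j) else 0)"
      unfolding inner_sum_right by (rule sum.cong) (use frame_dual(1)[OF ij(1)] in auto)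
    moreover have "?R *v ?y = (\<Sum>l<?d. B t $$ (l, j) *\<^sub>R (?R *v e l))"
      by (simp only: linear_sum[OF matrix_vector_mul_linear[of ?R]] matrix_vector_mult_scaleR)
    moreover have "(Rq * B t) $$ (i, j) = (\<Sum>l<?d. B t $$ (l, j) * (f i \<bullet> (?R *v e l)))"
      using Rq B[of t] ij by (simp add: scalar_prod_def atLeast0LessThan Rq_def mult.commute)
    ultimately have "B2 $$ (i, j) + (Rq * B t) $$ (i, j) = 0"
      using ij(1) by (simp only: inner_sum_right inner_scaleR_right) (simp add: inner_sum_right)
    then show "B2 $$ (i, j) = (- (Rq * B t)) $$ (i, j)"
      using ij Rq B[of t] by simp
  qed (use B2 Rq B[of t] in auto)
  have "B2 * minv (B t) = - Rq"
    using B2_eq Rq B[of t] inv assoc_mult_mat[OF Rq B inv(1)] by simp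
  then have Ric: "mtrace (B2 * minv (B t)) = - Ric A L (\<eta> t) (vel t)"
    by (simp add: Ric_frame mtrace_def Rq_def sum_negf)
  have sym: "?C $$ (i, j) = ?C $$ (j, i)" if ij: "i < ?d" "j < ?d" for i j
  proof -
    let ?h = "quot_metric A L (\<eta> t) (vel t)" and ?comb = "quot_comb (vel t) e"
    interpret C: finsler_chart "local_expr A c L" "chart_slit c" by (rule finsler_chart_local[OF atlas lf c_mem(1)])
    have z: "(snd c (\<eta> t), vel t) \<in> chart_slit c"
      using velocity_coords_slit[OF c_mem(1) K_times[OF t_mem]] by (simp add: velocity_coords_def vel_t)
    have gs: "gmetric A L (\<eta> t) (vel t) a b = gmetric A L (\<eta> t) (vel t) b a" for a b
      unfolding gmetric_def by (subst sum.swap) (simp add: C.g_sym[OF z] mult_ac)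
    have v_np: "vel t \<in> null_perp A L (\<eta> t) (vel t)"
      using null_perp_Oc[OF t_mem, of "u t"] lam_u[OF t_mem] by (simp add: Oc_t vel_t)
    have np: "(\<Sum>i<?d. a i *\<^sub>R e i) \<in> null_perp A L (\<eta> t) (vel t)" for a
      by (intro subspace_sum[OF null_perp_subspace] subspace_scale[OF null_perp_subspace])
        (use quot_basis_mem[OF basis_t] in auto)
    have h: "?h (?comb a) (?cl (e l)) = a l" "?h (?cl (e l)) (?comb a) = a l" if l: "l < ?d" for a l
    proof -
      have el: "e l \<in> null_perp A L (\<eta> t) (vel t)" using quot_basis_mem[OF basis_t l] .
      have "gmetric A L (\<eta> t) (vel t) (e l) (\<Sum>i<?d. a i *\<^sub>R e i) = (\<Sum>i<?d. a i * gmetric A L (\<eta> t) (vel t) (e l) (e i))"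
        unfolding gmetric_pref
        by (simp only: linear_sum[OF matrix_vector_mul_linear] matrix_vector_mult_scaleR inner_sum_right inner_scaleR_right)
      also have "\<dots> = (\<Sum>i<?d. if i = l then a i else 0)"
        by (rule sum.cong) (use on[OF l] in auto)
      finally have "gmetric A L (\<eta> t) (vel t) (e l) (\<Sum>i<?d. a i *\<^sub>R e i) = a l" using l by simp
      then show "?h (?comb a) (?cl (e l)) = a l" "?h (?cl (e l)) (?comb a) = a l"
        unfolding quot_comb_def quot_metric_class[OF gs v_np np el] quot_metric_class[OF gs v_np el np]
        using gs by auto
    qed
    obtain JT JT' where T: "is_quot_transpose A L (\<eta> t) (vel t) (J t) JT" "is_quot_transpose A L (\<eta> t) (vel t) (J' t) JT'"
      "\<forall>q\<in>?Q. JT' (J t q) = JT (J' t q)"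
      using lag tI unfolding lagrange_tensor_field_def by blast
    have lagr: "?h (J t q) (J' t q') = ?h (J' t q) (J t q')" if q: "q \<in> ?Q" "q' \<in> ?Q" for q q'
    proof -
      have "J t q \<in> ?Q" "J' t q \<in> ?Q" using endo[OF tI] q by (auto simp: quot_endo_def)
      then have "?h (JT' (J t q)) q' = ?h (J t q) (J' t q')" "?h (JT (J' t q)) q' = ?h (J' t q) (J t q')"
        using T(1,2) q unfolding is_quot_transpose_def by blast+
      then show ?thesis using T(3) q by simp
    qed
    \<comment> \<open>\<open>?p l\<close> is the preimage of the class of \<open>e l\<close> under
      \<open>J t\<close>. Inserting \<open>?p i\<close> and \<open>?p j\<close> into the Lagrange
      identity pairs basis vectors with columns of \<open>?C\<close>, and orthonormality reads off
      the entries.\<close>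
    define \<delta> where "\<delta> l = (\<lambda>i. if i = l then 1 else 0 :: real)" for l :: nat
    let ?p = "\<lambda>l. ?comb (mat_apply ?d (minv (B t)) (\<delta> l))"
    have p: "?p l \<in> ?Q" "J t (?p l) = ?cl (e l)" "J' t (?p l) = ?comb (\<lambda>i. ?C $$ (i, l))" if l: "l < ?d" for l
    proof -
      note qt = quot_trace_quotient(2,3)[OF endo(1,2)[OF tI] basis_t B B1 JBt JB1t bij]
      show "?p l \<in> ?Q" by (rule quot_basis_comb(1)[OF basis_t])
      show "J t (?p l) = ?cl (e l)"
        using qt(1)[of "\<delta> l"] quot_comb_basis_vector[OF l, of "vel t" e] by (simp add: \<delta>_def)
      show "J' t (?p l) = ?comb (\<lambda>i. ?C $$ (i, l))"
        using qt(2)[of "\<delta> l"] by (simp add: \<delta>_def mat_apply_basis_vector[OF l] cong: quot_comb_cong)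
    qed
    have "?h (?cl (e i)) (?comb (\<lambda>k. ?C $$ (k, j))) = ?h (?comb (\<lambda>k. ?C $$ (k, i))) (?cl (e j))"
      using lagr[OF p(1)[OF ij(1)] p(1)[OF ij(2)]] p(2,3)[OF ij(1)] p(2,3)[OF ij(2)] by simp
    then show ?thesis unfolding h(2)[OF ij(1)] h(1)[OF ij(2)] .
  qed
  have "?d > 0" using dim by simp
  from mtrace_square_symmetric[OF Ccar this sym]
  have "(mtrace ?C)\<^sup>2 / real ?d \<le> mtrace (?C * ?C)" .
  moreover have "real ?d = real CARD('m) - 2" using dim by (simp add: of_nat_diff)
  ultimately have "?\<theta>' \<le> - (expansion A L \<eta> J J' t)\<^sup>2 / (real CARD('m) - 2) - Ric A L (\<eta> t) (vel t)"
    unfolding exp_t Ric by simp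
  with deriv show ?thesis by blast
qed

end

theorem (in null_geod) raychaudhuri:
  assumes "CARD('m) \<ge> 3" "t \<in> I" "lagrange_tensor_field A L I \<eta> J J'"
    and "bij_betw (J t) (quot_space A L (\<eta> t) (velocity A \<eta> t)) (quot_space A L (\<eta> t) (velocity A \<eta> t))"
  obtains \<theta>' where "(expansion A L \<eta> J J' has_real_derivative \<theta>') (at t)"
    "\<theta>' \<le> - (expansion A L \<eta> J J' t)\<^sup>2 / (real CARD('m) - 2) - Ric A L (\<eta> t) (velocity A \<eta> t)"
proof -
  obtain e z0 f fv fz r r' where fr: "null_geod_frame A L X I \<eta> t e z0 f fv fz r r'"
    and on: "\<And>i j. i < CARD('m) - 2 \<Longrightarrow> j < CARD('m) - 2 \<Longrightarrow>
       gmetric A L (\<eta> t) (velocity A \<eta> t) (e i) (e j) = (if i = j then 1 else 0)"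
    using adapted_frame[OF assms(2)] by blast
  interpret null_geod_frame A L X I \<eta> t e z0 f fv fz r r' by (rule fr)
  show ?thesis using frame_expansion_derivative[OF assms(1) on assms(3,4)] that by blast
qed

section \<open>Local uniqueness of geodesics\<close>

lemma smooth_on_lipschitz:
  fixes H :: "'a::euclidean_space \<Rightarrow> 'b::real_normed_vector"
  assumes "open S" "smooth_on S H" "z0 \<in> S"
  obtains \<rho> B where "\<rho> > 0" "cball z0 \<rho> \<subseteq> S" "B \<ge> 0"
    "\<And>x y. x \<in> cball z0 \<rho> \<Longrightarrow> y \<in> cball z0 \<rho> \<Longrightarrow> norm (H x - H y) \<le> B * norm (x - y)"
proof -
  obtain \<rho> where \<rho>: "\<rho> > 0" "cball z0 \<rho> \<subseteq> S"
    using assms(1,3) open_contains_cball by blast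
  let ?D = "\<lambda>z. frechet_derivative H (at z)"
  \<comment> \<open>The sum of the norms of the partial derivatives: continuous in \<open>z\<close>,
    hence bounded on the ball, and an upper bound for the operator norm.\<close>
  define q where "q z = (\<Sum>b\<in>Basis. norm (?D z b))" for z
  have "continuous_on (cball z0 \<rho>) q"
    unfolding q_def
    by (intro continuous_intros continuous_on_subset[OF smooth_on_continuous[OF smooth_on_frechet[OF assms(2)]] \<rho>(2)])
  moreover have "cball z0 \<rho> \<noteq> {}" using \<rho>(1) by auto
  ultimately obtain zm where zm: "\<And>z. z \<in> cball z0 \<rho> \<Longrightarrow> q z \<le> q zm"
    using continuous_attains_sup[OF compact_cball] by blast
  have "norm (H x - H y) \<le> q zm * norm (x - y)" if xy: "x \<in> cball z0 \<rho>" "y \<in> cball z0 \<rho>" for x y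
  proof (rule differentiable_bound[OF convex_cball _ _ xy])
    fix z assume z: "z \<in> cball z0 \<rho>"
    have D: "(H has_derivative ?D z) (at z)"
      using smooth_on_has_derivative[OF assms(2)] z \<rho>(2) by blast
    then show "(H has_derivative ?D z) (at z within cball z0 \<rho>)" by (rule has_derivative_at_withinI)
    have lin: "linear (?D z)" by (rule has_derivative_linear[OF D])
    show "onorm (?D z) \<le> q zm"
    proof (rule onorm_le)
      fix v
      have "?D z v = ?D z (\<Sum>b\<in>Basis. (v \<bullet> b) *\<^sub>R b)" by (simp add: euclidean_representation)
      also have "\<dots> = (\<Sum>b\<in>Basis. (v \<bullet> b) *\<^sub>R ?D z b)"
        by (simp only: linear_sum[OF lin] linear_cmul[OF lin])
      also have "norm \<dots> \<le> (\<Sum>b\<in>Basis. norm (?D z b) * norm v)"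
        by (rule sum_norm_le) (simp add: mult.commute[of "norm (?D z _)"] mult_right_mono Basis_le_norm)
      also have "\<dots> = q z * norm v" by (simp add: q_def sum_distrib_right)
      also have "\<dots> \<le> q zm * norm v" using zm[OF z] by (rule mult_right_mono) simp
      finally show "norm (?D z v) \<le> q zm * norm v" .
    qed
  qed
  moreover have "q zm \<ge> 0" by (simp add: q_def sum_nonneg)
  ultimately show ?thesis using that \<rho> by blast
qed

text \<open>Gronwall's argument for the squared distance: the bound \<open>2 B\<close> on its
  logarithmic rate makes its product with a decaying exponential nonincreasing forward in time, and
  its product with a growing one nondecreasing when approaching 0 from the past.\<close>

lemma lipschitz_ode_unique:
  fixes z1 z2 :: "real \<Rightarrow> 'a::euclidean_space"
  assumes d1: "\<And>s. \<bar>s\<bar> < \<delta> \<Longrightarrow> (z1 has_vector_derivative H (z1 s)) (at s)"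
    and d2: "\<And>s. \<bar>s\<bar> < \<delta> \<Longrightarrow> (z2 has_vector_derivative H (z2 s)) (at s)"
    and lip: "\<And>s. \<bar>s\<bar> < \<delta> \<Longrightarrow> norm (H (z1 s) - H (z2 s)) \<le> B * norm (z1 s - z2 s)"
    and init: "z1 0 = z2 0" and s: "\<bar>s\<bar> < \<delta>"
  shows "z1 s = z2 s"
proof -
  define \<phi> where "\<phi> s = (z1 s - z2 s) \<bullet> (z1 s - z2 s)" for s
  define \<phi>' where "\<phi>' s = 2 * ((z1 s - z2 s) \<bullet> (H (z1 s) - H (z2 s)))" for s
  have d\<phi>: "(\<phi> has_real_derivative \<phi>' s) (at s)" if "\<bar>s\<bar> < \<delta>" for s
  proof -
    have "((\<lambda>s. z1 s - z2 s) has_derivative (\<lambda>r. r *\<^sub>R (H (z1 s) - H (z2 s)))) (at s)"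
      using has_vector_derivative_diff[OF d1[OF that] d2[OF that]] by (simp add: has_vector_derivative_def)
    from has_derivative_inner[OF this this] show ?thesis
      unfolding \<phi>_def \<phi>'_def
      by (rule has_derivative_imp_has_field_derivative) (simp add: inner_commute algebra_simps)
  qed
  have bound: "\<bar>\<phi>' s\<bar> \<le> 2 * B * \<phi> s" if "\<bar>s\<bar> < \<delta>" for s
  proof -
    have "\<bar>(z1 s - z2 s) \<bullet> (H (z1 s) - H (z2 s))\<bar> \<le> norm (z1 s - z2 s) * norm (H (z1 s) - H (z2 s))"
      by (rule Cauchy_Schwarz_ineq2)
    also have "\<dots> \<le> norm (z1 s - z2 s) * (B * norm (z1 s - z2 s))"
      using lip[OF that] by (rule mult_left_mono) simp
    also have "\<dots> = B * \<phi> s" by (simp add: \<phi>_def dot_square_norm power2_eq_square)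
    finally show ?thesis by (simp add: \<phi>'_def abs_mult)
  qed
  have 0: "\<phi> 0 = 0" by (simp add: \<phi>_def init)
  have "\<phi> s \<le> 0"
  proof (cases "s \<ge> 0")
    case True
    have "\<phi> s * exp (- (2 * B) * s) \<le> \<phi> 0 * exp (- (2 * B) * 0)"
    proof (rule DERIV_nonpos_imp_nonincreasing[OF True])
      fix x assume x: "0 \<le> x" "x \<le> s"
      then have xd: "\<bar>x\<bar> < \<delta>" using s by simp
      have "((\<lambda>s. \<phi> s * exp (- (2 * B) * s)) has_real_derivative (\<phi>' x - 2 * B * \<phi> x) * exp (- (2 * B) * x)) (at x)"
        by (auto intro!: derivative_eq_intros d\<phi>[OF xd] simp: algebra_simps)
      moreover have "(\<phi>' x - 2 * B * \<phi> x) * exp (- (2 * B) * x) \<le> 0"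
        using bound[OF xd] by (intro mult_nonpos_nonneg) auto
      ultimately show "\<exists>y. ((\<lambda>s. \<phi> s * exp (- (2 * B) * s)) has_real_derivative y) (at x) \<and> y \<le> 0" by blast
    qed
    then show ?thesis using 0 by (simp add: mult_le_0_iff)
  next
    case False
    have "\<phi> s * exp (2 * B * s) \<le> \<phi> 0 * exp (2 * B * 0)"
    proof (rule DERIV_nonneg_imp_nondecreasing[of s 0])
      show "s \<le> 0" using False by simp
      fix x assume x: "s \<le> x" "x \<le> 0"
      then have xd: "\<bar>x\<bar> < \<delta>" using s by simp
      have "((\<lambda>s. \<phi> s * exp (2 * B * s)) has_real_derivative (\<phi>' x + 2 * B * \<phi> x) * exp (2 * B * x)) (at x)"
        by (auto intro!: derivative_eq_intros d\<phi>[OF xd] simp: algebra_simps)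
      moreover have "(\<phi>' x + 2 * B * \<phi> x) * exp (2 * B * x) \<ge> 0"
        using bound[OF xd] by (intro mult_nonneg_nonneg) auto
      ultimately show "\<exists>y. ((\<lambda>s. \<phi> s * exp (2 * B * s)) has_real_derivative y) (at x) \<and> 0 \<le> y" by blast
    qed
    then show ?thesis using 0 by (simp add: mult_le_0_iff)
  qed
  moreover have "\<phi> s \<ge> 0" by (simp add: \<phi>_def)
  ultimately have "\<phi> s = 0" by simp
  then show ?thesis by (simp add: \<phi>_def)
qed

text \<open>In one chart the geodesic equation becomes a first order system for position and
  velocity whose right side \<open>H\<close> is smooth off the zero section, hence locally
  Lipschitz. This is what pins down the geodesic selected by \<open>geodesic_from\<close>.\<close>

lemma geodesic_unique:
  fixes A :: "('a::topological_space, 'm::finite) chart set"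
  assumes atlas: "smooth_atlas A" and lf: "lorentz_finsler A L"
    and g1: "causal_geodesic A L X I1 \<sigma>1" "open I1" "0 \<in> I1"
    and g2: "causal_geodesic A L X I2 \<sigma>2" "open I2" "0 \<in> I2"
    and init: "\<sigma>1 0 = \<sigma>2 0" "velocity A \<sigma>1 0 = velocity A \<sigma>2 0"
  shows "eventually (\<lambda>s. \<sigma>1 s = \<sigma>2 s \<and> velocity A \<sigma>1 s = velocity A \<sigma>2 s) (nhds 0)"
proof -
  interpret g1: causal_geod A L X I1 \<sigma>1 by unfold_locales fact+
  interpret g2: causal_geod A L X I2 \<sigma>2 by unfold_locales fact+
  define c where "c = pref_chart A (\<sigma>1 0)"
  have c: "c \<in> A" "\<sigma>1 0 \<in> fst c" "\<sigma>2 0 \<in> fst c"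
    using pref_chart[OF atlas] init(1) by (simp_all add: c_def)
  interpret C: finsler_chart "local_expr A c L" "chart_slit c" by (rule finsler_chart_local[OF atlas lf c(1)])
  let ?z1 = "velocity_coords c \<sigma>1" and ?z2 = "velocity_coords c \<sigma>2"
  define H where "H z = (snd z, \<chi> \<alpha>. - 2 * spray (local_expr A c L) \<alpha> z)" for z
  have "smooth_on (chart_slit c) (\<lambda>z. \<chi> \<alpha>. - 2 * spray (local_expr A c L) \<alpha> z)"
    by (rule smooth_on_vec_lambda[OF C.open_S])
      (simp, intro smooth_on_minus smooth_on_mult C.open_S smooth_on_const C.smooth_spray)
  then have smH: "smooth_on (chart_slit c) H"
    unfolding H_def by (intro smooth_on_Pair smooth_on_snd smooth_on_id C.open_S)
  have T: "0 \<in> g1.chart_times c" "0 \<in> g2.chart_times c"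
    using c g1(3) g2(3) by (auto simp: g1.chart_times_def g2.chart_times_def)
  have z0: "?z1 0 = ?z2 0"
    using g1.to_chart_velocity[OF c(1) T(1)] g2.to_chart_velocity[OF c(1) T(2)] init
    by (simp add: velocity_coords_def)
  obtain \<rho> B where \<rho>: "\<rho> > 0" "cball (?z1 0) \<rho> \<subseteq> chart_slit c"
    and lip: "\<And>x y. x \<in> cball (?z1 0) \<rho> \<Longrightarrow> y \<in> cball (?z1 0) \<rho> \<Longrightarrow> norm (H x - H y) \<le> B * norm (x - y)"
    using smooth_on_lipschitz[OF C.open_S smH g1.velocity_coords_slit[OF c(1) T(1)]] by metis
  have near: "eventually (\<lambda>s. s \<in> chart_times \<and> z s \<in> ball (z 0) \<rho>) (nhds 0)"
    if "open chart_times" "0 \<in> chart_times" "smooth_on chart_times z" for chart_times and z :: "real \<Rightarrow> 'm tangent"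
  proof -
    have "open (chart_times \<inter> z -` ball (z 0) \<rho>)"
      by (rule continuous_open_preimage[OF smooth_on_continuous[OF that(3)] that(1) open_ball])
    then show ?thesis
      using eventually_nhds_in_open[of "chart_times \<inter> z -` ball (z 0) \<rho>" 0] that(2) \<rho>(1) by simp
  qed
  have "eventually (\<lambda>s. (s \<in> g1.chart_times c \<and> ?z1 s \<in> ball (?z1 0) \<rho>) \<and> (s \<in> g2.chart_times c \<and> ?z2 s \<in> ball (?z1 0) \<rho>)) (nhds 0)"
    using near[OF g1.open_chart_times[OF c(1)] T(1) g1.smooth_velocity_coords[OF c(1)]]
      near[OF g2.open_chart_times[OF c(1)] T(2) g2.smooth_velocity_coords[OF c(1)]]
    unfolding z0 by (rule eventually_conj)
  then obtain \<delta> where \<delta>: "\<delta> > 0" and nb: "\<And>s. \<bar>s\<bar> < \<delta> \<Longrightarrow> s \<in> g1.chart_times c \<and> ?z1 s \<in> ball (?z1 0) \<rho> \<and> s \<in> g2.chart_times c \<and> ?z2 s \<in> ball (?z1 0) \<rho>"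
    unfolding eventually_nhds_metric dist_real_def by auto
  have eq: "?z1 s = ?z2 s" if "\<bar>s\<bar> < \<delta>" for s
  proof (rule lipschitz_ode_unique[where ?z1.0="?z1" and ?z2.0="?z2" and H=H and \<delta>=\<delta> and B=B, OF _ _ _ z0 that])
    fix s assume s: "\<bar>s\<bar> < \<delta>"
    show "(?z1 has_vector_derivative H (?z1 s)) (at s)"
      using g1.velocity_coords_derivative[OF c(1)] nb[OF s] by (simp add: H_def velocity_coords_def)
    show "(?z2 has_vector_derivative H (?z2 s)) (at s)"
      using g2.velocity_coords_derivative[OF c(1)] nb[OF s] by (simp add: H_def velocity_coords_def)
    show "norm (H (?z1 s) - H (?z2 s)) \<le> B * norm (?z1 s - ?z2 s)"
      using nb[OF s] by (intro lip) auto
  qed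
  have "\<sigma>1 s = \<sigma>2 s \<and> velocity A \<sigma>1 s = velocity A \<sigma>2 s" if "\<bar>s\<bar> < \<delta>" for s
  proof -
    have t: "s \<in> g1.chart_times c" "s \<in> g2.chart_times c" using nb[OF that] by auto
    have e: "snd c (\<sigma>1 s) = snd c (\<sigma>2 s)" "g1.coord_velocity c s = g2.coord_velocity c s"
      using eq[OF that] by (simp_all add: velocity_coords_def)
    have "\<sigma>1 s = \<sigma>2 s"
      using arg_cong[OF e(1), of "chart_inv c"] chart_inv_left[OF atlas c(1)]
        g1.chart_times_mem(2)[OF c(1) t(1)] g2.chart_times_mem(2)[OF c(1) t(2)] by simp
    moreover have "velocity A \<sigma>1 s = velocity A \<sigma>2 s"
      unfolding g1.velocity_eq[OF c(1) t(1)] g2.velocity_eq[OF c(1) t(2)] e ..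
    ultimately show ?thesis by simp
  qed
  then show ?thesis unfolding eventually_nhds_metric dist_real_def using \<delta> by auto
qed

section \<open>Reparametrization and the weight along a geodesic\<close>

lemma lorentz_finsler_scale: "lorentz_finsler A L \<Longrightarrow> k > 0 \<Longrightarrow> L p (k *\<^sub>R v) = k\<^sup>2 * L p v"
  by (simp add: lorentz_finsler_def)

lemma lorentz_finsler_zero: "lorentz_finsler A L \<Longrightarrow> L p 0 = 0"
  using lorentz_finsler_scale[of A L 2 p 0] by simp

text \<open>The segment of the ray between \<open>v\<close> and \<open>k v\<close> is connected and
  avoids 0, and the closed timelike set is invariant under positive scaling; so both ends lie in one
  component.\<close>

lemma future_causal_scale:
  assumes L: "lorentz_finsler A L" and v: "future_causal L X p v" and k: "k > 0"
  shows "future_causal L X p (k *\<^sub>R v)"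
proof -
  let ?T = "{w. timelike L p w}"
  let ?S = "closure ?T - {0}"
  have scaleT: "(*\<^sub>R) s ` ?T \<subseteq> ?T" if "s > 0" for s
    using lorentz_finsler_scale[OF L that] that by (auto simp: timelike_def mult_less_0_iff)
  have vS: "v \<in> ?S" and comp: "connected_component ?S (X p) v"
    using v connected_component_in unfolding future_causal_def by blast+
  have scaleS: "s *\<^sub>R v \<in> ?S" if "s > 0" for s
  proof -
    have "s *\<^sub>R v \<in> (*\<^sub>R) s ` closure ?T" using vS by blast
    also have "\<dots> = closure ((*\<^sub>R) s ` ?T)" by (rule closure_scaleR)
    also have "\<dots> \<subseteq> closure ?T" by (rule closure_mono[OF scaleT[OF that]])
    finally show ?thesis using vS that by simp
  qed
  have "connected ((\<lambda>s. s *\<^sub>R v) ` {min 1 k..max 1 k})"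
    by (intro connected_continuous_image continuous_intros) simp
  moreover have "(\<lambda>s. s *\<^sub>R v) ` {min 1 k..max 1 k} \<subseteq> ?S"
    by (intro image_subsetI scaleS) (use k in auto)
  moreover have "v \<in> (\<lambda>s. s *\<^sub>R v) ` {min 1 k..max 1 k}" by (rule image_eqI[of _ _ 1]) auto
  moreover have "k *\<^sub>R v \<in> (\<lambda>s. s *\<^sub>R v) ` {min 1 k..max 1 k}" by (rule image_eqI[of _ _ k]) auto
  ultimately have "connected_component ?S v (k *\<^sub>R v)"
    unfolding connected_component_def by blast
  then have "connected_component ?S (X p) (k *\<^sub>R v)" using comp connected_component_trans by blast
  moreover have "causal L p (k *\<^sub>R v)"
    using v k lorentz_finsler_scale[OF L k]
    by (auto simp: future_causal_def causal_def timelike_def lightlike_def mult_less_0_iff)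
  ultimately show ?thesis by (simp add: future_causal_def)
qed

text \<open>The weight lives on the closure of the open cone, while geodesics are described by
  components of the closed one. A lightlike \<open>v\<close> is approximated by moving against the
  fibre gradient \<open>m\<close> of \<open>L\<close>: \<open>L\<close> decreases at first order,
  \<open>m\<close> being nonzero since the metric is invertible, and the segment stays in the
  component of \<open>v\<close>.\<close>

lemma future_causal_closure:
  fixes A :: "('a::topological_space, 'm::finite) chart set"
  assumes atlas: "smooth_atlas A" and L: "lorentz_finsler A L" and v: "future_causal L X p v"
  shows "v \<in> closure (Omega L X p)"
proof (cases "timelike L p v")
  case True
  then have "v \<in> Omega L X p" using v by (simp add: Omega_def)
  then show ?thesis using closure_subset by blast
next
  case False
  then have l: "L p v = 0" "v \<noteq> 0" using v by (auto simp: future_causal_def causal_def lightlike_def)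
  let ?c = "pref_chart A p"
  note c = pref_chart[OF atlas, of p]
  interpret C: finsler_chart "local_expr A ?c L" "chart_slit ?c" by (rule finsler_chart_local[OF atlas L c(1)])
  let ?z = "(snd ?c p, v)"
  have z: "?z \<in> chart_slit ?c" using c l by (auto simp: chart_slit_def)
  define m where "m = (\<chi> \<alpha>. dv \<alpha> (local_expr A ?c L) ?z)"
  have expr: "local_expr A ?c L (snd ?c p, w) = L p w" for w
    by (simp add: local_expr_snd[OF atlas c] of_chart_pref[OF atlas])
  have gv: "C.g ?z *v v = m"
    using C.g_snd[OF z] by (simp add: vec_eq_iff matrix_vector_mult_def m_def)
  have "m \<noteq> 0"
  proof
    assume "m = 0"
    then have "matrix_inv (C.g ?z) *v (C.g ?z *v v) = 0" unfolding gv by simp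
    then show False
      using matrix_inv_mult(2)[OF C.inv_g[OF z]] l(2) by (simp add: matrix_vector_mul_assoc)
  qed
  have "DERIV (\<lambda>s. L p (v + s *\<^sub>R (- m))) 0 :> - (m \<bullet> m)"
    using C.fibre_derivative[OF z, of "- m"] by (simp add: expr m_def inner_vec_def sum_negf)
  moreover have "- (m \<bullet> m) < 0" using \<open>m \<noteq> 0\<close> by simp
  ultimately obtain d where d: "d > 0" "\<And>s. 0 < s \<Longrightarrow> s < d \<Longrightarrow> L p (v + s *\<^sub>R (- m)) < 0"
    using DERIV_neg_dec_right[of "\<lambda>s. L p (v + s *\<^sub>R (- m))" "- (m \<bullet> m)" 0] l(1) by auto
  let ?S = "closure {w. timelike L p w} - {0}"
  have comp: "connected_component ?S (X p) v" using v by (simp add: future_causal_def)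
  then have vS: "v \<in> ?S" by (rule connected_component_in[THEN conjunct2])
  have Om: "v + s *\<^sub>R (- m) \<in> Omega L X p" if s: "0 < s" "s < d" for s
  proof -
    have in_S: "v + r *\<^sub>R (- m) \<in> ?S" if "0 \<le> r" "r \<le> s" for r
    proof (cases "r = 0")
      case False
      then have "L p (v + r *\<^sub>R (- m)) < 0" using d(2) that s by simp
      then have "v + r *\<^sub>R (- m) \<in> {w. timelike L p w}" "v + r *\<^sub>R (- m) \<noteq> 0"
        using lorentz_finsler_zero[OF L, of p] by (auto simp: timelike_def simp del: scaleR_minus_right add_uminus_conv_diff)
      then show ?thesis using closure_subset by blast
    qed (use vS in simp)
    have "connected ((\<lambda>r. v + r *\<^sub>R (- m)) ` {0..s})"
      by (intro connected_continuous_image continuous_intros) simp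
    moreover have "(\<lambda>r. v + r *\<^sub>R (- m)) ` {0..s} \<subseteq> ?S" using in_S by auto
    moreover have "v \<in> (\<lambda>r. v + r *\<^sub>R (- m)) ` {0..s}" by (rule image_eqI[of _ _ 0]) (use s in auto)
    moreover have "v + s *\<^sub>R (- m) \<in> (\<lambda>r. v + r *\<^sub>R (- m)) ` {0..s}" by (rule image_eqI[of _ _ s]) (use s in auto)
    ultimately have "connected_component ?S v (v + s *\<^sub>R (- m))"
      unfolding connected_component_def by blast
    then have "connected_component ?S (X p) (v + s *\<^sub>R (- m))" using comp connected_component_trans by blast
    then show ?thesis using d(2)[OF s] by (simp add: Omega_def future_causal_def causal_def timelike_def)
  qed
  show ?thesis
    unfolding closure_approachable
  proof (intro allI impI)
    fix e :: real assume e: "e > 0"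
    define s where "s = min (d / 2) (e / (2 * norm m))"
    have nm: "norm m > 0" using \<open>m \<noteq> 0\<close> by simp
    have s: "0 < s" "s < d" using d(1) e nm by (auto simp: s_def)
    have "s * norm m \<le> (e / (2 * norm m)) * norm m" using nm by (intro mult_right_mono) (auto simp: s_def)
    also have "\<dots> < e" using nm e by simp
    finally have "dist (v + s *\<^sub>R (- m)) v < e" using s by (simp add: dist_norm)
    then show "\<exists>y\<in>Omega L X p. dist y v < e" using Om[OF s] by blast
  qed
qed

lemma DERIV_affine:
  fixes q :: "real \<Rightarrow> real"
  assumes "(q has_real_derivative q') (at (t + k * s))"
  shows "((\<lambda>s. q (t + k * s)) has_real_derivative k * q') (at s)"
proof -
  have "((\<lambda>s. t + k * s) has_real_derivative k) (at s)"
    by (auto intro!: derivative_eq_intros)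
  from DERIV_chain2[where f=q and g="\<lambda>s. t + k * s", OF assms this] show ?thesis
    by (simp add: mult.commute)
qed

context causal_geod
begin

lemma reparam_vector_derivative:
  assumes "(h has_vector_derivative h') (at (t + k * s))"
  shows "((\<lambda>s. h (t + k * s)) has_vector_derivative k *\<^sub>R h') (at s)"
proof -
  have "((\<lambda>s. t + k * s) has_vector_derivative k) (at s)"
    by (auto intro!: derivative_eq_intros simp: has_real_derivative_iff_has_vector_derivative[symmetric])
  from vector_diff_chain_at[OF this assms] show ?thesis by (simp add: o_def)
qed

text \<open>The factor \<open>k\<close> scales the velocity and its square scales the acceleration,
  in agreement with the degree 2 of the spray. The sign of \<open>k\<close> keeps the curve
  future-directed.\<close>

lemma reparam:
  fixes k t \<delta> :: real
  defines "\<sigma> \<equiv> \<lambda>s. \<eta> (t + k * s)"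
  assumes k: "k > 0" and dom: "\<And>s. \<bar>s\<bar> < \<delta> \<Longrightarrow> t + k * s \<in> I"
  shows "causal_geodesic A L X {-\<delta><..<\<delta>} \<sigma>"
    and "\<bar>s\<bar> < \<delta> \<Longrightarrow> velocity A \<sigma> s = k *\<^sub>R velocity A \<eta> (t + k * s)"
proof -
  let ?J = "{-\<delta><..<\<delta>}"
  have J: "s \<in> ?J \<longleftrightarrow> \<bar>s\<bar> < \<delta>" for s by auto
  have pos: "((snd c \<circ> \<sigma>) has_vector_derivative k *\<^sub>R coord_velocity c (t + k * s)) (at s)"
    if "c \<in> A" "t + k * s \<in> chart_times c" for c s
    using reparam_vector_derivative[OF position_derivative[OF that]] by (simp add: \<sigma>_def o_def)
  have vel: "velocity A \<sigma> s = k *\<^sub>R velocity A \<eta> (t + k * s)" if s: "\<bar>s\<bar> < \<delta>" for s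
  proof -
    let ?c = "pref_chart A (\<eta> (t + k * s))"
    have "?c \<in> A" "t + k * s \<in> chart_times ?c"
      using pref_chart[OF atlas] dom[OF s] by (auto simp: chart_times_def)
    from vector_derivative_at[OF pos[OF this]] show ?thesis
      by (simp add: velocity_def \<sigma>_def)
  qed
  then show "\<bar>s\<bar> < \<delta> \<Longrightarrow> velocity A \<sigma> s = k *\<^sub>R velocity A \<eta> (t + k * s)" .
  have cont: "continuous_on ?J \<sigma>"
    unfolding \<sigma>_def
    by (rule continuous_on_compose2[OF cont_\<eta>(1)]) (use dom in \<open>auto intro!: continuous_intros simp: J\<close>)
  have open_T: "open {s \<in> ?J. \<sigma> s \<in> fst c}" if c: "c \<in> A" for c
  proof -
    have "open (?J \<inter> \<sigma> -` fst c)"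
      by (rule continuous_open_preimage[OF cont _ chart_dom_open[OF atlas c]]) simp
    moreover have "?J \<inter> \<sigma> -` fst c = {s \<in> ?J. \<sigma> s \<in> fst c}" by auto
    ultimately show ?thesis by simp
  qed
  have times: "t + k * s \<in> chart_times c" if "s \<in> {s \<in> ?J. \<sigma> s \<in> fst c}" for s c
    using that dom[of s] by (simp add: chart_times_def \<sigma>_def abs_less_iff)
  have smooth: "smooth_on {s \<in> ?J. \<sigma> s \<in> fst c} (snd c \<circ> \<sigma>)" if c: "c \<in> A" for c
  proof -
    have "smooth_on {s \<in> ?J. \<sigma> s \<in> fst c} (\<lambda>s. (snd c \<circ> \<eta>) (t + k * s))"
    proof (rule smooth_on_compose[OF open_T[OF c] open_chart_times[OF c] _ _ smooth_position[OF c]])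
      show "(\<lambda>s. t + k * s) ` {s \<in> ?J. \<sigma> s \<in> fst c} \<subseteq> chart_times c" using times by blast
      show "smooth_on {s \<in> ?J. \<sigma> s \<in> fst c} (\<lambda>s. t + k * s)"
        by (intro smooth_on_add smooth_on_mult smooth_on_const smooth_on_id open_T c)
    qed
    then show ?thesis by (simp add: \<sigma>_def o_def)
  qed
  have causal: "future_causal L X (\<sigma> s) (velocity A \<sigma> s)" if "s \<in> ?J" for s
  proof -
    have s: "\<bar>s\<bar> < \<delta>" using that by auto
    have "future_causal L X (\<eta> (t + k * s)) (velocity A \<eta> (t + k * s))"
      using geod dom[OF s] unfolding causal_geodesic_def by blast
    from future_causal_scale[OF lf this k] show ?thesis
      unfolding vel[OF s] by (simp add: \<sigma>_def)
  qed
  have geo: "vector_derivative (\<lambda>s. vector_derivative (snd c \<circ> \<sigma>) (at s)) (at s) $ \<alpha>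
      + 2 * spray (local_expr A c L) \<alpha> (velocity_coords c \<sigma> s) = 0"
    if c: "c \<in> A" and s: "s \<in> ?J" "\<sigma> s \<in> fst c" for c s \<alpha>
  proof -
    interpret C: finsler_chart "local_expr A c L" "chart_slit c" by (rule finsler_chart_local[OF atlas lf c])
    have sT: "s \<in> {s \<in> ?J. \<sigma> s \<in> fst c}" using s by blast
    let ?z = "velocity_coords c \<eta> (t + k * s)"
    have vd: "vector_derivative (snd c \<circ> \<sigma>) (at s) = k *\<^sub>R coord_velocity c (t + k * s)"
      if "s \<in> {s \<in> ?J. \<sigma> s \<in> fst c}" for s
      by (rule vector_derivative_at[OF pos[OF c times[OF that]]])
    have "((\<lambda>s. k *\<^sub>R coord_velocity c (t + k * s)) has_vector_derivative
        k *\<^sub>R k *\<^sub>R (\<chi> \<alpha>. - 2 * spray (local_expr A c L) \<alpha> ?z)) (at s)"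
      by (rule bounded_linear.has_vector_derivative[OF bounded_linear_scaleR_right
            reparam_vector_derivative[OF acceleration[OF c times[OF sT]]]])
    then have "((\<lambda>s. vector_derivative (snd c \<circ> \<sigma>) (at s)) has_vector_derivative
        k *\<^sub>R k *\<^sub>R (\<chi> \<alpha>. - 2 * spray (local_expr A c L) \<alpha> ?z)) (at s)"
      by (rule has_vector_derivative_transform_within_open[OF _ open_T[OF c] sT]) (simp add: vd)
    from vector_derivative_at[OF this]
    have "vector_derivative (\<lambda>s. vector_derivative (snd c \<circ> \<sigma>) (at s)) (at s) $ \<alpha> =
        - 2 * (k\<^sup>2 * spray (local_expr A c L) \<alpha> ?z)"
      by (simp add: power2_eq_square)
    moreover have "velocity_coords c \<sigma> s = (fst ?z, k *\<^sub>R snd ?z)"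
      by (simp add: velocity_coords_def vd[OF sT]) (simp add: \<sigma>_def)
    moreover have "spray (local_expr A c L) \<alpha> (fst ?z, k *\<^sub>R snd ?z) = k\<^sup>2 * spray (local_expr A c L) \<alpha> ?z"
      using C.hom_spray[of \<alpha>] velocity_coords_slit[OF c times[OF sT]] k unfolding homogeneous_def
      by (metis prod.collapse)
    ultimately show ?thesis by simp
  qed
  show "causal_geodesic A L X ?J \<sigma>"
    unfolding causal_geodesic_def smooth_curve_def
    by (intro conjI ballI impI allI cont smooth causal geo)
qed

lemma velocity_closure:
  assumes "s \<in> I" shows "velocity A \<eta> s \<in> closure (Omega L X (\<eta> s)) - {0}"
proof -
  have "future_causal L X (\<eta> s) (velocity A \<eta> s)"
    using geod assms unfolding causal_geodesic_def by blast
  from future_causal_closure[OF atlas lf this] causal_velocity_nonzero[OF assms]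
  show ?thesis by simp
qed

text \<open>On the boundary of the cone the weight is smooth only through local extensions. The
  velocity curve stays in the domain of the weight, so near \<open>t\<close> the weight along
  \<open>\<eta>\<close> is the composition of a smooth extension \<open>g\<close> with a smooth
  curve.\<close>

lemma weight_along_locally_smooth:
  assumes w: "weight A L X \<psi>" and t: "t \<in> I"
  obtains N where "open N" "t \<in> N" "N \<subseteq> I" "smooth_on N (weight_along A \<psi> \<eta>)"
proof -
  define c where "c = pref_chart A (\<eta> t)"
  have c: "c \<in> A" "\<eta> t \<in> fst c" using pref_chart[OF atlas] by (simp_all add: c_def)
  have tc: "t \<in> chart_times c" using c t by (simp add: chart_times_def)
  let ?z = "velocity_coords c \<eta>"
  let ?D = "{(x, u). x \<in> snd c ` fst c \<and> u \<noteq> 0 \<and> of_chart A c x u \<in> closure (Omega L X (chart_inv c x))}"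
  have zD: "?z s \<in> ?D" if s: "s \<in> chart_times c" for s
  proof -
    note mem = chart_times_mem[OF c(1) s]
    have inv: "chart_inv c (snd c (\<eta> s)) = \<eta> s" by (rule chart_inv_left[OF atlas c(1) mem(2)])
    have v: "of_chart A c (snd c (\<eta> s)) (coord_velocity c s) \<in> closure (Omega L X (\<eta> s))"
      using DiffD1[OF velocity_closure[OF mem(1)]] by (simp only: velocity_eq[OF c(1) s])
    show ?thesis
      unfolding velocity_coords_def
      by (simp only: mem_Collect_eq prod.case inv) (use v coord_velocity_nonzero[OF c(1) s] mem(2) in blast)
  qed
  have "smooth_ext_on ?D (local_expr A c \<psi>)"
    by (rule bspec[OF conjunct1[OF w[unfolded weight_def]] c(1)])
  from bspec[OF this[unfolded smooth_ext_on_def] zD[OF tc]]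
  obtain U g where U: "open U" "?z t \<in> U" "smooth_on U g" "\<forall>y\<in>?D \<inter> U. g y = local_expr A c \<psi> y"
    by (elim exE conjE)
  define N where "N = chart_times c \<inter> ?z -` U"
  have N: "open N"
    unfolding N_def
    by (rule continuous_open_preimage[OF smooth_on_continuous[OF smooth_velocity_coords[OF c(1)]] open_chart_times[OF c(1)] U(1)])
  have sm: "smooth_on N (\<lambda>s. g (?z s))"
    by (rule smooth_on_compose[OF N U(1) _ smooth_on_subset[OF smooth_velocity_coords[OF c(1)]] U(3)])
      (auto simp: N_def)
  have eq: "g (?z s) = weight_along A \<psi> \<eta> s" if "s \<in> N" for s
  proof -
    have s: "s \<in> chart_times c" "?z s \<in> U" using that by (auto simp: N_def)
    have "g (?z s) = local_expr A c \<psi> (?z s)" by (rule bspec[OF U(4) IntI[OF zD[OF s(1)] s(2)]])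
    also have "\<dots> = weight_along A \<psi> \<eta> s"
      unfolding weight_along_def velocity_eq[OF c(1) s(1)] velocity_coords_def
      by (rule local_expr_snd[OF atlas c(1) chart_times_mem(2)[OF c(1) s(1)]])
    finally show ?thesis .
  qed
  have "smooth_on N (weight_along A \<psi> \<eta>)" by (rule smooth_on_cong[OF N eq sm])
  moreover have "t \<in> N" "N \<subseteq> I" using tc U(2) by (auto simp: N_def chart_times_def)
  ultimately show ?thesis using that[of N] N by simp
qed

end

section \<open>Derivatives of the weight and the sign of the weighted Ricci curvature under
  rescaling\<close>

lemma smooth_on_deriv:
  fixes f :: "real \<Rightarrow> real"
  assumes "open S" "smooth_on S f"
  shows "s \<in> S \<Longrightarrow> (f has_real_derivative deriv f s) (at s)" and "smooth_on S (deriv f)"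
proof -
  show d: "(f has_real_derivative deriv f s) (at s)" if "s \<in> S" for s
    using smooth_on_differentiable[OF assms(2) that] DERIV_deriv_iff_real_differentiable by blast
  have "vector_derivative f (at s) = deriv f s" if "s \<in> S" for s
    using d[OF that] by (simp add: has_real_derivative_iff_has_vector_derivative vector_derivative_at)
  then show "smooth_on S (deriv f)"
    by (rule smooth_on_cong[OF assms(1) _ smooth_on_vector_derivative[OF assms]])
qed

context causal_geod
begin

lemma weight_along_derivatives:
  assumes w: "weight A L X \<psi>" and t: "t \<in> I"
  shows "(weight_along A \<psi> \<eta> has_real_derivative deriv (weight_along A \<psi> \<eta>) t) (at t)"
    "(deriv (weight_along A \<psi> \<eta>) has_real_derivative deriv (deriv (weight_along A \<psi> \<eta>)) t) (at t)"
proof -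
  obtain N where N: "open N" "t \<in> N" "N \<subseteq> I" "smooth_on N (weight_along A \<psi> \<eta>)"
    by (rule weight_along_locally_smooth[OF w t])
  note d = smooth_on_deriv[OF N(1,4)]
  show "(weight_along A \<psi> \<eta> has_real_derivative deriv (weight_along A \<psi> \<eta>) t) (at t)"
    by (rule d(1)[OF N(2)])
  show "(deriv (weight_along A \<psi> \<eta>) has_real_derivative deriv (deriv (weight_along A \<psi> \<eta>)) t) (at t)"
    by (rule smooth_on_deriv(1)[OF N(1) d(2) N(2)])
qed

text \<open>The affine reparametrization of \<open>\<eta>\<close> shows that a geodesic with this
  initial velocity exists; by uniqueness, whichever one was selected coincides with it near
  0.\<close>

lemma geodesic_from_reparam:
  assumes t: "t \<in> I" and k: "k > 0"
  defines "\<sigma> \<equiv> geodesic_from A L X (\<eta> t) (k *\<^sub>R velocity A \<eta> t)"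
  shows "eventually (\<lambda>s. t + k * s \<in> I \<and> \<sigma> s = \<eta> (t + k * s) \<and> velocity A \<sigma> s = k *\<^sub>R velocity A \<eta> (t + k * s)) (nhds 0)"
proof -
  obtain \<epsilon> where \<epsilon>: "\<epsilon> > 0" "ball t \<epsilon> \<subseteq> I" by (rule openE[OF open_I t])
  define \<delta> where "\<delta> = \<epsilon> / k"
  have \<delta>: "\<delta> > 0" using \<epsilon> k by (simp add: \<delta>_def)
  have dom: "t + k * s \<in> I" if "\<bar>s\<bar> < \<delta>" for s
  proof -
    have "\<bar>k * s\<bar> < \<epsilon>" using that k by (simp add: \<delta>_def abs_mult field_simps)
    then show ?thesis using \<epsilon>(2) by (auto simp: dist_real_def subset_iff)
  qed
  let ?\<rho> = "\<lambda>s. \<eta> (t + k * s)"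
  have rep: "causal_geodesic A L X {- \<delta><..<\<delta>} ?\<rho>"
    "\<bar>s\<bar> < \<delta> \<Longrightarrow> velocity A ?\<rho> s = k *\<^sub>R velocity A \<eta> (t + k * s)" for s
    by (rule reparam(1)[OF k], rule dom, assumption) (rule reparam(2)[OF k dom])
  have "(\<exists>\<delta>>0. causal_geodesic A L X {- \<delta><..<\<delta>} ?\<rho>) \<and> ?\<rho> 0 = \<eta> t \<and> velocity A ?\<rho> 0 = k *\<^sub>R velocity A \<eta> t"
    using rep(1) rep(2)[of 0] \<delta> by auto
  from someI[where P="\<lambda>\<sigma>. (\<exists>\<delta>>0. causal_geodesic A L X {- \<delta><..<\<delta>} \<sigma>) \<and> \<sigma> 0 = \<eta> t \<and>
      velocity A \<sigma> 0 = k *\<^sub>R velocity A \<eta> t", OF this]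
  have "(\<exists>\<delta>>0. causal_geodesic A L X {- \<delta><..<\<delta>} \<sigma>) \<and> \<sigma> 0 = \<eta> t \<and> velocity A \<sigma> 0 = k *\<^sub>R velocity A \<eta> t"
    unfolding \<sigma>_def geodesic_from_def .
  then obtain \<delta>' where \<sigma>: "\<delta>' > 0" "causal_geodesic A L X {- \<delta>'<..<\<delta>'} \<sigma>" "\<sigma> 0 = \<eta> t"
    "velocity A \<sigma> 0 = k *\<^sub>R velocity A \<eta> t" by blast
  have "eventually (\<lambda>s. \<sigma> s = ?\<rho> s \<and> velocity A \<sigma> s = velocity A ?\<rho> s) (nhds 0)"
    by (rule geodesic_unique[OF atlas lf \<sigma>(2) _ _ rep(1)]) (use \<sigma> \<delta> rep(2)[of 0] in auto)
  moreover have "eventually (\<lambda>s. \<bar>s\<bar> < \<delta>) (nhds 0)"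
    unfolding eventually_nhds_metric dist_real_def using \<delta> by auto
  ultimately show ?thesis
    by eventually_elim (use rep(2) dom in auto)
qed

text \<open>The weight has degree 0, so it does not notice the rescaled velocity; the powers of
  \<open>k\<close> come only from the chain rule.\<close>

lemma weight_geodesic_from:
  assumes w: "weight A L X \<psi>" and t: "t \<in> I" and k: "k > 0"
  defines "\<sigma> \<equiv> geodesic_from A L X (\<eta> t) (k *\<^sub>R velocity A \<eta> t)"
  shows "deriv (weight_along A \<psi> \<sigma>) 0 = k * deriv (weight_along A \<psi> \<eta>) t"
    "deriv (deriv (weight_along A \<psi> \<sigma>)) 0 = k\<^sup>2 * deriv (deriv (weight_along A \<psi> \<eta>)) t"
proof -
  let ?f = "weight_along A \<psi> \<eta>" and ?h = "weight_along A \<psi> \<sigma>"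
  have hom: "\<psi> (\<eta> s) (k *\<^sub>R velocity A \<eta> s) = \<psi> (\<eta> s) (velocity A \<eta> s)" if "s \<in> I" for s
    using w velocity_closure[OF that] k unfolding weight_def by blast
  have ev: "eventually (\<lambda>s. t + k * s \<in> I \<and> ?h s = ?f (t + k * s)) (nhds 0)"
    using geodesic_from_reparam[OF t k] unfolding \<sigma>_def[symmetric]
    by eventually_elim (auto simp: weight_along_def hom)
  have chain: "deriv (\<lambda>s. q (t + k * s)) s = k * q'" if "(q has_real_derivative q') (at (t + k * s))"
    for q :: "real \<Rightarrow> real" and q' s
    by (rule DERIV_imp_deriv[OF DERIV_affine[OF that]])
  \<comment> \<open>A second derivative requires the first derivatives to agree near 0, so the
    agreement of the functions is needed near every nearby point.\<close>
  have "eventually (\<lambda>y. t + k * y \<in> I \<and> eventually (\<lambda>s. ?h s = ?f (t + k * s)) (nhds y)) (nhds 0)"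
    using ev eventually_eventually[of "\<lambda>s. ?h s = ?f (t + k * s)" 0] by (auto simp: eventually_conj_iff)
  then have ev1: "eventually (\<lambda>s. deriv ?h s = k * deriv ?f (t + k * s)) (nhds 0)"
  proof eventually_elim
    case (elim y)
    then have "deriv ?h y = deriv (\<lambda>s. ?f (t + k * s)) y" by (intro deriv_cong_ev) auto
    also have "\<dots> = k * deriv ?f (t + k * y)"
      by (rule chain[OF weight_along_derivatives(1)[OF w]]) (use elim in simp)
    finally show ?case .
  qed
  then show "deriv ?h 0 = k * deriv ?f t" using eventually_nhds_x_imp_x by fastforce
  have "deriv (deriv ?h) 0 = deriv (\<lambda>s. k * deriv ?f (t + k * s)) 0"
    by (rule deriv_cong_ev[OF ev1 refl])
  also have "\<dots> = k * (k * deriv (deriv ?f) t)"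
  proof (rule DERIV_imp_deriv[OF DERIV_cmult])
    show "((\<lambda>s. deriv ?f (t + k * s)) has_real_derivative k * deriv (deriv ?f) t) (at 0)"
      by (rule DERIV_affine) (simp add: weight_along_derivatives(2)[OF w t])
  qed
  finally show "deriv (deriv ?h) 0 = k\<^sup>2 * deriv (deriv ?f) t" by (simp add: power2_eq_square)
qed

lemma Ric_scale:
  assumes t: "t \<in> I" and k: "k > 0"
  shows "Ric A L (\<eta> t) (k *\<^sub>R velocity A \<eta> t) = k\<^sup>2 * Ric A L (\<eta> t) (velocity A \<eta> t)"
proof -
  let ?c = "pref_chart A (\<eta> t)"
  note c = pref_chart[OF atlas, of "\<eta> t"]
  interpret C: finsler_chart "local_expr A ?c L" "chart_slit ?c" by (rule finsler_chart_local[OF atlas lf c(1)])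
  have "(snd ?c (\<eta> t), velocity A \<eta> t) \<in> chart_slit ?c"
    using c causal_velocity_nonzero[OF t] by (simp add: chart_slit_def)
  then have "curv (local_expr A ?c L) \<alpha> \<beta> (snd ?c (\<eta> t), k *\<^sub>R velocity A \<eta> t) =
      k\<^sup>2 * curv (local_expr A ?c L) \<alpha> \<beta> (snd ?c (\<eta> t), velocity A \<eta> t)" for \<alpha> \<beta>
    using C.hom_curv k unfolding homogeneous_def by blast
  then show ?thesis by (simp add: Ric_def trace_def Rmat_def sum_distrib_left)
qed

text \<open>The curvature and the second derivative of the weight scale with the square of
  \<open>k\<close>, and so does the squared first derivative. Hence nonnegativity at the rescaled
  velocity passes to the velocity itself, in each case of the definition.\<close>

lemma Ric_N_nonneg:
  assumes w: "weight A L X \<psi>" and t: "t \<in> I" and k: "k > 0"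
    and Ric: "Ric_N A L X \<psi> N (\<eta> t) (k *\<^sub>R velocity A \<eta> t) \<ge> 0"
  defines "D1 \<equiv> deriv (weight_along A \<psi> \<eta>) t" and "D2 \<equiv> deriv (deriv (weight_along A \<psi> \<eta>)) t"
    and "R \<equiv> Ric A L (\<eta> t) (velocity A \<eta> t)"
  shows "N = \<infinity> \<Longrightarrow> R + D2 \<ge> 0"
    and "N = ereal (real CARD('m) - 1) \<Longrightarrow> D1 = 0 \<and> R + D2 \<ge> 0"
    and "N \<noteq> \<infinity> \<Longrightarrow> N \<noteq> ereal (real CARD('m) - 1) \<Longrightarrow>
       R + D2 \<ge> D1\<^sup>2 / (real_of_ereal N - (real CARD('m) - 1))"
proof -
  have scale: "k\<^sup>2 * R + k\<^sup>2 * D2 = k\<^sup>2 * (R + D2)" "(k * D1)\<^sup>2 = k\<^sup>2 * D1\<^sup>2" "k\<^sup>2 > 0"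
    using k by (simp_all add: algebra_simps power_mult_distrib)
  have *: "(0::ereal) \<le> (if N = \<infinity> then ereal (k\<^sup>2 * R + k\<^sup>2 * D2)
      else if N = ereal (real CARD('m) - 1) then (if k * D1 = 0 then ereal (k\<^sup>2 * R + k\<^sup>2 * D2) else -\<infinity>)
      else ereal (k\<^sup>2 * R + k\<^sup>2 * D2 - (k * D1)\<^sup>2 / (real_of_ereal N - (real CARD('m) - 1))))"
    using Ric unfolding Ric_N_def Let_def Ric_scale[OF t k] weight_geodesic_from[OF w t k] R_def D1_def D2_def .
  show "N = \<infinity> \<Longrightarrow> R + D2 \<ge> 0"
    using * scale by (simp add: zero_le_mult_iff)
  show "N = ereal (real CARD('m) - 1) \<Longrightarrow> D1 = 0 \<and> R + D2 \<ge> 0"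
    using * scale k by (auto simp: zero_le_mult_iff split: if_splits)
  assume N: "N \<noteq> \<infinity>" "N \<noteq> ereal (real CARD('m) - 1)"
  then have "0 \<le> k\<^sup>2 * (R + D2 - D1\<^sup>2 / (real_of_ereal N - (real CARD('m) - 1)))"
    using * unfolding scale by (simp add: right_diff_distrib)
  then have "0 \<le> R + D2 - D1\<^sup>2 / (real_of_ereal N - (real CARD('m) - 1))"
    using scale(3) by (simp add: zero_le_mult_iff)
  then show "R + D2 \<ge> D1\<^sup>2 / (real_of_ereal N - (real CARD('m) - 1))" by simp
qed

end

section \<open>The weighted Riccati inequality\<close>

text \<open>Numerator and denominator have equal signs: both are negative for \<open>N < 1\<close>,
  as \<open>n \<ge> 2\<close>, and both positive for \<open>N > n\<close>. The inverse of this
  quotient is the factor of \<open>\<epsilon>^2\<close> in \<open>c\<close>.\<close>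

lemma eps_ratio:
  assumes n: "n \<ge> 2" and N: "(N \<noteq> -\<infinity> \<and> N \<le> 1) \<or> N \<ge> ereal (real n)" and eps: "eps_admissible n N \<epsilon>"
    and "N \<noteq> 1" "N \<noteq> \<infinity>" "N \<noteq> ereal (real n)"
  obtains r where "N = ereal r" "(r - 1) / (r - real n) > 0" "\<epsilon>\<^sup>2 < (r - 1) / (r - real n)"
proof -
  obtain r where r: "N = ereal r" using N assms(5) by (cases N) auto
  then have r1: "r \<noteq> 1" "r \<noteq> real n" "r < 1 \<or> r > real n"
    using assms(4,6) N by (auto simp: one_ereal_def)
  then have pos: "(r - 1) / (r - real n) > 0"
    using n by (auto simp: zero_less_divide_iff)
  have "\<bar>\<epsilon>\<bar> < sqrt ((r - 1) / (r - real n))"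
    using eps assms(4-6) r by (simp add: eps_admissible_def)
  then have "\<epsilon>\<^sup>2 < (r - 1) / (r - real n)"
    using pos by (metis abs_ge_zero power2_abs power_strict_mono real_sqrt_pow2 less_imp_le zero_less_numeral)
  then show ?thesis using that r pos by blast
qed

text \<open>In the generic case the bracket in \<open>c\<close> is
  \<open>1 - \<epsilon>^2 / q\<close> with \<open>q = (N - 1) / (N - n)\<close>, so the bound on
  \<open>\<epsilon>\<close> gives positivity; at \<open>N = n\<close> the term in
  \<open>\<epsilon>\<close> is 0.\<close>

lemma c_const_pos:
  assumes n: "n \<ge> 2" and N: "(N \<noteq> -\<infinity> \<and> N \<le> 1) \<or> N \<ge> ereal (real n)" and eps: "eps_admissible n N \<epsilon>"
  shows "c_const n N \<epsilon> > 0"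
proof -
  consider "N = 1" | "N = \<infinity>" | "N = ereal (real n)" "N \<noteq> 1" | "N \<noteq> 1" "N \<noteq> \<infinity>" "N \<noteq> ereal (real n)" by blast
  then show ?thesis
  proof cases
    case 2
    then have "\<bar>\<epsilon>\<bar> < 1" using eps by (simp add: eps_admissible_def)
    then have "\<epsilon>\<^sup>2 < 1" by (simp add: abs_square_less_1)
    then show ?thesis using 2 n by (simp add: c_const_def)
  next
    case 4
    obtain r where r: "N = ereal r" "(r - 1) / (r - real n) > 0" "\<epsilon>\<^sup>2 < (r - 1) / (r - real n)"
      using eps_ratio[OF n N eps 4] by blast
    define q where "q = (r - 1) / (r - real n)"
    have "\<epsilon>\<^sup>2 * ((r - real n) / (r - 1)) = \<epsilon>\<^sup>2 / q" by (simp add: q_def)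
    also have "\<dots> < 1" using r by (simp add: q_def[symmetric])
    finally show ?thesis using 4 r(1) n by (simp add: c_const_def)
  qed (use n in \<open>auto simp: c_const_def\<close>)
qed

text \<open>In terms of \<open>y = \<theta> - D1\<close> the left side is bounded by a quadratic
  form in \<open>y\<close> and \<open>D1\<close>. The curvature hypothesis fixes its coefficient of
  the squared \<open>D1\<close>; in the generic case, completing the square in \<open>D1\<close>
  leaves \<open>- c y^2\<close>.\<close>

lemma weighted_riccati:
  fixes \<theta> \<theta>' R D1 D2 :: real
  assumes n: "n \<ge> 2" and N: "(N \<noteq> -\<infinity> \<and> N \<le> 1) \<or> N \<ge> ereal (real n)" and eps: "eps_admissible n N \<epsilon>"
    and ray: "\<theta>' \<le> - \<theta>\<^sup>2 / (real n - 1) - R"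
    and R1: "N = \<infinity> \<Longrightarrow> R + D2 \<ge> 0"
    and R2: "N = ereal (real n) \<Longrightarrow> D1 = 0 \<and> R + D2 \<ge> 0"
    and R3: "N \<noteq> \<infinity> \<Longrightarrow> N \<noteq> ereal (real n) \<Longrightarrow> R + D2 \<ge> D1\<^sup>2 / (real_of_ereal N - real n)"
  shows "2 * (1 - \<epsilon>) / (real n - 1) * D1 * (\<theta> - D1) + \<theta>' - D2 \<le> - c_const n N \<epsilon> * (\<theta> - D1)\<^sup>2"
proof -
  define d where "d = real n - 1"
  have d: "d > 0" using n by (simp add: d_def)
  define y where "y = \<theta> - D1"
  have "2 * (1 - \<epsilon>) / d * D1 * y + \<theta>' - D2 \<le> 2 * (1 - \<epsilon>) / d * D1 * y - (y + D1)\<^sup>2 / d - (R + D2)"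
    using ray by (simp add: y_def d_def)
  \<comment> \<open>This is the effect of the factor \<open>2 (1 - \<epsilon>) / (n - 1)\<close> in
    the exponent: it reduces the mixed term from \<open>2 D1 y\<close> to
    \<open>2 \<epsilon> D1 y\<close>.\<close>
  also have "\<dots> = - (y\<^sup>2 + 2 * \<epsilon> * D1 * y + D1\<^sup>2) / d - (R + D2)"
    using d by (simp add: field_simps power2_eq_square)
  finally have main: "2 * (1 - \<epsilon>) / d * D1 * y + \<theta>' - D2 \<le> - (y\<^sup>2 + 2 * \<epsilon> * D1 * y + D1\<^sup>2) / d - (R + D2)" .
  consider "N = \<infinity>" | "N = ereal (real n)" | "N = 1" "N \<noteq> ereal (real n)" | "N \<noteq> 1" "N \<noteq> \<infinity>" "N \<noteq> ereal (real n)" by blast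
  then have "- (y\<^sup>2 + 2 * \<epsilon> * D1 * y + D1\<^sup>2) / d - (R + D2) \<le> - c_const n N \<epsilon> * y\<^sup>2"
  proof cases
    case 1
    have c: "c_const n N \<epsilon> = (1 - \<epsilon>\<^sup>2) / d" using 1 by (simp add: c_const_def d_def)
    have "- (y\<^sup>2 + 2 * \<epsilon> * D1 * y + D1\<^sup>2) / d = - ((1 - \<epsilon>\<^sup>2) / d) * y\<^sup>2 - (\<epsilon> * y + D1)\<^sup>2 / d"
      using d by (simp add: field_simps power2_eq_square)
    moreover have "(\<epsilon> * y + D1)\<^sup>2 / d \<ge> 0" using d by simp
    ultimately show ?thesis using R1[OF 1] unfolding c by linarith
  next
    case 2
    then have "c_const n N \<epsilon> = 1 / d" using n by (auto simp: c_const_def d_def one_ereal_def)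
    then show ?thesis using R2[OF 2] by simp
  next
    case 3
    \<comment> \<open>For \<open>N = 1\<close> one has \<open>1 / d + 1 / (N - n) = 0\<close>: the
      curvature bound cancels the squared \<open>D1\<close>, leaving nothing to absorb a mixed term;
      with \<open>\<epsilon> = 0\<close> there is none.\<close>
    then have "\<epsilon> = 0" using eps by (simp add: eps_admissible_def)
    have "D1\<^sup>2 / (real_of_ereal N - real n) = - (D1\<^sup>2 / d)"
    proof -
      have "real_of_ereal N - real n = - d" using 3(1) by (simp add: d_def)
      then show ?thesis by simp
    qed
    moreover have "N \<noteq> \<infinity>" using 3 by auto
    ultimately have "R + D2 \<ge> - (D1\<^sup>2 / d)" using R3 3(2) by simp
    then show ?thesis using 3 \<open>\<epsilon> = 0\<close> by (simp add: c_const_def d_def[symmetric] add_divide_distrib diff_divide_distrib)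
  next
    case 4
    obtain r where r: "N = ereal r" "(r - 1) / (r - real n) > 0" "\<epsilon>\<^sup>2 < (r - 1) / (r - real n)"
      using eps_ratio[OF n N eps 4] by blast
    define q where "q = (r - 1) / (r - real n)"
    have q: "q > 0" using r by (simp add: q_def)
    have nz: "r - real n \<noteq> 0" using r(2) by auto
    have c: "c_const n N \<epsilon> = (1 - \<epsilon>\<^sup>2 / q) / d"
      using 4 r(1) by (simp add: c_const_def d_def q_def)
    \<comment> \<open>Because \<open>d = n - 1\<close>, the sum \<open>1 / d + 1 / (r - n)\<close>
      equals \<open>q / d\<close>. The weight \<open>q\<close> on the squared \<open>D1\<close> is
      what puts \<open>\<epsilon>^2 / q\<close> into \<open>c\<close>.\<close>
    have "D1\<^sup>2 / d + D1\<^sup>2 / (r - real n) = q * D1\<^sup>2 / d"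
      using d nz by (simp add: q_def d_def field_simps)
    then have "- (y\<^sup>2 + 2 * \<epsilon> * D1 * y + D1\<^sup>2) / d - (R + D2) \<le> - (y\<^sup>2 + 2 * \<epsilon> * D1 * y + q * D1\<^sup>2) / d"
      using R3[OF 4(2,3)] r(1) by (simp add: add_divide_distrib diff_divide_distrib)
    also have "\<dots> = - ((1 - \<epsilon>\<^sup>2 / q) / d) * y\<^sup>2 - (\<epsilon> * y + q * D1)\<^sup>2 / (q * d)"
      using d q by (simp add: field_simps power2_eq_square)
    also have "\<dots> \<le> - ((1 - \<epsilon>\<^sup>2 / q) / d) * y\<^sup>2" using d q by simp
    finally show ?thesis unfolding c .
  qed
  with main show ?thesis by (simp add: y_def d_def)
qed

lemma riccati_no_global_solution:
  fixes x \<tau> :: "real \<Rightarrow> real"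
  assumes t: "t0 < t1" and c: "c > 0"
    and dx: "\<And>t. t0 \<le> t \<Longrightarrow> t \<le> t1 \<Longrightarrow> \<exists>x'. (x has_real_derivative x') (at t) \<and> x' \<le> - c * \<tau>' t * (x t)\<^sup>2"
    and d\<tau>: "\<And>t. t0 \<le> t \<Longrightarrow> t \<le> t1 \<Longrightarrow> (\<tau> has_real_derivative \<tau>' t) (at t)"
    and pos: "\<And>t. \<tau>' t > 0" and x0: "x t0 < 0"
    and target: "\<tau> t1 = \<tau> t0 - 1 / (c * x t0)"
  shows False
proof -
  \<comment> \<open>\<open>x\<close> is nonincreasing and starts below 0, so its reciprocal is
    differentiable on the whole interval.\<close>
  have neg: "x t < 0" if t: "t0 \<le> t" "t \<le> t1" for t
  proof -
    have "x t \<le> x t0"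
    proof (rule DERIV_nonpos_imp_nonincreasing[OF t(1)])
      fix s assume "t0 \<le> s" "s \<le> t"
      then obtain x' where "(x has_real_derivative x') (at s)" "x' \<le> - c * \<tau>' s * (x s)\<^sup>2"
        using dx[of s] t(2) by auto
      moreover have "- c * \<tau>' s * (x s)\<^sup>2 \<le> 0" using c pos[of s] by (simp add: mult_nonneg_nonneg less_imp_le)
      ultimately show "\<exists>y. (x has_real_derivative y) (at s) \<and> y \<le> 0" by force
    qed
    then show ?thesis using x0 by simp
  qed
  have "inverse (x t0) - c * \<tau> t0 \<le> inverse (x t1) - c * \<tau> t1"
  proof (rule DERIV_nonneg_imp_nondecreasing[OF less_imp_le[OF t]])
    fix s assume s: "t0 \<le> s" "s \<le> t1"
    obtain x' where x': "(x has_real_derivative x') (at s)" "x' \<le> - c * \<tau>' s * (x s)\<^sup>2" using dx[OF s] by blast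
    have "((\<lambda>s. inverse (x s) - c * \<tau> s) has_real_derivative - (inverse (x s) * x' * inverse (x s)) - c * \<tau>' s) (at s)"
      using neg[OF s] by (auto intro!: derivative_eq_intros x'(1) d\<tau>[OF s] simp: power2_eq_square)
    moreover have "- (inverse (x s) * x' * inverse (x s)) \<ge> c * \<tau>' s"
    proof -
      have sq: "(x s)\<^sup>2 > 0" using neg[OF s] by simp
      have "c * \<tau>' s * (x s)\<^sup>2 \<le> - x'" using x'(2) by simp
      then have "c * \<tau>' s \<le> (- x') / (x s)\<^sup>2" by (simp only: pos_le_divide_eq[OF sq])
      then show ?thesis by (simp add: power2_eq_square divide_inverse mult_ac)
    qed
    ultimately show "\<exists>y. ((\<lambda>s. inverse (x s) - c * \<tau> s) has_real_derivative y) (at s) \<and> 0 \<le> y"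
      by force
  qed
  \<comment> \<open>The target is chosen so that \<open>c \<tau>\<close> grows by exactly
    \<open>-1 / x t0\<close>; monotonicity then forces a nonnegative reciprocal at
    \<open>t1\<close>.\<close>
  moreover have "c * \<tau> t1 = c * \<tau> t0 - inverse (x t0)"
    unfolding target using c x0 by (simp add: field_simps)
  ultimately have "inverse (x t1) \<ge> 0" by simp
  moreover have "x t1 < 0" using neg[of t1] t by simp
  ultimately show False by simp
qed

text \<open>Time reversal: \<open>- h (- s)\<close> has derivative \<open>h'\<close> taken at
  \<open>- s\<close>, so the reflected functions satisfy the same inequality, while the sign of the
  initial value flips.\<close>

lemma riccati_no_global_solution_backward:
  fixes x \<tau> :: "real \<Rightarrow> real"
  assumes t: "t1 < t0" and c: "c > 0"
    and dx: "\<And>t. t1 \<le> t \<Longrightarrow> t \<le> t0 \<Longrightarrow> \<exists>x'. (x has_real_derivative x') (at t) \<and> x' \<le> - c * \<tau>' t * (x t)\<^sup>2"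
    and d\<tau>: "\<And>t. t1 \<le> t \<Longrightarrow> t \<le> t0 \<Longrightarrow> (\<tau> has_real_derivative \<tau>' t) (at t)"
    and pos: "\<And>t. \<tau>' t > 0" and x0: "x t0 > 0"
    and target: "\<tau> t1 = \<tau> t0 - 1 / (c * x t0)"
  shows False
proof (rule riccati_no_global_solution[of "- t0" "- t1" c "\<lambda>s. - x (- s)" "\<lambda>s. \<tau>' (- s)" "\<lambda>s. - \<tau> (- s)"])
  have flip: "((\<lambda>s. - h (- s)) has_real_derivative h') (at s)" if "(h has_real_derivative h') (at (- s))"
    for h :: "real \<Rightarrow> real" and h' s
    using DERIV_minus[OF DERIV_affine[of h h' 0 "-1" s]] that by simp
  fix s assume s: "- t0 \<le> s" "s \<le> - t1"
  then obtain x' where "(x has_real_derivative x') (at (- s))" "x' \<le> - c * \<tau>' (- s) * (x (- s))\<^sup>2"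
    using dx[of "- s"] by auto
  then show "\<exists>x'. ((\<lambda>s. - x (- s)) has_real_derivative x') (at s) \<and> x' \<le> - c * \<tau>' (- s) * (- x (- s))\<^sup>2"
    using flip by force
  show "((\<lambda>s. - \<tau> (- s)) has_real_derivative \<tau>' (- s)) (at s)"
    using s by (intro flip d\<tau>) auto
qed (use assms in auto)

lemma (in null_geod) eps_expansion_riccati:
  assumes n: "CARD('m) = n + 1" "n \<ge> 2" and w: "weight A L X \<psi>"
    and N: "(N \<noteq> -\<infinity> \<and> N \<le> 1) \<or> N \<ge> ereal (real n)" and eps: "eps_admissible n N \<epsilon>"
    and Ric: "Ric_N A L X \<psi> N (\<eta> t)
        (exp (2 * (1 - \<epsilon>) / (real n - 1) * weight_along A \<psi> \<eta> t) *\<^sub>R velocity A \<eta> t) \<ge> 0"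
    and t: "t \<in> I" and lag: "lagrange_tensor_field A L I \<eta> J J'"
    and bij: "bij_betw (J t) (quot_space A L (\<eta> t) (velocity A \<eta> t)) (quot_space A L (\<eta> t) (velocity A \<eta> t))"
  shows "\<exists>x'. (eps_expansion A L \<psi> \<epsilon> \<eta> J J' has_real_derivative x') (at t) \<and>
    x' \<le> - c_const n N \<epsilon> * exp (2 * (\<epsilon> - 1) / (real n - 1) * weight_along A \<psi> \<eta> t) * (eps_expansion A L \<psi> \<epsilon> \<eta> J J' t)\<^sup>2"
proof -
  let ?f = "weight_along A \<psi> \<eta>" and ?\<theta> = "expansion A L \<eta> J J'"
  let ?D1 = "deriv ?f t" and ?D2 = "deriv (deriv ?f) t" and ?R = "Ric A L (\<eta> t) (velocity A \<eta> t)"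
  define \<kappa> where "\<kappa> = 2 * (1 - \<epsilon>) / (real n - 1)"
  have card: "real CARD('m) - 2 = real n - 1" "real CARD('m) - 1 = real n" using n by auto
  have "CARD('m) \<ge> 3" using n by simp
  from raychaudhuri[OF this t lag bij] obtain \<theta>' where \<theta>': "(?\<theta> has_real_derivative \<theta>') (at t)"
    "\<theta>' \<le> - (?\<theta> t)\<^sup>2 / (real n - 1) - ?R" unfolding card by blast
  note f = weight_along_derivatives[OF w t]
  let ?x' = "exp (\<kappa> * ?f t) * (\<kappa> * ?D1 * (?\<theta> t - ?D1) + \<theta>' - ?D2)"
  have x: "eps_expansion A L \<psi> \<epsilon> \<eta> J J' = (\<lambda>t. exp (\<kappa> * ?f t) * (?\<theta> t - deriv ?f t))"
    unfolding eps_expansion_def[abs_def] card \<kappa>_def ..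
  have deriv: "((\<lambda>t. exp (\<kappa> * ?f t) * (?\<theta> t - deriv ?f t)) has_real_derivative ?x') (at t)"
    by (auto intro!: derivative_eq_intros f \<theta>'(1) simp: algebra_simps)
  have "?x' \<le> exp (\<kappa> * ?f t) * (- c_const n N \<epsilon> * (?\<theta> t - ?D1)\<^sup>2)"
    unfolding \<kappa>_def
    by (intro mult_left_mono weighted_riccati[OF n(2) N eps \<theta>'(2)]
        Ric_N_nonneg[OF w t exp_gt_zero Ric, unfolded card]) auto
  \<comment> \<open>With \<open>E = exp (\<kappa> * ?f t)\<close> the derivative of
    \<open>\<tau>\<close> is \<open>1 / E\<close> and the expansion is \<open>E y\<close>; hence
    \<open>E y^2\<close> becomes the derivative of \<open>\<tau>\<close> times the squared
    expansion.\<close>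
  also have "exp (\<kappa> * ?f t) * (- c_const n N \<epsilon> * (?\<theta> t - ?D1)\<^sup>2) =
      - c_const n N \<epsilon> * exp (2 * (\<epsilon> - 1) / (real n - 1) * ?f t) * (exp (\<kappa> * ?f t) * (?\<theta> t - ?D1))\<^sup>2"
  proof -
    have "2 * (\<epsilon> - 1) / (real n - 1) * ?f t = - (\<kappa> * ?f t)"
      by (simp add: \<kappa>_def diff_divide_distrib algebra_simps)
    moreover have "E * (- C * Y\<^sup>2) = - C * inverse E * (E * Y)\<^sup>2" if "E \<noteq> 0" for E C Y :: real
      using that by (simp add: power2_eq_square)
    ultimately show ?thesis by (simp only: exp_minus exp_not_eq_zero not_False_eq_True)
  qed
  finally have le: "?x' \<le> - c_const n N \<epsilon> * exp (2 * (\<epsilon> - 1) / (real n - 1) * ?f t) * (exp (\<kappa> * ?f t) * (?\<theta> t - ?D1))\<^sup>2" .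
  show ?thesis unfolding x by (rule exI, rule conjI, rule deriv, rule le)
qed

theorem proposition6p3:
  fixes A :: "('a::{t2_space, second_countable_topology}, 'm::finite) chart set"
    and L :: "'a \<Rightarrow> real^'m \<Rightarrow> real" and X :: "'a \<Rightarrow> real^'m" and \<psi> :: "'a \<Rightarrow> real^'m \<Rightarrow> real"
    and n :: nat and N a b :: ereal and \<epsilon> t0 :: real
    and I :: "real set" and \<eta> :: "real \<Rightarrow> 'a" and \<tau> :: "real \<Rightarrow> real"
    and J J' :: "real \<Rightarrow> (real^'m) set \<Rightarrow> (real^'m) set"
  assumes "CARD('m) = n + 1" and "n \<ge> 2"
    and "finsler_spacetime A L X" and "weight A L X \<psi>"
    and "(N \<noteq> -\<infinity> \<and> N \<le> 1) \<or> N \<ge> ereal (real n)"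
    and "eps_admissible n N \<epsilon>"
    and I: "I = {t. a < ereal t \<and> ereal t < b}"
    and "lightlike_geodesic A L X I \<eta>"
    and "\<And>t. t \<in> I \<Longrightarrow>
      Ric_N A L X \<psi> N (\<eta> t)
        (exp (2 * (1 - \<epsilon>) / (real n - 1) * weight_along A \<psi> \<eta> t) *\<^sub>R velocity A \<eta> t) \<ge> 0"
    and "\<And>t. t \<in> I \<Longrightarrow>
      (\<tau> has_real_derivative exp (2 * (\<epsilon> - 1) / (real n - 1) * weight_along A \<psi> \<eta> t)) (at t)"
    and "lagrange_tensor_field A L I \<eta> J J'"
    and "t0 \<in> I"
    and "bij_betw (J t0) (quot_space A L (\<eta> t0) (velocity A \<eta> t0))
                         (quot_space A L (\<eta> t0) (velocity A \<eta> t0))"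
  shows "let \<theta>0 = eps_expansion A L \<psi> \<epsilon> \<eta> J J' t0;
             target = \<tau> t0 - 1 / (c_const n N \<epsilon> * \<theta>0);
             s0 = inv_into I \<tau> target - t0
         in (\<theta>0 < 0 \<and> target \<in> \<tau> ` I \<longrightarrow>
               (\<exists>t\<in>{t0..t0 + s0}. quot_det A L (\<eta> t) (velocity A \<eta> t) (J t) = 0)) \<and>
            (\<theta>0 > 0 \<and> target \<in> \<tau> ` I \<longrightarrow>
               (\<exists>t\<in>{t0 + s0..t0}. quot_det A L (\<eta> t) (velocity A \<eta> t) (J t) = 0))"
proof -
  have I_vimage: "I = ereal -` {a<..<b}" by (auto simp: I)
  have open_I: "open I" unfolding I_vimage by (intro open_ereal_vimage) auto
  have I_between: "t \<in> I" if "r \<in> I" "s \<in> I" "r \<le> t" "t \<le> s" for r s t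
    using that less_le_trans[of a "ereal r" "ereal t"] le_less_trans[of "ereal t" "ereal s" b] by (simp add: I)
  have atlas: "smooth_atlas A" and lf: "lorentz_finsler A L"
    using assms(3) by (auto simp: finsler_spacetime_def)
  interpret null_geod A L X I \<eta>
    by unfold_locales (use atlas lf open_I assms(8) in \<open>auto simp: lightlike_geodesic_def lightlike_def\<close>)
  define x where "x = eps_expansion A L \<psi> \<epsilon> \<eta> J J'"
  define c where "c = c_const n N \<epsilon>"
  define \<tau>' where "\<tau>' t = exp (2 * (\<epsilon> - 1) / (real n - 1) * weight_along A \<psi> \<eta> t)" for t
  define target where "target = \<tau> t0 - 1 / (c * x t0)"
  define t1 where "t1 = inv_into I \<tau> target"
  have c: "c > 0" unfolding c_def by (rule c_const_pos[OF assms(2,5,6)])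
  have \<tau>'_pos: "\<tau>' t > 0" for t by (simp add: \<tau>'_def)
  have d\<tau>: "(\<tau> has_real_derivative \<tau>' t) (at t)" if "t \<in> I" for t
    unfolding \<tau>'_def by (rule assms(10)[OF that])
  have mono: "\<tau> r < \<tau> s" if rs: "r \<in> I" "s \<in> I" "r < s" for r s
  proof (rule DERIV_pos_imp_increasing[OF rs(3)])
    fix y assume "r \<le> y" "y \<le> s"
    from d\<tau>[OF I_between[OF rs(1,2) this]] \<tau>'_pos[of y]
    show "\<exists>D. (\<tau> has_real_derivative D) (at y) \<and> 0 < D" by (intro exI conjI)
  qed
  \<comment> \<open>\<open>expansion\<close> is meaningful where \<open>J t\<close> is bijective,
    which a nonzero determinant ensures. Under the hypothesis for contradiction this covers the
    closed interval up to \<open>t1\<close>.\<close>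
  have dx: "\<exists>x'. (x has_real_derivative x') (at t) \<and> x' \<le> - c * \<tau>' t * (x t)\<^sup>2"
    if t: "t \<in> I" and det: "quot_det A L (\<eta> t) (velocity A \<eta> t) (J t) \<noteq> 0" for t
  proof -
    have "quot_endo A L (\<eta> t) (velocity A \<eta> t) (J t)"
      using assms(11) t by (simp add: lagrange_tensor_field_def jacobi_tensor_field_def smooth_quot_endo_field_def)
    moreover obtain b where "quot_basis A L (\<eta> t) (velocity A \<eta> t) b" using quot_basis_exists[OF t] ..
    ultimately have "bij_betw (J t) (quot_space A L (\<eta> t) (velocity A \<eta> t)) (quot_space A L (\<eta> t) (velocity A \<eta> t))"
      using det by (rule quot_det_nonzero_bij)
    from eps_expansion_riccati[OF assms(1,2,4,5,6) assms(9)[OF t] t assms(11) this]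
    show ?thesis by (simp add: x_def c_def \<tau>'_def)
  qed
  \<comment> \<open>Attainment of \<open>target\<close> is what makes \<open>inv_into\<close> return
    a true preimage; \<open>t1\<close> is \<open>t0 + s0\<close>.\<close>
  have t1: "t1 \<in> I" "\<tau> t1 = target" if "target \<in> \<tau> ` I"
    using inv_into_into[OF that] f_inv_into_f[OF that] by (simp_all add: t1_def)
  have "\<exists>t\<in>{t0..t1}. quot_det A L (\<eta> t) (velocity A \<eta> t) (J t) = 0" if neg: "x t0 < 0" and tgt: "target \<in> \<tau> ` I"
  proof (rule ccontr)
    assume no: "\<not> ?thesis"
    \<comment> \<open>As \<open>x t0\<close> is negative, the target exceeds
      \<open>\<tau> t0\<close>; since \<open>\<tau>\<close> is increasing, it is reached after
      \<open>t0\<close>.\<close>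
    have "\<tau> t0 < \<tau> t1"
      using neg c by (simp add: t1(2)[OF tgt] target_def zero_less_divide_iff divide_less_0_iff mult_less_0_iff)
    then have less: "t0 < t1" using mono[OF t1(1)[OF tgt] assms(12)] by (cases t0 t1 rule: linorder_cases) auto
    show False
    proof (rule riccati_no_global_solution[OF less c, of x \<tau>' \<tau>])
      show "\<exists>x'. (x has_real_derivative x') (at t) \<and> x' \<le> - c * \<tau>' t * (x t)\<^sup>2" if "t0 \<le> t" "t \<le> t1" for t
        using dx[OF I_between[OF assms(12) t1(1)[OF tgt] that]] no that by auto
      show "(\<tau> has_real_derivative \<tau>' t) (at t)" if "t0 \<le> t" "t \<le> t1" for t
        by (rule d\<tau>[OF I_between[OF assms(12) t1(1)[OF tgt] that]])
    qed (use \<tau>'_pos neg t1(2)[OF tgt] in \<open>auto simp: target_def\<close>)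
  qed
  moreover have "\<exists>t\<in>{t1..t0}. quot_det A L (\<eta> t) (velocity A \<eta> t) (J t) = 0" if pos: "x t0 > 0" and tgt: "target \<in> \<tau> ` I"
  proof (rule ccontr)
    assume no: "\<not> ?thesis"
    have "\<tau> t1 < \<tau> t0"
      using pos c by (simp add: t1(2)[OF tgt] target_def)
    then have less: "t1 < t0" using mono[OF assms(12) t1(1)[OF tgt]] by (cases t0 t1 rule: linorder_cases) auto
    show False
    proof (rule riccati_no_global_solution_backward[OF less c, of x \<tau>' \<tau>])
      show "\<exists>x'. (x has_real_derivative x') (at t) \<and> x' \<le> - c * \<tau>' t * (x t)\<^sup>2" if "t1 \<le> t" "t \<le> t0" for t
        using dx[OF I_between[OF t1(1)[OF tgt] assms(12) that]] no that by auto
      show "(\<tau> has_real_derivative \<tau>' t) (at t)" if "t1 \<le> t" "t \<le> t0" for t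
        by (rule d\<tau>[OF I_between[OF t1(1)[OF tgt] assms(12) that]])
    qed (use \<tau>'_pos pos t1(2)[OF tgt] in \<open>auto simp: target_def\<close>)
  qed
  ultimately show ?thesis
    unfolding Let_def x_def[symmetric] c_def[symmetric] target_def[symmetric] t1_def[symmetric] by simp
qed

end
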